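(* Nearly Sasakian (non-Sasakian) structures on a $5$-dimensional manifold are in one-to-one correspondence with $SU(2)$-structures $(\eta,\omega_1,\omega_2,\omega_3)$ satisfying $$d\eta=-2\omega_3+2\lambda\omega_1,\qquad d\omega_1=3\eta\wedge\omega_2,\qquad d\omega_2=-3\eta\wedge\omega_1-3\lambda\,\eta\wedge\omega_3$$ for some real number $\lambda\neq0$. These $SU(2)$-structures are nearly hypo.
   Context: All manifolds are smooth and connected; $\nabla$ is the Levi-Civita connection of $g$; $d\eta(X,Y)=X(\eta(Y))-Y(\eta(X))-\eta([X,Y])$ and $u\wedge v=u\otimes v-v\otimes u$ for $1$-forms. An almost contact metric structure $(\phi,\xi,\eta,g)$ on $M^{2n+1}$ consists of a $(1,1)$-tensor field $\phi$, a vector field $\xi$, a $1$-form $\eta$ and a Riemannian metric $g$ with $\phi^2=-I+\eta\otimes\xi$, $\eta(\xi)=1$, $g(\phi X,\phi Y)=g(X,Y)-\eta(X)\eta(Y)$. It is Sasakian if $(\nabla_X\phi)Y=g(X,Y)\xi-\eta(Y)X$, and nearly Sasakian if $(\nabla_X\phi)Y+(\nabla_Y\phi)X=2g(X,Y)\xi-\eta(X)Y-\eta(Y)X$ for all vector fields $X,Y$. An $SU(2)$-structure on a $5$-manifold is given equivalently by (i) three almost contact metric structures $(\phi_i,\xi,\eta,g)$, $i\in\{1,2,3\}$, with the same $\xi,\eta,g$ and $\phi_i\phi_j=\phi_k=-\phi_j\phi_i$ for every even permutation $(i,j,k)$ of $(1,2,3)$; or (ii) a quadruplet $(\eta,\omega_1,\omega_2,\omega_3)$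 of a $1$-form and three $2$-forms with $\omega_i\wedge\omega_j=\delta_{ij}v$ for some $4$-form $v$ with $v\wedge\eta\neq0$, and such that $X\lrcorner\,\omega_1=Y\lrcorner\,\omega_2$ implies $\omega_3(X,Y)\ge0$. The two descriptions are related by $\omega_i(X,Y)=g(\phi_iX,Y)$. An $SU(2)$-structure $(\eta,\omega_1,\omega_2,\omega_3)$ is called nearly hypo if $d\omega_1=3\eta\wedge\omega_2$ and $d(\eta\wedge\omega_3)=-2\omega_1\wedge\omega_1$.
   Formalization: For λ≠0 the correspondence is two-to-one, since (η,−ω₁,−ω₂,ω₃) with −λ gives the same nearly Sasakian structure (φ₃,ξ,η,g); what is proved is that each fibre is exactly such a pair, and that the correspondence is one-to-one when λ>0. *)

theory Defs
  imports "HOL-Analysis.Analysis" "HOL-Library.Function_Algebras"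
begin

text \<open>
  A manifold is a topological space given by a type \<open>'a\<close> together with a smooth atlas modelled on a
  Euclidean space \<open>'e\<close>. Tangent vectors at a point are derivations at that point of the algebra of
  smooth real-valued functions. All fields are total functions that vanish outside the tangent
  spaces, so that equality of fields is equality of functions.
\<close>

instantiation "fun" :: (type, real_vector) real_vector
begin

definition scaleR_fun :: "real \<Rightarrow> ('a \<Rightarrow> 'b) \<Rightarrow> 'a \<Rightarrow> 'b"
  where "scaleR_fun c f = (\<lambda>x. c *\<^sub>R f x)"

instance
  by standard (auto simp: scaleR_fun_def fun_eq_iff scaleR_add_right scaleR_add_left)

end

section \<open>Smooth manifolds and vector fields\<close>

text \<open>Continuous differentiability of order \<open>k\<close> on an open set \<open>S\<close>, by directional derivatives.\<close>

primrec Ck_on :: "nat \<Rightarrow> 'e::euclidean_space set \<Rightarrow> ('e \<Rightarrow> 'f::real_normed_vector) \<Rightarrow> bool" where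
  "Ck_on 0 S f \<longleftrightarrow> continuous_on S f"
| "Ck_on (Suc k) S f \<longleftrightarrow>
     f differentiable_on S \<and> (\<forall>v. Ck_on k S (\<lambda>x. frechet_derivative f (at x) v))"

definition smooth_on :: "'e::euclidean_space set \<Rightarrow> ('e \<Rightarrow> 'f::real_normed_vector) \<Rightarrow> bool"
  where "smooth_on S f \<longleftrightarrow> (\<forall>k. Ck_on k S f)"

type_synonym ('a, 'e) atlas = "('a set \<times> ('a \<Rightarrow> 'e)) set"

definition smooth_manifold ::
  "('a::{t2_space, second_countable_topology}, 'e::euclidean_space) atlas \<Rightarrow> bool" where
  "smooth_manifold A \<longleftrightarrow>
     connected (UNIV :: 'a set) \<and>
     (\<Union>(U, x)\<in>A. U) = UNIV \<and>
     (\<forall>(U, x)\<in>A. open U \<and> open (x ` U) \<and> homeomorphism U (x ` U) x (the_inv_into U x)) \<and>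
     (\<forall>(U, x)\<in>A. \<forall>(V, y)\<in>A. smooth_on (x ` (U \<inter> V)) (y \<circ> the_inv_into U x))"

definition smooth_fun :: "('a, 'e::euclidean_space) atlas \<Rightarrow> ('a \<Rightarrow> real) \<Rightarrow> bool"
  where "smooth_fun A f \<longleftrightarrow> (\<forall>(U, x)\<in>A. smooth_on (x ` U) (f \<circ> the_inv_into U x))"

type_synonym 'a tangent = "('a \<Rightarrow> real) \<Rightarrow> real"

definition tangent_space :: "('a, 'e::euclidean_space) atlas \<Rightarrow> 'a \<Rightarrow> 'a tangent set" where
  "tangent_space A p = {v.
     (\<forall>f. \<not> smooth_fun A f \<longrightarrow> v f = 0) \<and>
     (\<forall>f g. smooth_fun A f \<longrightarrow> smooth_fun A g \<longrightarrow> v (f + g) = v f + v g) \<and>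
     (\<forall>c f. smooth_fun A f \<longrightarrow> v (c *\<^sub>R f) = c * v f) \<and>
     (\<forall>f g. smooth_fun A f \<longrightarrow> smooth_fun A g \<longrightarrow> v (f * g) = v f * g p + f p * v g)}"

type_synonym 'a vfield = "'a \<Rightarrow> 'a tangent"

definition vector_field :: "('a, 'e::euclidean_space) atlas \<Rightarrow> 'a vfield \<Rightarrow> bool" where
  "vector_field A X \<longleftrightarrow>
     (\<forall>p. X p \<in> tangent_space A p) \<and> (\<forall>f. smooth_fun A f \<longrightarrow> smooth_fun A (\<lambda>p. X p f))"

definition lie_bracket :: "'a vfield \<Rightarrow> 'a vfield \<Rightarrow> 'a vfield"
  where "lie_bracket X Y = (\<lambda>p f. X p (\<lambda>q. Y q f) - Y p (\<lambda>q. X q f))"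

section \<open>Differential forms\<close>

text \<open>A \<open>k\<close>-form takes, at each point, a list of \<open>k\<close> tangent vectors.\<close>

type_synonym 'a form = "'a \<Rightarrow> 'a tangent list \<Rightarrow> real"

definition diff_form :: "('a, 'e::euclidean_space) atlas \<Rightarrow> nat \<Rightarrow> 'a form \<Rightarrow> bool" where
  "diff_form A k \<alpha> \<longleftrightarrow>
     (\<forall>p vs. \<not> (length vs = k \<and> set vs \<subseteq> tangent_space A p) \<longrightarrow> \<alpha> p vs = 0) \<and>
     (\<forall>p vs i a b v w. length vs = k \<longrightarrow> set vs \<subseteq> tangent_space A p \<longrightarrow> i < k \<longrightarrow>
        v \<in> tangent_space A p \<longrightarrow> w \<in> tangent_space A p \<longrightarrow>
        \<alpha> p (vs[i := a *\<^sub>R v + b *\<^sub>R w]) = a * \<alpha> p (vs[i := v]) + b * \<alpha> p (vs[i := w])) \<and>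
     (\<forall>p vs i j. length vs = k \<longrightarrow> set vs \<subseteq> tangent_space A p \<longrightarrow> i < j \<longrightarrow> j < k \<longrightarrow>
        vs ! i = vs ! j \<longrightarrow> \<alpha> p vs = 0) \<and>
     (\<forall>Xs. length Xs = k \<longrightarrow> (\<forall>X\<in>set Xs. vector_field A X) \<longrightarrow>
        smooth_fun A (\<lambda>p. \<alpha> p (map (\<lambda>X. X p) Xs)))"

text \<open>
  Wedge product of a \<open>k\<close>-form and an \<open>l\<close>-form, normalised by \<open>1/(k! l!)\<close> so that
  \<open>u \<and> v = u \<otimes> v - v \<otimes> u\<close> for \<open>1\<close>-forms.
\<close>

definition wedge :: "nat \<Rightarrow> nat \<Rightarrow> 'a form \<Rightarrow> 'a form \<Rightarrow> 'a form" where
  "wedge k l \<alpha> \<beta> = (\<lambda>p vs.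
     (\<Sum>\<sigma> | \<sigma> permutes {..<k + l}.
        of_int (sign \<sigma>) * \<alpha> p (take k (permute_list \<sigma> vs)) * \<beta> p (drop k (permute_list \<sigma> vs)))
     / (fact k * fact l))"

text \<open>
  \<open>has_ext_deriv A k \<alpha> \<theta>\<close> states \<open>d\<alpha> = \<theta>\<close> for a \<open>k\<close>-form \<open>\<alpha>\<close>, by the invariant formula without
  normalising factor, i.e. \<open>d\<eta>(X,Y) = X(\<eta>(Y)) - Y(\<eta>(X)) - \<eta>([X,Y])\<close> for \<open>k = 1\<close>.
  Here \<open>nths Xs (- {i})\<close> is the list \<open>Xs\<close> without its entry at index \<open>i\<close>.
\<close>

definition has_ext_deriv ::
  "('a, 'e::euclidean_space) atlas \<Rightarrow> nat \<Rightarrow> 'a form \<Rightarrow> 'a form \<Rightarrow> bool" where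
  "has_ext_deriv A k \<alpha> \<theta> \<longleftrightarrow>
     diff_form A k \<alpha> \<and> diff_form A (Suc k) \<theta> \<and>
     (\<forall>Xs p. length Xs = Suc k \<longrightarrow> (\<forall>X\<in>set Xs. vector_field A X) \<longrightarrow>
        \<theta> p (map (\<lambda>X. X p) Xs) =
          (\<Sum>i\<le>k. (-1) ^ i * (Xs ! i) p (\<lambda>q. \<alpha> q (map (\<lambda>X. X q) (nths Xs (- {i}))))) +
          (\<Sum>j\<le>k. \<Sum>i<j. (-1) ^ (i + j) *
             \<alpha> p (lie_bracket (Xs ! i) (Xs ! j) p # map (\<lambda>X. X p) (nths Xs (- {i, j})))))"

section \<open>Metrics and the Levi-Civita connection\<close>

type_synonym 'a metric = "'a \<Rightarrow> 'a tangent \<Rightarrow> 'a tangent \<Rightarrow> real"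

definition riemannian_metric :: "('a, 'e::euclidean_space) atlas \<Rightarrow> 'a metric \<Rightarrow> bool" where
  "riemannian_metric A g \<longleftrightarrow>
     (\<forall>p v w. \<not> (v \<in> tangent_space A p \<and> w \<in> tangent_space A p) \<longrightarrow> g p v w = 0) \<and>
     (\<forall>p a b. \<forall>u\<in>tangent_space A p. \<forall>v\<in>tangent_space A p. \<forall>w\<in>tangent_space A p.
        g p (a *\<^sub>R u + b *\<^sub>R v) w = a * g p u w + b * g p v w) \<and>
     (\<forall>p v w. g p v w = g p w v) \<and>
     (\<forall>p. \<forall>v\<in>tangent_space A p. v \<noteq> 0 \<longrightarrow> 0 < g p v v) \<and>
     (\<forall>X Y. vector_field A X \<longrightarrow> vector_field A Y \<longrightarrow> smooth_fun A (\<lambda>p. g p (X p) (Y p)))"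

definition affine_connection ::
  "('a, 'e::euclidean_space) atlas \<Rightarrow> ('a vfield \<Rightarrow> 'a vfield \<Rightarrow> 'a vfield) \<Rightarrow> bool" where
  "affine_connection A D \<longleftrightarrow>
     (\<forall>X Y. vector_field A X \<longrightarrow> vector_field A Y \<longrightarrow> vector_field A (D X Y)) \<and>
     (\<forall>X X' Y. vector_field A X \<longrightarrow> vector_field A X' \<longrightarrow> vector_field A Y \<longrightarrow>
        D (X + X') Y = D X Y + D X' Y \<and> D Y (X + X') = D Y X + D Y X') \<and>
     (\<forall>f X Y. smooth_fun A f \<longrightarrow> vector_field A X \<longrightarrow> vector_field A Y \<longrightarrow>
        D (\<lambda>p. f p *\<^sub>R X p) Y = (\<lambda>p. f p *\<^sub>R D X Y p) \<and>
        D X (\<lambda>p. f p *\<^sub>R Y p) = (\<lambda>p. X p f *\<^sub>R Y p + f p *\<^sub>R D X Y p))"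

definition levi_civita ::
  "('a, 'e::euclidean_space) atlas \<Rightarrow> 'a metric \<Rightarrow> ('a vfield \<Rightarrow> 'a vfield \<Rightarrow> 'a vfield) \<Rightarrow> bool" where
  "levi_civita A g D \<longleftrightarrow>
     affine_connection A D \<and>
     (\<forall>X Y. vector_field A X \<longrightarrow> vector_field A Y \<longrightarrow> D X Y - D Y X = lie_bracket X Y) \<and>
     (\<forall>X Y Z p. vector_field A X \<longrightarrow> vector_field A Y \<longrightarrow> vector_field A Z \<longrightarrow>
        X p (\<lambda>q. g q (Y q) (Z q)) = g p (D X Y p) (Z p) + g p (Y p) (D X Z p))"

section \<open>Almost contact metric structures\<close>

type_synonym 'a endo = "'a \<Rightarrow> 'a tangent \<Rightarrow> 'a tangent"

definition endo_field :: "('a, 'e::euclidean_space) atlas \<Rightarrow> 'a endo \<Rightarrow> bool" where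
  "endo_field A \<phi> \<longleftrightarrow>
     (\<forall>p v. v \<notin> tangent_space A p \<longrightarrow> \<phi> p v = 0) \<and>
     (\<forall>p a b. \<forall>v\<in>tangent_space A p. \<forall>w\<in>tangent_space A p.
        \<phi> p (a *\<^sub>R v + b *\<^sub>R w) = a *\<^sub>R \<phi> p v + b *\<^sub>R \<phi> p w) \<and>
     (\<forall>X. vector_field A X \<longrightarrow> vector_field A (\<lambda>p. \<phi> p (X p)))"

definition almost_contact_metric ::
  "('a, 'e::euclidean_space) atlas \<Rightarrow> 'a endo \<Rightarrow> 'a vfield \<Rightarrow> 'a form \<Rightarrow> 'a metric \<Rightarrow> bool" where
  "almost_contact_metric A \<phi> \<xi> \<eta> g \<longleftrightarrow>
     odd DIM('e) \<and>
     endo_field A \<phi> \<and> vector_field A \<xi> \<and> diff_form A 1 \<eta> \<and> riemannian_metric A g \<and>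
     (\<forall>p. \<forall>v\<in>tangent_space A p. \<phi> p (\<phi> p v) = - v + \<eta> p [v] *\<^sub>R \<xi> p) \<and>
     (\<forall>p. \<eta> p [\<xi> p] = 1) \<and>
     (\<forall>p. \<forall>v\<in>tangent_space A p. \<forall>w\<in>tangent_space A p.
        g p (\<phi> p v) (\<phi> p w) = g p v w - \<eta> p [v] * \<eta> p [w])"

definition nabla_endo ::
  "('a vfield \<Rightarrow> 'a vfield \<Rightarrow> 'a vfield) \<Rightarrow> 'a endo \<Rightarrow> 'a vfield \<Rightarrow> 'a vfield \<Rightarrow> 'a vfield" where
  "nabla_endo D \<phi> X Y = D X (\<lambda>q. \<phi> q (Y q)) - (\<lambda>p. \<phi> p (D X Y p))"

definition sasakian ::
  "('a, 'e::euclidean_space) atlas \<Rightarrow> 'a endo \<Rightarrow> 'a vfield \<Rightarrow> 'a form \<Rightarrow> 'a metric \<Rightarrow> bool" where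
  "sasakian A \<phi> \<xi> \<eta> g \<longleftrightarrow>
     almost_contact_metric A \<phi> \<xi> \<eta> g \<and>
     (\<exists>D. levi_civita A g D \<and>
        (\<forall>X Y p. vector_field A X \<longrightarrow> vector_field A Y \<longrightarrow>
           nabla_endo D \<phi> X Y p = g p (X p) (Y p) *\<^sub>R \<xi> p - \<eta> p [Y p] *\<^sub>R X p))"

definition nearly_sasakian ::
  "('a, 'e::euclidean_space) atlas \<Rightarrow> 'a endo \<Rightarrow> 'a vfield \<Rightarrow> 'a form \<Rightarrow> 'a metric \<Rightarrow> bool" where
  "nearly_sasakian A \<phi> \<xi> \<eta> g \<longleftrightarrow>
     almost_contact_metric A \<phi> \<xi> \<eta> g \<and>
     (\<exists>D. levi_civita A g D \<and>
        (\<forall>X Y p. vector_field A X \<longrightarrow> vector_field A Y \<longrightarrow>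
           nabla_endo D \<phi> X Y p + nabla_endo D \<phi> Y X p =
             (2 * g p (X p) (Y p)) *\<^sub>R \<xi> p - \<eta> p [X p] *\<^sub>R Y p - \<eta> p [Y p] *\<^sub>R X p))"

type_synonym 'a acm = "'a endo \<times> 'a vfield \<times> 'a form \<times> 'a metric"

definition proper_nearly_sasakian :: "('a, 'e::euclidean_space) atlas \<Rightarrow> 'a acm set" where
  "proper_nearly_sasakian A =
     {(\<phi>, \<xi>, \<eta>, g). nearly_sasakian A \<phi> \<xi> \<eta> g \<and> \<not> sasakian A \<phi> \<xi> \<eta> g}"

section \<open>\<open>SU(2)\<close>-structures in dimension five\<close>

text \<open>\<open>SU(2)\<close>-structures as triples of almost contact metric structures.\<close>

definition su2_triple ::
  "('a, 'e::euclidean_space) atlas \<Rightarrow> 'a endo \<Rightarrow> 'a endo \<Rightarrow> 'a endo \<Rightarrow>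
     'a vfield \<Rightarrow> 'a form \<Rightarrow> 'a metric \<Rightarrow> bool" where
  "su2_triple A \<phi>1 \<phi>2 \<phi>3 \<xi> \<eta> g \<longleftrightarrow>
     DIM('e) = 5 \<and>
     (\<forall>\<phi>\<in>{\<phi>1, \<phi>2, \<phi>3}. almost_contact_metric A \<phi> \<xi> \<eta> g) \<and>
     (\<forall>(\<phi>, \<psi>, \<theta>)\<in>{(\<phi>1, \<phi>2, \<phi>3), (\<phi>2, \<phi>3, \<phi>1), (\<phi>3, \<phi>1, \<phi>2)}.
        \<forall>p. \<forall>v\<in>tangent_space A p. \<phi> p (\<psi> p v) = \<theta> p v \<and> \<theta> p v = - \<psi> p (\<phi> p v))"

text \<open>\<open>SU(2)\<close>-structures as quadruplets of forms.\<close>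

type_synonym 'a su2 = "'a form \<times> 'a form \<times> 'a form \<times> 'a form"

definition su2_forms ::
  "('a, 'e::euclidean_space) atlas \<Rightarrow> 'a form \<Rightarrow> 'a form \<Rightarrow> 'a form \<Rightarrow> 'a form \<Rightarrow> bool" where
  "su2_forms A \<eta> \<omega>1 \<omega>2 \<omega>3 \<longleftrightarrow>
     DIM('e) = 5 \<and>
     diff_form A 1 \<eta> \<and> (\<forall>\<omega>\<in>{\<omega>1, \<omega>2, \<omega>3}. diff_form A 2 \<omega>) \<and>
     (\<exists>v. diff_form A 4 v \<and>
        (\<forall>i<3. \<forall>j<3. wedge 2 2 ([\<omega>1, \<omega>2, \<omega>3] ! i) ([\<omega>1, \<omega>2, \<omega>3] ! j) = (if i = j then v else 0)) \<and>
        (\<forall>p. wedge 4 1 v \<eta> p \<noteq> 0)) \<and>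
     (\<forall>p. \<forall>x\<in>tangent_space A p. \<forall>y\<in>tangent_space A p.
        (\<forall>z\<in>tangent_space A p. \<omega>1 p [x, z] = \<omega>2 p [y, z]) \<longrightarrow> 0 \<le> \<omega>3 p [x, y])"

text \<open>
  Compatibility of a quadruplet of forms with an almost contact metric structure: the latter is the
  third one, \<open>(\<phi>\<^sub>3, \<xi>, \<eta>, g)\<close>, of the triple that describes the same \<open>SU(2)\<close>-structure through
  \<open>\<omega>\<^sub>i(X,Y) = g(\<phi>\<^sub>i X, Y)\<close>.
\<close>

definition third_acm ::
  "('a, 'e::euclidean_space) atlas \<Rightarrow> 'a su2 \<Rightarrow> 'a acm \<Rightarrow> bool" where
  "third_acm A = (\<lambda>(\<eta>, \<omega>1, \<omega>2, \<omega>3) (\<phi>, \<xi>, \<eta>', g).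
     \<eta>' = \<eta> \<and>
     (\<exists>\<phi>1 \<phi>2. su2_triple A \<phi>1 \<phi>2 \<phi> \<xi> \<eta> g \<and>
        (\<forall>(\<omega>, \<psi>)\<in>{(\<omega>1, \<phi>1), (\<omega>2, \<phi>2), (\<omega>3, \<phi>)}.
           \<forall>p. \<forall>v\<in>tangent_space A p. \<forall>w\<in>tangent_space A p. \<omega> p [v, w] = g p (\<psi> p v) w)))"

definition nearly_hypo :: "('a, 'e::euclidean_space) atlas \<Rightarrow> 'a su2 \<Rightarrow> bool" where
  "nearly_hypo A = (\<lambda>(\<eta>, \<omega>1, \<omega>2, \<omega>3).
     su2_forms A \<eta> \<omega>1 \<omega>2 \<omega>3 \<and>
     has_ext_deriv A 2 \<omega>1 (3 *\<^sub>R wedge 1 2 \<eta> \<omega>2) \<and>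
     has_ext_deriv A 3 (wedge 1 2 \<eta> \<omega>3) (- 2 *\<^sub>R wedge 2 2 \<omega>1 \<omega>1))"

definition su2_family :: "('a, 'e::euclidean_space) atlas \<Rightarrow> real set \<Rightarrow> 'a su2 set" where
  "su2_family A L = {(\<eta>, \<omega>1, \<omega>2, \<omega>3).
     su2_forms A \<eta> \<omega>1 \<omega>2 \<omega>3 \<and>
     (\<exists>l\<in>L.
        has_ext_deriv A 1 \<eta> (- 2 *\<^sub>R \<omega>3 + (2 * l) *\<^sub>R \<omega>1) \<and>
        has_ext_deriv A 2 \<omega>1 (3 *\<^sub>R wedge 1 2 \<eta> \<omega>2) \<and>
        has_ext_deriv A 2 \<omega>2 (- 3 *\<^sub>R wedge 1 2 \<eta> \<omega>1 - (3 * l) *\<^sub>R wedge 1 2 \<eta> \<omega>3))}"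

text \<open>
  If \<open>(\<eta>, \<omega>\<^sub>1, \<omega>\<^sub>2, \<omega>\<^sub>3)\<close> is a solution for \<open>\<lambda>\<close>, then \<open>(\<eta>, -\<omega>\<^sub>1, -\<omega>\<^sub>2, \<omega>\<^sub>3)\<close> is a solution for \<open>-\<lambda>\<close>
  with the same third almost contact metric structure.
\<close>

definition su2_flip :: "'a su2 \<Rightarrow> 'a su2"
  where "su2_flip = (\<lambda>(\<eta>, \<omega>1, \<omega>2, \<omega>3). (\<eta>, - \<omega>1, - \<omega>2, \<omega>3))"

end

theory Submission
  imports Defs
begin

text \<open>
  Let \<open>h = -\<phi>k\<close> with \<open>k = \<nabla>\<^sub>\<xi>\<phi>\<close> on a nearly Sasakian 5-manifold. The tensor
  \<open>g((\<nabla>\<^sub>X\<phi>)Y,Z) - g(X,Y)\<eta>(Z) + \<eta>(Y)g(X,Z)\<close> is totally skew. Differentiating \<open>\<phi>\<^sup>2\<close> shows that on the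
  contact distribution it commutes with \<open>\<phi>\<close> in its last two arguments; as this distribution has rank
  four, the tensor vanishes there, and it therefore is \<open>\<eta> \<and> \<sigma>\<^sub>2\<close> with \<open>\<sigma>\<^sub>2 = g(k\<cdot>,\<cdot>)\<close>. Hence
  \<open>\<nabla>\<^sub>X\<xi> = -\<phi>X + hX\<close>, \<open>d\<eta> = -2\<omega>\<^sub>3 + 2\<sigma>\<^sub>1\<close> with \<open>\<sigma>\<^sub>1 = g(h\<cdot>,\<cdot>)\<close>, and \<open>d\<omega>\<^sub>3 = d\<sigma>\<^sub>1 = 3\<eta> \<and> \<sigma>\<^sub>2\<close>. The
  field \<open>\<xi>\<close> is Killing, \<open>h\<^sup>2 = -f\<close> on the contact distribution, and taking Lie derivatives of \<open>\<phi>\<close>, \<open>h\<close> and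
  \<open>k = \<phi>h\<close> along \<open>\<xi>\<close> gives \<open>d\<sigma>\<^sub>2 = -3\<eta> \<and> \<sigma>\<^sub>1 - 3f \<eta> \<and> \<omega>\<^sub>3\<close>. Since \<open>d\<close> commutes with the Lie derivative,
  \<open>f\<close> is constant. If \<open>f = 0\<close>, the structure is Sasakian; otherwise \<open>f = \<lambda>\<^sup>2\<close>, and \<open>h/\<lambda>\<close>, \<open>k/\<lambda>\<close>, \<open>\<phi>\<close> is the
  required triple.

  Conversely, the equations and \<open>d\<^sup>2\<eta> = 0\<close> show that the Lie derivative along \<open>\<xi>\<close> acts on the span of the
  \<open>\<omega>\<^sub>i\<close>. This makes \<open>\<xi>\<close> a Killing field and determines \<open>\<nabla>\<xi>\<close> and \<open>\<nabla>\<^sub>\<xi>\<phi>\<^sub>3\<close>. The \<open>\<omega>\<^sub>i\<close> are closed on the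
  contact distribution, so by Hitchin's lemma the remaining part of \<open>\<nabla>\<phi>\<^sub>3\<close> vanishes.
\<close>


section \<open>Smooth functions on open subsets of Euclidean space\<close>

text \<open>A structure \<open>(\<phi>, \<xi>, \<eta>, g)\<close> does not see the sign of
  \<lambda>: h/\<lambda> and k/\<lambda> change sign with \<lambda> while \<phi> stays, so each
  proper nearly Sasakian structure belongs to two quadruplets, interchanged by
  \<open>su2_flip\<close>, and to one with \<lambda> > 0. Constancy of f: the Lie derivative of
  \<sigma>2 is -3\<sigma>1 - 3f\<omega>3, and its differential, being the Lie derivative of
  d\<sigma>2, is a multiple of \<eta>. On the contact distribution this leaves df \<and> \<omega>3 =
  0, and in rank four wedging 1-forms with a nondegenerate 2-form is injective. In the converse,
  \<xi> is Killing because \<omega>1 and \<omega>2 alone determine \<phi>3: their Lie derivatives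
  give that of \<phi>3, and comparison with that of \<omega>3 leaves nothing for g. A quadruplet
  comes without \<xi>, \<phi>i and g: \<xi> spans the common kernel of the \<omega>i, the \<phi>i
  solve linear equations between two of the forms, and the metric is read off last.\<close>

lemma has_derivative_frechet_at:
  assumes "f differentiable_on S" "open S" "x \<in> S"
  shows "(f has_derivative frechet_derivative f (at x)) (at x)"
  using assms by (metis differentiable_on_eq_differentiable_at frechet_derivative_works)

lemma Ck_on_SucI:
  assumes "open S" and d: "\<And>x. x \<in> S \<Longrightarrow> (f has_derivative f' x) (at x)"
    and c: "\<And>v. Ck_on k S (\<lambda>x. frechet_derivative f (at x) v)"
  shows "Ck_on (Suc k) S f"
  unfolding Ck_on.simps differentiable_on_eq_differentiable_at[OF assms(1)]
  using c differentiableI[OF d] by blast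

text \<open>\<open>Ck_on\<close> speaks of total functions and of derivatives in the whole space; on
  an open set the values there decide both. Functions defined by cases, such as extensions by zero,
  become tractable through this.\<close>

lemma Ck_on_cong:
  assumes "open S" "\<And>x. x \<in> S \<Longrightarrow> f x = g x" "Ck_on k S f"
  shows "Ck_on k S g"
  using assms(2,3)
proof (induction k arbitrary: f g)
  case 0
  then show ?case using continuous_on_cong[OF refl, of S f g] by auto
next
  case (Suc k)
  have d: "(g has_derivative frechet_derivative f (at x)) (at x)" if "x \<in> S" for x
  proof (rule has_derivative_transform_within_open[of f])
    show "(f has_derivative frechet_derivative f (at x)) (at x)"
      using Suc.prems(2) that assms(1) by (auto intro: has_derivative_frechet_at)
  qed (use that assms Suc.prems in auto)
  have e: "frechet_derivative f (at x) = frechet_derivative g (at x)" if "x \<in> S" for x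
    using frechet_derivative_at[OF d[OF that]] .
  show ?case
  proof (rule Ck_on_SucI[OF assms(1) d])
    fix v
    show "Ck_on k S (\<lambda>x. frechet_derivative g (at x) v)"
      by (rule Suc.IH[of "\<lambda>x. frechet_derivative f (at x) v"]) (use Suc.prems e in auto)
  qed
qed

text \<open>Any formula for the derivative may replace \<open>frechet_derivative\<close>; most
  closure rules below are inductions through this rule.\<close>

lemma Ck_on_SucI':
  assumes "open S" and d: "\<And>x. x \<in> S \<Longrightarrow> (f has_derivative f' x) (at x)"
    and c: "\<And>v. Ck_on k S (\<lambda>x. f' x v)"
  shows "Ck_on (Suc k) S f"
proof (rule Ck_on_SucI[OF assms(1) d])
  fix v
  show "Ck_on k S (\<lambda>x. frechet_derivative f (at x) v)"
    by (rule Ck_on_cong[OF assms(1) _ c[of v]]) (metis d frechet_derivative_at)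
qed

lemma Ck_on_subset:
  assumes "open S" "open T" "T \<subseteq> S" "Ck_on k S f"
  shows "Ck_on k T f"
  using assms(4)
  by (induction k arbitrary: f)
    (use assms in \<open>auto intro: continuous_on_subset differentiable_on_subset\<close>)

lemma Ck_on_imp_continuous_on: "Ck_on k S f \<Longrightarrow> continuous_on S f"
  by (cases k) (auto intro: differentiable_imp_continuous_on)

lemma Ck_on_mono_Suc: "Ck_on (Suc k) S f \<Longrightarrow> Ck_on k S f"
proof (induction k arbitrary: f)
  case 0
  then show ?case by (auto intro: differentiable_imp_continuous_on)
next
  case (Suc k)
  then have "f differentiable_on S" by simp
  moreover have "Ck_on k S (\<lambda>x. frechet_derivative f (at x) v)" for v
    by (rule Suc.IH) (use Suc.prems in simp)
  ultimately show ?case by simp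
qed

lemma Ck_on_local:
  assumes "open S" "\<And>x. x \<in> S \<Longrightarrow> \<exists>T. open T \<and> x \<in> T \<and> Ck_on k T f"
  shows "Ck_on k S f"
  using assms(2)
proof (induction k arbitrary: f)
  case 0
  have "\<forall>x\<in>S. isCont f x"
    using 0 unfolding Ck_on.simps by (meson continuous_on_eq_continuous_at)
  then show ?case
    using assms(1) by (auto simp: continuous_on_eq_continuous_at)
next
  case (Suc k)
  show ?case
  proof (rule Ck_on_SucI[OF assms(1)])
    fix x assume "x \<in> S"
    then show "(f has_derivative frechet_derivative f (at x)) (at x)"
      using Suc.prems[of x] by (auto intro: has_derivative_frechet_at)
  next
    fix v show "Ck_on k S (\<lambda>x. frechet_derivative f (at x) v)"
      by (rule Suc.IH) (use Suc.prems in fastforce)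
  qed
qed

lemma Ck_on_const: "Ck_on k S (\<lambda>x. c)"
proof (induction k arbitrary: c)
  case (Suc k)
  then show ?case by simp
qed simp

lemma Ck_on_bounded_linear_compose:
  assumes "open S" "bounded_linear L" "Ck_on k S f"
  shows "Ck_on k S (\<lambda>x. L (f x))"
  using assms(3)
proof (induction k arbitrary: f)
  case 0
  then show ?case using assms(2) by (auto intro: bounded_linear.continuous_on)
next
  case (Suc k)
  show ?case
  proof (rule Ck_on_SucI'[OF assms(1)])
    fix x assume "x \<in> S"
    then show "((\<lambda>x. L (f x)) has_derivative (\<lambda>v. L (frechet_derivative f (at x) v))) (at x)"
      using Suc.prems assms(1)
      by (intro bounded_linear.has_derivative[OF assms(2)] has_derivative_frechet_at[of f S]) simp_all
  qed (use Suc in auto)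
qed

lemma Ck_on_bounded_linear:
  assumes "open S" "bounded_linear L"
  shows "Ck_on k S L"
proof (cases k)
  case 0
  then show ?thesis using assms(2) by (auto intro: linear_continuous_on)
next
  case (Suc m)
  show ?thesis unfolding Suc
    by (rule Ck_on_SucI'[OF assms(1)])
      (auto intro: bounded_linear_imp_has_derivative[OF assms(2)] Ck_on_const)
qed

lemma Ck_on_add:
  assumes "open S" "Ck_on k S f" "Ck_on k S g"
  shows "Ck_on k S (\<lambda>x. f x + g x)"
  using assms(2,3)
proof (induction k arbitrary: f g)
  case (Suc k)
  show ?case
  proof (rule Ck_on_SucI'[OF assms(1)])
    fix x assume "x \<in> S"
    then show "((\<lambda>x. f x + g x) has_derivative
        (\<lambda>v. frechet_derivative f (at x) v + frechet_derivative g (at x) v)) (at x)"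
      using Suc.prems assms(1) by (auto intro!: has_derivative_add has_derivative_frechet_at)
  qed (use Suc in auto)
qed (auto intro: continuous_intros)

lemma Ck_on_scaleR:
  assumes "open S" "Ck_on k S f" "Ck_on k S g"
  shows "Ck_on k S (\<lambda>x. f x *\<^sub>R g x)"
  using assms(2,3)
proof (induction k arbitrary: f g)
  case (Suc k)
  show ?case
  proof (rule Ck_on_SucI'[OF assms(1)])
    fix x assume "x \<in> S"
    then show "((\<lambda>x. f x *\<^sub>R g x) has_derivative
        (\<lambda>v. f x *\<^sub>R frechet_derivative g (at x) v + frechet_derivative f (at x) v *\<^sub>R g x)) (at x)"
      using Suc.prems assms(1) by (auto intro!: has_derivative_scaleR has_derivative_frechet_at)
  next
    fix v
    have "Ck_on k S f" "Ck_on k S g"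
      using Suc.prems Ck_on_mono_Suc by blast+
    then show "Ck_on k S (\<lambda>x. f x *\<^sub>R frechet_derivative g (at x) v + frechet_derivative f (at x) v *\<^sub>R g x)"
      by (intro Ck_on_add[OF assms(1)] Suc.IH) (use Suc.prems in auto)
  qed
qed (auto intro: continuous_intros)

lemma Ck_on_mult:
  fixes f g :: "'e::euclidean_space \<Rightarrow> real"
  assumes "open S" "Ck_on k S f" "Ck_on k S g"
  shows "Ck_on k S (\<lambda>x. f x * g x)"
  using Ck_on_scaleR[OF assms] by simp

lemma Ck_on_sum:
  assumes "open S" "\<And>i. i \<in> I \<Longrightarrow> Ck_on k S (f i)"
  shows "Ck_on k S (\<lambda>x. \<Sum>i\<in>I. f i x)"
  using assms(2)
  by (induction I rule: infinite_finite_induct) (auto intro: Ck_on_const Ck_on_add assms(1))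

lemma Ck_on_inverse:
  fixes f :: "'e::euclidean_space \<Rightarrow> real"
  assumes "open S" "Ck_on k S f" "\<And>x. x \<in> S \<Longrightarrow> f x \<noteq> 0"
  shows "Ck_on k S (\<lambda>x. inverse (f x))"
  using assms(2)
proof (induction k)
  case 0
  then show ?case using assms(3) by (auto intro!: continuous_intros)
next
  case (Suc k)
  show ?case
  proof (rule Ck_on_SucI'[OF assms(1)])
    fix x assume "x \<in> S"
    then show "((\<lambda>x. inverse (f x)) has_derivative
        (\<lambda>v. (-1) * (inverse (f x) * frechet_derivative f (at x) v * inverse (f x)))) (at x)"
      using Suc.prems assms Deriv.has_derivative_inverse[OF assms(3) has_derivative_frechet_at[of f S x]]
      by auto
  next
    fix v
    have "Ck_on k S (\<lambda>x. inverse (f x))"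
      using Suc.prems Suc.IH Ck_on_mono_Suc by blast
    then show "Ck_on k S (\<lambda>x. (-1) * (inverse (f x) * frechet_derivative f (at x) v * inverse (f x)))"
      by (intro Ck_on_mult[OF assms(1)] Ck_on_const) (use Suc.prems in auto)
  qed
qed

text \<open>In the chain rule f'(g x)(g'(x) v) the direction varies with x. Expanding it in the
  basis leaves directional derivatives of f along fixed vectors, to which the induction hypothesis
  (for arbitrary f, fixed g) applies.\<close>

lemma Ck_on_compose:
  fixes g :: "'e::euclidean_space \<Rightarrow> 'f::euclidean_space" and f :: "'f \<Rightarrow> 'h::real_normed_vector"
  assumes "open S" "open T" "g ` S \<subseteq> T" "Ck_on k S g" "Ck_on k T f"
  shows "Ck_on k S (\<lambda>x. f (g x))"
  using assms(4,5)
proof (induction k arbitrary: f)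
  case 0
  then show ?case using assms(3) by (auto intro: continuous_on_compose2)
next
  case (Suc k)
  have lin: "linear (frechet_derivative f (at (g x)))" if "x \<in> S" for x
  proof -
    have "g x \<in> T" using that assms(3) by auto
    then have "(f has_derivative frechet_derivative f (at (g x))) (at (g x))"
      using Suc.prems assms(2) by (auto intro: has_derivative_frechet_at)
    then show ?thesis by (rule has_derivative_linear)
  qed
  show ?case
  proof (rule Ck_on_SucI[OF assms(1)])
    fix x assume x: "x \<in> S"
    then have "g x \<in> T" using assms(3) by auto
    then show D: "((\<lambda>x. f (g x)) has_derivative
        (\<lambda>v. frechet_derivative f (at (g x)) (frechet_derivative g (at x) v))) (at x)"
      using Suc.prems assms x
      by (intro has_derivative_compose[of g _ _ _ f]) (auto intro: has_derivative_frechet_at)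
  next
    fix v
    let ?F = "\<lambda>x. \<Sum>b\<in>Basis. (frechet_derivative g (at x) v \<bullet> b) *\<^sub>R frechet_derivative f (at (g x)) b"
    have "Ck_on k S g" using Suc.prems(1) Ck_on_mono_Suc by blast
    then have "Ck_on k S ?F"
      using Suc.prems
      by (intro Ck_on_sum Ck_on_scaleR Suc.IH assms(1)
            Ck_on_bounded_linear_compose[OF assms(1) bounded_linear_inner_left]) auto
    then show "Ck_on k S (\<lambda>x. frechet_derivative (\<lambda>x. f (g x)) (at x) v)"
    proof (rule Ck_on_cong[OF assms(1), rotated])
      fix x assume x: "x \<in> S"
      then have gx: "g x \<in> T" using assms(3) by auto
      have "((\<lambda>x. f (g x)) has_derivative
        (\<lambda>v. frechet_derivative f (at (g x)) (frechet_derivative g (at x) v))) (at x)"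
        using Suc.prems assms x gx
        by (intro has_derivative_compose[of g _ _ _ f]) (auto intro: has_derivative_frechet_at)
      then have "frechet_derivative (\<lambda>x. f (g x)) (at x) v =
          frechet_derivative f (at (g x)) (frechet_derivative g (at x) v)"
        by (metis frechet_derivative_at)
      also have "\<dots> = frechet_derivative f (at (g x))
          (\<Sum>b\<in>Basis. (frechet_derivative g (at x) v \<bullet> b) *\<^sub>R b)"
        by (simp add: euclidean_representation)
      also have "\<dots> = ?F x"
        using lin[OF x] by (simp add: linear_sum linear_scale)
      finally show "?F x = frechet_derivative (\<lambda>x. f (g x)) (at x) v" ..
    qed
  qed
qed

lemma smooth_on_cong:
  "open S \<Longrightarrow> (\<And>x. x \<in> S \<Longrightarrow> f x = g x) \<Longrightarrow> smooth_on S f \<Longrightarrow> smooth_on S g"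
  unfolding smooth_on_def using Ck_on_cong by blast

lemma smooth_on_subset: "open S \<Longrightarrow> open T \<Longrightarrow> T \<subseteq> S \<Longrightarrow> smooth_on S f \<Longrightarrow> smooth_on T f"
  unfolding smooth_on_def using Ck_on_subset by blast

lemma smooth_on_local:
  "open S \<Longrightarrow> (\<And>x. x \<in> S \<Longrightarrow> \<exists>T. open T \<and> x \<in> T \<and> smooth_on T f) \<Longrightarrow> smooth_on S f"
  unfolding smooth_on_def using Ck_on_local by meson

lemma smooth_on_continuous_on: "smooth_on S f \<Longrightarrow> continuous_on S f"
  unfolding smooth_on_def using Ck_on_imp_continuous_on by blast

lemma smooth_on_const: "smooth_on S (\<lambda>x. c)"
  by (simp add: smooth_on_def Ck_on_const)

lemma smooth_on_bounded_linear: "open S \<Longrightarrow> bounded_linear L \<Longrightarrow> smooth_on S L"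
  by (simp add: smooth_on_def Ck_on_bounded_linear)

lemma smooth_on_add:
  "open S \<Longrightarrow> smooth_on S f \<Longrightarrow> smooth_on S g \<Longrightarrow> smooth_on S (\<lambda>x. f x + g x)"
  by (simp add: smooth_on_def Ck_on_add)

lemma smooth_on_mult:
  fixes f g :: "'e::euclidean_space \<Rightarrow> real"
  shows "open S \<Longrightarrow> smooth_on S f \<Longrightarrow> smooth_on S g \<Longrightarrow> smooth_on S (\<lambda>x. f x * g x)"
  by (simp add: smooth_on_def Ck_on_mult)

lemma smooth_on_sum:
  "open S \<Longrightarrow> (\<And>i. i \<in> I \<Longrightarrow> smooth_on S (f i)) \<Longrightarrow> smooth_on S (\<lambda>x. \<Sum>i\<in>I. f i x)"
  by (simp add: smooth_on_def Ck_on_sum)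

lemma smooth_on_inverse:
  fixes f :: "'e::euclidean_space \<Rightarrow> real"
  shows "open S \<Longrightarrow> smooth_on S f \<Longrightarrow> (\<And>x. x \<in> S \<Longrightarrow> f x \<noteq> 0) \<Longrightarrow> smooth_on S (\<lambda>x. inverse (f x))"
  by (simp add: smooth_on_def Ck_on_inverse)

lemma smooth_on_compose:
  fixes g :: "'e::euclidean_space \<Rightarrow> 'f::euclidean_space"
  shows "open S \<Longrightarrow> open T \<Longrightarrow> g ` S \<subseteq> T \<Longrightarrow> smooth_on S g \<Longrightarrow> smooth_on T f \<Longrightarrow>
    smooth_on S (\<lambda>x. f (g x))"
  unfolding smooth_on_def using Ck_on_compose by blast

lemma smooth_on_frechet_derivative:
  "smooth_on S f \<Longrightarrow> smooth_on S (\<lambda>x. frechet_derivative f (at x) v)"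
  unfolding smooth_on_def by (metis Ck_on.simps(2))

lemma smooth_on_has_derivative:
  "smooth_on S f \<Longrightarrow> open S \<Longrightarrow> x \<in> S \<Longrightarrow> (f has_derivative frechet_derivative f (at x)) (at x)"
  unfolding smooth_on_def by (metis Ck_on.simps(2) has_derivative_frechet_at)

subsection \<open>Bump functions\<close>

text \<open>The powers of 1/t are carried along because the family is then closed under
  differentiation, at 0 included, so that all members are shown smooth by one induction.\<close>

definition flat :: "nat \<Rightarrow> real \<Rightarrow> real"
  where "flat n t = (if t > 0 then exp (- inverse t) * inverse t ^ n else 0)"

lemma flat_tendsto_0: "(flat n \<longlongrightarrow> 0) (at 0)"
proof -
  have "((\<lambda>t. inverse t ^ n / exp (inverse t)) \<longlongrightarrow> (0::real)) (at_right 0)"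
    by (rule filterlim_compose[OF tendsto_power_div_exp_0 filterlim_inverse_at_top_right])
  moreover have "eventually (\<lambda>t. inverse t ^ n / exp (inverse t) = flat n t) (at_right 0)"
    using eventually_at_right_less[of "0::real"]
    by eventually_elim (simp add: flat_def exp_minus field_simps)
  ultimately have "(flat n \<longlongrightarrow> 0) (at_right 0)"
    by (rule Lim_transform_eventually)
  moreover have "(flat n \<longlongrightarrow> 0) (at_left 0)"
    by (rule Lim_transform_eventually[of "\<lambda>_. 0"])
      (auto simp: eventually_at_filter flat_def)
  ultimately show ?thesis
    by (simp add: filterlim_split_at)
qed

lemma flat_deriv: "(flat n has_real_derivative (flat (n + 2) t - n * flat (n + 1) t)) (at t)"
proof -
  consider "t > 0" | "t < 0" | "t = 0" by linarith
  then show ?thesis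
  proof cases
    case 1
    have "((\<lambda>t. exp (- inverse t) * inverse t ^ n) has_real_derivative
        (flat (n + 2) t - n * flat (n + 1) t)) (at t)"
    proof -
      have "((\<lambda>t. inverse t ^ n) has_real_derivative - (n * inverse t ^ (n + 1))) (at t)"
        using 1 DERIV_power[OF DERIV_inverse[of t UNIV], of n] by (cases n) (simp_all add: mult_ac)
      moreover have "((\<lambda>t. exp (- inverse t)) has_real_derivative exp (- inverse t) * inverse t ^ 2) (at t)"
        using 1 by (auto intro!: derivative_eq_intros simp: power2_eq_square)
      ultimately show ?thesis
        using 1 DERIV_mult by (fastforce simp: flat_def algebra_simps power2_eq_square)
    qed
    then show ?thesis
      by (rule has_field_derivative_transform_within_open[of _ _ _ "{0<..}"])
        (use 1 in \<open>auto simp: flat_def\<close>)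
  next
    case 2
    have "((\<lambda>t. 0) has_real_derivative (flat (n + 2) t - n * flat (n + 1) t)) (at t)"
      using 2 by (auto simp: flat_def)
    then show ?thesis
      by (rule has_field_derivative_transform_within_open[of _ _ _ "{..<0}"])
        (use 2 in \<open>auto simp: flat_def\<close>)
  next
    case 3
    have "(\<lambda>h. (flat n (0 + h) - flat n 0) / h) = flat (n + 1)"
      by (auto simp: flat_def fun_eq_iff field_simps)
    then show ?thesis
      using flat_tendsto_0[of "n + 1"] 3
      by (simp add: DERIV_def flat_def)
  qed
qed

lemma smooth_flat: "smooth_on UNIV (flat n)"
proof -
  have "Ck_on k UNIV (flat n)" for k
  proof (induction k arbitrary: n)
    case 0
    have "continuous_on UNIV (flat n)"
      by (rule DERIV_continuous_on) (use flat_deriv in blast)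
    then show ?case by simp
  next
    case (Suc k)
    show ?case
    proof (rule Ck_on_SucI')
      fix x :: real
      show "(flat n has_derivative (*) (flat (n + 2) x - n * flat (n + 1) x)) (at x)"
        using flat_deriv[of n x] by (simp add: has_field_derivative_def)
    next
      fix v :: real
      have "Ck_on k UNIV (\<lambda>x. (flat (n + 2) x + (- real n) * flat (n + 1) x) * v)"
        by (intro Ck_on_mult Ck_on_add Ck_on_const Suc.IH) auto
      then show "Ck_on k UNIV (\<lambda>x. (flat (n + 2) x - n * flat (n + 1) x) * v)"
        by simp
    qed auto
  qed
  then show ?thesis by (simp add: smooth_on_def)
qed

text \<open>The quotient p/(p + q), where p is positive exactly inside radius r and q exactly
  outside the closed ball of radius r/2; hence the denominator never vanishes. The distance enters
  squared to be smooth at the centre.\<close>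

lemma bump_exists:
  fixes a :: "'e::euclidean_space"
  assumes "r > 0"
  obtains b :: "'e \<Rightarrow> real" where "smooth_on UNIV b" "\<And>x. x \<in> ball a (r / 2) \<Longrightarrow> b x = 1"
    "\<And>x. x \<notin> ball a r \<Longrightarrow> b x = 0"
proof -
  define N where "N = (\<lambda>x. (x - a) \<bullet> (x - a))"
  have inner_eq: "N = (\<lambda>x. \<Sum>i\<in>Basis. (x \<bullet> i + (- (a \<bullet> i))) * (x \<bullet> i + (- (a \<bullet> i))))"
    unfolding N_def fun_eq_iff by (subst euclidean_inner) (simp add: inner_diff_left)
  have sN: "smooth_on UNIV N"
    unfolding inner_eq
    by (intro smooth_on_sum smooth_on_mult smooth_on_add smooth_on_const
          smooth_on_bounded_linear[OF _ bounded_linear_inner_left]) auto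
  define p q where "p = (\<lambda>x. flat 0 (r\<^sup>2 + (-1) * N x))" and "q = (\<lambda>x. flat 0 (N x + (- (r\<^sup>2 / 4))))"
  have sp: "smooth_on UNIV p"
    unfolding p_def
    by (rule smooth_on_compose[OF open_UNIV open_UNIV subset_UNIV _ smooth_flat])
      (intro smooth_on_add smooth_on_mult smooth_on_const sN open_UNIV)
  have sq: "smooth_on UNIV q"
    unfolding q_def
    by (rule smooth_on_compose[OF open_UNIV open_UNIV subset_UNIV _ smooth_flat])
      (intro smooth_on_add smooth_on_mult smooth_on_const sN open_UNIV)
  have N: "N x = (dist a x)\<^sup>2" for x
    by (simp add: N_def dist_norm norm_minus_commute dot_square_norm)
  have pq: "p x + q x \<noteq> 0" for x
  proof -
    have "p x > 0 \<or> q x > 0"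
    proof (cases "N x < r\<^sup>2")
      case False
      then have "N x > r\<^sup>2 / 4" using assms zero_less_power[of r 2] by linarith
      then show ?thesis by (simp add: q_def flat_def)
    qed (simp add: p_def flat_def)
    moreover have "p x \<ge> 0" "q x \<ge> 0" by (auto simp: p_def q_def flat_def)
    ultimately show ?thesis by linarith
  qed
  show thesis
  proof
    show "smooth_on UNIV (\<lambda>x. p x * inverse (p x + q x))"
      by (intro smooth_on_mult smooth_on_inverse smooth_on_add sp sq pq) auto
    fix x
    show "p x * inverse (p x + q x) = 1" if "x \<in> ball a (r / 2)"
    proof -
      have "(dist a x)\<^sup>2 < (r / 2)\<^sup>2"
        using that by (intro power_strict_mono) auto
      then have "q x = 0"
        by (auto simp: q_def flat_def N power_divide)
      then show ?thesis using pq[of x] by simp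
    qed
    show "p x * inverse (p x + q x) = 0" if "x \<notin> ball a r"
    proof -
      have "r\<^sup>2 \<le> (dist a x)\<^sup>2"
        using that assms by (intro power_mono) auto
      then have "p x = 0" by (auto simp: p_def flat_def N)
      then show ?thesis by simp
    qed
  qed
qed

subsection \<open>Hadamard's lemma\<close>

lemma segment_in_ball:
  fixes a :: "'e::real_normed_vector"
  assumes "y \<in> ball a r" "t \<in> {0..1}"
  shows "a + t *\<^sub>R (y - a) \<in> ball a r"
proof -
  have "dist a (a + t *\<^sub>R (y - a)) = t * dist a y"
    using assms by (simp add: dist_norm norm_minus_commute[of a y])
  also have "\<dots> \<le> 1 * dist a y" using assms by (intro mult_right_mono) auto
  finally show ?thesis using assms by auto
qed

text \<open>Differentiation under the integral brings down one factor t. The weight t^m is part of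
  the statement so that the derivative is made of integrals of the same kind and the induction for
  smoothness closes.\<close>

lemma integral_has_derivative:
  fixes f :: "'e::euclidean_space \<Rightarrow> real"
  assumes f: "smooth_on (ball a r) f" and y: "y \<in> ball a r"
  shows "((\<lambda>y. integral {0..1} (\<lambda>t. t ^ m * f (a + t *\<^sub>R (y - a)))) has_derivative
     (\<lambda>v. \<Sum>b\<in>Basis. (v \<bullet> b) *
        integral {0..1} (\<lambda>t. t ^ Suc m * frechet_derivative f (at (a + t *\<^sub>R (y - a))) b))) (at y)"
proof -
  let ?B = "ball a r"
  let ?D = "\<lambda>b x. frechet_derivative f (at x) b"
  define fx where "fx = (\<lambda>y t. \<Sum>b\<in>Basis. (t ^ Suc m * ?D b (a + t *\<^sub>R (y - a))) *\<^sub>R blinfun_inner_left b)"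
  have lin: "linear (frechet_derivative f (at x))" if "x \<in> ?B" for x
    using smooth_on_has_derivative[OF f _ that] by (auto intro: has_derivative_linear)
  have Dc: "continuous_on ?B (?D b)" for b
    by (intro smooth_on_continuous_on smooth_on_frechet_derivative f)
  have c2: "continuous_on (?B \<times> {0..1}) (\<lambda>(y, t). a + t *\<^sub>R (y - a))"
    by (auto simp: case_prod_unfold intro!: continuous_intros)
  have cseg: "continuous_on (?B \<times> {0..1}) (\<lambda>(y, t). h (a + t *\<^sub>R (y - a)))"
    if "continuous_on ?B h" for h :: "'e \<Rightarrow> real"
    using continuous_on_compose2[OF that c2] segment_in_ball[of _ a r]
    by (force simp: case_prod_unfold)
  have cfix: "continuous_on {0..1} (\<lambda>t. h (a + t *\<^sub>R (x - a)))"
    if "continuous_on ?B h" "x \<in> ?B" for h :: "'e \<Rightarrow> real" and x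
    by (rule continuous_on_compose2[OF that(1)])
      (use segment_in_ball[OF that(2)] in \<open>auto intro!: continuous_intros\<close>)
  have "((\<lambda>y. integral (cbox 0 1) (\<lambda>t. t ^ m * f (a + t *\<^sub>R (y - a)))) has_derivative
      blinfun_apply (integral (cbox 0 1) (fx y))) (at y within ?B)"
  proof (rule leibniz_rule[where fx = fx])
    fix x and t :: real assume x: "x \<in> ?B" and t: "t \<in> cbox 0 1"
    have xt: "a + t *\<^sub>R (x - a) \<in> ?B"
      using segment_in_ball[OF x] t by auto
    have "((\<lambda>x. t ^ m * f (a + t *\<^sub>R (x - a))) has_derivative
       (\<lambda>v. t ^ m * frechet_derivative f (at (a + t *\<^sub>R (x - a))) (t *\<^sub>R v))) (at x)"
      by (rule has_derivative_mult_right, rule has_derivative_compose[of _ _ _ _ f])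
        (auto intro!: derivative_eq_intros smooth_on_has_derivative[OF f] xt[unfolded mem_ball])
    moreover have "(\<lambda>v. t ^ m * frechet_derivative f (at (a + t *\<^sub>R (x - a))) (t *\<^sub>R v)) =
       blinfun_apply (fx x t)"
    proof
      fix v
      have "frechet_derivative f (at (a + t *\<^sub>R (x - a))) (t *\<^sub>R v) =
        frechet_derivative f (at (a + t *\<^sub>R (x - a))) (t *\<^sub>R (\<Sum>b\<in>Basis. (v \<bullet> b) *\<^sub>R b))"
        by (simp add: euclidean_representation)
      also have "\<dots> = t * (\<Sum>b\<in>Basis. (v \<bullet> b) * ?D b (a + t *\<^sub>R (x - a)))"
        using lin[OF xt] by (simp add: linear_sum linear_scale sum_distrib_left mult.assoc)
      finally show "t ^ m * frechet_derivative f (at (a + t *\<^sub>R (x - a))) (t *\<^sub>R v) =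
         blinfun_apply (fx x t) v"
        by (simp add: fx_def blinfun.sum_left blinfun.scaleR_left sum_distrib_left mult_ac inner_commute cong: sum.cong)
    qed
    ultimately show "((\<lambda>x. t ^ m * f (a + t *\<^sub>R (x - a))) has_derivative blinfun_apply (fx x t)) (at x within ?B)"
      by (simp add: has_derivative_at_withinI)
  next
    fix x assume "x \<in> ?B"
    then show "(\<lambda>t. t ^ m * f (a + t *\<^sub>R (x - a))) integrable_on cbox 0 1"
      by (intro integrable_continuous)
        (auto intro!: continuous_intros cfix[unfolded atLeastAtMost_iff] smooth_on_continuous_on[OF f]
          simp: cbox_interval)
  next
    have "continuous_on (?B \<times> {0..1}) (\<lambda>(x, t). fx x t)"
      unfolding fx_def case_prod_unfold
      by (intro continuous_intros cseg[OF Dc, unfolded case_prod_unfold])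
    then show "continuous_on (?B \<times> cbox 0 1) (\<lambda>(x, t). fx x t)" by (simp add: cbox_interval)
  qed (use y in auto)
  moreover have "blinfun_apply (integral (cbox 0 1) (fx y)) = (\<lambda>v. \<Sum>b\<in>Basis. (v \<bullet> b) * integral {0..1} (\<lambda>t. t ^ Suc m * ?D b (a + t *\<^sub>R (y - a))))"
  proof
    fix v :: 'e
    have ci: "continuous_on {0..1} (\<lambda>t. t ^ Suc m * ?D b (a + t *\<^sub>R (y - a)))" for b
      by (intro continuous_intros cfix[OF Dc y])
    have "fx y integrable_on {0..1}"
      unfolding fx_def by (intro integrable_continuous_real continuous_intros cfix[OF Dc y])
    then have "blinfun_apply (integral {0..1} (fx y)) v = integral {0..1} (\<lambda>t. blinfun_apply (fx y t) v)"
      by (simp add: blinfun_apply_integral)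
    also have "(\<lambda>t. blinfun_apply (fx y t) v) =
        (\<lambda>t. \<Sum>b\<in>Basis. (v \<bullet> b) * (t ^ Suc m * ?D b (a + t *\<^sub>R (y - a))))"
      by (simp add: fx_def blinfun.sum_left blinfun.scaleR_left algebra_simps inner_commute fun_eq_iff)
    also have "integral {0..1} \<dots> =
       (\<Sum>b\<in>Basis. integral {0..1} (\<lambda>t. (v \<bullet> b) * (t ^ Suc m * ?D b (a + t *\<^sub>R (y - a)))))"
      by (rule integral_sum) (auto intro!: integrable_continuous_real continuous_intros cfix[OF Dc y])
    finally show "blinfun_apply (integral (cbox 0 1) (fx y)) v =
      (\<Sum>b\<in>Basis. (v \<bullet> b) * integral {0..1} (\<lambda>t. t ^ Suc m * ?D b (a + t *\<^sub>R (y - a))))"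
      by (simp add: cbox_interval)
  qed
  ultimately show ?thesis
    by (simp only: cbox_interval at_within_open[OF y open_ball])
qed

lemma smooth_on_integral:
  fixes f :: "'e::euclidean_space \<Rightarrow> real"
  assumes "smooth_on (ball a r) f"
  shows "smooth_on (ball a r) (\<lambda>y. integral {0..1} (\<lambda>t. t ^ m * f (a + t *\<^sub>R (y - a))))"
proof -
  have "Ck_on k (ball a r) (\<lambda>y. integral {0..1} (\<lambda>t. t ^ m * f (a + t *\<^sub>R (y - a))))" for k
    using assms
  proof (induction k arbitrary: m f)
    case 0
    have "\<forall>y\<in>ball a r. isCont (\<lambda>y. integral {0..1} (\<lambda>t. t ^ m * f (a + t *\<^sub>R (y - a)))) y"
      using integral_has_derivative[OF 0] has_derivative_continuous by blast
    then show ?case by (simp add: continuous_on_eq_continuous_at)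
  next
    case (Suc k)
    show ?case
      by (rule Ck_on_SucI'[OF _ integral_has_derivative[OF Suc.prems]])
        (auto intro!: Ck_on_sum Ck_on_mult Ck_on_const Suc.IH[of _ "Suc _", unfolded power_Suc]
          smooth_on_frechet_derivative Suc.prems)
  qed
  then show ?thesis by (simp add: smooth_on_def)
qed

text \<open>The fundamental theorem of calculus along the segment from a to y. It serves to show
  that a derivation is determined by its values on coordinates: the factors y - a vanish at a, so
  only \<open>G b a\<close> survives the product rule.\<close>

lemma Hadamard:
  fixes f :: "'e::euclidean_space \<Rightarrow> real"
  assumes f: "smooth_on (ball a r) f" and "r > 0"
  obtains G where "\<And>b. smooth_on (ball a r) (G b)"
    "\<And>b. G b a = frechet_derivative f (at a) b"
    "\<And>y. y \<in> ball a r \<Longrightarrow> f y = f a + (\<Sum>b\<in>Basis. ((y - a) \<bullet> b) * G b y)"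
proof
  let ?G = "\<lambda>b y. integral {0..1} (\<lambda>t. t ^ 0 * frechet_derivative f (at (a + t *\<^sub>R (y - a))) b)"
  show "smooth_on (ball a r) (?G b)" for b
    by (rule smooth_on_integral) (rule smooth_on_frechet_derivative[OF f])
  show "?G b a = frechet_derivative f (at a) b" for b by simp
  fix y assume y: "y \<in> ball a r"
  have D: "((\<lambda>t. f (a + t *\<^sub>R (y - a))) has_vector_derivative
      frechet_derivative f (at (a + t *\<^sub>R (y - a))) (y - a)) (at t within {0..1})" if "t \<in> {0..1}" for t
  proof -
    have fd: "(f has_derivative frechet_derivative f (at (a + t *\<^sub>R (y - a)))) (at (a + t *\<^sub>R (y - a)))"
      by (rule smooth_on_has_derivative[OF f _ segment_in_ball[OF y that]]) auto
    have "((\<lambda>t. f (a + t *\<^sub>R (y - a))) has_derivative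
       (\<lambda>s. frechet_derivative f (at (a + t *\<^sub>R (y - a))) (s *\<^sub>R (y - a)))) (at t)"
      by (rule has_derivative_compose[where f = "\<lambda>t. a + t *\<^sub>R (y - a)" and g = f, OF _ fd]) (auto intro!: derivative_eq_intros)
    then show ?thesis
      using has_derivative_linear[OF fd]
      by (simp add: has_vector_derivative_def linear_scale has_derivative_at_withinI)
  qed
  have cfix: "continuous_on {0..1} (\<lambda>t. frechet_derivative f (at (a + t *\<^sub>R (y - a))) b)" for b
    by (rule continuous_on_compose2[OF smooth_on_continuous_on[OF smooth_on_frechet_derivative[OF f]]])
      (use segment_in_ball[OF y] in \<open>auto intro!: continuous_intros\<close>)
  have "f y - f a = integral {0..1} (\<lambda>t. frechet_derivative f (at (a + t *\<^sub>R (y - a))) (y - a))"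
    using integral_unique[OF fundamental_theorem_of_calculus[OF _ D]] by simp
  also have "\<dots> = integral {0..1} (\<lambda>t. \<Sum>b\<in>Basis. ((y - a) \<bullet> b) *
      frechet_derivative f (at (a + t *\<^sub>R (y - a))) b)"
  proof (rule integral_cong)
    fix t :: real assume t: "t \<in> {0..1}"
    have "linear (frechet_derivative f (at (a + t *\<^sub>R (y - a))))"
      by (rule has_derivative_linear[OF smooth_on_has_derivative[OF f _ segment_in_ball[OF y t]]]) auto
    then have "frechet_derivative f (at (a + t *\<^sub>R (y - a))) (\<Sum>b\<in>Basis. ((y - a) \<bullet> b) *\<^sub>R b) =
       (\<Sum>b\<in>Basis. ((y - a) \<bullet> b) * frechet_derivative f (at (a + t *\<^sub>R (y - a))) b)"
      by (simp add: linear_sum linear_scale)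
    then show "frechet_derivative f (at (a + t *\<^sub>R (y - a))) (y - a) =
       (\<Sum>b\<in>Basis. ((y - a) \<bullet> b) * frechet_derivative f (at (a + t *\<^sub>R (y - a))) b)"
      by (simp only: euclidean_representation)
  qed
  also have "\<dots> = (\<Sum>b\<in>Basis. ((y - a) \<bullet> b) * ?G b y)"
    by (subst integral_sum) (auto intro!: integrable_continuous_real continuous_intros cfix)
  finally show "f y = f a + (\<Sum>b\<in>Basis. ((y - a) \<bullet> b) * ?G b y)" by simp
qed


section \<open>Smooth functions and tangent vectors on a manifold\<close>

lemma sum_fun_apply: "(\<Sum>i\<in>I. g i) x = (\<Sum>i\<in>I. g i x)"
  for g :: "'i \<Rightarrow> 'b \<Rightarrow> 'c::comm_monoid_add"
  by (induction I rule: infinite_finite_induct) auto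

lemma scaleR_fun_apply [simp]: "(c *\<^sub>R f) x = c *\<^sub>R f x"
  by (simp add: scaleR_fun_def)

lemma sum_Basis_vec: "(\<Sum>b\<in>Basis. h b) = (\<Sum>i\<in>UNIV. h (axis i (1::real)))"
  for h :: "real ^ 'n \<Rightarrow> 'b::comm_monoid_add"
proof -
  have "Basis = (\<lambda>i::'n. axis i (1::real)) ` UNIV"
    by (auto simp: Basis_vec_def)
  moreover have "inj (\<lambda>i::'n. axis i (1::real))"
    by (auto simp: inj_def axis_eq_axis)
  ultimately show ?thesis by (metis (no_types, lifting) sum.reindex_cong)
qed

text \<open>The model space is \<open>real ^ 'n\<close>: the index type gives coefficient matrices
  with respect to frames, whose determinants yield smooth solutions of linear systems and kernels of
  skew forms.\<close>

locale manifold =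
  fixes A :: "('a::{t2_space, second_countable_topology}, real ^ 'n::finite) atlas"
  assumes smooth_manifold: "smooth_manifold A"
begin

abbreviation "C \<equiv> smooth_fun A"
abbreviation "T \<equiv> tangent_space A"
abbreviation "VF \<equiv> vector_field A"
abbreviation "inv_chart \<equiv> the_inv_into :: 'a set \<Rightarrow> ('a \<Rightarrow> real ^ 'n) \<Rightarrow> real ^ 'n \<Rightarrow> 'a"

lemma chart_at: obtains U x where "(U, x) \<in> A" "p \<in> U"
proof -
  have "p \<in> (\<Union>(U, x)\<in>A. U)" using smooth_manifold by (simp add: smooth_manifold_def)
  then show thesis using that by auto
qed

context
  fixes U x assumes chart: "(U, x) \<in> A"
begin

lemma chart_props:
  shows open_chart: "open U" and open_chart_image: "open (x ` U)"
    and chart_homeo: "homeomorphism U (x ` U) x (inv_chart U x)"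
  using smooth_manifold chart unfolding smooth_manifold_def by blast+

lemma inv_chart [simp]: "q \<in> U \<Longrightarrow> inv_chart U x (x q) = q"
  using chart_homeo unfolding homeomorphism_def by blast

lemma open_chart_image_Int:
  assumes "open W" shows "open (x ` (U \<inter> W))"
proof -
  have "x ` (U \<inter> W) = x ` U \<inter> inv_chart U x -` W"
    by force
  moreover have "open (x ` U \<inter> inv_chart U x -` W)"
    by (rule continuous_open_preimage[OF _ open_chart_image assms])
      (use chart_homeo in \<open>simp add: homeomorphism_def\<close>)
  ultimately show ?thesis by simp
qed

lemma open_chart_vimage:
  assumes "open S" shows "open (U \<inter> x -` S)"
  by (rule continuous_open_preimage[OF _ open_chart assms])
    (use chart_homeo in \<open>simp add: homeomorphism_def\<close>)

lemma smooth_fun_chart: "C f \<Longrightarrow> smooth_on (x ` U) (f \<circ> inv_chart U x)"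
  using chart unfolding smooth_fun_def by fast

end

lemma smooth_transition:
  "(U, x) \<in> A \<Longrightarrow> (V, y) \<in> A \<Longrightarrow> smooth_on (x ` (U \<inter> V)) (y \<circ> inv_chart U x)"
  using smooth_manifold unfolding smooth_manifold_def by fast

lemma smooth_fun_chartI:
  assumes "\<And>V y q. (V, y) \<in> A \<Longrightarrow> q \<in> V \<Longrightarrow>
    \<exists>N. open N \<and> q \<in> N \<and> smooth_on (y ` (V \<inter> N)) (f \<circ> inv_chart V y)"
  shows "C f"
  unfolding smooth_fun_def
proof clarify
  fix V y assume c: "(V, y) \<in> A"
  show "smooth_on (y ` V) (f \<circ> inv_chart V y)"
  proof (rule smooth_on_local[OF open_chart_image[OF c]])
    fix z assume "z \<in> y ` V"
    then obtain q where q: "q \<in> V" "z = y q" by auto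
    with assms[OF c q(1)] obtain N where "open N" "q \<in> N" "smooth_on (y ` (V \<inter> N)) (f \<circ> inv_chart V y)"
      by auto
    then show "\<exists>T. open T \<and> z \<in> T \<and> smooth_on T (f \<circ> inv_chart V y)"
      using open_chart_image_Int[OF c] q by blast
  qed
qed

lemma smooth_fun_localI:
  assumes "\<And>p. \<exists>g W. open W \<and> p \<in> W \<and> C g \<and> (\<forall>q\<in>W. f q = g q)"
  shows "C f"
proof (rule smooth_fun_chartI)
  fix V y q assume c: "(V, y) \<in> A" and q: "q \<in> V"
  obtain g W where g: "open W" "q \<in> W" "C g" "\<forall>q\<in>W. f q = g q" using assms by blast
  have "smooth_on (y ` (V \<inter> W)) (g \<circ> inv_chart V y)"
    by (rule smooth_on_subset[OF open_chart_image[OF c] open_chart_image_Int[OF c g(1)] _ smooth_fun_chart[OF c g(3)]])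
      auto
  then have "smooth_on (y ` (V \<inter> W)) (f \<circ> inv_chart V y)"
    by (rule smooth_on_cong[OF open_chart_image_Int[OF c g(1)], rotated]) (use g(4) inv_chart[OF c] in auto)
  then show "\<exists>N. open N \<and> q \<in> N \<and> smooth_on (y ` (V \<inter> N)) (f \<circ> inv_chart V y)"
    using g by blast
qed

lemma C_const [simp]: "C (\<lambda>q. c)"
  by (auto simp: smooth_fun_def o_def smooth_on_const)

lemma C_add: "C f \<Longrightarrow> C g \<Longrightarrow> C (\<lambda>q. f q + g q)"
  unfolding smooth_fun_def o_def by (auto intro!: smooth_on_add open_chart_image)

lemma C_mult: "C f \<Longrightarrow> C g \<Longrightarrow> C (\<lambda>q. f q * g q)"
  unfolding smooth_fun_def o_def by (auto intro!: smooth_on_mult open_chart_image)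

lemma C_cmult: "C f \<Longrightarrow> C (\<lambda>q. c * f q)"
  by (rule C_mult) auto

lemma C_minus: "C f \<Longrightarrow> C (\<lambda>q. - f q)"
  using C_cmult[of f "-1"] by simp

lemma C_diff: "C f \<Longrightarrow> C g \<Longrightarrow> C (\<lambda>q. f q - g q)"
  using C_add[OF _ C_minus, of f g] by simp

lemma C_sum: "(\<And>i. i \<in> I \<Longrightarrow> C (f i)) \<Longrightarrow> C (\<lambda>q. \<Sum>i\<in>I. f i q)"
  by (induction I rule: infinite_finite_induct) (auto intro: C_add)

lemma C_prod: "(\<And>i. i \<in> I \<Longrightarrow> C (f i)) \<Longrightarrow> C (\<lambda>q. \<Prod>i\<in>I. f i q)"
  by (induction I rule: infinite_finite_induct) (auto intro: C_mult)

lemma C_power2: "C f \<Longrightarrow> C (\<lambda>q. (f q)\<^sup>2)"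
  unfolding power2_eq_square by (rule C_mult)

lemmas C_intros = C_const C_add C_mult C_minus C_diff C_sum C_prod C_power2

text \<open>The Hausdorff property enters here: K is the image of a compact ball, hence closed in
  the whole manifold, so the extension of the bump by zero is smooth also at points outside the
  chart.\<close>

lemma cutoff:
  assumes "open W" "p \<in> W"
  obtains \<beta> K N where "C \<beta>" "closed K" "K \<subseteq> W" "\<And>q. q \<notin> K \<Longrightarrow> \<beta> q = 0"
    "open N" "p \<in> N" "N \<subseteq> W" "\<And>q. q \<in> N \<Longrightarrow> \<beta> q = 1"
proof -
  obtain U x where c: "(U, x) \<in> A" and p: "p \<in> U" by (rule chart_at)
  let ?O = "x ` (U \<inter> W)"
  have "open ?O" "x p \<in> ?O" using open_chart_image_Int[OF c] assms p by auto
  then obtain r where r: "r > 0" "cball (x p) r \<subseteq> ?O" by (meson open_contains_cball)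
  obtain b where b: "smooth_on UNIV b" "\<And>z. z \<in> ball (x p) (r / 2) \<Longrightarrow> b z = 1"
    "\<And>z. z \<notin> ball (x p) r \<Longrightarrow> b z = (0::real)" using bump_exists[OF r(1), of "x p"] by metis
  define K where "K = inv_chart U x ` cball (x p) r"
  define \<beta> where "\<beta> = (\<lambda>q. if q \<in> U then b (x q) else 0)"
  have "continuous_on (cball (x p) r) (inv_chart U x)"
    by (rule continuous_on_subset[of "x ` U"]) (use chart_homeo[OF c] r in \<open>auto simp: homeomorphism_def\<close>)
  then have clK: "closed K"
    unfolding K_def by (intro compact_imp_closed compact_continuous_image) auto
  have KW: "K \<subseteq> U \<inter> W" using r(2) inv_chart[OF c] unfolding K_def by fastforce
  have \<beta>0: "\<beta> q = 0" if "q \<notin> K" for q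
  proof (cases "q \<in> U \<and> x q \<in> cball (x p) r")
    case True
    then have "q \<in> K" unfolding K_def using inv_chart[OF c, of q] by (metis imageI)
    then show ?thesis using that by simp
  qed (auto simp: \<beta>_def b(3))
  have C\<beta>: "C \<beta>"
  proof (rule smooth_fun_chartI)
    fix V y q assume d: "(V, y) \<in> A" and q: "q \<in> V"
    show "\<exists>N. open N \<and> q \<in> N \<and> smooth_on (y ` (V \<inter> N)) (\<beta> \<circ> inv_chart V y)"
    proof (cases "q \<in> U")
      case True
      have o: "open (y ` (V \<inter> U))" using open_chart_image_Int[OF d open_chart[OF c]] .
      have "smooth_on (y ` (V \<inter> U)) (\<lambda>z. b ((x \<circ> inv_chart V y) z))"
        by (rule smooth_on_compose[OF o open_UNIV subset_UNIV smooth_transition[OF d c] b(1)])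
      then have "smooth_on (y ` (V \<inter> U)) (\<beta> \<circ> inv_chart V y)"
        by (rule smooth_on_cong[OF o, rotated]) (auto simp: \<beta>_def inv_chart[OF d])
      then show ?thesis using True open_chart[OF c] by blast
    next
      case False
      then have q: "q \<in> - K" using KW by auto
      have o: "open (y ` (V \<inter> - K))" using open_chart_image_Int[OF d open_Compl[OF clK]] .
      have "smooth_on (y ` (V \<inter> - K)) (\<beta> \<circ> inv_chart V y)"
        by (rule smooth_on_cong[OF o _ smooth_on_const[of _ 0]]) (auto simp: \<beta>0 inv_chart[OF d])
      then show ?thesis using q clK by blast
    qed
  qed
  show thesis
  proof (rule that[of \<beta> K "U \<inter> x -` ball (x p) (r / 2) \<inter> W"])
    show "open (U \<inter> x -` ball (x p) (r / 2) \<inter> W)"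
      using open_chart_vimage[OF c] assms by auto
  qed (use C\<beta> clK KW \<beta>0 p r assms b(2) in \<open>auto simp: \<beta>_def\<close>)
qed

text \<open>Tangent vectors act on globally defined functions only; this provides a global smooth
  function with a prescribed germ in a chart.\<close>

lemma chart_extend:
  assumes c: "(U, x) \<in> A" and S: "open S" "S \<subseteq> x ` U" and p: "p \<in> U" "x p \<in> S" and F: "smooth_on S F"
  obtains f N where "C f" "open N" "p \<in> N" "N \<subseteq> U" "x ` N \<subseteq> S" "\<And>q. q \<in> N \<Longrightarrow> f q = F (x q)"
proof -
  define W where "W = U \<inter> x -` S"
  have W: "open W" "p \<in> W" using open_chart_vimage[OF c S(1)] p by (auto simp: W_def)
  obtain \<beta> K N where \<beta>: "C \<beta>" "closed K" "K \<subseteq> W" "\<And>q. q \<notin> K \<Longrightarrow> \<beta> q = 0"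
    "open N" "p \<in> N" "N \<subseteq> W" "\<And>q. q \<in> N \<Longrightarrow> \<beta> q = 1" using cutoff[OF W] by metis
  define f where "f = (\<lambda>q. if q \<in> W then \<beta> q * F (x q) else 0)"
  have "C f"
  proof (rule smooth_fun_chartI)
    fix V y q assume d: "(V, y) \<in> A" and q: "q \<in> V"
    show "\<exists>N. open N \<and> q \<in> N \<and> smooth_on (y ` (V \<inter> N)) (f \<circ> inv_chart V y)"
    proof (cases "q \<in> W")
      case True
      have o: "open (y ` (V \<inter> W))" using open_chart_image_Int[OF d W(1)] .
      have t: "smooth_on (y ` (V \<inter> W)) (x \<circ> inv_chart V y)"
        by (rule smooth_on_subset[OF _ o _ smooth_transition[OF d c]])
          (use open_chart_image_Int[OF d open_chart[OF c]] in \<open>auto simp: W_def\<close>)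
      have "smooth_on (y ` (V \<inter> W)) (\<beta> \<circ> inv_chart V y)"
        by (rule smooth_on_subset[OF open_chart_image[OF d] o _ smooth_fun_chart[OF d \<beta>(1)]]) auto
      moreover have "smooth_on (y ` (V \<inter> W)) (\<lambda>z. F ((x \<circ> inv_chart V y) z))"
        by (rule smooth_on_compose[OF o S(1) _ t F]) (auto simp: W_def inv_chart[OF d])
      ultimately have "smooth_on (y ` (V \<inter> W)) (\<lambda>z. (\<beta> \<circ> inv_chart V y) z * F ((x \<circ> inv_chart V y) z))"
        by (rule smooth_on_mult[OF o])
      then have "smooth_on (y ` (V \<inter> W)) (f \<circ> inv_chart V y)"
        by (rule smooth_on_cong[OF o, rotated]) (auto simp: f_def inv_chart[OF d])
      then show ?thesis using True W by blast
    next
      case False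
      then have q: "q \<in> - K" using \<beta>(3) by auto
      have o: "open (y ` (V \<inter> - K))" using open_chart_image_Int[OF d open_Compl[OF \<beta>(2)]] .
      have "smooth_on (y ` (V \<inter> - K)) (f \<circ> inv_chart V y)"
        by (rule smooth_on_cong[OF o _ smooth_on_const[of _ 0]]) (auto simp: f_def \<beta>(4) inv_chart[OF d])
      then show ?thesis using q \<beta>(2) by blast
    qed
  qed
  then show thesis
    by (rule that[of f N]) (use \<beta> in \<open>auto simp: f_def W_def\<close>)
qed

lemma C_inverse_local:
  assumes f: "C f" and p: "f p \<noteq> 0"
  obtains g N where "C g" "open N" "p \<in> N" "\<And>q. q \<in> N \<Longrightarrow> g q * f q = 1"
proof -
  obtain U x where c: "(U, x) \<in> A" and pU: "p \<in> U" by (rule chart_at)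
  let ?F = "f \<circ> inv_chart U x"
  have F: "smooth_on (x ` U) ?F" by (rule smooth_fun_chart[OF c f])
  define S where "S = x ` U \<inter> ?F -` (- {0})"
  have S: "open S" unfolding S_def
    by (rule continuous_open_preimage[OF smooth_on_continuous_on[OF F] open_chart_image[OF c]]) auto
  have pS: "x p \<in> S" using p pU by (auto simp: S_def inv_chart[OF c])
  have "smooth_on S (\<lambda>z. inverse (?F z))"
    by (rule smooth_on_inverse[OF S smooth_on_subset[OF open_chart_image[OF c] S _ F]])
      (auto simp: S_def)
  then obtain g N where "C g" "open N" "p \<in> N" "N \<subseteq> U" "x ` N \<subseteq> S" "\<And>q. q \<in> N \<Longrightarrow> g q = inverse (?F (x q))"
    using chart_extend[OF c S _ pU pS] S_def by (metis (no_types, lifting) inf_le1)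
  note g = this
  show thesis
  proof (rule that[OF g(1-3)])
    fix q assume q: "q \<in> N"
    then have "q \<in> U" "x q \<in> S" using g by auto
    then show "g q * f q = 1" using g(6)[OF q] by (auto simp: S_def inv_chart[OF c])
  qed
qed

subsection \<open>Tangent vectors\<close>

lemma tangent_not_smooth: "v \<in> T p \<Longrightarrow> \<not> C f \<Longrightarrow> v f = 0"
  unfolding tangent_space_def by auto

lemma tangent_add: "v \<in> T p \<Longrightarrow> C f \<Longrightarrow> C g \<Longrightarrow> v (\<lambda>q. f q + g q) = v f + v g"
  unfolding tangent_space_def plus_fun_def by auto

lemma tangent_cmult: "v \<in> T p \<Longrightarrow> C f \<Longrightarrow> v (\<lambda>q. c * f q) = c * v f"
  unfolding tangent_space_def scaleR_fun_def by auto

lemma tangent_mult: "v \<in> T p \<Longrightarrow> C f \<Longrightarrow> C g \<Longrightarrow> v (\<lambda>q. f q * g q) = v f * g p + f p * v g"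
  unfolding tangent_space_def times_fun_def by auto

lemma tangent_minus: "v \<in> T p \<Longrightarrow> C f \<Longrightarrow> v (\<lambda>q. - f q) = - v f"
  using tangent_cmult[of v p f "-1"] by simp

lemma tangent_diff: "v \<in> T p \<Longrightarrow> C f \<Longrightarrow> C g \<Longrightarrow> v (\<lambda>q. f q - g q) = v f - v g"
  using tangent_add[of v p f "\<lambda>q. - g q"] tangent_minus[of v p g] by (simp add: C_minus)

lemma tangent_const: "v \<in> T p \<Longrightarrow> v (\<lambda>q. c) = 0"
  using tangent_mult[of v p "\<lambda>q. 1" "\<lambda>q. 1"] tangent_cmult[of v p "\<lambda>q. 1" c] by simp

lemma tangent_sum:
  "v \<in> T p \<Longrightarrow> (\<And>i. i \<in> I \<Longrightarrow> C (f i)) \<Longrightarrow> v (\<lambda>q. \<Sum>i\<in>I. f i q) = (\<Sum>i\<in>I. v (f i))"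
  by (induction I rule: infinite_finite_induct) (auto simp: tangent_add[OF _ _ C_sum] tangent_const[of v p])

text \<open>Tangent vectors see only germs: f - g equals (1 - \<beta>)(f - g), a product of two
  functions that both vanish at p.\<close>

lemma tangent_cong:
  assumes v: "v \<in> T p" and f: "C f" and g: "C g" and W: "open W" "p \<in> W" "\<And>q. q \<in> W \<Longrightarrow> f q = g q"
  shows "v f = v g"
proof -
  obtain \<beta> K N where \<beta>: "C \<beta>" "closed K" "K \<subseteq> W" "\<And>q. q \<notin> K \<Longrightarrow> \<beta> q = (0::real)"
    "open N" "p \<in> N" "N \<subseteq> W" "\<And>q. q \<in> N \<Longrightarrow> \<beta> q = 1" using cutoff[OF W(1,2)] by metis
  have "(\<lambda>q. f q - g q) = (\<lambda>q. (1 - \<beta> q) * (f q - g q))"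
  proof
    show "f q - g q = (1 - \<beta> q) * (f q - g q)" for q
      using \<beta>(4)[of q] W(3)[of q] \<beta>(3) by (cases "q \<in> K") auto
  qed
  then have "v (\<lambda>q. f q - g q) = v (\<lambda>q. (1 - \<beta> q) * (f q - g q))" by (rule arg_cong)
  also have "\<dots> = 0"
    using f g \<beta>(1) \<beta>(8)[OF \<beta>(6)] W
    by (simp add: tangent_mult[OF v] tangent_diff[OF v] tangent_const[OF v] C_diff)
  finally show ?thesis using f g by (simp add: tangent_diff[OF v])
qed

lemma tangentI:
  assumes "\<And>f. \<not> C f \<Longrightarrow> v f = 0" "\<And>f g. C f \<Longrightarrow> C g \<Longrightarrow> v (\<lambda>q. f q + g q) = v f + v g"
    "\<And>c f. C f \<Longrightarrow> v (\<lambda>q. c * f q) = c * v f"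
    "\<And>f g. C f \<Longrightarrow> C g \<Longrightarrow> v (\<lambda>q. f q * g q) = v f * g p + f p * v g"
  shows "v \<in> T p"
  unfolding tangent_space_def plus_fun_def scaleR_fun_def times_fun_def using assms by auto

lemma subspace_T: "subspace (T p)"
  unfolding subspace_def tangent_space_def by (auto simp: algebra_simps)

lemma T_zero [simp]: "0 \<in> T p" by (rule subspace_0[OF subspace_T])
lemma T_add: "v \<in> T p \<Longrightarrow> w \<in> T p \<Longrightarrow> v + w \<in> T p" by (rule subspace_add[OF subspace_T])
lemma T_diff: "v \<in> T p \<Longrightarrow> w \<in> T p \<Longrightarrow> v - w \<in> T p" by (rule subspace_diff[OF subspace_T])
lemma T_scale: "v \<in> T p \<Longrightarrow> c *\<^sub>R v \<in> T p" by (rule subspace_scale[OF subspace_T])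
lemma T_minus: "v \<in> T p \<Longrightarrow> - v \<in> T p" by (rule subspace_neg[OF subspace_T])
lemma T_sum: "(\<And>i. i \<in> I \<Longrightarrow> v i \<in> T p) \<Longrightarrow> (\<Sum>i\<in>I. v i) \<in> T p" by (rule subspace_sum[OF subspace_T])

lemmas T_intros = T_zero T_add T_diff T_scale T_minus T_sum

definition partial :: "'a set \<Rightarrow> ('a \<Rightarrow> real ^ 'n) \<Rightarrow> 'n \<Rightarrow> 'a \<Rightarrow> 'a tangent" where
  "partial U x i q f = (if C f then frechet_derivative (f \<circ> inv_chart U x) (at (x q)) (axis i 1) else 0)"

lemma partial_tangent:
  assumes c: "(U, x) \<in> A" and q: "q \<in> U"
  shows "partial U x i q \<in> T q"
proof (rule tangentI)
  have D: "((f \<circ> inv_chart U x) has_derivative frechet_derivative (f \<circ> inv_chart U x) (at (x q))) (at (x q))"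
    if "C f" for f
    by (rule smooth_on_has_derivative[OF smooth_fun_chart[OF c that] open_chart_image[OF c]]) (use q in auto)
  fix f assume f: "C f"
  show "partial U x i q (\<lambda>q. r * f q) = r * partial U x i q f" for r
    using frechet_derivative_at[OF has_derivative_mult_right[OF D[OF f], of r], symmetric] f
    by (simp add: partial_def C_cmult o_def)
  fix g assume g: "C g"
  show "partial U x i q (\<lambda>q. f q + g q) = partial U x i q f + partial U x i q g"
    using frechet_derivative_at[OF has_derivative_add[OF D[OF f] D[OF g]], symmetric] f g
    by (simp add: partial_def C_add o_def)
  show "partial U x i q (\<lambda>q. f q * g q) = partial U x i q f * g q + f q * partial U x i q g"
    using frechet_derivative_at[OF has_derivative_mult[OF D[OF f] D[OF g]], symmetric] f g inv_chart[OF c q]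
    by (simp add: partial_def C_mult o_def)
qed (simp add: partial_def)

lemma vector_fieldI:
  "(\<And>p. X p \<in> T p) \<Longrightarrow> (\<And>f. C f \<Longrightarrow> C (\<lambda>p. X p f)) \<Longrightarrow> VF X"
  by (simp add: vector_field_def)

lemma VF_T [simp]: "VF X \<Longrightarrow> X p \<in> T p"
  by (simp add: vector_field_def)

lemma VF_C [simp]: "VF X \<Longrightarrow> C f \<Longrightarrow> C (\<lambda>p. X p f)"
  by (simp add: vector_field_def)

text \<open>The coordinate fields cut off to global vector fields, together with global functions
  that agree with the coordinates near p. That they span is the statement that derivations are
  combinations of partial derivatives.\<close>

lemma frame_at:
  obtains E \<theta> W where "open W" "p \<in> W" "\<And>i::'n. VF (E i)" "\<And>i. C (\<theta> i)"
    "\<And>i j q. q \<in> W \<Longrightarrow> E i q (\<theta> j) = (if i = j then 1 else 0)"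
    "\<And>q v. q \<in> W \<Longrightarrow> v \<in> T q \<Longrightarrow> v = (\<Sum>i\<in>UNIV. v (\<theta> i) *\<^sub>R E i q)"
proof -
  obtain U x where c: "(U, x) \<in> A" and p: "p \<in> U" by (rule chart_at)
  obtain \<beta> K N where \<beta>: "C \<beta>" "closed K" "K \<subseteq> U" "\<And>q. q \<notin> K \<Longrightarrow> \<beta> q = 0"
    "open N" "p \<in> N" "N \<subseteq> U" "\<And>q. q \<in> N \<Longrightarrow> \<beta> q = 1" using cutoff[OF open_chart[OF c] p] by metis
  have "\<exists>f N. C f \<and> open N \<and> p \<in> N \<and> (\<forall>q\<in>N. f q = x q $ j)" for j
    by (rule chart_extend[OF c open_chart_image[OF c] _ p, of "\<lambda>z. z $ j"])
      (use p in \<open>auto intro!: smooth_on_bounded_linear open_chart_image[OF c] bounded_linear_vec_nth\<close>, blast)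
  then obtain \<theta> M where \<theta>: "\<And>j. C (\<theta> j)" "\<And>j. open (M j)" "\<And>j. p \<in> M j" "\<And>j q. q \<in> M j \<Longrightarrow> \<theta> j q = x q $ j"
    by metis
  define E where "E = (\<lambda>i q. if q \<in> U then \<beta> q *\<^sub>R partial U x i q else 0)"
  define W where "W = N \<inter> (\<Inter>j. M j)"
  have W: "open W" "p \<in> W" "W \<subseteq> U" "W \<subseteq> N"
    using \<beta> \<theta> open_INT[of UNIV M] by (auto simp: W_def)
  have E: "VF (E i)" for i
  proof (rule vector_fieldI)
    show "E i q \<in> T q" for q
      using partial_tangent[OF c] by (auto simp: E_def intro: T_scale)
    fix f assume f: "C f"
    show "C (\<lambda>q. E i q f)"
    proof (rule smooth_fun_localI)
      fix q
      show "\<exists>g W. open W \<and> q \<in> W \<and> C g \<and> (\<forall>q\<in>W. E i q f = g q)"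
      proof (cases "q \<in> U")
        case True
        define F where "F = (\<lambda>z. frechet_derivative (f \<circ> inv_chart U x) (at z) (axis i (1::real)))"
        have "smooth_on (x ` U) F"
          unfolding F_def by (rule smooth_on_frechet_derivative[OF smooth_fun_chart[OF c f]])
        then obtain g M where g: "C g" "open M" "q \<in> M" "M \<subseteq> U" "x ` M \<subseteq> x ` U"
          "\<And>q. q \<in> M \<Longrightarrow> g q = F (x q)"
          using chart_extend[OF c open_chart_image[OF c] order_refl True imageI[OF True]] by metis
        have "\<forall>q\<in>M. E i q f = \<beta> q * g q"
          using g(4,6) f by (simp add: E_def partial_def F_def subset_iff)
        then show ?thesis
          using g(1-3) C_mult[OF \<beta>(1) g(1)] by (intro exI[of _ "\<lambda>q. \<beta> q * g q"] exI[of _ M]) simp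
      next
        case False
        then have "\<forall>q\<in>- K. E i q f = 0" "q \<in> - K" using \<beta>(3,4) by (auto simp: E_def)
        then show ?thesis
          using \<beta>(2) by (intro exI[of _ "\<lambda>q. 0"] exI[of _ "- K"]) auto
      qed
    qed
  qed
  have E_app: "E i q f = frechet_derivative (f \<circ> inv_chart U x) (at (x q)) (axis i 1)" if "q \<in> W" "C f" for i q f
    using that W \<beta>(8) by (auto simp: E_def partial_def subset_iff)
  have \<theta>W: "\<theta> j q = x q $ j" if "q \<in> W" for j q
    using that \<theta>(4) by (auto simp: W_def)
  show thesis
  proof (rule that[OF W(1,2) E \<theta>(1)])
    fix i j q assume q: "q \<in> W"
    have "((\<lambda>z. z $ j) has_derivative (\<lambda>z. z $ j)) (at (x q))"
      by (rule bounded_linear_imp_has_derivative[OF bounded_linear_vec_nth])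
    then have "((\<theta> j \<circ> inv_chart U x) has_derivative (\<lambda>z. z $ j)) (at (x q))"
      by (rule has_derivative_transform_within_open[OF _ open_chart_image_Int[OF c W(1)]])
        (use q W(3) \<theta>W inv_chart[OF c] in auto)
    then have "E i q (\<theta> j) = axis i 1 $ j"
      using E_app[OF q \<theta>(1)] frechet_derivative_at by metis
    then show "E i q (\<theta> j) = (if i = j then 1 else 0)" by (simp add: axis_def)
  next
    fix q v assume q: "q \<in> W" and v: "v \<in> T q"
    show "v = (\<Sum>i\<in>UNIV. v (\<theta> i) *\<^sub>R E i q)"
    proof
      fix f
      show "v f = (\<Sum>i\<in>UNIV. v (\<theta> i) *\<^sub>R E i q) f"
      proof (cases "C f")
        case False
        then show ?thesis
          using tangent_not_smooth[OF v] tangent_not_smooth[OF VF_T[OF E]] by (simp add: sum_fun_apply)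
      next
        case f: True
        let ?F = "f \<circ> inv_chart U x"
        have o: "open (x ` (U \<inter> W))" by (rule open_chart_image_Int[OF c W(1)])
        moreover have "x q \<in> x ` (U \<inter> W)" using q W by auto
        ultimately obtain r where r: "r > 0" "ball (x q) r \<subseteq> x ` (U \<inter> W)"
          by (meson open_contains_ball)
        \<comment> \<open>Hadamard's lemma is applied in the chart; its coefficient functions are
          then replaced by global functions with the same germs, since v cannot be applied to
          anything else.\<close>
        have "smooth_on (ball (x q) r) ?F"
          by (rule smooth_on_subset[OF open_chart_image[OF c] _ _ smooth_fun_chart[OF c f]]) (use r in auto)
        then obtain G where G: "\<And>b. smooth_on (ball (x q) r) (G b)"
          "\<And>b. G b (x q) = frechet_derivative ?F (at (x q)) b"
          "\<And>y. y \<in> ball (x q) r \<Longrightarrow> ?F y = ?F (x q) + (\<Sum>b\<in>Basis. ((y - x q) \<bullet> b) * G b y)"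
          using Hadamard r(1) by blast
        have qU: "q \<in> U" using q W by auto
        have "\<exists>g N. C g \<and> open N \<and> q \<in> N \<and> N \<subseteq> U \<and> x ` N \<subseteq> ball (x q) r \<and> (\<forall>q\<in>N. g q = G (axis i 1) (x q))" for i :: 'n
        proof -
          have "ball (x q) r \<subseteq> x ` U" using r by auto
          then show ?thesis
            using chart_extend[OF c open_ball[of "x q" r] _ qU _ G(1)[of "axis i 1"]] r(1)
            by (metis centre_in_ball)
        qed
        then obtain g M where g: "\<And>i::'n. C (g i)" "\<And>i. open (M i)" "\<And>i. q \<in> M i" "\<And>i. M i \<subseteq> U"
          "\<And>i. x ` M i \<subseteq> ball (x q) r" "\<And>i q. q \<in> M i \<Longrightarrow> g i q = G (axis i 1) (x q)"
          by metis
        have Cg: "C (\<lambda>s. f q + (\<Sum>i\<in>UNIV. (\<theta> i s - \<theta> i q) * g i s))"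
          by (intro C_intros \<theta>(1) g(1))
        have "v f = v (\<lambda>s. f q + (\<Sum>i\<in>UNIV. (\<theta> i s - \<theta> i q) * g i s))"
        proof (rule tangent_cong[OF v f Cg])
          show "open (W \<inter> (\<Inter>i. M i))" "q \<in> W \<inter> (\<Inter>i. M i)"
            using W g q open_INT[of UNIV M] by auto
          fix s assume s: "s \<in> W \<inter> (\<Inter>i. M i)"
          then have "x s \<in> x ` M undefined" "s \<in> U" using W by auto
          then have "x s \<in> ball (x q) r" "s \<in> U" using g(5)[of undefined] by blast+
          with G(3)[of "x s"] qU have "f s = f q + (\<Sum>b\<in>Basis. ((x s - x q) \<bullet> b) * G b (x s))"
            using inv_chart[OF c] by simp
          also have "(\<Sum>b\<in>Basis. ((x s - x q) \<bullet> b) * G b (x s)) = (\<Sum>i\<in>UNIV. (\<theta> i s - \<theta> i q) * g i s)"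
            unfolding sum_Basis_vec by (rule sum.cong) (use s q \<theta>W g(6) in \<open>auto simp: inner_axis\<close>)
          finally show "f s = f q + (\<Sum>i\<in>UNIV. (\<theta> i s - \<theta> i q) * g i s)" .
        qed
        also have "\<dots> = (\<Sum>i\<in>UNIV. v (\<lambda>s. (\<theta> i s - \<theta> i q) * g i s))"
          using \<theta>(1) g(1) by (simp add: tangent_add[OF v] tangent_sum[OF v] tangent_const[OF v] C_intros)
        \<comment> \<open>The factors \<open>\<theta> i s - \<theta> i q\<close> vanish at q, so the
          derivatives of the \<open>g i\<close> drop out.\<close>
        also have "\<dots> = (\<Sum>i\<in>UNIV. v (\<theta> i) * g i q)"
          using \<theta>(1) g(1) by (simp add: tangent_mult[OF v] tangent_diff[OF v] tangent_const[OF v] C_intros)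
        also have "\<dots> = (\<Sum>i\<in>UNIV. v (\<theta> i) *\<^sub>R E i q) f"
          using q f g G(2) by (simp add: sum_fun_apply E_app)
        finally show ?thesis .
      qed
    qed
  qed
qed

text \<open>The coordinate vectors kill f, so f is constant on coordinate balls; connectedness of
  the manifold does the rest. It is used for the factor f in h^2.\<close>

lemma constant_if_derivatives_vanish:
  assumes f: "C f" and d: "\<And>p v. v \<in> T p \<Longrightarrow> v f = 0"
  shows "f p = f q"
proof (rule connected_local_const[of UNIV p q f])
  show "connected (UNIV :: 'a set)" using smooth_manifold by (simp add: smooth_manifold_def)
  show "\<forall>a\<in>UNIV. \<forall>\<^sub>F b in at a. f a = f b"
  proof
    fix p
    obtain U x where c: "(U, x) \<in> A" and p: "p \<in> U" by (rule chart_at)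
    obtain r where r: "r > 0" "ball (x p) r \<subseteq> x ` U"
      using open_chart_image[OF c] p by (meson imageI open_contains_ball)
    let ?F = "f \<circ> inv_chart U x"
    have D: "(?F has_derivative (\<lambda>_. 0)) (at z)" if z: "z \<in> x ` U" for z
    proof -
      obtain s where s: "s \<in> U" "z = x s" using z by auto
      have 1: "(?F has_derivative frechet_derivative ?F (at z)) (at z)"
        by (rule smooth_on_has_derivative[OF smooth_fun_chart[OF c f] open_chart_image[OF c] z])
      have "frechet_derivative ?F (at z) (axis i 1) = 0" for i
        using d[OF partial_tangent[OF c s(1)], of i] f s by (simp add: partial_def)
      moreover have "linear (frechet_derivative ?F (at z))" using 1 by (rule has_derivative_linear)
      ultimately have "frechet_derivative ?F (at z) v = 0" for v
        using linear_sum[of "frechet_derivative ?F (at z)" "\<lambda>b. (v \<bullet> b) *\<^sub>R b" Basis]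
        by (simp add: euclidean_representation linear_scale sum_Basis_vec)
      then have "frechet_derivative ?F (at z) = (\<lambda>_. 0)" by blast
      then show ?thesis using 1 by simp
    qed
    have "(?F has_derivative (\<lambda>h. 0)) (at z within ball (x p) r)" if "z \<in> ball (x p) r" for z
      using D r that has_derivative_at_withinI by blast
    then have "?F z = ?F (x p)" if "z \<in> ball (x p) r" for z
      using has_derivative_zero_unique[OF convex_ball, of "x p" r ?F z "x p"] that r by simp
    then have "f s = f p" if "s \<in> U \<inter> x -` ball (x p) r" for s
      using that p inv_chart[OF c] by fastforce
    moreover have "open (U \<inter> x -` ball (x p) r)" "p \<in> U \<inter> x -` ball (x p) r"
      using open_chart_vimage[OF c] p r by auto
    ultimately show "\<forall>\<^sub>F b in at p. f p = f b"
      unfolding eventually_at_topological by metis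
  qed
qed auto

end


section \<open>Vector fields, tensors and the Levi-Civita connection\<close>

text \<open>
  Tangent vectors are functions, and unification produces them in eta-long form; the pointwise
  simplification rules would then unfold sums of tangent vectors.
\<close>

lemmas pointwise = plus_fun_apply zero_fun_apply scaleR_fun_apply minus_apply uminus_apply

declare pointwise [simp del]

lemma mult_delta: "a * (if P then 1 else 0) = (if P then a else (0::real))"
  by simp

context manifold
begin

section \<open>Operations on vector fields and the Lie bracket\<close>

lemma VF_add: "VF X \<Longrightarrow> VF Y \<Longrightarrow> VF (\<lambda>q. X q + Y q)"
  by (rule vector_fieldI) (auto intro: T_intros C_intros simp: pointwise)

lemma VF_scale: "C f \<Longrightarrow> VF X \<Longrightarrow> VF (\<lambda>q. f q *\<^sub>R X q)"
  by (rule vector_fieldI) (auto intro: T_intros C_intros simp: pointwise)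

lemma VF_cscale: "VF X \<Longrightarrow> VF (\<lambda>q. c *\<^sub>R X q)"
  by (rule VF_scale) auto

lemma VF_minus: "VF X \<Longrightarrow> VF (\<lambda>q. - X q)"
  by (rule vector_fieldI) (auto intro: T_intros C_intros simp: pointwise)

lemma VF_diff: "VF X \<Longrightarrow> VF Y \<Longrightarrow> VF (\<lambda>q. X q - Y q)"
  by (rule vector_fieldI) (auto intro: T_intros C_intros simp: pointwise)

lemma VF_zero: "VF (\<lambda>q. 0)"
  by (rule vector_fieldI) (auto simp: pointwise)

lemma VF_sum: "(\<And>i. i \<in> I \<Longrightarrow> VF (X i)) \<Longrightarrow> VF (\<lambda>q. \<Sum>i\<in>I. X i q)"
  by (induction I rule: infinite_finite_induct) (auto intro: VF_zero VF_add)

lemmas VF_intros = VF_add VF_scale VF_cscale VF_minus VF_diff VF_zero VF_sum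

lemma VF_deriv:
  assumes "VF X"
  shows "C f \<Longrightarrow> C g \<Longrightarrow> X p (\<lambda>q. f q + g q) = X p f + X p g"
    "C f \<Longrightarrow> C g \<Longrightarrow> X p (\<lambda>q. f q - g q) = X p f - X p g"
    "C f \<Longrightarrow> X p (\<lambda>q. - f q) = - X p f"
    "C f \<Longrightarrow> C g \<Longrightarrow> X p (\<lambda>q. f q * g q) = X p f * g p + f p * X p g"
    "C f \<Longrightarrow> X p (\<lambda>q. c * f q) = c * X p f"
    "X p (\<lambda>q. c) = 0"
  using VF_T[OF assms, of p]
  by (auto simp: tangent_add tangent_diff tangent_minus tangent_mult[of _ p] tangent_cmult tangent_const[of _ p])

text \<open>In the product rule for the commutator the mixed terms X f * Y g cancel, which makes it
  a derivation.\<close>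

lemma VF_lie_bracket:
  assumes X: "VF X" and Y: "VF Y"
  shows "VF (lie_bracket X Y)"
proof (rule vector_fieldI)
  fix p
  have ns: "Z p f = 0" if "VF Z" "\<not> C f" for Z f p
    using tangent_not_smooth[OF VF_T[OF that(1)] that(2)] .
  show "lie_bracket X Y p \<in> T p"
    by (rule tangentI)
      (use X Y in \<open>auto simp: lie_bracket_def pointwise VF_deriv[OF X] VF_deriv[OF Y] VF_C[OF X] VF_C[OF Y] ns C_intros algebra_simps\<close>)
  show "C f \<Longrightarrow> C (\<lambda>p. lie_bracket X Y p f)" for f
    using X Y by (auto simp: lie_bracket_def intro: C_intros)
qed

lemma T_lie_bracket: "VF X \<Longrightarrow> VF Y \<Longrightarrow> lie_bracket X Y p \<in> T p"
  by (rule VF_T[OF VF_lie_bracket])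

lemma tangent_eqI: "v \<in> T p \<Longrightarrow> w \<in> T p \<Longrightarrow> (\<And>f. C f \<Longrightarrow> v f = w f) \<Longrightarrow> v = w"
  using tangent_not_smooth by (metis ext)

lemma lie_bracket_swap: "lie_bracket X Y p = - lie_bracket Y X p"
  by (auto simp: lie_bracket_def fun_eq_iff pointwise)

lemma lie_bracket_add_right:
  assumes "VF X" "VF Y" "VF Z"
  shows "lie_bracket X (\<lambda>q. Y q + Z q) p = lie_bracket X Y p + lie_bracket X Z p"
proof (rule tangent_eqI[of _ p], goal_cases)
  case (3 f)
  then show ?case
    using assms by (simp add: lie_bracket_def pointwise VF_deriv[OF assms(1)] VF_deriv[OF assms(2)] VF_deriv[OF assms(3)] assms[THEN VF_C])
qed (use assms in \<open>auto intro!: T_intros T_lie_bracket VF_intros\<close>)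

lemma lie_bracket_diff_right:
  assumes "VF X" "VF Y" "VF Z"
  shows "lie_bracket X (\<lambda>q. Y q - Z q) p = lie_bracket X Y p - lie_bracket X Z p"
proof (rule tangent_eqI[of _ p], goal_cases)
  case (3 f)
  then show ?case
    using assms by (simp add: lie_bracket_def pointwise VF_deriv[OF assms(1)] VF_deriv[OF assms(2)] VF_deriv[OF assms(3)] assms[THEN VF_C])
qed (use assms in \<open>auto intro!: T_intros T_lie_bracket VF_intros\<close>)

lemma lie_bracket_scale_right:
  assumes "VF X" "VF Y" "C f"
  shows "lie_bracket X (\<lambda>q. f q *\<^sub>R Y q) p = X p f *\<^sub>R Y p + f p *\<^sub>R lie_bracket X Y p"
proof (rule tangent_eqI[of _ p], goal_cases)
  case (3 h)
  then show ?case
    using assms by (simp add: lie_bracket_def pointwise VF_deriv[OF assms(1)] C_mult assms(3) assms(1,2)[THEN VF_C] algebra_simps)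
qed (use assms in \<open>auto intro!: T_intros T_lie_bracket VF_intros\<close>)

lemma lie_bracket_add_left:
  assumes "VF X" "VF Y" "VF Z"
  shows "lie_bracket (\<lambda>q. Y q + Z q) X p = lie_bracket Y X p + lie_bracket Z X p"
  using lie_bracket_add_right[OF assms, of p]
  by (simp add: lie_bracket_swap[of "\<lambda>q. Y q + Z q" X] lie_bracket_swap[of Y X] lie_bracket_swap[of Z X])

lemma lie_bracket_scale_left:
  assumes "VF X" "VF Y" "C f"
  shows "lie_bracket (\<lambda>q. f q *\<^sub>R Y q) X p = f p *\<^sub>R lie_bracket Y X p - X p f *\<^sub>R Y p"
  using lie_bracket_scale_right[OF assms, of p]
  by (simp add: lie_bracket_swap[of "\<lambda>q. f q *\<^sub>R Y q" X] lie_bracket_swap[of Y X])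

lemmas lie_bracket_simps = lie_bracket_add_right lie_bracket_add_left lie_bracket_diff_right
  lie_bracket_scale_right lie_bracket_scale_left

lemma Jacobi:
  assumes "VF X" "VF Y" "VF Z"
  shows "lie_bracket X (lie_bracket Y Z) p =
    lie_bracket (lie_bracket X Y) Z p + lie_bracket Y (lie_bracket X Z) p"
proof (rule tangent_eqI[of _ p], goal_cases)
  case (3 f)
  then show ?case
    using assms by (simp add: lie_bracket_def pointwise VF_deriv[OF assms(1)] VF_deriv[OF assms(2)] VF_deriv[OF assms(3)] assms[THEN VF_C])
qed (use assms in \<open>auto intro!: T_intros T_lie_bracket VF_lie_bracket\<close>)

subsection \<open>Tensoriality\<close>

lemma extend_tangent:
  assumes "v \<in> T p" obtains X where "VF X" "X p = v"
proof -
  obtain E \<theta> W where fr: "open W" "p \<in> W" "\<And>i::'n. VF (E i)" "\<And>i. C (\<theta> i)"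
    "\<And>i j q. q \<in> W \<Longrightarrow> E i q (\<theta> j) = (if i = j then 1 else 0)"
    "\<And>q v. q \<in> W \<Longrightarrow> v \<in> T q \<Longrightarrow> v = (\<Sum>i\<in>UNIV. v (\<theta> i) *\<^sub>R E i q)"
    by (rule frame_at[of p]) (rule that)
  show thesis
  proof
    show "VF (\<lambda>q. \<Sum>i\<in>UNIV. v (\<theta> i) *\<^sub>R E i q)"
      by (intro VF_sum VF_cscale fr(3))
    show "(\<Sum>i\<in>UNIV. v (\<theta> i) *\<^sub>R E i p) = v" using fr(6)[OF fr(2) assms] by simp
  qed
qed

text \<open>An arbitrary choice. It is only used inside expressions that are tensorial, where the
  value at p does not depend on it.\<close>

definition extend :: "'a \<Rightarrow> 'a tangent \<Rightarrow> 'a vfield"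
  where "extend p v = (SOME X. VF X \<and> X p = v)"

lemma extend:
  assumes "v \<in> T p"
  shows VF_extend: "VF (extend p v)" and extend_apply: "extend p v p = v"
  using someI_ex[of "\<lambda>X. VF X \<and> X p = v"] extend_tangent[OF assms] unfolding extend_def by blast+

lemma finite_basis_T: "\<exists>B. finite B \<and> independent B \<and> span B = T p \<and> card B = CARD('n)"
proof -
  obtain E \<theta> W where fr: "open W" "p \<in> W" "\<And>i::'n. VF (E i)" "\<And>i. C (\<theta> i)"
    "\<And>i j q. q \<in> W \<Longrightarrow> E i q (\<theta> j) = (if i = j then 1 else 0)"
    "\<And>q v. q \<in> W \<Longrightarrow> v \<in> T q \<Longrightarrow> v = (\<Sum>i\<in>UNIV. v (\<theta> i) *\<^sub>R E i q)"
    by (rule frame_at[of p]) (rule that)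
  let ?e = "\<lambda>i. E i p"
  have \<theta>: "?e i (\<theta> j) = (if i = j then 1 else 0)" for i j by (rule fr(5)[OF fr(2)])
  have inj: "inj ?e"
  proof (rule injI)
    fix i j assume "?e i = ?e j"
    then have "?e i (\<theta> i) = ?e j (\<theta> i)" by simp
    then show "i = j" unfolding \<theta> by (auto split: if_splits)
  qed
  \<comment> \<open>The functions \<open>\<theta> j\<close> are dual to the frame at p, so
    evaluating a linear relation on them picks out its coefficients.\<close>
  have z: "c v = 0" if 0: "(\<Sum>x\<in>range ?e. c x *\<^sub>R x) = 0" and r: "v \<in> range ?e" for c v
  proof -
    obtain j where j: "v = ?e j" using r by auto
    have "(\<Sum>i\<in>UNIV. c (?e i) *\<^sub>R ?e i) = 0"
      using 0 sum.reindex[OF inj, of "\<lambda>x. c x *\<^sub>R x"] by (simp only: o_def)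
    then have "0 = (\<Sum>i\<in>UNIV. c (?e i) *\<^sub>R ?e i) (\<theta> j)" by (simp only: zero_fun_apply)
    also have "\<dots> = (\<Sum>i\<in>UNIV. if i = j then c (?e i) else 0)"
      by (simp only: sum_fun_apply scaleR_fun_apply real_scaleR_def \<theta> mult_delta)
    also have "\<dots> = c (?e j)" by (subst sum.delta) (rule finite, simp only: UNIV_I if_True)
    finally show "c v = 0" unfolding j by (rule sym)
  qed
  have ind: "independent (range ?e)"
    using z by (subst dependent_finite[OF finite_imageI[OF finite]]) blast
  have "span (range ?e) = T p"
  proof
    show "span (range ?e) \<subseteq> T p" by (rule span_minimal[OF _ subspace_T]) (use fr in auto)
    show "T p \<subseteq> span (range ?e)"
    proof
      fix v assume "v \<in> T p"
      then have "v = (\<Sum>i\<in>UNIV. v (\<theta> i) *\<^sub>R ?e i)" by (rule fr(6)[OF fr(2)])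
      also have "\<dots> \<in> span (range ?e)" by (intro span_sum span_scale span_base) auto
      finally show "v \<in> span (range ?e)" .
    qed
  qed
  moreover have "card (range ?e) = CARD('n)" by (rule card_image[OF inj])
  ultimately show "\<exists>B. finite B \<and> independent B \<and> span B = T p \<and> card B = CARD('n)"
    using ind by (intro exI[of _ "range ?e"] conjI finite_imageI finite)
qed

text \<open>The value type is a parameter, so that real-valued forms and vector-valued operators
  such as \<open>nabla_endo D \<psi> X\<close> are covered at once.\<close>

definition tensorial :: "('a vfield \<Rightarrow> 'a \<Rightarrow> 'b::real_vector) \<Rightarrow> bool" where
  "tensorial F \<longleftrightarrow>
     (\<forall>X Y p. VF X \<longrightarrow> VF Y \<longrightarrow> F (\<lambda>q. X q + Y q) p = F X p + F Y p) \<and>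
     (\<forall>f X p. C f \<longrightarrow> VF X \<longrightarrow> F (\<lambda>q. f q *\<^sub>R X q) p = f p *\<^sub>R F X p)"

lemma tensorial_add: "tensorial F \<Longrightarrow> VF X \<Longrightarrow> VF Y \<Longrightarrow> F (\<lambda>q. X q + Y q) p = F X p + F Y p"
  and tensorial_scale: "tensorial F \<Longrightarrow> C f \<Longrightarrow> VF X \<Longrightarrow> F (\<lambda>q. f q *\<^sub>R X q) p = f p *\<^sub>R F X p"
  unfolding tensorial_def by auto

lemma tensorial_zero_field: "tensorial F \<Longrightarrow> F (\<lambda>q. 0) p = 0"
  using tensorial_scale[of F "\<lambda>q. 0" "\<lambda>q. 0" p] by (simp add: VF_zero)

lemma tensorial_sum:
  "tensorial F \<Longrightarrow> (\<And>i. i \<in> I \<Longrightarrow> VF (X i)) \<Longrightarrow> F (\<lambda>q. \<Sum>i\<in>I. X i q) p = (\<Sum>i\<in>I. F (X i) p)"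
proof (induction I rule: infinite_finite_induct)
  case (insert i I)
  then show ?case using tensorial_add[of F "X i" "\<lambda>q. \<Sum>i\<in>I. X i q" p] by (simp add: VF_sum)
qed (simp_all add: tensorial_zero_field)

text \<open>A local frame expansion of X cannot be inserted into F, which takes global fields.
  Multiplied by a cutoff it becomes a global identity, and the cutoff is 1 at p.\<close>

lemma tensorial_zero:
  assumes F: "tensorial F" and X: "VF X" and p: "X p = 0"
  shows "F X p = 0"
proof -
  obtain E \<theta> W where fr: "open W" "p \<in> W" "\<And>i::'n. VF (E i)" "\<And>i. C (\<theta> i)"
    "\<And>i j q. q \<in> W \<Longrightarrow> E i q (\<theta> j) = (if i = j then 1 else 0)"
    "\<And>q v. q \<in> W \<Longrightarrow> v \<in> T q \<Longrightarrow> v = (\<Sum>i\<in>UNIV. v (\<theta> i) *\<^sub>R E i q)"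
    by (rule frame_at[of p]) (rule that)
  obtain \<beta> K N where \<beta>: "C \<beta>" "closed K" "K \<subseteq> W" "\<And>q. q \<notin> K \<Longrightarrow> \<beta> q = 0"
    "open N" "p \<in> N" "N \<subseteq> W" "\<And>q. q \<in> N \<Longrightarrow> \<beta> q = 1" using cutoff[OF fr(1,2)] by metis
  have "(\<lambda>q. \<beta> q *\<^sub>R X q) = (\<lambda>q. \<Sum>i\<in>UNIV. (\<beta> q * X q (\<theta> i)) *\<^sub>R E i q)"
  proof
    fix q
    show "\<beta> q *\<^sub>R X q = (\<Sum>i\<in>UNIV. (\<beta> q * X q (\<theta> i)) *\<^sub>R E i q)"
    proof (cases "q \<in> W")
      case True
      then have "X q = (\<Sum>i\<in>UNIV. X q (\<theta> i) *\<^sub>R E i q)" using fr(6) X by simp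
      then have "\<beta> q *\<^sub>R X q = \<beta> q *\<^sub>R (\<Sum>i\<in>UNIV. X q (\<theta> i) *\<^sub>R E i q)" by (rule arg_cong)
      then show ?thesis by (simp add: scaleR_right.sum)
    next
      case False
      then have "\<beta> q = 0" using \<beta>(3,4) by auto
      then show ?thesis by simp
    qed
  qed
  then have "F (\<lambda>q. \<beta> q *\<^sub>R X q) p = F (\<lambda>q. \<Sum>i\<in>UNIV. (\<beta> q * X q (\<theta> i)) *\<^sub>R E i q) p" by simp
  also have "\<dots> = (\<Sum>i\<in>UNIV. F (\<lambda>q. (\<beta> q * X q (\<theta> i)) *\<^sub>R E i q) p)"
    by (rule tensorial_sum[OF F]) (intro VF_scale C_mult \<beta>(1) fr(3,4) VF_C[OF X])
  also have "\<dots> = (\<Sum>i\<in>UNIV. (\<beta> p * X p (\<theta> i)) *\<^sub>R F (E i) p)"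
    by (intro sum.cong refl tensorial_scale[OF F] C_mult \<beta>(1) fr(3,4) VF_C[OF X])
  also have "\<dots> = 0" using p by (simp add: pointwise)
  also have "F (\<lambda>q. \<beta> q *\<^sub>R X q) p = F X p"
    using tensorial_scale[OF F \<beta>(1) X, of p] \<beta>(6,8) by simp
  finally show ?thesis .
qed

lemma tensorial_minus: "tensorial F \<Longrightarrow> VF X \<Longrightarrow> F (\<lambda>q. - X q) p = - F X p"
  using tensorial_scale[of F "\<lambda>q. -1" X p] by simp

lemma tensorial_diff:
  "tensorial F \<Longrightarrow> VF X \<Longrightarrow> VF Y \<Longrightarrow> F (\<lambda>q. X q - Y q) p = F X p - F Y p"
  using tensorial_add[of F X "\<lambda>q. - Y q" p] tensorial_minus[of F Y p] by (simp add: VF_minus)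

lemma tensorial_cong:
  assumes "tensorial F" "VF X" "VF Y" "X p = Y p"
  shows "F X p = F Y p"
  using tensorial_zero[OF assms(1) VF_diff[OF assms(2,3)], of p] assms by (simp add: tensorial_diff)

definition value_at :: "('a vfield \<Rightarrow> 'a \<Rightarrow> 'b::real_vector) \<Rightarrow> 'a \<Rightarrow> 'a tangent \<Rightarrow> 'b"
  where "value_at F p v = (if v \<in> T p then F (extend p v) p else 0)"

lemma value_at_field: "tensorial F \<Longrightarrow> VF X \<Longrightarrow> value_at F p (X p) = F X p"
  using tensorial_cong[of F "extend p (X p)" X p] by (simp add: value_at_def extend)

lemma value_at_linear:
  assumes "tensorial F" "v \<in> T p" "w \<in> T p"
  shows "value_at F p (a *\<^sub>R v + b *\<^sub>R w) = a *\<^sub>R value_at F p v + b *\<^sub>R value_at F p w"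
proof -
  have "value_at F p ((\<lambda>q. a *\<^sub>R extend p v q + b *\<^sub>R extend p w q) p) =
      F (\<lambda>q. a *\<^sub>R extend p v q + b *\<^sub>R extend p w q) p"
    by (rule value_at_field) (use assms in \<open>auto intro!: VF_intros VF_extend\<close>)
  also have "\<dots> = a *\<^sub>R F (extend p v) p + b *\<^sub>R F (extend p w) p"
    using assms tensorial_scale[OF assms(1), of "\<lambda>_. a"] tensorial_scale[OF assms(1), of "\<lambda>_. b"]
    by (simp add: tensorial_add[OF assms(1)] VF_cscale VF_extend)
  finally show ?thesis using assms by (simp add: value_at_def extend T_intros)
qed

definition bilinear_field :: "('a \<Rightarrow> 'a tangent \<Rightarrow> 'a tangent \<Rightarrow> real) \<Rightarrow> bool" where
  "bilinear_field B \<longleftrightarrow>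
     (\<forall>p a b. \<forall>u\<in>T p. \<forall>v\<in>T p. \<forall>w\<in>T p. B p (a *\<^sub>R u + b *\<^sub>R v) w = a * B p u w + b * B p v w) \<and>
     (\<forall>p a b. \<forall>u\<in>T p. \<forall>v\<in>T p. \<forall>w\<in>T p. B p w (a *\<^sub>R u + b *\<^sub>R v) = a * B p w u + b * B p w v) \<and>
     (\<forall>X Y. VF X \<longrightarrow> VF Y \<longrightarrow> C (\<lambda>p. B p (X p) (Y p)))"

lemma bilinear_field_sum_left:
  assumes B: "bilinear_field B" and "finite I" "\<And>i. i \<in> I \<Longrightarrow> e i \<in> T p" and w: "w \<in> T p"
  shows "B p (\<Sum>i\<in>I. c i *\<^sub>R e i) w = (\<Sum>i\<in>I. c i * B p (e i) w)"
  using assms(2,3)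
proof (induction I rule: finite_induct)
  case empty
  have "B p (0 *\<^sub>R w + 0 *\<^sub>R w) w = 0 * B p w w + 0 * B p w w"
    using B w unfolding bilinear_field_def by blast
  then show ?case by simp
next
  case (insert i I)
  have "B p (c i *\<^sub>R e i + 1 *\<^sub>R (\<Sum>i\<in>I. c i *\<^sub>R e i)) w = c i * B p (e i) w + 1 * B p (\<Sum>i\<in>I. c i *\<^sub>R e i) w"
    using B w insert.prems unfolding bilinear_field_def by (blast intro: T_intros)
  then show ?case using insert by simp
qed

lemma bilinear_field_sum_right:
  assumes B: "bilinear_field B" and "finite I" "\<And>i. i \<in> I \<Longrightarrow> e i \<in> T p" and w: "w \<in> T p"
  shows "B p w (\<Sum>i\<in>I. c i *\<^sub>R e i) = (\<Sum>i\<in>I. c i * B p w (e i))"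
proof -
  have "bilinear_field (\<lambda>p v w. B p w v)" using B unfolding bilinear_field_def by blast
  from bilinear_field_sum_left[OF this assms(2-)] show ?thesis by simp
qed

lemma C_det:
  assumes "\<And>i j::'m::finite. C (\<lambda>q. M q $ i $ j)"
  shows "C (\<lambda>q. det (M q))"
  unfolding det_def by (intro C_intros assms)

text \<open>The isomorphism between vector fields and 1-forms given by a nondegenerate bilinear
  field. B need not be symmetric: besides the metric it is applied to \<omega> + \<eta> \<otimes>
  \<eta>, before any metric is available.\<close>

lemma duality:
  assumes B: "bilinear_field B"
    and nd: "\<And>p u. u \<in> T p \<Longrightarrow> (\<And>v. v \<in> T p \<Longrightarrow> B p u v = 0) \<Longrightarrow> u = 0"
    and F: "tensorial F" and CF: "\<And>X. VF X \<Longrightarrow> C (F X)"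
  obtains Z where "VF Z" "\<And>X p. VF X \<Longrightarrow> B p (Z p) (X p) = F X p"
proof -
  have BC: "C (\<lambda>p. B p (X p) (Y p))" if "VF X" "VF Y" for X Y
    using B that unfolding bilinear_field_def by blast
  have local: "\<exists>Z W. VF Z \<and> open W \<and> p \<in> W \<and> (\<forall>q\<in>W. \<forall>Y. VF Y \<longrightarrow> B q (Z q) (Y q) = F Y q)" for p
  proof -
    obtain E \<theta> W where fr: "open W" "p \<in> W" "\<And>i::'n. VF (E i)" "\<And>i. C (\<theta> i)"
      "\<And>i j q. q \<in> W \<Longrightarrow> E i q (\<theta> j) = (if i = j then 1 else 0)"
      "\<And>q v. q \<in> W \<Longrightarrow> v \<in> T q \<Longrightarrow> v = (\<Sum>i\<in>UNIV. v (\<theta> i) *\<^sub>R E i q)"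
      by (rule frame_at[of p]) (rule that)
    define M :: "'a \<Rightarrow> real^'n^'n" where "M = (\<lambda>q. \<chi> j k. B q (E k q) (E j q))"
    define b :: "'a \<Rightarrow> real^'n" where "b = (\<lambda>q. \<chi> j. F (E j) q)"
    have "det (M p) \<noteq> 0"
    proof -
      have "z = 0" if z: "M p *v z = 0" for z
      proof -
        define x where "x = (\<Sum>k\<in>UNIV. z $ k *\<^sub>R E k p)"
        have xT: "x \<in> T p" unfolding x_def by (intro T_intros VF_T fr)
        have *: "B p x (E j p) = 0" for j
          using arg_cong[OF z, of "\<lambda>v. v $ j"] fr
          by (simp add: x_def bilinear_field_sum_left[OF B] M_def matrix_vector_mult_def mult.commute)
        have "B p x v = 0" if v: "v \<in> T p" for v
          by (subst fr(6)[OF fr(2) v]) (simp add: bilinear_field_sum_right[OF B] fr xT *)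
        then have "x = 0" by (rule nd[OF xT])
        then have "x (\<theta> j) = 0" for j by (simp add: pointwise)
        then have "z $ j = 0" for j
          by (simp add: x_def sum_fun_apply pointwise fr(5)[OF fr(2)] mult_delta)
        then show ?thesis by (simp add: vec_eq_iff)
      qed
      then show ?thesis
        by (metis invertible_det_nz invertible_left_inverse matrix_left_invertible_ker)
    qed
    moreover have CM: "C (\<lambda>q. det (M q))"
      by (rule C_det) (simp add: M_def BC fr)
    ultimately obtain h N where h: "C h" "open N" "p \<in> N" "\<And>q. q \<in> N \<Longrightarrow> h q * det (M q) = 1"
      using C_inverse_local by metis
    \<comment> \<open>The matrices of Cramer's rule. Solving the linear system by determinants shows
      at once that the solution depends smoothly on the point.\<close>
    define R :: "'n \<Rightarrow> 'a \<Rightarrow> real^'n^'n" where "R = (\<lambda>k q. \<chi> i j. if j = k then b q $ i else M q $ i $ j)"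
    have CR: "C (\<lambda>q. det (R k q))" for k
    proof (rule C_det)
      show "C (\<lambda>q. R k q $ i $ j)" for i j
        by (cases "j = k") (simp_all add: R_def M_def b_def BC CF fr)
    qed
    define Z where "Z = (\<lambda>q. \<Sum>k\<in>UNIV. (h q * det (R k q)) *\<^sub>R E k q)"
    have VZ: "VF Z" unfolding Z_def by (intro VF_sum VF_scale C_mult h(1) CR fr(3))
    have "B q (Z q) (Y q) = F Y q" if q: "q \<in> W \<inter> N" and Y: "VF Y" for q Y
    proof -
      have d0: "det (M q) \<noteq> 0" using h(4)[of q] q by auto
      then have hq: "h q = inverse (det (M q))" using h(4)[of q] q by (simp add: field_simps)
      have "M q *v (\<chi> k. det (R k q) / det (M q)) = b q"
        using cramer[OF d0, of _ "b q"] unfolding R_def by simp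
      then have Bj: "B q (Z q) (E j q) = F (E j) q" for j
        using fr by (simp add: Z_def bilinear_field_sum_left[OF B] vec_eq_iff matrix_vector_mult_def
          M_def b_def hq divide_inverse mult_ac)
      have Yq: "Y q = (\<Sum>j\<in>UNIV. Y q (\<theta> j) *\<^sub>R E j q)" using fr(6) q Y by simp
      have "B q (Z q) (Y q) = (\<Sum>j\<in>UNIV. Y q (\<theta> j) * F (E j) q)"
        by (subst Yq) (simp add: bilinear_field_sum_right[OF B] VZ fr Bj)
      also have "\<dots> = F (\<lambda>s. \<Sum>j\<in>UNIV. Y s (\<theta> j) *\<^sub>R E j s) q"
        using Y fr(3,4)
        by (simp add: tensorial_sum[OF F] VF_scale VF_C[OF Y] tensorial_scale[OF F])
      also have "\<dots> = F Y q"
        by (rule tensorial_cong[where F = F and Y = Y and p = q and X = "\<lambda>s. \<Sum>j\<in>UNIV. Y s (\<theta> j) *\<^sub>R E j s", OF F _ Y Yq[symmetric]]) (intro VF_sum VF_scale VF_C[OF Y] fr(3,4))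
      finally show ?thesis .
    qed
    then show ?thesis using VZ h fr by (intro exI[of _ Z] exI[of _ "W \<inter> N"]) auto
  qed
  have uniq: "u = v" if "u \<in> T p" "v \<in> T p" "\<And>Y. VF Y \<Longrightarrow> B p u (Y p) = B p v (Y p)" for u v p
  proof -
    have "u - v = 0"
    proof (rule nd[OF T_diff[OF that(1,2)]])
      fix w assume w: "w \<in> T p"
      have "B p (1 *\<^sub>R u + (-1) *\<^sub>R v) w = 1 * B p u w + (-1) * B p v w"
        using B w that unfolding bilinear_field_def by blast
      then show "B p (u - v) w = 0"
        using that(3)[OF VF_extend[OF w]] extend_apply[OF w] by simp
    qed
    then show ?thesis by simp
  qed
  \<comment> \<open>The pointwise solution is unique, hence near each point it coincides with a
    smooth local one.\<close>
  define Z where "Z p = (THE z. z \<in> T p \<and> (\<forall>Y. VF Y \<longrightarrow> B p z (Y p) = F Y p))" for p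
  have Zeq: "Z q = z" if "z \<in> T q" "\<forall>Y. VF Y \<longrightarrow> B q z (Y q) = F Y q" for q z
    unfolding Z_def by (rule the_equality) (use that uniq in auto)
  have ZT: "Z p \<in> T p \<and> (\<forall>Y. VF Y \<longrightarrow> B p (Z p) (Y p) = F Y p)" for p
  proof -
    obtain z where "z \<in> T p" "\<forall>Y. VF Y \<longrightarrow> B p z (Y p) = F Y p" using local[of p] VF_T by metis
    then show ?thesis using Zeq by auto
  qed
  have "VF Z"
  proof (rule vector_fieldI)
    fix f assume f: "C f"
    show "C (\<lambda>p. Z p f)"
    proof (rule smooth_fun_localI)
      fix p
      obtain Z' W where Z': "VF Z'" "open W" "p \<in> W" "\<forall>q\<in>W. \<forall>Y. VF Y \<longrightarrow> B q (Z' q) (Y q) = F Y q"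
        using local[of p] by blast
      then have "\<forall>q\<in>W. Z q f = Z' q f" using Zeq VF_T by metis
      then show "\<exists>g W. open W \<and> p \<in> W \<and> C g \<and> (\<forall>q\<in>W. Z q f = g q)"
        using Z' f by (intro exI[of _ "\<lambda>q. Z' q f"] exI[of _ W]) simp
    qed
  qed (use ZT in auto)
  then show thesis using that ZT by blast
qed

end

subsection \<open>The Levi-Civita connection\<close>

locale riemannian_manifold = manifold A for A :: "('a::{t2_space, second_countable_topology}, real ^ 'n::finite) atlas" +
  fixes g :: "'a metric"
  assumes metric: "riemannian_metric A g"
begin

lemma g_sym: "g p v w = g p w v"
  and g_outside: "\<not> (v \<in> T p \<and> w \<in> T p) \<Longrightarrow> g p v w = 0"
  and g_pos: "v \<in> T p \<Longrightarrow> v \<noteq> 0 \<Longrightarrow> 0 < g p v v"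
  and g_C [simp]: "VF X \<Longrightarrow> VF Y \<Longrightarrow> C (\<lambda>p. g p (X p) (Y p))"
  using metric unfolding riemannian_metric_def by simp_all

lemma g_lin':
  "u \<in> T p \<Longrightarrow> v \<in> T p \<Longrightarrow> w \<in> T p \<Longrightarrow> g p (a *\<^sub>R u + b *\<^sub>R v) w = a * g p u w + b * g p v w"
proof -
  have "\<forall>p a b. \<forall>u\<in>T p. \<forall>v\<in>T p. \<forall>w\<in>T p. g p (a *\<^sub>R u + b *\<^sub>R v) w = a * g p u w + b * g p v w"
    using metric unfolding riemannian_metric_def by (elim conjE) assumption
  then show "u \<in> T p \<Longrightarrow> v \<in> T p \<Longrightarrow> w \<in> T p \<Longrightarrow>
    g p (a *\<^sub>R u + b *\<^sub>R v) w = a * g p u w + b * g p v w" by blast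
qed

lemma g_lin: "u \<in> T p \<Longrightarrow> v \<in> T p \<Longrightarrow> g p (a *\<^sub>R u + b *\<^sub>R v) w = a * g p u w + b * g p v w"
  by (cases "w \<in> T p") (simp_all add: g_lin' g_outside)

lemma g_add_left: "u \<in> T p \<Longrightarrow> v \<in> T p \<Longrightarrow> g p (u + v) w = g p u w + g p v w"
  using g_lin[of u p v 1 1 w] by simp
lemma g_diff_left: "u \<in> T p \<Longrightarrow> v \<in> T p \<Longrightarrow> g p (u - v) w = g p u w - g p v w"
  using g_lin[of u p v 1 "-1" w] by simp
lemma g_scale_left: "u \<in> T p \<Longrightarrow> g p (a *\<^sub>R u) w = a * g p u w"
  using g_lin[of u p u a 0 w] by simp
lemma g_minus_left: "u \<in> T p \<Longrightarrow> g p (- u) w = - g p u w"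
  using g_scale_left[of u p "-1" w] by simp
lemma g_zero_left [simp]: "g p 0 w = 0"
  using g_scale_left[of 0 p 0 w] by simp
lemma g_add_right: "u \<in> T p \<Longrightarrow> v \<in> T p \<Longrightarrow> g p w (u + v) = g p w u + g p w v"
  using g_add_left[of u p v w] by (simp add: g_sym)
lemma g_diff_right: "u \<in> T p \<Longrightarrow> v \<in> T p \<Longrightarrow> g p w (u - v) = g p w u - g p w v"
  using g_diff_left[of u p v w] by (simp add: g_sym)
lemma g_scale_right: "u \<in> T p \<Longrightarrow> g p w (a *\<^sub>R u) = a * g p w u"
  using g_scale_left[of u p a w] by (simp add: g_sym)
lemma g_minus_right: "u \<in> T p \<Longrightarrow> g p w (- u) = - g p w u"
  using g_minus_left[of u p w] by (simp add: g_sym)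
lemma g_zero_right [simp]: "g p w 0 = 0"
  using g_zero_left[of p w] by (simp add: g_sym)

lemmas g_simps = g_add_left g_diff_left g_scale_left g_minus_left
  g_add_right g_diff_right g_scale_right g_minus_right

lemma bilinear_field_g: "bilinear_field g"
  unfolding bilinear_field_def by (auto simp: g_simps T_intros)

lemma g_nondegenerate: "u \<in> T p \<Longrightarrow> (\<And>v. v \<in> T p \<Longrightarrow> g p u v = 0) \<Longrightarrow> u = 0"
  using g_pos[of u p] by force

lemma g_eqI: "u \<in> T p \<Longrightarrow> v \<in> T p \<Longrightarrow> (\<And>w. w \<in> T p \<Longrightarrow> g p u w = g p v w) \<Longrightarrow> u = v"
  using g_nondegenerate[of "u - v" p] by (simp add: g_simps T_intros)

lemma VF_g_eqI:
  assumes "VF X" "VF Y" "\<And>Z p. VF Z \<Longrightarrow> g p (X p) (Z p) = g p (Y p) (Z p)"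
  shows "X = Y"
proof
  fix p
  show "X p = Y p"
    by (rule g_eqI[of _ p]) (use assms VF_extend extend_apply in \<open>auto, metis\<close>)
qed

text \<open>The Koszul formula. It is tensorial in its last argument, so \<open>duality\<close>
  turns it into a vector field.\<close>

definition Koszul :: "'a vfield \<Rightarrow> 'a vfield \<Rightarrow> 'a vfield \<Rightarrow> 'a \<Rightarrow> real" where
  "Koszul X Y Z p = (X p (\<lambda>q. g q (Y q) (Z q)) + Y p (\<lambda>q. g q (Z q) (X q)) - Z p (\<lambda>q. g q (X q) (Y q))
     + g p (lie_bracket X Y p) (Z p) - g p (lie_bracket X Z p) (Y p) - g p (lie_bracket Y Z p) (X p)) / 2"

lemmas Koszul_simps = Koszul_def pointwise VF_deriv g_simps T_intros lie_bracket_simps VF_lie_bracket VF_intros C_intros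

lemma tensorial_Koszul:
  assumes X: "VF X" and Y: "VF Y"
  shows "tensorial (Koszul X Y)"
  unfolding tensorial_def
  using X Y by (auto simp: Koszul_simps VF_deriv[OF X] VF_deriv[OF Y] g_sym field_simps)

definition nabla :: "'a vfield \<Rightarrow> 'a vfield \<Rightarrow> 'a vfield" where
  "nabla X Y = (SOME Z. VF Z \<and> (\<forall>W p. VF W \<longrightarrow> g p (Z p) (W p) = Koszul X Y W p))"

lemma
  assumes "VF X" "VF Y"
  shows VF_nabla: "VF (nabla X Y)"
    and g_nabla: "VF W \<Longrightarrow> g p (nabla X Y p) (W p) = Koszul X Y W p"
proof -
  have "C (Koszul X Y W)" if W: "VF W" for W
    unfolding Koszul_def divide_inverse
    by (intro C_add C_diff C_mult C_const VF_C[OF W] VF_C[OF assms(1)] VF_C[OF assms(2)]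
        g_C VF_lie_bracket assms W)
  then obtain Z where "VF Z" "\<And>W p. VF W \<Longrightarrow> g p (Z p) (W p) = Koszul X Y W p"
    using duality[OF bilinear_field_g, of "Koszul X Y"] g_nondegenerate tensorial_Koszul[OF assms] by blast
  then have "\<exists>Z. VF Z \<and> (\<forall>W p. VF W \<longrightarrow> g p (Z p) (W p) = Koszul X Y W p)" by blast
  from someI_ex[OF this] show "VF (nabla X Y)"
    "VF W \<Longrightarrow> g p (nabla X Y p) (W p) = Koszul X Y W p"
    unfolding nabla_def by blast+
qed

lemma nabla_eqI:
  assumes "VF X" "VF Y" "VF Z" "\<And>W p. VF W \<Longrightarrow> Koszul X Y W p = g p (Z p) (W p)"
  shows "nabla X Y = Z"
  by (rule VF_g_eqI) (simp_all add: assms VF_nabla g_nabla)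

text \<open>\<open>nearly_sasakian\<close> asserts that a Levi-Civita connection exists. Starting
  from forms alone, it has to be supplied for the metric found there.\<close>

lemma levi_civita_nabla: "levi_civita A g nabla"
  unfolding levi_civita_def affine_connection_def
proof (intro conjI allI impI)
  fix X Y assume X: "VF X" and Y: "VF Y"
  note d = VF_deriv[OF X] VF_deriv[OF Y]
  show "VF (nabla X Y)" by (rule VF_nabla[OF X Y])
  have "nabla X Y = (\<lambda>p. nabla Y X p + lie_bracket X Y p)"
  proof (rule nabla_eqI[OF X Y])
    fix W p assume W: "VF W"
    show "Koszul X Y W p = g p (nabla Y X p + lie_bracket X Y p) (W p)"
      using X Y W by (simp add: g_simps VF_nabla g_nabla T_lie_bracket lie_bracket_swap[of Y X] Koszul_def)
        (simp add: g_sym field_simps)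
  qed (use X Y in \<open>auto intro!: VF_add VF_nabla VF_lie_bracket\<close>)
  then show "nabla X Y - nabla Y X = lie_bracket X Y" by (auto simp: pointwise)
  fix f assume f: "C f"
  show "nabla (\<lambda>p. f p *\<^sub>R X p) Y = (\<lambda>p. f p *\<^sub>R nabla X Y p)"
  proof (rule nabla_eqI)
    fix W p assume W: "VF W"
    show "Koszul (\<lambda>p. f p *\<^sub>R X p) Y W p = g p (f p *\<^sub>R nabla X Y p) (W p)"
      using X Y W f by (simp add: g_nabla VF_nabla Koszul_simps d VF_deriv[OF W])
        (simp add: g_sym field_simps)
  qed (use X Y f in \<open>auto intro!: VF_scale VF_nabla\<close>)
  show "nabla X (\<lambda>p. f p *\<^sub>R Y p) = (\<lambda>p. X p f *\<^sub>R Y p + f p *\<^sub>R nabla X Y p)"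
  proof (rule nabla_eqI)
    fix W p assume W: "VF W"
    show "Koszul X (\<lambda>p. f p *\<^sub>R Y p) W p = g p (X p f *\<^sub>R Y p + f p *\<^sub>R nabla X Y p) (W p)"
      using X Y W f by (simp add: g_nabla VF_nabla Koszul_simps d VF_deriv[OF W])
        (simp add: g_sym field_simps)
  qed (use X Y f in \<open>auto intro!: VF_scale VF_add VF_nabla VF_C[OF X]\<close>)
next
  fix X X' Y assume X: "VF X" and X': "VF X'" and Y: "VF Y"
  note d = VF_deriv[OF X] VF_deriv[OF Y]
  have "nabla (\<lambda>p. X p + X' p) Y = (\<lambda>p. nabla X Y p + nabla X' Y p)"
  proof (rule nabla_eqI)
    fix W p assume W: "VF W"
    show "Koszul (\<lambda>p. X p + X' p) Y W p = g p (nabla X Y p + nabla X' Y p) (W p)"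
      using X Y W X' by (simp add: g_nabla VF_nabla Koszul_simps d VF_deriv[OF W] VF_deriv[OF X'])
        (simp add: g_sym field_simps)
  qed (use X Y X' in \<open>auto intro!: VF_add VF_nabla\<close>)
  then show "nabla (X + X') Y = nabla X Y + nabla X' Y" by (simp add: plus_fun_def)
  have "nabla Y (\<lambda>p. X p + X' p) = (\<lambda>p. nabla Y X p + nabla Y X' p)"
  proof (rule nabla_eqI)
    fix W p assume W: "VF W"
    show "Koszul Y (\<lambda>p. X p + X' p) W p = g p (nabla Y X p + nabla Y X' p) (W p)"
      using X Y W X' by (simp add: g_nabla VF_nabla Koszul_simps d VF_deriv[OF W] VF_deriv[OF X'])
        (simp add: g_sym field_simps)
  qed (use X Y X' in \<open>auto intro!: VF_add VF_nabla\<close>)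
  then show "nabla Y (X + X') = nabla Y X + nabla Y X'" by (simp add: plus_fun_def)
next
  fix X Y Z p assume X: "VF X" and Y: "VF Y" and Z: "VF Z"
  have "g p (nabla X Y p) (Z p) + g p (nabla X Z p) (Y p) = X p (\<lambda>q. g q (Y q) (Z q))"
    using X Y Z by (simp add: g_nabla Koszul_def lie_bracket_swap[of Z Y] g_simps T_lie_bracket)
      (simp add: g_sym field_simps)
  then show "X p (\<lambda>q. g q (Y q) (Z q)) = g p (nabla X Y p) (Z p) + g p (Y p) (nabla X Z p)"
    by (simp add: g_sym)
qed

end


section \<open>Differential forms\<close>

lemma permutes_transpose_nat: "i < n \<Longrightarrow> j < n \<Longrightarrow> Transposition.transpose i j permutes {..<n}" for i j n :: nat
  by (rule permutes_swap_id) auto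

lemma permute_list_transpose:
  assumes "i < length vs" "j < length vs"
  shows "permute_list (Transposition.transpose i j) vs = vs[i := vs ! j, j := vs ! i]"
  by (rule nth_equalityI)
    (use assms in \<open>auto simp: permute_list_nth[OF permutes_transpose_nat[OF assms]] nth_list_update Transposition.transpose_def\<close>)

lemma permute_list_update:
  assumes s: "\<sigma> permutes {..<length vs}" and i: "i < length vs"
  shows "permute_list \<sigma> (vs[i := x]) = (permute_list \<sigma> vs)[inv \<sigma> i := x]"
proof (rule nth_equalityI)
  fix m assume "m < length (permute_list \<sigma> (vs[i := x]))"
  then have m: "m < length vs" by simp
  have "\<sigma> m < length vs" using permutes_in_image[OF s, of m] m by simp
  moreover have "inv \<sigma> i = m \<longleftrightarrow> i = \<sigma> m" using permutes_inverses[OF s] by metis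
  ultimately show "permute_list \<sigma> (vs[i := x]) ! m = (permute_list \<sigma> vs)[inv \<sigma> i := x] ! m"
    using s m i by (auto simp: permute_list_nth nth_list_update)
qed simp

text \<open>The six permutations give each of the three terms twice, which the factor 1/(1! 2!)
  undoes. In degree 2 + 2 below, the 24 permutations give each of six terms four times.\<close>

lemma wedge_1_2:
  assumes "\<And>a b. \<omega> p [a, b] = - \<omega> p [b, a]"
  shows "wedge 1 2 \<eta> \<omega> p [x, y, z] =
    \<eta> p [x] * \<omega> p [y, z] - \<eta> p [y] * \<omega> p [x, z] + \<eta> p [z] * \<omega> p [x, y]"
proof -
  have s: "{..<1 + 2 :: nat} = insert 0 (insert 1 {2})" by auto
  have f1: "finite {1, 2::nat}" "0 \<notin> {1, 2::nat}" and f2: "finite {2::nat}" "1 \<notin> {2::nat}" by auto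
  show ?thesis
    unfolding wedge_def s sum_over_permutations_insert[OF f1] sum_over_permutations_insert[OF f2] permutes_sing
    by (simp add: sign_swap_id permutation_swap_id sign_compose sign_id permutation_compose permute_list_def upt_rec
        Transposition.transpose_def assms[of z y] assms[of z x] assms[of y x] numeral_2_eq_2 fact_numeral) 
qed

lemma wedge_2_2:
  assumes a: "\<And>a b. \<alpha> p [a, b] = - \<alpha> p [b, a]" and b: "\<And>a b. \<beta> p [a, b] = - \<beta> p [b, a]"
  shows "wedge 2 2 \<alpha> \<beta> p [w, x, y, z] =
    \<alpha> p [w, x] * \<beta> p [y, z] - \<alpha> p [w, y] * \<beta> p [x, z] + \<alpha> p [w, z] * \<beta> p [x, y] +
    \<alpha> p [x, y] * \<beta> p [w, z] - \<alpha> p [x, z] * \<beta> p [w, y] + \<alpha> p [y, z] * \<beta> p [w, x]"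
proof -
  have s: "{..<2 + 2 :: nat} = insert 0 (insert 1 (insert 2 {3}))" by auto
  have f1: "finite {1, 2, 3::nat}" "0 \<notin> {1, 2, 3::nat}" and f2: "finite {2, 3::nat}" "1 \<notin> {2, 3::nat}"
    and f3: "finite {3::nat}" "2 \<notin> {3::nat}" by auto
  show ?thesis
    unfolding wedge_def s sum_over_permutations_insert[OF f1] sum_over_permutations_insert[OF f2]
      sum_over_permutations_insert[OF f3] permutes_sing
    by (simp add: sign_swap_id permutation_swap_id sign_compose sign_id permutation_compose permute_list_def upt_rec
        Transposition.transpose_def a[of x w] a[of y w] a[of z w] a[of y x] a[of z x] a[of z y]
        b[of x w] b[of y w] b[of z w] b[of y x] b[of z x] b[of z y] numeral_2_eq_2 numeral_3_eq_3 fact_numeral)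
qed

context manifold
begin

context
  fixes k \<alpha> assumes form: "diff_form A k \<alpha>"
begin

lemma form_outside: "\<not> (length vs = k \<and> set vs \<subseteq> T p) \<Longrightarrow> \<alpha> p vs = 0"
  using form[unfolded diff_form_def, THEN conjunct1] by simp

lemma form_linear:
  "length vs = k \<Longrightarrow> set vs \<subseteq> T p \<Longrightarrow> i < k \<Longrightarrow> v \<in> T p \<Longrightarrow> w \<in> T p \<Longrightarrow>
    \<alpha> p (vs[i := a *\<^sub>R v + b *\<^sub>R w]) = a * \<alpha> p (vs[i := v]) + b * \<alpha> p (vs[i := w])"
  using form[unfolded diff_form_def, THEN conjunct2, THEN conjunct1] by simp

lemma form_alternating:
  "length vs = k \<Longrightarrow> set vs \<subseteq> T p \<Longrightarrow> i < j \<Longrightarrow> j < k \<Longrightarrow> vs ! i = vs ! j \<Longrightarrow> \<alpha> p vs = 0"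
  using form[unfolded diff_form_def, THEN conjunct2, THEN conjunct2, THEN conjunct1] by simp

lemma form_smooth:
  "length Xs = k \<Longrightarrow> (\<And>X. X \<in> set Xs \<Longrightarrow> VF X) \<Longrightarrow> C (\<lambda>p. \<alpha> p (map (\<lambda>X. X p) Xs))"
  using form[unfolded diff_form_def, THEN conjunct2, THEN conjunct2, THEN conjunct2] by simp

lemma form_add:
  "length vs = k \<Longrightarrow> set vs \<subseteq> T p \<Longrightarrow> i < k \<Longrightarrow> v \<in> T p \<Longrightarrow> w \<in> T p \<Longrightarrow>
    \<alpha> p (vs[i := v + w]) = \<alpha> p (vs[i := v]) + \<alpha> p (vs[i := w])"
  using form_linear[of vs p i v w 1 1] by simp

text \<open>Polarisation: the form vanishes with a + b in both places i and j; expand by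
  bilinearity.\<close>

lemma form_swap:
  assumes vs: "length vs = k" "set vs \<subseteq> T p" and ij: "i \<noteq> j" "i < k" "j < k"
  shows "\<alpha> p (vs[i := vs ! j, j := vs ! i]) = - \<alpha> p vs"
proof -
  let ?f = "\<lambda>a b. \<alpha> p (vs[i := a, j := b])"
  have mem: "vs ! i \<in> T p" "vs ! j \<in> T p" using vs ij by auto
  have upd: "set (vs[n := a]) \<subseteq> T p" if "a \<in> T p" for n a
    using that vs(2) set_update_subset_insert[of vs n a] by auto
  have upd2: "set (vs[i := a, j := b]) \<subseteq> T p" if "a \<in> T p" "b \<in> T p" for a b
    using that upd[of a i] set_update_subset_insert[of "vs[i := a]" j b] by auto
  have zero: "?f a a = 0" if "a \<in> T p" for a
  proof (cases "i < j")
    case True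
    then show ?thesis by (intro form_alternating[of _ _ i j]) (use vs ij upd2 that in auto)
  next
    case False
    then show ?thesis by (intro form_alternating[of _ _ j i]) (use vs ij upd2 that in auto)
  qed
  have R: "?f a (b + c) = ?f a b + ?f a c" if "a \<in> T p" "b \<in> T p" "c \<in> T p" for a b c
    using form_add[of "vs[i := a]" p j b c] that vs ij upd by simp
  have L: "?f (b + c) a = ?f b a + ?f c a" if "a \<in> T p" "b \<in> T p" "c \<in> T p" for a b c
    using form_add[of "vs[j := a]" p i b c] that vs ij upd by (simp add: list_update_swap[of i j])
  have "?f a b + ?f b a = 0" if "a \<in> T p" "b \<in> T p" for a b
    using zero[of "a + b"] zero[of a] zero[of b] that by (simp add: R L T_add)
  from this[OF mem] show ?thesis by (simp add: list_update_swap add_eq_0_iff2)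
qed

lemma form_permute:
  assumes "\<sigma> permutes {..<k}" "length vs = k" "set vs \<subseteq> T p"
  shows "\<alpha> p (permute_list \<sigma> vs) = of_int (sign \<sigma>) * \<alpha> p vs"
  using assms(1) finite_lessThan assms(2,3)
proof (induction arbitrary: vs rule: permutes_induct)
  case (swap i j \<sigma>)
  then have ij: "i < k" "j < k" by auto
  let ?ws = "permute_list (Transposition.transpose i j) vs"
  have ws: "length ?ws = k" "set ?ws \<subseteq> T p"
    using swap.prems ij by (simp_all add: permutes_transpose_nat)
  have "\<alpha> p (permute_list (Transposition.transpose i j \<circ> \<sigma>) vs) = \<alpha> p (permute_list \<sigma> ?ws)"
    using swap by (simp add: permute_list_compose)
  also have "\<dots> = of_int (sign \<sigma>) * \<alpha> p ?ws" by (rule swap.IH[OF ws])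
  also have "\<alpha> p ?ws = - \<alpha> p vs"
    using form_swap[OF swap.prems \<open>i \<noteq> j\<close> ij] ij swap.prems by (simp add: permute_list_transpose)
  moreover have "sign (Transposition.transpose i j \<circ> \<sigma>) = - sign \<sigma>"
    using sign_compose[OF permutation_swap_id[of i j], of \<sigma>] swap.hyps(3,4)
    by (auto simp: permutation_permutes sign_swap_id)
  ultimately show ?case by (simp add: o_def)
qed (simp add: sign_id)

end

lemma form_eqI:
  assumes "diff_form A k \<alpha>" "diff_form A k \<beta>"
    "\<And>p vs. length vs = k \<Longrightarrow> set vs \<subseteq> T p \<Longrightarrow> \<alpha> p vs = \<beta> p vs"
  shows "\<alpha> = \<beta>"
proof (intro ext)
  fix p vs
  show "\<alpha> p vs = \<beta> p vs"
    using assms(3)[of vs p] form_outside[OF assms(1), of vs p] form_outside[OF assms(2), of vs p] by argo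
qed

lemma diff_form_lincomb:
  assumes a: "diff_form A k \<alpha>" and b: "diff_form A k \<beta>"
  shows "diff_form A k (r *\<^sub>R \<alpha> + s *\<^sub>R \<beta>)"
  unfolding diff_form_def
proof (intro conjI allI impI)
  fix p vs assume "\<not> (length vs = k \<and> set vs \<subseteq> T p)"
  then show "(r *\<^sub>R \<alpha> + s *\<^sub>R \<beta>) p vs = 0" by (simp add: pointwise form_outside[OF a] form_outside[OF b])
next
  fix p vs i c d v w assume *: "length vs = k" "set vs \<subseteq> T p" "i < k" "v \<in> T p" "w \<in> T p"
  show "(r *\<^sub>R \<alpha> + s *\<^sub>R \<beta>) p (vs[i := c *\<^sub>R v + d *\<^sub>R w]) =
      c * ((r *\<^sub>R \<alpha> + s *\<^sub>R \<beta>) p (vs[i := v])) +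
      d * ((r *\<^sub>R \<alpha> + s *\<^sub>R \<beta>) p (vs[i := w]))"
    by (simp add: pointwise form_linear[OF a *] form_linear[OF b *] algebra_simps)
next
  fix p vs and i j :: nat assume *: "length vs = k" "set vs \<subseteq> T p" "i < j" "j < k" "vs ! i = vs ! j"
  show "(r *\<^sub>R \<alpha> + s *\<^sub>R \<beta>) p vs = 0"
    by (simp add: pointwise form_alternating[OF a *] form_alternating[OF b *])
next
  fix Xs assume *: "length Xs = k" "\<forall>X\<in>set Xs. VF X"
  show "C (\<lambda>p. (r *\<^sub>R \<alpha> + s *\<^sub>R \<beta>) p (map (\<lambda>X. X p) Xs))"
    using * unfolding pointwise real_scaleR_def by (intro C_add C_cmult form_smooth[OF a] form_smooth[OF b]) auto
qed

lemma diff_form_scale: "diff_form A k \<alpha> \<Longrightarrow> diff_form A k (r *\<^sub>R \<alpha>)"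
  using diff_form_lincomb[of k \<alpha> \<alpha> r 0] by simp

lemma diff_form_minus: "diff_form A k \<alpha> \<Longrightarrow> diff_form A k (- \<alpha>)"
  using diff_form_scale[of k \<alpha> "-1"] by simp

lemma diff_form_diff: "diff_form A k \<alpha> \<Longrightarrow> diff_form A k \<beta> \<Longrightarrow> diff_form A k (\<alpha> - \<beta>)"
  using diff_form_lincomb[of k \<alpha> \<beta> 1 "-1"] by simp

text \<open>Replacing an entry of the list replaces one entry of the permuted list, which lies
  either in the first k places or in the last l; multilinearity is inherited from the factor
  concerned.\<close>

lemma diff_form_wedge:
  assumes a: "diff_form A k \<alpha>" and b: "diff_form A l \<beta>"
  shows "diff_form A (k + l) (wedge k l \<alpha> \<beta>)"
  unfolding diff_form_def
proof (intro conjI allI impI)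
  fix p vs assume *: "\<not> (length vs = k + l \<and> set vs \<subseteq> T p)"
  have "\<alpha> p (take k (permute_list \<sigma> vs)) * \<beta> p (drop k (permute_list \<sigma> vs)) = 0"
    if "\<sigma> permutes {..<k + l}" for \<sigma>
  proof (rule ccontr)
    assume "\<not> ?thesis"
    then have 1: "length (take k (permute_list \<sigma> vs)) = k" "set (take k (permute_list \<sigma> vs)) \<subseteq> T p"
      "length (drop k (permute_list \<sigma> vs)) = l" "set (drop k (permute_list \<sigma> vs)) \<subseteq> T p"
      using form_outside[OF a, of "take k (permute_list \<sigma> vs)" p]
        form_outside[OF b, of "drop k (permute_list \<sigma> vs)" p] by fastforce+
    have len: "length vs = k + l" using 1(1,3) by auto
    then have "set vs = set (permute_list \<sigma> vs)" using that by simp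
    also have "\<dots> = set (take k (permute_list \<sigma> vs)) \<union> set (drop k (permute_list \<sigma> vs))"
      by (metis append_take_drop_id set_append)
    finally show False using * 1 len by simp
  qed
  then show "wedge k l \<alpha> \<beta> p vs = 0"
    unfolding wedge_def by (simp add: mult.assoc sum.neutral)
next
  fix p vs i c d v w
  assume vs: "length vs = k + l" "set vs \<subseteq> T p" and i: "i < k + l" and v: "v \<in> T p" and w: "w \<in> T p"
  have "\<alpha> p (take k (permute_list \<sigma> (vs[i := c *\<^sub>R v + d *\<^sub>R w]))) *
        \<beta> p (drop k (permute_list \<sigma> (vs[i := c *\<^sub>R v + d *\<^sub>R w]))) =
      c * (\<alpha> p (take k (permute_list \<sigma> (vs[i := v]))) * \<beta> p (drop k (permute_list \<sigma> (vs[i := v])))) +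
      d * (\<alpha> p (take k (permute_list \<sigma> (vs[i := w]))) * \<beta> p (drop k (permute_list \<sigma> (vs[i := w]))))"
    if s: "\<sigma> permutes {..<k + l}" for \<sigma>
  proof -
    let ?u = "permute_list \<sigma> vs" and ?j = "inv \<sigma> i"
    have u: "permute_list \<sigma> (vs[i := x]) = ?u[?j := x]" for x
      by (rule permute_list_update) (use s vs i in auto)
    have lu: "length ?u = k + l" "set ?u \<subseteq> T p" using s vs by simp_all
    have tu: "set (take k ?u) \<subseteq> T p" "set (drop k ?u) \<subseteq> T p"
      using lu(2) set_take_subset[of k ?u] set_drop_subset[of k ?u] by blast+
    show ?thesis
    proof (cases "?j < k")
      case True
      then show ?thesis
        using form_linear[OF a, of "take k ?u" p ?j v w c d] lu tu v w
        by (simp add: u take_update_swap algebra_simps)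
    next
      case False
      moreover have "?j < k + l" using permutes_in_image[OF permutes_inv[OF s], of i] i by simp
      ultimately show ?thesis
        using form_linear[OF b, of "drop k ?u" p "?j - k" v w c d] lu tu v w
        by (simp add: u take_update_cancel drop_update_swap algebra_simps)
    qed
  qed
  then have "(\<Sum>\<sigma> | \<sigma> permutes {..<k + l}. real_of_int (sign \<sigma>) *
        \<alpha> p (take k (permute_list \<sigma> (vs[i := c *\<^sub>R v + d *\<^sub>R w]))) *
        \<beta> p (drop k (permute_list \<sigma> (vs[i := c *\<^sub>R v + d *\<^sub>R w])))) =
      c * (\<Sum>\<sigma> | \<sigma> permutes {..<k + l}. real_of_int (sign \<sigma>) *
        \<alpha> p (take k (permute_list \<sigma> (vs[i := v]))) * \<beta> p (drop k (permute_list \<sigma> (vs[i := v])))) +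
      d * (\<Sum>\<sigma> | \<sigma> permutes {..<k + l}. real_of_int (sign \<sigma>) *
        \<alpha> p (take k (permute_list \<sigma> (vs[i := w]))) * \<beta> p (drop k (permute_list \<sigma> (vs[i := w]))))"
    unfolding sum_distrib_left sum.distrib[symmetric]
    by (intro sum.cong refl) (simp add: mult.assoc, simp add: algebra_simps)
  then show "wedge k l \<alpha> \<beta> p (vs[i := c *\<^sub>R v + d *\<^sub>R w]) =
      c * wedge k l \<alpha> \<beta> p (vs[i := v]) + d * wedge k l \<alpha> \<beta> p (vs[i := w])"
    unfolding wedge_def by (simp add: add_divide_distrib)
next
  fix p vs and i j :: nat
  assume vs: "length vs = k + l" "set vs \<subseteq> T p" and ij: "i < j" "j < k + l" "vs ! i = vs ! j"
  let ?f = "\<lambda>\<sigma>. real_of_int (sign \<sigma>) * \<alpha> p (take k (permute_list \<sigma> vs)) * \<beta> p (drop k (permute_list \<sigma> vs))"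
  let ?P = "{\<sigma>. \<sigma> permutes {..<k + l}}"
  have t: "Transposition.transpose i j permutes {..<k + l}" by (rule permutes_transpose_nat) (use ij in auto)
  have tv: "permute_list (Transposition.transpose i j) vs = vs"
    using ij vs by (simp add: permute_list_transpose) (metis list_update_id)
  \<comment> \<open>Composition with the transposition of the two equal entries leaves the permuted
    list unchanged and reverses the sign, so the sum equals its own negative.\<close>
  have "sum ?f ?P = sum (\<lambda>\<sigma>. ?f (Transposition.transpose i j \<circ> \<sigma>)) ?P"
    by (rule setum_permutations_compose_left[OF t])
  also have "\<dots> = sum (\<lambda>\<sigma>. - ?f \<sigma>) ?P"
  proof (rule sum.cong)
    fix \<sigma> assume "\<sigma> \<in> ?P"
    then have s: "\<sigma> permutes {..<k + l}" by simp
    have "sign (Transposition.transpose i j \<circ> \<sigma>) = - sign \<sigma>"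
      using s ij sign_compose[OF permutation_swap_id[of i j], of \<sigma>]
      by (auto simp: permutation_permutes sign_swap_id)
    moreover have "permute_list (Transposition.transpose i j \<circ> \<sigma>) vs = permute_list \<sigma> vs"
      using s vs by (simp add: permute_list_compose tv)
    ultimately show "?f (Transposition.transpose i j \<circ> \<sigma>) = - ?f \<sigma>" by simp
  qed simp
  finally have "sum ?f ?P = 0" by (simp add: sum_negf)
  then show "wedge k l \<alpha> \<beta> p vs = 0" unfolding wedge_def by simp
next
  fix Xs assume Xs: "length Xs = k + l" "\<forall>X\<in>set Xs. VF X"
  have "C (\<lambda>p. real_of_int (sign \<sigma>) * \<alpha> p (take k (permute_list \<sigma> (map (\<lambda>X. X p) Xs))) *
      \<beta> p (drop k (permute_list \<sigma> (map (\<lambda>X. X p) Xs))))" if s: "\<sigma> permutes {..<k + l}" for \<sigma>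
  proof -
    have m: "permute_list \<sigma> (map (\<lambda>X. X p) Xs) = map (\<lambda>X. X p) (permute_list \<sigma> Xs)" for p
      by (rule permute_list_map) (use s Xs in simp)
    have "set (take k (permute_list \<sigma> Xs)) \<subseteq> set Xs" "set (drop k (permute_list \<sigma> Xs)) \<subseteq> set Xs"
      using set_take_subset[of k "permute_list \<sigma> Xs"] set_drop_subset[of k "permute_list \<sigma> Xs"] s Xs by simp_all
    then show ?thesis
      unfolding m take_map drop_map
      by (intro C_mult C_const form_smooth[OF a] form_smooth[OF b]) (use Xs in auto)
  qed
  then show "C (\<lambda>p. wedge k l \<alpha> \<beta> p (map (\<lambda>X. X p) Xs))"
    unfolding wedge_def divide_inverse by (intro C_mult[OF C_sum C_const]) simp
qed

text \<open>Vectors in the kernel of both factors are in the kernel of the product. Applied to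
  \<omega> \<and> \<omega> and to v \<and> \<eta>, it bounds the kernels of the forms of an
  SU(2)-structure.\<close>

lemma wedge_update_zero:
  assumes a: "\<And>us j. length us = k \<Longrightarrow> set us \<subseteq> T p \<Longrightarrow> j < k \<Longrightarrow> \<alpha> p (us[j := x]) = 0"
    and b: "\<And>us j. length us = l \<Longrightarrow> set us \<subseteq> T p \<Longrightarrow> j < l \<Longrightarrow> \<beta> p (us[j := x]) = 0"
    and vs: "length vs = k + l" "set vs \<subseteq> T p" and i: "i < k + l"
  shows "wedge k l \<alpha> \<beta> p (vs[i := x]) = 0"
proof -
  have "\<alpha> p (take k (permute_list \<sigma> (vs[i := x]))) * \<beta> p (drop k (permute_list \<sigma> (vs[i := x]))) = 0"
    if s: "\<sigma> permutes {..<k + l}" for \<sigma>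
  proof -
    let ?u = "permute_list \<sigma> vs" and ?j = "inv \<sigma> i"
    have u: "permute_list \<sigma> (vs[i := x]) = ?u[?j := x]"
      by (rule permute_list_update) (use s vs i in auto)
    have lu: "length ?u = k + l" "set ?u \<subseteq> T p" using s vs by simp_all
    have tu: "set (take k ?u) \<subseteq> T p" "set (drop k ?u) \<subseteq> T p"
      using lu(2) set_take_subset[of k ?u] set_drop_subset[of k ?u] by blast+
    show ?thesis
    proof (cases "?j < k")
      case True
      then show ?thesis using a[of "take k ?u" ?j] lu tu by (simp add: u take_update_swap)
    next
      case False
      moreover have "?j < k + l" using permutes_in_image[OF permutes_inv[OF s], of i] i by simp
      ultimately show ?thesis using b[of "drop k ?u" "?j - k"] lu tu by (simp add: u drop_update_swap)
    qed
  qed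
  then show ?thesis unfolding wedge_def by (simp add: mult.assoc sum.neutral)
qed

text \<open>The vector x sits at position 4 of the list. Permutations that move 4 put a vector
  annihilated by \<eta> into the last place; each of the others contributes the same v(es)
  \<eta>(x), the sign appearing squared. The identity is among them, so nothing cancels.\<close>

lemma wedge_4_1_nonzero:
  assumes v: "diff_form A 4 v" and e: "set es \<subseteq> T p" "length es = 4" "x \<in> T p"
    and \<eta>: "\<And>u. u \<in> set es \<Longrightarrow> \<eta> p [u] = 0" and 1: "\<eta> p [x] \<noteq> 0" "v p es \<noteq> 0"
  shows "wedge 4 1 v \<eta> p \<noteq> 0"
proof -
  let ?vs = "es @ [x]"
  let ?f = "\<lambda>\<sigma>. real_of_int (sign \<sigma>) * v p (take 4 (permute_list \<sigma> ?vs)) * \<eta> p (drop 4 (permute_list \<sigma> ?vs))"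
  have f: "?f \<sigma> = (if \<sigma> 4 = 4 then v p es * \<eta> p [x] else 0)" if s: "\<sigma> permutes {..<4 + 1}" for \<sigma>
  proof -
    have s5: "\<sigma> permutes {..<length ?vs}" using s e by simp
    have d: "drop 4 (permute_list \<sigma> ?vs) = [?vs ! \<sigma> 4]"
      by (rule nth_equalityI) (use e permute_list_nth[OF s5] in auto)
    have r: "\<sigma> 4 < 5" using permutes_in_image[OF s, of 4] by simp
    show ?thesis
    proof (cases "\<sigma> 4 = 4")
      case True
      have "\<sigma> permutes {..<4}"
        proof (rule permutes_superset[OF s])
        fix x :: nat assume "x \<in> {..<4 + 1} - {..<4}"
        then have "x = 4" by auto
        then show "\<sigma> x = x" using True by simp
      qed
      then have "take 4 (permute_list \<sigma> ?vs) = permute_list \<sigma> es"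
        by (intro nth_equalityI) (use e permute_list_nth[OF s5] permutes_in_image[of \<sigma> "{..<4}"] in
            \<open>auto simp: permute_list_nth nth_append\<close>)
      then have "real_of_int (sign \<sigma>) * v p (take 4 (permute_list \<sigma> ?vs)) = of_int (sign \<sigma>) * of_int (sign \<sigma>) * v p es"
        using form_permute[OF v \<open>\<sigma> permutes {..<4}\<close> e(2,1)] by simp
      also have "\<dots> = v p es" by (simp add: sign_def)
      finally show ?thesis using True d e by (simp add: nth_append)
    next
      case False
      then have "?vs ! \<sigma> 4 \<in> set es" using r e by (auto simp: nth_append)
      then show ?thesis using False d \<eta> by simp
    qed
  qed
  let ?P = "{\<sigma>. \<sigma> permutes {..<4 + 1 :: nat}}"
  have fin: "finite ?P" by (rule finite_permutations) simp
  have "(\<Sum>\<sigma>\<in>?P. ?f \<sigma>) = (\<Sum>\<sigma>\<in>?P. if \<sigma> 4 = 4 then v p es * \<eta> p [x] else 0)"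
    by (rule sum.cong) (use f in auto)
  also have "\<dots> = real (card {\<sigma>\<in>?P. \<sigma> 4 = 4}) * (v p es * \<eta> p [x])"
    using fin by (simp add: sum.If_cases Int_def)
  also have "\<dots> \<noteq> 0"
  proof -
    have "id \<in> {\<sigma>\<in>?P. \<sigma> 4 = 4}" by (simp add: permutes_id)
    moreover have "finite {\<sigma>\<in>?P. \<sigma> 4 = 4}" by (rule finite_subset[OF _ fin]) blast
    ultimately have "card {\<sigma>\<in>?P. \<sigma> 4 = 4} > 0" unfolding card_gt_0_iff by blast
    then show ?thesis using 1 by simp
  qed
  finally have "wedge 4 1 v \<eta> p ?vs \<noteq> 0"
    unfolding wedge_def by (simp only: divide_eq_0_iff mult_eq_0_iff fact_nonzero simp_thms)
  then show ?thesis by (auto simp: zero_fun_apply)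
qed

end


section \<open>Exterior and Lie derivatives on vector fields\<close>

context manifold
begin

section \<open>Calculation rules for 1-forms and 2-forms\<close>

lemma form1_lin:
  assumes "diff_form A 1 \<eta>" "v \<in> T p" "w \<in> T p"
  shows "\<eta> p [a *\<^sub>R v + b *\<^sub>R w] = a * \<eta> p [v] + b * \<eta> p [w]"
  using form_linear[OF assms(1), of "[v]" p 0 v w a b] assms by simp

lemma form1_simps:
  assumes "diff_form A 1 \<eta>"
  shows "v \<in> T p \<Longrightarrow> w \<in> T p \<Longrightarrow> \<eta> p [v + w] = \<eta> p [v] + \<eta> p [w]"
    "v \<in> T p \<Longrightarrow> w \<in> T p \<Longrightarrow> \<eta> p [v - w] = \<eta> p [v] - \<eta> p [w]"
    "v \<in> T p \<Longrightarrow> \<eta> p [a *\<^sub>R v] = a * \<eta> p [v]"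
    "v \<in> T p \<Longrightarrow> \<eta> p [- v] = - \<eta> p [v]"
    "\<eta> p [0] = 0"
  using form1_lin[OF assms, of v p w 1 1] form1_lin[OF assms, of v p w 1 "-1"]
    form1_lin[OF assms, of v p v a 0] form1_lin[OF assms, of v p v "-1" 0]
    form1_lin[OF assms, of 0 p 0 0 0]
  by simp_all

lemma form2_lin_left:
  assumes "diff_form A 2 \<omega>" "u \<in> T p" "v \<in> T p"
  shows "\<omega> p [a *\<^sub>R u + b *\<^sub>R v, w] = a * \<omega> p [u, w] + b * \<omega> p [v, w]"
proof (cases "w \<in> T p")
  case True
  then show ?thesis using form_linear[OF assms(1), of "[u, w]" p 0 u v a b] assms by simp
qed (simp add: form_outside[OF assms(1)])

lemma form2_lin_right:
  assumes "diff_form A 2 \<omega>" "u \<in> T p" "v \<in> T p"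
  shows "\<omega> p [w, a *\<^sub>R u + b *\<^sub>R v] = a * \<omega> p [w, u] + b * \<omega> p [w, v]"
proof (cases "w \<in> T p")
  case True
  then show ?thesis using form_linear[OF assms(1), of "[w, u]" p 1 u v a b] assms by simp
qed (simp add: form_outside[OF assms(1)])

lemma form2_simps:
  assumes "diff_form A 2 \<omega>"
  shows "u \<in> T p \<Longrightarrow> v \<in> T p \<Longrightarrow> \<omega> p [u + v, w] = \<omega> p [u, w] + \<omega> p [v, w]"
    "u \<in> T p \<Longrightarrow> v \<in> T p \<Longrightarrow> \<omega> p [u - v, w] = \<omega> p [u, w] - \<omega> p [v, w]"
    "u \<in> T p \<Longrightarrow> \<omega> p [a *\<^sub>R u, w] = a * \<omega> p [u, w]"
    "u \<in> T p \<Longrightarrow> \<omega> p [- u, w] = - \<omega> p [u, w]"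
    "\<omega> p [0, w] = 0"
    "u \<in> T p \<Longrightarrow> v \<in> T p \<Longrightarrow> \<omega> p [w, u + v] = \<omega> p [w, u] + \<omega> p [w, v]"
    "u \<in> T p \<Longrightarrow> v \<in> T p \<Longrightarrow> \<omega> p [w, u - v] = \<omega> p [w, u] - \<omega> p [w, v]"
    "u \<in> T p \<Longrightarrow> \<omega> p [w, a *\<^sub>R u] = a * \<omega> p [w, u]"
    "u \<in> T p \<Longrightarrow> \<omega> p [w, - u] = - \<omega> p [w, u]"
    "\<omega> p [w, 0] = 0"
  using form2_lin_left[OF assms, of u p v 1 1 w] form2_lin_left[OF assms, of u p v 1 "-1" w]
    form2_lin_left[OF assms, of u p u a 0 w] form2_lin_left[OF assms, of u p u "-1" 0 w]
    form2_lin_left[OF assms, of 0 p 0 0 0 w]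
    form2_lin_right[OF assms, of u p v w 1 1] form2_lin_right[OF assms, of u p v w 1 "-1"]
    form2_lin_right[OF assms, of u p u w a 0] form2_lin_right[OF assms, of u p u w "-1" 0]
    form2_lin_right[OF assms, of 0 p 0 w 0 0]
  by simp_all

lemma form2_antisym:
  assumes "diff_form A 2 \<omega>"
  shows "\<omega> p [v, w] = - \<omega> p [w, v]"
proof (cases "v \<in> T p \<and> w \<in> T p")
  case True
  then show ?thesis using form_swap[OF assms, of "[w, v]" p 0 1] by simp
next
  case False
  then show ?thesis using form_outside[OF assms] by auto
qed

lemma bilinear_field_form2: "diff_form A 2 \<omega> \<Longrightarrow> bilinear_field (\<lambda>p v w. \<omega> p [v, w])"
  unfolding bilinear_field_def
  using form_smooth[of 2 \<omega> "[X, Y]" for X Y] by (auto simp: form2_lin_left form2_lin_right)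

definition form2_of :: "('a \<Rightarrow> 'a tangent \<Rightarrow> 'a tangent \<Rightarrow> real) \<Rightarrow> 'a form" where
  "form2_of B p vs = (if length vs = 2 \<and> set vs \<subseteq> T p then B p (vs ! 0) (vs ! 1) else 0)"

lemma form2_of_apply: "v \<in> T p \<Longrightarrow> w \<in> T p \<Longrightarrow> form2_of B p [v, w] = B p v w"
  by (simp add: form2_of_def)

lemma length2: "length vs = 2 \<longleftrightarrow> (\<exists>x y. vs = [x, y])"
  by (auto simp: numeral_2_eq_2 length_Suc_conv)

lemma diff_form_form2_of:
  assumes B: "bilinear_field B" and alt: "\<And>p v. v \<in> T p \<Longrightarrow> B p v v = 0"
  shows "diff_form A 2 (form2_of B)"
  unfolding diff_form_def
proof (intro conjI allI impI)
  fix p vs i a b v w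
  assume vs: "length vs = 2" "set vs \<subseteq> T p" and i: "i < (2::nat)" and v: "v \<in> T p" and w: "w \<in> T p"
  obtain x y where xy: "vs = [x, y]" using vs(1) by (auto simp: length2)
  have mem: "x \<in> T p" "y \<in> T p" using vs xy by auto
  have 1: "B p (a *\<^sub>R v + b *\<^sub>R w) y = a * B p v y + b * B p w y"
    by (rule B[unfolded bilinear_field_def, THEN conjunct1, rule_format, OF v w mem(2)])
  have 2: "B p x (a *\<^sub>R v + b *\<^sub>R w) = a * B p x v + b * B p x w"
    by (rule B[unfolded bilinear_field_def, THEN conjunct2, THEN conjunct1, rule_format, OF v w mem(1)])
  consider "i = 0" | "i = 1" using i by linarith
  then show "form2_of B p (vs[i := a *\<^sub>R v + b *\<^sub>R w]) =
      a * form2_of B p (vs[i := v]) + b * form2_of B p (vs[i := w])"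
    by cases (use mem v w 1 2 in \<open>simp_all add: xy form2_of_def T_intros\<close>)
next
  fix p vs i j assume "length vs = 2" "set vs \<subseteq> T p" "i < j" "j < (2::nat)" "vs ! i = vs ! j"
  moreover from this have "i = 0" "j = 1" by linarith+
  moreover have "vs ! 0 \<in> T p" using calculation by auto
  ultimately show "form2_of B p vs = 0" using alt by (simp add: form2_of_def)
next
  fix Xs assume Xs: "length Xs = 2" "\<forall>X\<in>set Xs. VF X"
  obtain X Y where "Xs = [X, Y]" using Xs(1) by (auto simp: length2)
  with Xs have XY: "Xs = [X, Y]" "VF X" "VF Y" by auto
  then have "C (\<lambda>p. B p (X p) (Y p))" using B unfolding bilinear_field_def by blast
  then show "C (\<lambda>p. form2_of B p (map (\<lambda>X. X p) Xs))" using XY by (simp add: form2_of_def)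
qed (auto simp: form2_of_def)

section \<open>Forms as operators on vector fields: exterior and Lie derivatives\<close>

definition one_form :: "('a vfield \<Rightarrow> 'a \<Rightarrow> real) \<Rightarrow> bool" where
  "one_form a \<longleftrightarrow> tensorial a \<and> (\<forall>X. VF X \<longrightarrow> C (a X))"

text \<open>Operators on fields instead of \<open>'a form\<close>, because \<open>d1 a\<close> and
  \<open>lie_deriv V b\<close> are themselves formulas in fields to which \<open>d2\<close> is
  applied again. Tensoriality in the first slot follows from skew symmetry.\<close>

definition two_form :: "('a vfield \<Rightarrow> 'a vfield \<Rightarrow> 'a \<Rightarrow> real) \<Rightarrow> bool" where
  "two_form b \<longleftrightarrow> (\<forall>X. VF X \<longrightarrow> one_form (b X)) \<and> (\<forall>X Y p. VF X \<longrightarrow> VF Y \<longrightarrow> b X Y p = - b Y X p)"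

lemma one_formD: "one_form a \<Longrightarrow> tensorial a" "one_form a \<Longrightarrow> VF X \<Longrightarrow> C (a X)"
  by (auto simp: one_form_def)

lemma two_formD:
  assumes "two_form b"
  shows "VF X \<Longrightarrow> VF Y \<Longrightarrow> C (b X Y)" "VF X \<Longrightarrow> VF Y \<Longrightarrow> b X Y p = - b Y X p"
    "VF X \<Longrightarrow> tensorial (b X)" "VF Y \<Longrightarrow> tensorial (\<lambda>X. b X Y)"
proof -
  have t: "tensorial (b X)" and Cb: "VF Y \<Longrightarrow> C (b X Y)" if "VF X" for X Y
    using assms[unfolded two_form_def one_form_def, THEN conjunct1, rule_format, OF that] by auto
  have a: "b X Y p = - b Y X p" if "VF X" "VF Y" for X Y p
    using assms[unfolded two_form_def, THEN conjunct2, rule_format, OF that] .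
  show "VF X \<Longrightarrow> VF Y \<Longrightarrow> C (b X Y)" "VF X \<Longrightarrow> VF Y \<Longrightarrow> b X Y p = - b Y X p"
    "VF X \<Longrightarrow> tensorial (b X)"
    by (fact Cb a t)+
  show "tensorial (\<lambda>X. b X Y)" if Y: "VF Y"
    unfolding tensorial_def
  proof (intro conjI allI impI)
    fix U V p assume "VF U" "VF V"
    then show "b (\<lambda>q. U q + V q) Y p = b U Y p + b V Y p"
      using a[OF VF_add Y, of U V p] a[OF _ Y, of U p] a[OF _ Y, of V p] tensorial_add[OF t[OF Y], of U V p]
      by simp
  next
    fix f U p assume "C f" "VF U"
    then show "b (\<lambda>q. f q *\<^sub>R U q) Y p = f p *\<^sub>R b U Y p"
      using a[OF VF_scale Y, of f U p] a[OF _ Y, of U p] tensorial_scale[OF t[OF Y], of f U p]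
      by simp
  qed
qed

lemma one_form_form1:
  assumes "diff_form A 1 \<eta>" shows "one_form (\<lambda>X p. \<eta> p [X p])"
  unfolding one_form_def tensorial_def
  using form_smooth[OF assms, of "[X]" for X] by (auto simp: form1_simps[OF assms])

lemma two_form_form2:
  assumes "diff_form A 2 \<omega>" shows "two_form (\<lambda>X Y p. \<omega> p [X p, Y p])"
  unfolding two_form_def one_form_def tensorial_def
proof (intro conjI allI impI)
  show "\<omega> p [X p, Y p] = - \<omega> p [Y p, X p]" for X Y p by (rule form2_antisym[OF assms])
  show "C (\<lambda>p. \<omega> p [X p, Y p])" if "VF X" "VF Y" for X Y
    using form_smooth[OF assms, of "[X, Y]"] that by auto
qed (auto simp: form2_simps[OF assms])

definition d1 :: "('a vfield \<Rightarrow> 'a \<Rightarrow> real) \<Rightarrow> 'a vfield \<Rightarrow> 'a vfield \<Rightarrow> 'a \<Rightarrow> real" where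
  "d1 a X Y p = X p (a Y) - Y p (a X) - a (lie_bracket X Y) p"

definition d2 :: "('a vfield \<Rightarrow> 'a vfield \<Rightarrow> 'a \<Rightarrow> real) \<Rightarrow> 'a vfield \<Rightarrow> 'a vfield \<Rightarrow> 'a vfield \<Rightarrow> 'a \<Rightarrow> real" where
  "d2 b X Y Z p = X p (b Y Z) - Y p (b X Z) + Z p (b X Y)
     - b (lie_bracket X Y) Z p + b (lie_bracket X Z) Y p - b (lie_bracket Y Z) X p"

definition lie_deriv :: "'a vfield \<Rightarrow> ('a vfield \<Rightarrow> 'a vfield \<Rightarrow> 'a \<Rightarrow> real) \<Rightarrow> 'a vfield \<Rightarrow> 'a vfield \<Rightarrow> 'a \<Rightarrow> real" where
  "lie_deriv V b X Y p = V p (b X Y) - b (lie_bracket V X) Y p - b X (lie_bracket V Y) p"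

lemma Jacobi_fun:
  "VF X \<Longrightarrow> VF Y \<Longrightarrow> VF Z \<Longrightarrow> lie_bracket X (lie_bracket Y Z) =
    (\<lambda>p. lie_bracket (lie_bracket X Y) Z p + lie_bracket Y (lie_bracket X Z) p)"
  by (rule ext) (rule Jacobi)

lemma lie_bracket_swap_fun: "lie_bracket X Y = (\<lambda>p. - lie_bracket Y X p)"
  by (rule ext) (rule lie_bracket_swap)

lemma lie_bracket_apply: "lie_bracket X Y p f = X p (\<lambda>q. Y q f) - Y p (\<lambda>q. X q f)"
  by (simp add: lie_bracket_def)

text \<open>Second derivatives cancel because the bracket acts as the commutator; the values of a on
  iterated brackets cancel by the Jacobi identity.\<close>

lemma d2_d1:
  assumes a: "one_form a" and X: "VF X" and Y: "VF Y" and Z: "VF Z"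
  shows "d2 (d1 a) X Y Z p = 0"
proof -
  note V = VF_deriv[OF X] VF_deriv[OF Y] VF_deriv[OF Z]
  note L = VF_lie_bracket[OF X Y] VF_lie_bracket[OF Y Z] VF_lie_bracket[OF X Z]
  note Cf = one_formD(2)[OF a] VF_C[OF X] VF_C[OF Y] VF_C[OF Z]
  have J: "a (lie_bracket X (lie_bracket Y Z)) p =
      a (lie_bracket (lie_bracket X Y) Z) p + a (lie_bracket Y (lie_bracket X Z)) p"
    unfolding Jacobi_fun[OF X Y Z] by (rule tensorial_add[OF one_formD(1)[OF a]]) (intro VF_lie_bracket X Y Z)+
  have S: "a (lie_bracket (lie_bracket X Z) Y) p = - a (lie_bracket Y (lie_bracket X Z)) p"
    "a (lie_bracket (lie_bracket Y Z) X) p = - a (lie_bracket X (lie_bracket Y Z)) p"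
    using tensorial_minus[OF one_formD(1)[OF a] VF_lie_bracket, of Y "lie_bracket X Z" p]
      tensorial_minus[OF one_formD(1)[OF a] VF_lie_bracket, of X "lie_bracket Y Z" p] X Y Z L
    by (simp_all add: lie_bracket_swap_fun[of "lie_bracket X Z" Y] lie_bracket_swap_fun[of "lie_bracket Y Z" X])
  have e: "d1 a U W = (\<lambda>p. U p (a W) - W p (a U) - a (lie_bracket U W) p)" for U W
    by (rule ext) (simp add: d1_def)
  show ?thesis
    unfolding d2_def e using X Y Z L
    by (simp add: V Cf C_diff lie_bracket_apply S J)
qed

text \<open>The right-hand side is the Lie derivative of the 3-form d b, so that this says that d
  commutes with the Lie derivative. The Jacobi identity handles the iterated brackets.\<close>

lemma d2_lie_deriv:
  assumes b: "two_form b" and V: "VF V" and X: "VF X" and Y: "VF Y" and Z: "VF Z"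
  shows "d2 (lie_deriv V b) X Y Z p = V p (d2 b X Y Z) - d2 b (lie_bracket V X) Y Z p
    - d2 b X (lie_bracket V Y) Z p - d2 b X Y (lie_bracket V Z) p"
proof -
  note D = VF_deriv[OF V] VF_deriv[OF X] VF_deriv[OF Y] VF_deriv[OF Z]
  note L = VF_lie_bracket[OF V X] VF_lie_bracket[OF V Y] VF_lie_bracket[OF V Z]
    VF_lie_bracket[OF X Y] VF_lie_bracket[OF Y Z] VF_lie_bracket[OF X Z]
  note Cf = two_formD(1)[OF b] VF_C[OF V] VF_C[OF X] VF_C[OF Y] VF_C[OF Z]
  have J: "b (lie_bracket V (lie_bracket X' Y')) Z' p =
      b (lie_bracket (lie_bracket V X') Y') Z' p + b (lie_bracket X' (lie_bracket V Y')) Z' p"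
    if "VF X'" "VF Y'" "VF Z'" for X' Y' Z'
    unfolding Jacobi_fun[OF V that(1,2)]
    using tensorial_add[OF two_formD(4)[OF b that(3)], of "lie_bracket (lie_bracket V X') Y'" "lie_bracket X' (lie_bracket V Y')" p]
      that V by (simp add: VF_lie_bracket)
  have e: "lie_deriv V b U W = (\<lambda>p. V p (b U W) - b (lie_bracket V U) W p - b U (lie_bracket V W) p)" for U W
    by (rule ext) (simp add: lie_deriv_def)
  have e2: "d2 b X Y Z = (\<lambda>p. X p (b Y Z) - Y p (b X Z) + Z p (b X Y)
     - b (lie_bracket X Y) Z p + b (lie_bracket X Z) Y p - b (lie_bracket Y Z) X p)"
    by (rule ext) (simp add: d2_def)
  have S: "b U (lie_bracket V' W) p = - b (lie_bracket V' W) U p" if "VF U" "VF V'" "VF W" for U V' W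
    by (rule two_formD(2)[OF b that(1) VF_lie_bracket[OF that(2,3)]])
  show ?thesis
    unfolding e2 unfolding d2_def e using V X Y Z L
    by (simp add: D Cf C_diff C_add lie_bracket_apply J S[OF V] S[OF X] S[OF Y] S[OF Z])
qed

text \<open>Cartan's formula for a form annihilated by V: of the two terms of L_V b only the
  contraction of d b with V remains.\<close>

lemma d2_contract:
  assumes b: "two_form b" and V: "VF V" and Y: "VF Y" and Z: "VF Z"
    and 0: "\<And>X p. VF X \<Longrightarrow> b V X p = 0"
  shows "d2 b V Y Z p = lie_deriv V b Y Z p"
proof -
  have zero: "b V X = (\<lambda>p. 0)" if "VF X" for X using 0[OF that] by auto
  show ?thesis
    using two_formD(2)[OF b VF_lie_bracket[OF Y Z] V, of p] two_formD(2)[OF b VF_lie_bracket[OF V Z] Y, of p] Y Z V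
    by (simp add: d2_def lie_deriv_def zero VF_deriv[OF Y] VF_deriv[OF Z] VF_lie_bracket)
qed

text \<open>The rule d(a \<and> b) = da \<and> b - a \<and> db on four fields, with the left-hand
  side spelled out as the invariant formula for a 3-form.\<close>

lemma Leibniz_1_2:
  assumes a: "one_form a" and b: "two_form b" and W: "VF W" and X: "VF X" and Y: "VF Y" and Z: "VF Z"
  defines "c \<equiv> \<lambda>X Y Z q. a X q * b Y Z q - a Y q * b X Z q + a Z q * b X Y q"
  shows "W p (c X Y Z) - X p (c W Y Z) + Y p (c W X Z) - Z p (c W X Y)
      - c (lie_bracket W X) Y Z p + c (lie_bracket W Y) X Z p - c (lie_bracket W Z) X Y p
      - c (lie_bracket X Y) W Z p + c (lie_bracket X Z) W Y p - c (lie_bracket Y Z) W X p =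
    (d1 a W X p * b Y Z p - d1 a W Y p * b X Z p + d1 a W Z p * b X Y p
      + d1 a X Y p * b W Z p - d1 a X Z p * b W Y p + d1 a Y Z p * b W X p)
    - (a W p * d2 b X Y Z p - a X p * d2 b W Y Z p + a Y p * d2 b W X Z p - a Z p * d2 b W X Y p)"
proof -
  note D = VF_deriv[OF W] VF_deriv[OF X] VF_deriv[OF Y] VF_deriv[OF Z]
  note Cf = two_formD(1)[OF b] one_formD(2)[OF a]
  have S: "b U (lie_bracket V' W) p = - b (lie_bracket V' W) U p" if "VF U" "VF V'" "VF W" for U V' W
    by (rule two_formD(2)[OF b that(1) VF_lie_bracket[OF that(2,3)]])
  show ?thesis
    unfolding c_def d1_def d2_def using W X Y Z
    by (simp add: D Cf C_diff C_add C_mult S[OF W] S[OF X] S[OF Y] S[OF Z]) (simp add: algebra_simps)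
qed

section \<open>The exterior derivative on lists in degrees one to three\<close>

lemma nths_Compl_simps:
  "nths [x] (- {0}) = []" "nths [x, y] (- {0}) = [y]" "nths [x, y] (- {Suc 0}) = [x]"
  "nths [x, y, z] (- {0}) = [y, z]" "nths [x, y, z] (- {Suc 0}) = [x, z]"
  "nths [x, y, z] (- {Suc (Suc 0)}) = [x, y]"
  "nths [w, x, y, z] (- {0}) = [x, y, z]" "nths [w, x, y, z] (- {Suc 0}) = [w, y, z]"
  "nths [w, x, y, z] (- {Suc (Suc 0)}) = [w, x, z]" "nths [w, x, y, z] (- {Suc (Suc (Suc 0))}) = [w, x, y]"
  "nths [x, y] (- {0, Suc 0}) = []"
  "nths [x, y, z] (- {0, Suc 0}) = [z]" "nths [x, y, z] (- {0, Suc (Suc 0)}) = [y]"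
  "nths [x, y, z] (- {Suc 0, Suc (Suc 0)}) = [x]"
  "nths [w, x, y, z] (- {0, Suc 0}) = [y, z]" "nths [w, x, y, z] (- {0, Suc (Suc 0)}) = [x, z]"
  "nths [w, x, y, z] (- {0, Suc (Suc (Suc 0))}) = [x, y]"
  "nths [w, x, y, z] (- {Suc 0, Suc (Suc 0)}) = [w, z]"
  "nths [w, x, y, z] (- {Suc 0, Suc (Suc (Suc 0))}) = [w, y]"
  "nths [w, x, y, z] (- {Suc (Suc 0), Suc (Suc (Suc 0))}) = [w, x]"
  by (simp_all add: nths_Cons)

lemma has_ext_deriv_1:
  "has_ext_deriv A 1 \<eta> \<theta> \<longleftrightarrow> diff_form A 1 \<eta> \<and> diff_form A 2 \<theta> \<and>
    (\<forall>X Y p. VF X \<longrightarrow> VF Y \<longrightarrow> \<theta> p [X p, Y p] = d1 (\<lambda>X p. \<eta> p [X p]) X Y p)"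
proof -
  have "(\<forall>Xs p. length Xs = Suc 1 \<longrightarrow> (\<forall>X\<in>set Xs. VF X) \<longrightarrow> P Xs p) \<longleftrightarrow>
    (\<forall>X Y p. VF X \<longrightarrow> VF Y \<longrightarrow> P [X, Y] p)" for P :: "'a vfield list \<Rightarrow> 'a \<Rightarrow> bool"
    by (auto simp: length_Suc_conv)
  then show ?thesis
    unfolding has_ext_deriv_def
    by (simp add: d1_def nths_Compl_simps atMost_Suc lessThan_Suc numeral_2_eq_2 insert_commute)
qed

lemma has_ext_deriv_2:
  "has_ext_deriv A 2 \<omega> \<theta> \<longleftrightarrow> diff_form A 2 \<omega> \<and> diff_form A 3 \<theta> \<and>
    (\<forall>X Y Z p. VF X \<longrightarrow> VF Y \<longrightarrow> VF Z \<longrightarrow>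
      \<theta> p [X p, Y p, Z p] = d2 (\<lambda>X Y p. \<omega> p [X p, Y p]) X Y Z p)"
proof -
  have "(\<forall>Xs p. length Xs = Suc 2 \<longrightarrow> (\<forall>X\<in>set Xs. VF X) \<longrightarrow> P Xs p) \<longleftrightarrow>
    (\<forall>X Y Z p. VF X \<longrightarrow> VF Y \<longrightarrow> VF Z \<longrightarrow> P [X, Y, Z] p)" for P :: "'a vfield list \<Rightarrow> 'a \<Rightarrow> bool"
    by (auto simp: length_Suc_conv numeral_2_eq_2)
  then show ?thesis
    unfolding has_ext_deriv_def
    by (simp add: d2_def nths_Compl_simps atMost_Suc lessThan_Suc numeral_2_eq_2 numeral_3_eq_3 insert_commute algebra_simps)
qed

lemma has_ext_deriv_3:
  "has_ext_deriv A 3 \<alpha> \<theta> \<longleftrightarrow> diff_form A 3 \<alpha> \<and> diff_form A 4 \<theta> \<and>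
    (\<forall>W X Y Z p. VF W \<longrightarrow> VF X \<longrightarrow> VF Y \<longrightarrow> VF Z \<longrightarrow>
      \<theta> p [W p, X p, Y p, Z p] =
      W p (\<lambda>q. \<alpha> q [X q, Y q, Z q]) - X p (\<lambda>q. \<alpha> q [W q, Y q, Z q])
      + Y p (\<lambda>q. \<alpha> q [W q, X q, Z q]) - Z p (\<lambda>q. \<alpha> q [W q, X q, Y q])
      - \<alpha> p [lie_bracket W X p, Y p, Z p] + \<alpha> p [lie_bracket W Y p, X p, Z p]
      - \<alpha> p [lie_bracket W Z p, X p, Y p] - \<alpha> p [lie_bracket X Y p, W p, Z p]
      + \<alpha> p [lie_bracket X Z p, W p, Y p] - \<alpha> p [lie_bracket Y Z p, W p, X p])"
proof -
  have "(\<forall>Xs p. length Xs = Suc 3 \<longrightarrow> (\<forall>X\<in>set Xs. VF X) \<longrightarrow> P Xs p) \<longleftrightarrow>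
    (\<forall>W X Y Z p. VF W \<longrightarrow> VF X \<longrightarrow> VF Y \<longrightarrow> VF Z \<longrightarrow> P [W, X, Y, Z] p)" for P :: "'a vfield list \<Rightarrow> 'a \<Rightarrow> bool"
    by (auto simp: length_Suc_conv numeral_3_eq_3)
  then show ?thesis
    unfolding has_ext_deriv_def
    by (simp add: nths_Compl_simps atMost_Suc lessThan_Suc numeral_2_eq_2 numeral_3_eq_3 eval_nat_numeral insert_commute algebra_simps)
qed

end


section \<open>Linear algebra of almost contact metric structures\<close>

text \<open>A tangent space is a subspace of a type of functions, so everything is relative to V. In
  \<open>g_lin\<close> the vector w is arbitrary, in accordance with metrics vanishing outside the
  tangent spaces.\<close>

locale inner_space =
  fixes V :: "'v::real_vector set" and g :: "'v \<Rightarrow> 'v \<Rightarrow> real" and n :: nat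
  assumes subspace: "subspace V"
    and basis: "\<exists>B. finite B \<and> independent B \<and> span B = V \<and> card B = n"
    and g_lin: "\<And>a b u v w. u \<in> V \<Longrightarrow> v \<in> V \<Longrightarrow> g (a *\<^sub>R u + b *\<^sub>R v) w = a * g u w + b * g v w"
    and sym: "\<And>u v. g u v = g v u"
    and pos: "\<And>u. u \<in> V \<Longrightarrow> u \<noteq> 0 \<Longrightarrow> 0 < g u u"
begin

lemma V_zero [simp]: "0 \<in> V" by (rule subspace_0[OF subspace])
lemma V_add [simp]: "u \<in> V \<Longrightarrow> v \<in> V \<Longrightarrow> u + v \<in> V" by (rule subspace_add[OF subspace])
lemma V_diff [simp]: "u \<in> V \<Longrightarrow> v \<in> V \<Longrightarrow> u - v \<in> V" by (rule subspace_diff[OF subspace])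
lemma V_scale [simp]: "u \<in> V \<Longrightarrow> a *\<^sub>R u \<in> V" by (rule subspace_scale[OF subspace])
lemma V_minus [simp]: "u \<in> V \<Longrightarrow> - u \<in> V" by (rule subspace_neg[OF subspace])
lemma V_sum [simp]: "(\<And>i. i \<in> I \<Longrightarrow> x i \<in> V) \<Longrightarrow> (\<Sum>i\<in>I. x i) \<in> V" by (rule subspace_sum[OF subspace])

lemma add_left: "u \<in> V \<Longrightarrow> v \<in> V \<Longrightarrow> g (u + v) w = g u w + g v w"
  using g_lin[of u v 1 1 w] by simp
lemma diff_left: "u \<in> V \<Longrightarrow> v \<in> V \<Longrightarrow> g (u - v) w = g u w - g v w"
  using g_lin[of u v 1 "-1" w] by simp
lemma scale_left: "u \<in> V \<Longrightarrow> g (a *\<^sub>R u) w = a * g u w"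
  using g_lin[of u u a 0 w] by simp
lemma minus_left: "u \<in> V \<Longrightarrow> g (- u) w = - g u w"
  using scale_left[of u "-1" w] by simp
lemma zero_left [simp]: "g 0 w = 0"
  using scale_left[of 0 0 w] by simp
lemma add_right: "u \<in> V \<Longrightarrow> v \<in> V \<Longrightarrow> g w (u + v) = g w u + g w v"
  using add_left[of u v w] by (simp add: sym)
lemma diff_right: "u \<in> V \<Longrightarrow> v \<in> V \<Longrightarrow> g w (u - v) = g w u - g w v"
  using diff_left[of u v w] by (simp add: sym)
lemma scale_right: "u \<in> V \<Longrightarrow> g w (a *\<^sub>R u) = a * g w u"
  using scale_left[of u a w] by (simp add: sym)
lemma minus_right: "u \<in> V \<Longrightarrow> g w (- u) = - g w u"
  using minus_left[of u w] by (simp add: sym)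
lemma zero_right [simp]: "g w 0 = 0"
  using zero_left[of w] by (simp add: sym)

lemmas g_simps = add_left diff_left scale_left minus_left add_right diff_right scale_right minus_right

lemma sum_left: "(\<And>i. i \<in> I \<Longrightarrow> x i \<in> V) \<Longrightarrow> g (\<Sum>i\<in>I. c i *\<^sub>R x i) w = (\<Sum>i\<in>I. c i * g (x i) w)"
  by (induction I rule: infinite_finite_induct) (auto simp: add_left scale_left)

lemma eqI: "u \<in> V \<Longrightarrow> v \<in> V \<Longrightarrow> (\<And>w. w \<in> V \<Longrightarrow> g u w = g v w) \<Longrightarrow> u = v"
  using pos[of "u - v"] by (force simp: g_simps)

lemma independent_card: "independent S \<Longrightarrow> S \<subseteq> V \<Longrightarrow> card S \<le> n"
  using basis independent_span_bound by blast

lemma not_spanned: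
  assumes "finite S" "card S < n" shows "\<exists>x\<in>V. x \<notin> span S"
proof (rule ccontr)
  assume "\<not> ?thesis"
  then have s: "V \<subseteq> span S" by blast
  obtain B where "finite B" "independent B" "span B = V" "card B = n" using basis by blast
  then have "card B \<le> card S"
    using independent_span_bound[OF assms(1), of B] s span_superset[of B] by auto
  then show False using assms \<open>card B = n\<close> by simp
qed

lemma orthonormal_extend:
  assumes e: "\<And>i. i < m \<Longrightarrow> e i \<in> V" and on: "\<And>i j. i < m \<Longrightarrow> j < m \<Longrightarrow> g (e i) (e j) = (if i = j then 1 else 0)"
    and m: "m < n"
  obtains u where "u \<in> V" "g u u = 1" "\<And>i. i < m \<Longrightarrow> g u (e i) = 0"
proof -
  have "card (e ` {..<m}) < n" using card_image_le[of "{..<m}" e] m by simp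
  then obtain x where x: "x \<in> V" "x \<notin> span (e ` {..<m})" using not_spanned by blast
  define s where "s = (\<Sum>i<m. g x (e i) *\<^sub>R e i)"
  have s: "s \<in> V" unfolding s_def by (intro V_sum V_scale e) simp
  have s2: "s \<in> span (e ` {..<m})" unfolding s_def by (intro span_sum span_scale span_base) simp
  define y where "y = x - s"
  have y: "y \<in> V" "y \<noteq> 0" using x s s2 by (auto simp: y_def)
  have gs: "g s (e j) = g x (e j)" if "j < m" for j
  proof -
    have "g s (e j) = (\<Sum>i<m. g x (e i) * g (e i) (e j))" unfolding s_def using e by (subst sum_left) auto
    also have "\<dots> = (\<Sum>i<m. if i = j then g x (e i) else 0)" using on that by (intro sum.cong) auto
    finally show ?thesis using that by simp
  qed
  have ye: "g y (e j) = 0" if "j < m" for j using gs[OF that] x s by (simp add: y_def g_simps)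
  have p: "0 < g y y" using pos y by simp
  show thesis
  proof
    show "(1 / sqrt (g y y)) *\<^sub>R y \<in> V" using y by simp
    show "g ((1 / sqrt (g y y)) *\<^sub>R y) ((1 / sqrt (g y y)) *\<^sub>R y) = 1"
      using y p by (simp add: g_simps flip: power2_eq_square)
    show "\<And>i. i < m \<Longrightarrow> g ((1 / sqrt (g y y)) *\<^sub>R y) (e i) = 0" using y ye by (simp add: g_simps)
  qed
qed

text \<open>A nonzero y would give n + 1 nonzero orthogonal vectors, which are independent, in a
  space with a basis of n elements.\<close>

lemma orthonormal_complete:
  assumes e: "\<And>i. i < n \<Longrightarrow> e i \<in> V" and on: "\<And>i j. i < n \<Longrightarrow> j < n \<Longrightarrow> g (e i) (e j) = (if i = j then 1 else 0)"
    and y: "y \<in> V" "\<And>i. i < n \<Longrightarrow> g y (e i) = 0"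
  shows "y = 0"
proof (rule ccontr)
  assume "y \<noteq> 0"
  then have p: "0 < g y y" using pos y by simp
  define f where "f i = (if i < n then e i else y)" for i
  have fV: "f i \<in> V" for i using e y by (simp add: f_def)
  have orth: "g (f i) (f j) = 0" if "i \<le> n" "j \<le> n" "i \<noteq> j" for i j
    using that on y(2) sym by (auto simp: f_def)
  have nz: "g (f i) (f i) \<noteq> 0" for i using on p by (simp add: f_def)
  have inj: "inj_on f {..n}"
    using orth nz by (intro inj_onI) (metis atMost_iff)
  have "independent (f ` {..n})"
    unfolding dependent_finite[OF finite_imageI[OF finite_atMost]]
  proof (clarsimp)
    fix c i assume c0: "(\<Sum>v\<in>f ` {..n}. c v *\<^sub>R v) = 0" and i: "i \<le> n" and ci: "c (f i) \<noteq> 0"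
    have "0 = g (\<Sum>j\<le>n. c (f j) *\<^sub>R f j) (f i)" using c0 by (simp add: sum.reindex[OF inj])
    also have "\<dots> = (\<Sum>j\<le>n. c (f j) * g (f j) (f i))" by (subst sum_left) (auto simp: fV)
    also have "\<dots> = (\<Sum>j\<le>n. if j = i then c (f j) * g (f j) (f i) else 0)"
      using orth i by (intro sum.cong) auto
    also have "\<dots> = c (f i) * g (f i) (f i)" using i by simp
    finally show False using ci nz by simp
  qed
  then have "card (f ` {..n}) \<le> n" by (rule independent_card) (use fV in auto)
  then show False by (simp add: card_image[OF inj])
qed

end

locale acm_space = inner_space V g 5 for V :: "'v::real_vector set" and g +
  fixes \<phi> :: "'v \<Rightarrow> 'v" and \<xi> :: 'v and \<eta> :: "'v \<Rightarrow> real"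
  assumes phi_V [simp]: "\<And>u. u \<in> V \<Longrightarrow> \<phi> u \<in> V"
    and phi_lin: "\<And>a b u v. u \<in> V \<Longrightarrow> v \<in> V \<Longrightarrow> \<phi> (a *\<^sub>R u + b *\<^sub>R v) = a *\<^sub>R \<phi> u + b *\<^sub>R \<phi> v"
    and xi_V [simp]: "\<xi> \<in> V"
    and eta_lin: "\<And>a b u v. u \<in> V \<Longrightarrow> v \<in> V \<Longrightarrow> \<eta> (a *\<^sub>R u + b *\<^sub>R v) = a * \<eta> u + b * \<eta> v"
    and phi_phi: "\<And>u. u \<in> V \<Longrightarrow> \<phi> (\<phi> u) = - u + \<eta> u *\<^sub>R \<xi>"
    and eta_xi [simp]: "\<eta> \<xi> = 1"
    and g_phi_phi: "\<And>u v. u \<in> V \<Longrightarrow> v \<in> V \<Longrightarrow> g (\<phi> u) (\<phi> v) = g u v - \<eta> u * \<eta> v"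
begin

lemma phi_simps:
  "u \<in> V \<Longrightarrow> v \<in> V \<Longrightarrow> \<phi> (u + v) = \<phi> u + \<phi> v"
  "u \<in> V \<Longrightarrow> v \<in> V \<Longrightarrow> \<phi> (u - v) = \<phi> u - \<phi> v"
  "u \<in> V \<Longrightarrow> \<phi> (a *\<^sub>R u) = a *\<^sub>R \<phi> u"
  "u \<in> V \<Longrightarrow> \<phi> (- u) = - \<phi> u"
  "\<phi> 0 = 0"
  using phi_lin[of u v 1 1] phi_lin[of u v 1 "-1"] phi_lin[of u u a 0] phi_lin[of u u "-1" 0]
    phi_lin[of 0 0 0 0] by simp_all

lemma eta_simps:
  "u \<in> V \<Longrightarrow> v \<in> V \<Longrightarrow> \<eta> (u + v) = \<eta> u + \<eta> v"
  "u \<in> V \<Longrightarrow> v \<in> V \<Longrightarrow> \<eta> (u - v) = \<eta> u - \<eta> v"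
  "u \<in> V \<Longrightarrow> \<eta> (a *\<^sub>R u) = a * \<eta> u"
  "u \<in> V \<Longrightarrow> \<eta> (- u) = - \<eta> u"
  "\<eta> 0 = 0"
  using eta_lin[of u v 1 1] eta_lin[of u v 1 "-1"] eta_lin[of u u a 0] eta_lin[of u u "-1" 0]
    eta_lin[of 0 0 0 0] by simp_all

text \<open>Both \<phi>^2 \<xi> and \<phi>^3 \<xi> vanish; the latter says that \<phi>\<xi> = c
  \<xi> with c = \<eta>(\<phi>\<xi>), and then 0 = \<phi>^2 \<xi> = c \<phi>\<xi>.\<close>

lemma phi_xi [simp]: "\<phi> \<xi> = 0"
proof -
  have z: "\<phi> (\<phi> \<xi>) = 0" by (simp add: phi_phi)
  have c: "\<phi> \<xi> = \<eta> (\<phi> \<xi>) *\<^sub>R \<xi>"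
    using phi_phi[of "\<phi> \<xi>"] by (simp add: z phi_simps(5) del: neg_equal_iff_equal)
  have "0 = \<eta> (\<phi> \<xi>) *\<^sub>R \<phi> \<xi>" using z c by (metis phi_simps(3) xi_V)
  then show ?thesis using c by auto
qed

lemma eta_eq: "u \<in> V \<Longrightarrow> \<eta> u = g u \<xi>"
  using g_phi_phi[of u \<xi>] by simp

lemma g_xi_xi [simp]: "g \<xi> \<xi> = 1"
  using eta_eq[of \<xi>] by simp

text \<open>Compute \<phi>^3 u in two ways, as \<phi>^2 applied to \<phi>u and as \<phi> applied to
  \<phi>^2 u.\<close>

lemma eta_phi [simp]: "u \<in> V \<Longrightarrow> \<eta> (\<phi> u) = 0"
proof -
  assume u: "u \<in> V"
  have "\<phi> (\<phi> (\<phi> u)) = - \<phi> u + \<eta> (\<phi> u) *\<^sub>R \<xi>" by (rule phi_phi[OF phi_V[OF u]])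
  moreover have "\<phi> (\<phi> (\<phi> u)) = \<phi> (- u + \<eta> u *\<^sub>R \<xi>)" by (rule arg_cong[OF phi_phi[OF u]])
  moreover have "\<phi> (- u + \<eta> u *\<^sub>R \<xi>) = - \<phi> u" using u by (simp add: phi_simps del: neg_equal_iff_equal)
  ultimately have "\<eta> (\<phi> u) *\<^sub>R \<xi> = 0" by simp
  then show ?thesis using eta_xi by (metis eta_simps(5) scaleR_eq_0_iff zero_neq_one)
qed

lemma g_xi [simp]: "u \<in> V \<Longrightarrow> g u \<xi> = \<eta> u" "u \<in> V \<Longrightarrow> g \<xi> u = \<eta> u"
  using eta_eq[of u] sym[of u \<xi>] by auto

lemma phi_skew: "u \<in> V \<Longrightarrow> v \<in> V \<Longrightarrow> g (\<phi> u) v = - g u (\<phi> v)"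
proof -
  assume u: "u \<in> V" and v: "v \<in> V"
  have "g (\<phi> u) (\<phi> (\<phi> v)) = g u (\<phi> v)" using u v by (simp add: g_phi_phi)
  then show ?thesis using u v by (simp add: phi_phi g_simps)
qed

lemma g_phi_self [simp]: "u \<in> V \<Longrightarrow> g (\<phi> u) u = 0" "u \<in> V \<Longrightarrow> g u (\<phi> u) = 0"
  using phi_skew[of u u] sym[of u "\<phi> u"] by auto

text \<open>A unit horizontal e, then a unit w orthogonal to \<xi>, e and \<phi>e; orthogonality of
  \<phi>w to the rest is automatic. Dimension five leaves room for exactly two \<phi>-lines, and
  this is the form in which the dimension is used.\<close>

lemma adapted_basis:
  obtains e w where "e \<in> V" "w \<in> V" "\<eta> e = 0" "\<eta> w = 0" "g e e = 1" "g w w = 1"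
    "g e w = 0" "g (\<phi> e) w = 0"
    "\<And>x. x \<in> V \<Longrightarrow> x = \<eta> x *\<^sub>R \<xi> + g x e *\<^sub>R e + g x (\<phi> e) *\<^sub>R \<phi> e + g x w *\<^sub>R w + g x (\<phi> w) *\<^sub>R \<phi> w"
proof -
  obtain e where e: "e \<in> V" "g e e = 1" "g e \<xi> = 0"
    using orthonormal_extend[of 1 "\<lambda>_. \<xi>"] by auto
  have e0: "\<eta> e = 0" using e by simp
  have three: "i = 0 \<or> i = 1 \<or> i = 2" if "i < 3" for i :: nat using that by auto
  have m: "[\<xi>, e, \<phi> e] ! i \<in> V" if "i < 3" for i using three[OF that] e by auto
  have on: "g ([\<xi>, e, \<phi> e] ! i) ([\<xi>, e, \<phi> e] ! j) = (if i = j then 1 else 0)" if "i < 3" "j < 3" for i j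
    using three[OF that(1)] three[OF that(2)] e e0 by (elim disjE) (simp_all add: g_phi_phi)
  obtain w where w: "w \<in> V" "g w w = 1" and w': "\<And>i. i < 3 \<Longrightarrow> g w ([\<xi>, e, \<phi> e] ! i) = 0"
    using orthonormal_extend[of 3 "\<lambda>i. [\<xi>, e, \<phi> e] ! i", OF m on] by auto
  have w: "w \<in> V" "g w w = 1" "g w \<xi> = 0" "g w e = 0" "g w (\<phi> e) = 0"
    using w w'[of 0] w'[of 1] w'[of 2] by simp_all
  have w0: "\<eta> w = 0" using w by simp
  show thesis
  proof (rule that[OF e(1) w(1) e0 w0 e(2) w(2)])
    show "g e w = 0" "g (\<phi> e) w = 0" using w sym by auto
    fix x assume x: "x \<in> V"
    let ?s = "\<eta> x *\<^sub>R \<xi> + g x e *\<^sub>R e + g x (\<phi> e) *\<^sub>R \<phi> e + g x w *\<^sub>R w + g x (\<phi> w) *\<^sub>R \<phi> w"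
    have gs: "g e w = 0" "g (\<phi> e) w = 0" "g (\<phi> w) e = 0" "g e (\<phi> w) = 0" "g (\<phi> w) (\<phi> e) = 0" "g (\<phi> e) (\<phi> w) = 0"
      using w e sym e0 w0 phi_skew[of w e] by (auto simp: g_phi_phi)
    have "x - ?s = 0"
    proof (rule orthonormal_complete[of "\<lambda>i. [\<xi>, e, \<phi> e, w, \<phi> w] ! i"])
      show "x - ?s \<in> V" using x e w by simp
      fix i :: nat assume "i < 5"
      then have i: "i = 0 \<or> i = 1 \<or> i = 2 \<or> i = 3 \<or> i = 4" by auto
      then show "[\<xi>, e, \<phi> e, w, \<phi> w] ! i \<in> V" using e w by auto
      show "g (x - ?s) ([\<xi>, e, \<phi> e, w, \<phi> w] ! i) = 0"
        using i x e w e0 w0 gs by (elim disjE) (auto simp: g_simps eta_simps g_phi_phi)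
      fix j :: nat assume "j < 5"
      then have j: "j = 0 \<or> j = 1 \<or> j = 2 \<or> j = 3 \<or> j = 4" by auto
      show "g ([\<xi>, e, \<phi> e, w, \<phi> w] ! i) ([\<xi>, e, \<phi> e, w, \<phi> w] ! j) = (if i = j then 1 else 0)"
        using i j e w e0 w0 gs by (elim disjE) (auto simp: g_phi_phi)
    qed
    then show "x = ?s" by simp
  qed
qed

lemma horizontal_vanish:
  assumes F: "\<And>a b u v. u \<in> V \<Longrightarrow> v \<in> V \<Longrightarrow> F (a *\<^sub>R u + b *\<^sub>R v) = a * F u + b * (F v :: real)"
    and b: "\<And>x. x \<in> V \<Longrightarrow> x = \<eta> x *\<^sub>R \<xi> + g x e *\<^sub>R e + g x (\<phi> e) *\<^sub>R \<phi> e + g x w *\<^sub>R w + g x (\<phi> w) *\<^sub>R \<phi> w"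
    and V: "e \<in> V" "w \<in> V"
    and 0: "F e = 0" "F (\<phi> e) = 0" "F w = 0" "F (\<phi> w) = 0" and x: "x \<in> V" "\<eta> x = 0"
  shows "F x = 0"
proof -
  have add: "F (u + v) = F u + F v" and sc: "F (a *\<^sub>R u) = a * F u" if "u \<in> V" "v \<in> V" for u v a
    using F[of u v 1 1] F[of u u a 0] that by simp_all
  have "F x = F (g x e *\<^sub>R e + g x (\<phi> e) *\<^sub>R \<phi> e + g x w *\<^sub>R w + g x (\<phi> w) *\<^sub>R \<phi> w)"
    using b[OF x(1)] x(2) by simp
  also have "\<dots> = 0" using V 0 by (simp add: add sc)
  finally show ?thesis .
qed

text \<open>For the complex structure \<phi> on the horizontal space, P has type (3,0) + (0,3), and
  there are no such forms in complex dimension two. Concretely, three distinct members of e,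
  \<phi>e, w, \<phi>w always include a pair u, \<phi>u.\<close>

lemma skew_3_form_horizontal:
  assumes lin: "\<And>a b u v y z. u \<in> V \<Longrightarrow> v \<in> V \<Longrightarrow> y \<in> V \<Longrightarrow> z \<in> V \<Longrightarrow>
      P (a *\<^sub>R u + b *\<^sub>R v) y z = a * P u y z + b * (P v y z :: real)"
    and s1: "\<And>x y z. x \<in> V \<Longrightarrow> y \<in> V \<Longrightarrow> z \<in> V \<Longrightarrow> P x y z = - P y x z"
    and s2: "\<And>x y z. x \<in> V \<Longrightarrow> y \<in> V \<Longrightarrow> z \<in> V \<Longrightarrow> P x y z = - P x z y"
    and J: "\<And>x y z. x \<in> V \<Longrightarrow> y \<in> V \<Longrightarrow> z \<in> V \<Longrightarrow> \<eta> y = 0 \<Longrightarrow> \<eta> z = 0 \<Longrightarrow> P x (\<phi> y) z = P x y (\<phi> z)"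
    and xyz: "x \<in> V" "y \<in> V" "z \<in> V" "\<eta> x = 0" "\<eta> y = 0" "\<eta> z = 0"
  shows "P x y z = 0"
proof -
  obtain e w where ew: "e \<in> V" "w \<in> V" "\<eta> e = 0" "\<eta> w = 0"
    and b: "\<And>x. x \<in> V \<Longrightarrow> x = \<eta> x *\<^sub>R \<xi> + g x e *\<^sub>R e + g x (\<phi> e) *\<^sub>R \<phi> e + g x w *\<^sub>R w + g x (\<phi> w) *\<^sub>R \<phi> w"
    using adapted_basis by metis
  note van = horizontal_vanish[OF _ b ew(1,2)]
  \<comment> \<open>The condition J with both vectors equal to u makes P(x, \<phi>u, u) and P(x, u,
    \<phi>u) equal, while skewness makes them opposite.\<close>
  have diag: "P x u (\<phi> u) = 0" if "x \<in> V" "u \<in> V" "\<eta> u = 0" for x u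
    using J[of x u u] s2[of x u "\<phi> u"] that by simp
  have same: "P x x z = 0" if "x \<in> V" "z \<in> V" for x z using s1[of x x z] that by simp
  have rep: "P x u v = P v x u" if "x \<in> V" "u \<in> V" "v \<in> V" for x u v
    using s1[of x v u] s2[of x u v] that by simp
  have base: "P x u v = 0" if x: "x \<in> V" "\<eta> x = 0" and u: "u = e \<or> u = \<phi> e" and v: "v = w \<or> v = \<phi> w" for x u v
  proof (rule van[where F = "\<lambda>x. P x u v"])
    show "P (a *\<^sub>R x + b *\<^sub>R y) u v = a * P x u v + b * P y u v" if "x \<in> V" "y \<in> V" for a b x y
      using lin that u v ew by auto
    have c: "P s u v = 0" if "s = e \<or> s = \<phi> e" for s
      using that u v ew same[of s v] diag[of v e] s1[of s u v] rep[of s u v] rep[of u s v] by auto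
    have d: "P s u v = 0" if "s = w \<or> s = \<phi> w" for s
      using that u v ew same[of s u] diag[of u w] s2[of s u v] s1[of s u v] rep[of u v s] rep[of u s v] by auto
    show "P e u v = 0" "P (\<phi> e) u v = 0" "P w u v = 0" "P (\<phi> w) u v = 0" using c d by blast+
  qed (use x in auto)
  have all: "P x u v = 0" if x: "x \<in> V" "\<eta> x = 0" and u: "u \<in> {e, \<phi> e, w, \<phi> w}" and v: "v \<in> {e, \<phi> e, w, \<phi> w}" for x u v
  proof -
    have V: "u \<in> V" "v \<in> V" using u v ew by auto
    have s: "P x u v = - P x v u" by (rule s2[OF x(1) V])
    have k: "P x u u = 0" if "u \<in> V" for u using s2[of x u u] that x by simp
    show ?thesis
      using u v base[OF x, of u v] base[OF x, of v u] s k V diag[OF x(1) ew(1,3)] diag[OF x(1) ew(2,4)]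
        s2[of x "\<phi> e" e] s2[of x "\<phi> w" w] x ew
      by auto
  qed
  have lin2: "P x (a *\<^sub>R u + b *\<^sub>R v) z = a * P x u z + b * P x v z" if "x \<in> V" "u \<in> V" "v \<in> V" "z \<in> V" for a b x u v z
    using lin[of u v x z a b] s1[of x "a *\<^sub>R u + b *\<^sub>R v" z] s1[of x u z] s1[of x v z] that by simp
  have lin3: "P x y (a *\<^sub>R u + b *\<^sub>R v) = a * P x y u + b * P x y v" if "x \<in> V" "u \<in> V" "v \<in> V" "y \<in> V" for a b x u v y
    using lin2[of x u v y a b] s2[of x y "a *\<^sub>R u + b *\<^sub>R v"] s2[of x y u] s2[of x y v] that by simp
  have step: "P x u z = 0" if u: "u \<in> {e, \<phi> e, w, \<phi> w}" for u
  proof (rule van[where F = "\<lambda>z. P x u z"])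
    have uV: "u \<in> V" using u ew by auto
    show "P x u (a *\<^sub>R y + b *\<^sub>R z) = a * P x u y + b * P x u z" if "y \<in> V" "z \<in> V" for a b y z
      by (rule lin3[OF xyz(1) that uV])
  qed (use all[OF xyz(1,4) u] xyz in simp_all)
  show ?thesis
  proof (rule van[where F = "\<lambda>y. P x y z"])
    show "P x (a *\<^sub>R u + b *\<^sub>R v) z = a * P x u z + b * P x v z" if "u \<in> V" "v \<in> V" for a b u v
      by (rule lin2[OF xyz(1) that xyz(3)])
  qed (use step xyz in simp_all)
qed

text \<open>Skewness and anticommutation make h e orthogonal to e and \<phi>e, so h e = a w + c
  \<phi>w. The two numbers a, c determine h on the whole basis, and h^2 = -(a^2 + c^2) on it; a
  larger horizontal space would allow different eigenvalues.\<close>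

lemma anticommuting_skew_square:
  assumes hV: "\<And>u. u \<in> V \<Longrightarrow> h u \<in> V"
    and hlin: "\<And>a b u v. u \<in> V \<Longrightarrow> v \<in> V \<Longrightarrow> h (a *\<^sub>R u + b *\<^sub>R v) = a *\<^sub>R h u + b *\<^sub>R h v"
    and skew: "\<And>u v. u \<in> V \<Longrightarrow> v \<in> V \<Longrightarrow> g (h u) v = - g u (h v)"
    and anti: "\<And>u. u \<in> V \<Longrightarrow> h (\<phi> u) = - \<phi> (h u)"
    and xi: "h \<xi> = 0"
  obtains f where "f \<ge> 0" "\<And>u. u \<in> V \<Longrightarrow> h (h u) = - f *\<^sub>R (u - \<eta> u *\<^sub>R \<xi>)"
proof -
  obtain e w where ew: "e \<in> V" "w \<in> V" "\<eta> e = 0" "\<eta> w = 0" "g e e = 1" "g w w = 1"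
    "g e w = 0" "g (\<phi> e) w = 0"
    and b: "\<And>x. x \<in> V \<Longrightarrow> x = \<eta> x *\<^sub>R \<xi> + g x e *\<^sub>R e + g x (\<phi> e) *\<^sub>R \<phi> e + g x w *\<^sub>R w + g x (\<phi> w) *\<^sub>R \<phi> w"
    by (rule adapted_basis) (rule that)
  have hs: "h (u + v) = h u + h v" "h (a *\<^sub>R u) = a *\<^sub>R h u" "h (- u) = - h u" "h (u - v) = h u - h v"
    if "u \<in> V" "v \<in> V" for u v a
    using hlin[of u v 1 1] hlin[of u u a 0] hlin[of u u "-1" 0] hlin[of u v 1 "-1"] that by simp_all
  have eh: "\<eta> (h u) = 0" if "u \<in> V" for u
    using skew[OF that xi_V] that xi hV by simp
  have self: "g (h u) u = 0" "g (h u) (\<phi> u) = 0" if "u \<in> V" for u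
  proof -
    show "g (h u) u = 0" using skew[of u u] that sym[of u "h u"] by simp
    have "g (h u) (\<phi> u) = - g u (h (\<phi> u))" using skew[of u "\<phi> u"] that by simp
    also have "\<dots> = g u (\<phi> (h u))" using that hV by (simp add: anti g_simps)
    also have "\<dots> = - g (\<phi> u) (h u)" using phi_skew[of u "h u"] that hV by simp
    finally show "g (h u) (\<phi> u) = 0" using sym[of "\<phi> u" "h u"] by simp
  qed
  define a c where "a = g (h e) w" and "c = g (h e) (\<phi> w)"
  have he: "h e = a *\<^sub>R w + c *\<^sub>R \<phi> w"
    using b[OF hV[OF ew(1)]] self[OF ew(1)] eh[OF ew(1)] by (simp add: a_def c_def)
  have pp: "\<phi> (\<phi> e) = - e" "\<phi> (\<phi> w) = - w" using ew by (simp_all add: phi_phi)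
  have hpe: "h (\<phi> e) = c *\<^sub>R w - a *\<^sub>R \<phi> w"
    using ew by (simp add: anti he phi_simps pp)
  have "g (h w) e = - a" using skew[of w e] ew by (simp add: a_def sym hV)
  moreover have "g (h w) (\<phi> e) = - c"
    using skew[of w "\<phi> e"] ew by (simp add: hpe g_simps)
  ultimately have hw: "h w = - a *\<^sub>R e - c *\<^sub>R \<phi> e"
    using b[OF hV[OF ew(2)]] self[OF ew(2)] eh[OF ew(2)] by simp
  have hpw: "h (\<phi> w) = a *\<^sub>R \<phi> e - c *\<^sub>R e"
    using ew by (simp add: anti hw phi_simps pp)
  define f where "f = a\<^sup>2 + c\<^sup>2"
  have hh: "h (h e) = - f *\<^sub>R e" "h (h (\<phi> e)) = - f *\<^sub>R \<phi> e" "h (h w) = - f *\<^sub>R w" "h (h (\<phi> w)) = - f *\<^sub>R \<phi> w"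
    using ew by (simp_all add: he hpe hw hpw hs f_def power2_eq_square algebra_simps)
  show thesis
  proof (rule that)
    show "f \<ge> 0" by (simp add: f_def)
    fix u assume u: "u \<in> V"
    let ?s = "g u e *\<^sub>R e + g u (\<phi> e) *\<^sub>R \<phi> e + g u w *\<^sub>R w + g u (\<phi> w) *\<^sub>R \<phi> w"
    have us: "u = \<eta> u *\<^sub>R \<xi> + ?s" using b[OF u] by (simp add: add.assoc)
    have "h u = h (\<eta> u *\<^sub>R \<xi> + ?s)" using us by simp
    also have "\<dots> = h ?s" using ew by (simp add: hs xi)
    finally have "h (h u) = h (h ?s)" by simp
    also have "\<dots> = - f *\<^sub>R ?s" using ew by (simp add: hs hV hh algebra_simps)
    also have "?s = u - \<eta> u *\<^sub>R \<xi>" using us by (metis add_diff_cancel_left')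
    finally show "h (h u) = - f *\<^sub>R (u - \<eta> u *\<^sub>R \<xi>)" .
  qed
qed

end


section \<open>Linear algebra of \<open>SU(2)\<close>-structures\<close>

definition wedge22 :: "('v \<Rightarrow> 'v \<Rightarrow> real) \<Rightarrow> ('v \<Rightarrow> 'v \<Rightarrow> real) \<Rightarrow> 'v \<Rightarrow> 'v \<Rightarrow> 'v \<Rightarrow> 'v \<Rightarrow> real" where
  "wedge22 \<alpha> \<beta> w x y z = \<alpha> w x * \<beta> y z - \<alpha> w y * \<beta> x z + \<alpha> w z * \<beta> x y
     + \<alpha> x y * \<beta> w z - \<alpha> x z * \<beta> w y + \<alpha> y z * \<beta> w x"

locale su2_space = A1: acm_space V g \<phi>1 \<xi> \<eta> + A2: acm_space V g \<phi>2 \<xi> \<eta> + A3: acm_space V g \<phi>3 \<xi> \<eta>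
  for V :: "'v::real_vector set" and g \<phi>1 \<phi>2 \<phi>3 \<xi> \<eta> +
  assumes q12: "\<And>u. u \<in> V \<Longrightarrow> \<phi>1 (\<phi>2 u) = \<phi>3 u" and q21: "\<And>u. u \<in> V \<Longrightarrow> \<phi>2 (\<phi>1 u) = - \<phi>3 u"
    and q23: "\<And>u. u \<in> V \<Longrightarrow> \<phi>2 (\<phi>3 u) = \<phi>1 u" and q32: "\<And>u. u \<in> V \<Longrightarrow> \<phi>3 (\<phi>2 u) = - \<phi>1 u"
    and q31: "\<And>u. u \<in> V \<Longrightarrow> \<phi>3 (\<phi>1 u) = \<phi>2 u" and q13: "\<And>u. u \<in> V \<Longrightarrow> \<phi>1 (\<phi>3 u) = - \<phi>2 u"
begin

text \<open>The cyclic symmetry of the triple: results are proved for one index and transferred by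
  interpretation.\<close>

lemma rotate: "su2_space V g \<phi>2 \<phi>3 \<phi>1 \<xi> \<eta>"
  using A1.acm_space_axioms A2.acm_space_axioms A3.acm_space_axioms q12 q21 q23 q32 q31 q13
  by (simp add: su2_space_def su2_space_axioms_def)

lemmas quaternion = q12 q21 q23 q32 q31 q13 A1.phi_phi A2.phi_phi A3.phi_phi

lemma quaternion_basis:
  obtains e where "e \<in> V" "\<eta> e = 0" "g e e = 1"
    "\<And>x. x \<in> V \<Longrightarrow> x = \<eta> x *\<^sub>R \<xi> + g x e *\<^sub>R e + g x (\<phi>1 e) *\<^sub>R \<phi>1 e + g x (\<phi>2 e) *\<^sub>R \<phi>2 e + g x (\<phi>3 e) *\<^sub>R \<phi>3 e"
proof -
  obtain e where e: "e \<in> V" "g e e = 1" "g e \<xi> = 0"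
    using A1.orthonormal_extend[of 1 "\<lambda>_. \<xi>"] by auto
  have e0: "\<eta> e = 0" using e by simp
  have gs: "g (\<phi>1 e) (\<phi>2 e) = 0" "g (\<phi>1 e) (\<phi>3 e) = 0" "g (\<phi>2 e) (\<phi>3 e) = 0"
    using e A1.phi_skew[of e "\<phi>2 e"] A1.phi_skew[of e "\<phi>3 e"] A2.phi_skew[of e "\<phi>3 e"]
    by (simp_all add: quaternion A1.g_simps)
  then have gs': "g (\<phi>2 e) (\<phi>1 e) = 0" "g (\<phi>3 e) (\<phi>1 e) = 0" "g (\<phi>3 e) (\<phi>2 e) = 0"
    using A1.sym by auto
  show thesis
  proof (rule that[OF e(1) e0 e(2)])
    fix x assume x: "x \<in> V"
    let ?s = "\<eta> x *\<^sub>R \<xi> + g x e *\<^sub>R e + g x (\<phi>1 e) *\<^sub>R \<phi>1 e + g x (\<phi>2 e) *\<^sub>R \<phi>2 e + g x (\<phi>3 e) *\<^sub>R \<phi>3 e"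
    have "x - ?s = 0"
    proof (rule A1.orthonormal_complete[of "\<lambda>i. [\<xi>, e, \<phi>1 e, \<phi>2 e, \<phi>3 e] ! i"])
      show "x - ?s \<in> V" using x e by simp
      fix i :: nat assume "i < 5"
      then have i: "i = 0 \<or> i = 1 \<or> i = 2 \<or> i = 3 \<or> i = 4" by auto
      then show "[\<xi>, e, \<phi>1 e, \<phi>2 e, \<phi>3 e] ! i \<in> V" using e by auto
      show "g (x - ?s) ([\<xi>, e, \<phi>1 e, \<phi>2 e, \<phi>3 e] ! i) = 0"
        using i x e e0 gs gs' by (elim disjE)
          (auto simp: A1.g_simps A1.eta_simps A1.g_phi_phi A2.g_phi_phi A3.g_phi_phi)
      fix j :: nat assume "j < 5"
      then have j: "j = 0 \<or> j = 1 \<or> j = 2 \<or> j = 3 \<or> j = 4" by auto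
      show "g ([\<xi>, e, \<phi>1 e, \<phi>2 e, \<phi>3 e] ! i) ([\<xi>, e, \<phi>1 e, \<phi>2 e, \<phi>3 e] ! j) = (if i = j then 1 else 0)"
        using i j e e0 gs gs' by (elim disjE) (auto simp: A1.g_phi_phi A2.g_phi_phi A3.g_phi_phi)
    qed
    then show "x = ?s" by simp
  qed
qed

text \<open>In the coordinates dual to e, \<phi>1 e, \<phi>2 e, \<phi>3 e the forms are c01 + c23,
  c02 + c31 and c03 + c12, the standard basis of self-dual 2-forms. The relations between their
  wedge products thereby become polynomial identities.\<close>

lemma form_coordinates:
  obtains e c0 c1 c2 c3 where "e \<in> V" "\<eta> e = 0" "g e e = 1"
    "\<And>x y. x \<in> V \<Longrightarrow> y \<in> V \<Longrightarrow> g (\<phi>1 x) y = c0 x * c1 y - c1 x * c0 y + c2 x * c3 y - c3 x * c2 y"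
    "\<And>x y. x \<in> V \<Longrightarrow> y \<in> V \<Longrightarrow> g (\<phi>2 x) y = c0 x * c2 y - c2 x * c0 y + c3 x * c1 y - c1 x * c3 y"
    "\<And>x y. x \<in> V \<Longrightarrow> y \<in> V \<Longrightarrow> g (\<phi>3 x) y = c0 x * c3 y - c3 x * c0 y + c1 x * c2 y - c2 x * c1 y"
proof -
  obtain e where e: "e \<in> V" "\<eta> e = 0" "g e e = 1" and b: "\<And>x. x \<in> V \<Longrightarrow>
    x = \<eta> x *\<^sub>R \<xi> + g x e *\<^sub>R e + g x (\<phi>1 e) *\<^sub>R \<phi>1 e + g x (\<phi>2 e) *\<^sub>R \<phi>2 e + g x (\<phi>3 e) *\<^sub>R \<phi>3 e"
    by (rule quaternion_basis) (rule that)
  have p: "\<phi>1 (\<phi>1 e) = - e" "\<phi>2 (\<phi>2 e) = - e" "\<phi>3 (\<phi>3 e) = - e"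
    "\<phi>1 (\<phi>2 e) = \<phi>3 e" "\<phi>2 (\<phi>1 e) = - \<phi>3 e" "\<phi>2 (\<phi>3 e) = \<phi>1 e" "\<phi>3 (\<phi>2 e) = - \<phi>1 e"
    "\<phi>3 (\<phi>1 e) = \<phi>2 e" "\<phi>1 (\<phi>3 e) = - \<phi>2 e" using e by (simp_all add: quaternion)
  have expand: "\<psi> x = g x e *\<^sub>R \<psi> e + g x (\<phi>1 e) *\<^sub>R \<psi> (\<phi>1 e) + g x (\<phi>2 e) *\<^sub>R \<psi> (\<phi>2 e) + g x (\<phi>3 e) *\<^sub>R \<psi> (\<phi>3 e)"
    if x: "x \<in> V" and s: "\<And>u v. u \<in> V \<Longrightarrow> v \<in> V \<Longrightarrow> \<psi> (u + v) = \<psi> u + \<psi> v"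
      "\<And>u a. u \<in> V \<Longrightarrow> \<psi> (a *\<^sub>R u) = a *\<^sub>R \<psi> u" "\<psi> \<xi> = 0" for x and \<psi> :: "'v \<Rightarrow> 'v"
  proof -
    have "\<psi> x = \<psi> (\<eta> x *\<^sub>R \<xi> + g x e *\<^sub>R e + g x (\<phi>1 e) *\<^sub>R \<phi>1 e + g x (\<phi>2 e) *\<^sub>R \<phi>2 e + g x (\<phi>3 e) *\<^sub>R \<phi>3 e)"
      using b[OF x] by simp
    then show ?thesis using e by (simp add: s)
  qed
  show thesis
  proof (rule that[OF e, of "\<lambda>x. g x e" "\<lambda>x. g x (\<phi>1 e)" "\<lambda>x. g x (\<phi>2 e)" "\<lambda>x. g x (\<phi>3 e)"])
    fix x y assume x: "x \<in> V" and y: "y \<in> V"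
    show "g (\<phi>1 x) y = g x e * g y (\<phi>1 e) - g x (\<phi>1 e) * g y e + g x (\<phi>2 e) * g y (\<phi>3 e) - g x (\<phi>3 e) * g y (\<phi>2 e)"
      using e x y A1.sym[of y] by (subst expand[OF x, of \<phi>1]) (simp_all add: A1.phi_simps A1.g_simps p)
    show "g (\<phi>2 x) y = g x e * g y (\<phi>2 e) - g x (\<phi>2 e) * g y e + g x (\<phi>3 e) * g y (\<phi>1 e) - g x (\<phi>1 e) * g y (\<phi>3 e)"
      using e x y A1.sym[of y] by (subst expand[OF x, of \<phi>2]) (simp_all add: A2.phi_simps A1.g_simps p)
    show "g (\<phi>3 x) y = g x e * g y (\<phi>3 e) - g x (\<phi>3 e) * g y e + g x (\<phi>1 e) * g y (\<phi>2 e) - g x (\<phi>2 e) * g y (\<phi>1 e)"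
      using e x y A1.sym[of y] by (subst expand[OF x, of \<phi>3]) (simp_all add: A3.phi_simps A1.g_simps p)
  qed
qed

lemma wedge22_orthogonal:
  assumes V: "w \<in> V" "x \<in> V" "y \<in> V" "z \<in> V"
  shows "wedge22 (\<lambda>x. g (\<phi>1 x)) (\<lambda>x. g (\<phi>2 x)) w x y z = 0"
    "wedge22 (\<lambda>x. g (\<phi>2 x)) (\<lambda>x. g (\<phi>2 x)) w x y z = wedge22 (\<lambda>x. g (\<phi>1 x)) (\<lambda>x. g (\<phi>1 x)) w x y z"
proof -
  obtain e c0 c1 c2 c3 where c:
    "\<And>x y. x \<in> V \<Longrightarrow> y \<in> V \<Longrightarrow> g (\<phi>1 x) y = c0 x * c1 y - c1 x * c0 y + c2 x * c3 y - c3 x * c2 y"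
    "\<And>x y. x \<in> V \<Longrightarrow> y \<in> V \<Longrightarrow> g (\<phi>2 x) y = c0 x * c2 y - c2 x * c0 y + c3 x * c1 y - c1 x * c3 y"
    by (rule form_coordinates) (rule that)
  show "wedge22 (\<lambda>x. g (\<phi>1 x)) (\<lambda>x. g (\<phi>2 x)) w x y z = 0"
    using V by (simp add: wedge22_def c algebra_simps)
  show "wedge22 (\<lambda>x. g (\<phi>2 x)) (\<lambda>x. g (\<phi>2 x)) w x y z = wedge22 (\<lambda>x. g (\<phi>1 x)) (\<lambda>x. g (\<phi>1 x)) w x y z"
    using V by (simp add: wedge22_def c algebra_simps)
qed

lemma wedge22_nonzero:
  obtains e where "e \<in> V" "\<eta> e = 0"
    "wedge22 (\<lambda>x. g (\<phi>1 x)) (\<lambda>x. g (\<phi>1 x)) e (\<phi>1 e) (\<phi>2 e) (\<phi>3 e) \<noteq> 0"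
proof -
  obtain e where e: "e \<in> V" "\<eta> e = 0" "g e e = 1" by (rule quaternion_basis) (rule that)
  have "g (\<phi>1 e) (\<phi>2 e) = 0" "g (\<phi>1 e) (\<phi>3 e) = 0"
    using e A1.phi_skew[of e "\<phi>2 e"] A1.phi_skew[of e "\<phi>3 e"] by (simp_all add: quaternion A1.g_simps)
  then have "wedge22 (\<lambda>x. g (\<phi>1 x)) (\<lambda>x. g (\<phi>1 x)) e (\<phi>1 e) (\<phi>2 e) (\<phi>3 e) = 2"
    using e by (simp add: wedge22_def quaternion A1.g_simps A1.g_phi_phi A3.g_phi_phi)
  then show thesis using that[OF e(1,2)] by simp
qed

end

text \<open>
  Hitchin's lemma: the covariant derivatives of an \<open>SU(2)\<close>-triple have the form
  \<open>\<nabla>\<omega>\<^sub>1 = c \<otimes> \<omega>\<^sub>2 - b \<otimes> \<omega>\<^sub>3\<close> (cyclically, with 1-forms \<open>a, b, c\<close>) on the horizontal space. If the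
  \<open>\<omega>\<^sub>i\<close> are horizontally closed, then \<open>c(\<phi>\<^sub>1e) = -b(e)\<close>, \<open>a(\<phi>\<^sub>2e) = -c(e)\<close>, \<open>b(\<phi>\<^sub>3e) = -a(e)\<close>, and
  running through these relations once gives \<open>b(e) = -b(e)\<close>.
\<close>

locale su2_torsion = su2_space V g \<phi>1 \<phi>2 \<phi>3 \<xi> \<eta>
  for V :: "'v::real_vector set" and g \<phi>1 \<phi>2 \<phi>3 \<xi> \<eta> +
  fixes T1 T2 T3 :: "'v \<Rightarrow> 'v \<Rightarrow> 'v \<Rightarrow> real"
  assumes lin1_all: "\<forall>T\<in>{T1, T2, T3}. \<forall>a b. \<forall>u\<in>V. \<forall>v\<in>V. \<forall>y\<in>V. \<forall>z\<in>V.
      T (a *\<^sub>R u + b *\<^sub>R v) y z = a * T u y z + b * T v y z"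
    and lin3_all: "\<forall>T\<in>{T1, T2, T3}. \<forall>a b. \<forall>u\<in>V. \<forall>v\<in>V. \<forall>y\<in>V. \<forall>z\<in>V.
      T y z (a *\<^sub>R u + b *\<^sub>R v) = a * T y z u + b * T y z v"
    and skew_all: "\<forall>T\<in>{T1, T2, T3}. \<forall>x\<in>V. \<forall>y\<in>V. \<forall>z\<in>V. T x y z = - T x z y"
    and J1: "\<And>x y z. x \<in> V \<Longrightarrow> y \<in> V \<Longrightarrow> z \<in> V \<Longrightarrow> \<eta> y = 0 \<Longrightarrow> \<eta> z = 0 \<Longrightarrow> T1 x (\<phi>1 y) z = T1 x y (\<phi>1 z)"
    and J2: "\<And>x y z. x \<in> V \<Longrightarrow> y \<in> V \<Longrightarrow> z \<in> V \<Longrightarrow> \<eta> y = 0 \<Longrightarrow> \<eta> z = 0 \<Longrightarrow> T2 x (\<phi>2 y) z = T2 x y (\<phi>2 z)"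
    and J3: "\<And>x y z. x \<in> V \<Longrightarrow> y \<in> V \<Longrightarrow> z \<in> V \<Longrightarrow> \<eta> y = 0 \<Longrightarrow> \<eta> z = 0 \<Longrightarrow> T3 x (\<phi>3 y) z = T3 x y (\<phi>3 z)"
    and R3: "\<And>x y z. x \<in> V \<Longrightarrow> y \<in> V \<Longrightarrow> z \<in> V \<Longrightarrow> T3 x y z = T1 x (\<phi>2 y) z - T2 x y (\<phi>1 z)"
    and R1: "\<And>x y z. x \<in> V \<Longrightarrow> y \<in> V \<Longrightarrow> z \<in> V \<Longrightarrow> T1 x y z = T2 x (\<phi>3 y) z - T3 x y (\<phi>2 z)"
    and R2: "\<And>x y z. x \<in> V \<Longrightarrow> y \<in> V \<Longrightarrow> z \<in> V \<Longrightarrow> T2 x y z = T3 x (\<phi>1 y) z - T1 x y (\<phi>3 z)"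
    and closed_all: "\<forall>T\<in>{T1, T2, T3}. \<forall>x\<in>V. \<forall>y\<in>V. \<forall>z\<in>V. \<eta> x = 0 \<longrightarrow> \<eta> y = 0 \<longrightarrow> \<eta> z = 0 \<longrightarrow>
      T x y z + T y z x + T z x y = 0"
begin

lemmas lin1 = lin1_all[rule_format] and lin3 = lin3_all[rule_format]
  and skew = skew_all[rule_format] and closed = closed_all[rule_format]


lemma rotate_torsion: "su2_torsion V g \<phi>2 \<phi>3 \<phi>1 \<xi> \<eta> T2 T3 T1"
proof -
  interpret r: su2_space V g \<phi>2 \<phi>3 \<phi>1 \<xi> \<eta> by (rule rotate)
  have p: "{T2, T3, T1} = {T1, T2, T3}" by blast
  show ?thesis
    by (unfold_locales, unfold p) (fact lin1_all lin3_all skew_all closed_all J1 J2 J3 R1 R2 R3)+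
qed

lemma minus3: "T \<in> {T1, T2, T3} \<Longrightarrow> y \<in> V \<Longrightarrow> z \<in> V \<Longrightarrow> u \<in> V \<Longrightarrow> T y z (- u) = - T y z u"
  using lin3[of T u u y z "-1" 0] by simp

lemma minus1: "T \<in> {T1, T2, T3} \<Longrightarrow> y \<in> V \<Longrightarrow> z \<in> V \<Longrightarrow> u \<in> V \<Longrightarrow> T (- u) y z = - T u y z"
  using lin1[of T u u y z "-1" 0] by simp

lemma minus2: "T \<in> {T1, T2, T3} \<Longrightarrow> y \<in> V \<Longrightarrow> z \<in> V \<Longrightarrow> u \<in> V \<Longrightarrow> T y (- u) z = - T y u z"
  using minus3[of T y z u] skew[of T y "- u" z] skew[of T y u z] by simp

lemma diag: "T \<in> {T1, T2, T3} \<Longrightarrow> x \<in> V \<Longrightarrow> u \<in> V \<Longrightarrow> T x u u = 0"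
  using skew[of T x u u] by simp

context
  fixes u assumes u [simp]: "u \<in> V" "\<eta> u = 0"
begin

lemma quaternion_u:
  "\<phi>1 (\<phi>1 u) = - u" "\<phi>2 (\<phi>2 u) = - u" "\<phi>3 (\<phi>3 u) = - u"
  "\<phi>1 (\<phi>2 u) = \<phi>3 u" "\<phi>2 (\<phi>1 u) = - \<phi>3 u" "\<phi>2 (\<phi>3 u) = \<phi>1 u" "\<phi>3 (\<phi>2 u) = - \<phi>1 u"
  "\<phi>3 (\<phi>1 u) = \<phi>2 u" "\<phi>1 (\<phi>3 u) = - \<phi>2 u"
  by (simp_all add: quaternion)

lemma T1_11: "x \<in> V \<Longrightarrow> T1 x u (\<phi>1 u) = 0"
  using J1[of x u u] skew[of T1 x "\<phi>1 u" u] by simp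

text \<open>For unit u both sides are the coefficient b(x): it occurs in \<nabla>\<omega>3 with
  \<omega>1 and, with the opposite sign, in \<nabla>\<omega>1 with \<omega>3.\<close>

lemma T3_1: "x \<in> V \<Longrightarrow> T3 x u (\<phi>1 u) = - T1 x u (\<phi>3 u)"
  using R3[of x u "\<phi>1 u"] J1[of x "\<phi>2 u" u] skew[of T1 x "\<phi>3 u" u] diag[of T2 x u]
  by (simp add: quaternion_u minus3)

text \<open>The coefficient c(x) of \<omega>2 in \<nabla>\<omega>1 can be read off at u or at any
  \<phi>i u; this change of base vector lets the closedness relations be chained.\<close>

lemma T1_base: "x \<in> V \<Longrightarrow> T1 x (\<phi>1 u) (\<phi>2 (\<phi>1 u)) = T1 x u (\<phi>2 u)"
  "x \<in> V \<Longrightarrow> T1 x (\<phi>2 u) (\<phi>2 (\<phi>2 u)) = T1 x u (\<phi>2 u)"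
  "x \<in> V \<Longrightarrow> T1 x (\<phi>3 u) (\<phi>2 (\<phi>3 u)) = T1 x u (\<phi>2 u)"
  using J1[of x u "\<phi>3 u"] J1[of x "\<phi>3 u" u] skew[of T1 x "\<phi>2 u" u]
  by (simp_all add: quaternion_u minus3 minus2)

lemma closed1: "T1 (\<phi>1 u) u (\<phi>2 u) = - T3 u u (\<phi>1 u)"
  using closed[of T1 "\<phi>1 u" u "\<phi>2 u"] J1[of u "\<phi>2 u" u] J1[of "\<phi>2 u" u u]
    skew[of T1 "\<phi>2 u" "\<phi>1 u" u] skew[of T1 u "\<phi>3 u" u] T3_1[of u]
  by (simp add: quaternion_u)

end

end

context su2_torsion
begin

interpretation r: su2_torsion V g \<phi>2 \<phi>3 \<phi>1 \<xi> \<eta> T2 T3 T1 by (rule rotate_torsion)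
interpretation rr: su2_torsion V g \<phi>3 \<phi>1 \<phi>2 \<xi> \<eta> T3 T1 T2 by (rule r.rotate_torsion)

text \<open>Three closedness relations, each with a factor -1, transport the coefficient from u to
  \<phi>1 u, then along \<phi>2 and \<phi>3. Since \<phi>3 \<phi>2 \<phi>1 is the identity on
  horizontal vectors, the chain returns to u with the sign (-1)^3.\<close>

lemma T3_diag:
  assumes u: "u \<in> V" "\<eta> u = 0"
  shows "T3 u u (\<phi>1 u) = 0"
proof -
  note q = quaternion_u[OF u]
  have v: "\<phi>1 u \<in> V" "\<eta> (\<phi>1 u) = 0" "\<phi>3 u \<in> V" "\<eta> (\<phi>3 u) = 0" using u by simp_all
  have "T3 u u (\<phi>1 u) = - T1 (\<phi>1 u) u (\<phi>2 u)" using closed1[OF u] by simp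
  also have "T1 (\<phi>1 u) u (\<phi>2 u) = T1 (\<phi>1 u) (\<phi>1 u) (\<phi>2 (\<phi>1 u))"
    using T1_base(1)[OF u, of "\<phi>1 u"] u by simp
  also have "\<dots> = - T2 (\<phi>2 (\<phi>1 u)) (\<phi>1 u) (\<phi>3 (\<phi>1 u))" using r.closed1[OF v(1,2)] by simp
  also have "\<dots> = T2 (\<phi>3 u) (\<phi>1 u) (\<phi>3 (\<phi>1 u))" using u by (simp add: q minus1)
  also have "\<dots> = T2 (\<phi>3 u) u (\<phi>3 u)" using r.T1_base(3)[OF u, of "\<phi>3 u"] u by simp
  also have "\<dots> = T2 (\<phi>3 u) (\<phi>3 u) (\<phi>3 (\<phi>3 u))" using r.T1_base(2)[OF u, of "\<phi>3 u"] u by simp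
  also have "\<dots> = - T3 (\<phi>3 (\<phi>3 u)) (\<phi>3 u) (\<phi>1 (\<phi>3 u))" using rr.closed1[OF v(3,4)] by simp
  also have "\<dots> = T3 u (\<phi>3 u) (\<phi>1 (\<phi>3 u))" using u by (simp add: q minus1 minus3)
  also have "\<dots> = T3 u u (\<phi>1 u)" using rr.T1_base(1)[OF u, of u] u by simp
  finally show ?thesis by simp
qed

text \<open>Read off at the base vector \<phi>i u, the coefficient b(\<phi>i u) is again a diagonal
  one.\<close>

lemma T3_first:
  assumes u: "u \<in> V" "\<eta> u = 0" and x: "x = u \<or> x = \<phi>1 u \<or> x = \<phi>2 u \<or> x = \<phi>3 u"
  shows "T3 x u (\<phi>1 u) = 0"
  using x T3_diag[OF u] T3_diag[of "\<phi>1 u"] T3_diag[of "\<phi>2 u"] T3_diag[of "\<phi>3 u"] u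
    rr.T1_base(1)[OF u, of "\<phi>3 u"] rr.T1_base(2)[OF u, of "\<phi>1 u"] rr.T1_base(3)[OF u, of "\<phi>2 u"]
  by auto

end

text \<open>The context is reopened so that the rotated interpretations also contain
  \<open>T3_first\<close>.\<close>

context su2_torsion
begin

interpretation r: su2_torsion V g \<phi>2 \<phi>3 \<phi>1 \<xi> \<eta> T2 T3 T1 by (rule rotate_torsion)
interpretation rr: su2_torsion V g \<phi>3 \<phi>1 \<phi>2 \<xi> \<eta> T3 T1 T2 by (rule r.rotate_torsion)

text \<open>T3 is b \<otimes> \<omega>1 - a \<otimes> \<omega>2 on horizontal vectors.
  \<open>B\<close> gives b = 0 directly, \<open>Aa\<close> gives a = 0 through T2; the remaining
  components are conjugates of these or belong to \<omega>3.\<close>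

lemma T3_horizontal:
  assumes "x \<in> V" "y \<in> V" "z \<in> V" "\<eta> x = 0" "\<eta> y = 0" "\<eta> z = 0"
  shows "T3 x y z = 0"
proof -
  obtain e where e: "e \<in> V" "\<eta> e = 0" "g e e = 1" and b: "\<And>x. x \<in> V \<Longrightarrow>
    x = \<eta> x *\<^sub>R \<xi> + g x e *\<^sub>R e + g x (\<phi>1 e) *\<^sub>R \<phi>1 e + g x (\<phi>2 e) *\<^sub>R \<phi>2 e + g x (\<phi>3 e) *\<^sub>R \<phi>3 e"
    by (rule quaternion_basis) (rule that)
  have hor: "F x = 0" if lin: "\<And>a b u v. u \<in> V \<Longrightarrow> v \<in> V \<Longrightarrow> F (a *\<^sub>R u + b *\<^sub>R v) = a * F u + b * (F v :: real)"
    and 0: "F e = 0" "F (\<phi>1 e) = 0" "F (\<phi>2 e) = 0" "F (\<phi>3 e) = 0" and x: "x \<in> V" "\<eta> x = 0" for F x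
  proof -
    have add: "F (u + v) = F u + F v" and sc: "F (a *\<^sub>R u) = a * F u" if "u \<in> V" "v \<in> V" for u v a
      using lin[of u v 1 1] lin[of u u a 0] that by simp_all
    have "F x = F (g x e *\<^sub>R e + g x (\<phi>1 e) *\<^sub>R \<phi>1 e + g x (\<phi>2 e) *\<^sub>R \<phi>2 e + g x (\<phi>3 e) *\<^sub>R \<phi>3 e)"
      using b[OF x(1)] x(2) by simp
    also have "\<dots> = 0" using e 0 by (simp add: add sc)
    finally show ?thesis .
  qed
  note q = quaternion_u[OF e(1,2)]
  have H: "\<phi>1 e \<in> V" "\<phi>2 e \<in> V" "\<phi>3 e \<in> V" "\<eta> (\<phi>1 e) = 0" "\<eta> (\<phi>2 e) = 0" "\<eta> (\<phi>3 e) = 0"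
    using e by simp_all
  have B: "T3 s e (\<phi>1 e) = 0" if "s \<in> V" "\<eta> s = 0" for s
    by (rule hor[where F = "\<lambda>s. T3 s e (\<phi>1 e)"]) (use that e H T3_first[OF e(1,2)] in \<open>simp_all add: lin1\<close>)
  have Aa: "T2 s e (\<phi>3 e) = 0" if "s \<in> V" "\<eta> s = 0" for s
    by (rule hor[where F = "\<lambda>s. T2 s e (\<phi>3 e)"]) (use that e H rr.T3_first[OF e(1,2)] in \<open>simp_all add: lin1\<close>)
  have base: "T3 s v w = 0" if s: "s \<in> V" "\<eta> s = 0" and v: "v \<in> {e, \<phi>1 e, \<phi>2 e, \<phi>3 e}" and w: "w \<in> {e, \<phi>1 e, \<phi>2 e, \<phi>3 e}" for s v w
  proof -
    have 1: "T3 s e (\<phi>3 e) = 0" "T3 s (\<phi>1 e) (\<phi>2 e) = 0"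
      using rr.T1_11[OF e(1,2) s(1)] rr.T1_11[OF H(1,4) s(1)] by (simp_all add: q)
    have 2: "T3 s e (\<phi>2 e) = 0" using r.T3_1[OF e(1,2) s(1)] rr.T3_1[OF e(1,2) s(1)] Aa[OF s] by simp
    have 3: "T3 s (\<phi>2 e) (\<phi>3 e) = 0" using rr.T1_base(3)[OF e(1,2) s(1)] B[OF s] by (simp add: q)
    have "T2 s (\<phi>1 e) (\<phi>3 (\<phi>1 e)) = 0" using r.T1_base(3)[OF e(1,2) s(1)] Aa[OF s] by simp
    then have "T3 s (\<phi>1 e) (\<phi>2 (\<phi>1 e)) = 0" using rr.T3_1[OF H(1,4) s(1)] by simp
    then have 4: "T3 s (\<phi>1 e) (\<phi>3 e) = 0" using H s by (simp add: q minus3)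
    show ?thesis
    proof -
      have sw: "T3 s b a = 0" if "T3 s a b = 0" "a \<in> V" "b \<in> V" for a b
        using skew[of T3 s b a] that s by simp
      have d: "T3 s a a = 0" if "a \<in> V" for a using diag[of T3 s a] that s by simp
      show ?thesis
        using v w 1 2 3 4 B[OF s] sw[OF 1(1)] sw[OF 1(2)] sw[OF 2] sw[OF 3] sw[OF 4] sw[OF B[OF s]]
          d[of e] d[of "\<phi>1 e"] d[of "\<phi>2 e"] d[of "\<phi>3 e"] e H
        by (elim insertE emptyE) simp_all
    qed
  qed
  have lin2: "T3 s (a *\<^sub>R u + b *\<^sub>R v) w = a * T3 s u w + b * T3 s v w" if "s \<in> V" "u \<in> V" "v \<in> V" "w \<in> V" for s a b u v w
    using lin3[of T3 u v s w a b] skew[of T3 s _ w] that by simp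
  have step: "T3 x v z = 0" if v: "v \<in> {e, \<phi>1 e, \<phi>2 e, \<phi>3 e}" for v
  proof (rule hor[where F = "\<lambda>z. T3 x v z"])
    have "v \<in> V" using v e H by auto
    then show "T3 x v (a *\<^sub>R u + b *\<^sub>R w) = a * T3 x v u + b * T3 x v w" if "u \<in> V" "w \<in> V" for a b u w
      using lin3[of T3 u w x v a b] that assms(1) by simp
  qed (use assms base[OF assms(1,4) v] in simp_all)
  show ?thesis
  proof (rule hor[where F = "\<lambda>y. T3 x y z"])
    show "T3 x (a *\<^sub>R u + b *\<^sub>R v) z = a * T3 x u z + b * T3 x v z" if "u \<in> V" "v \<in> V" for a b u v
      by (rule lin2[OF assms(1) that assms(3)])
  qed (use assms step in simp_all)
qed

end

subsection \<open>From forms to endomorphisms\<close>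

text \<open>The metric is not yet available, so the \<phi>i are specified by equations between two
  forms: \<omega>2(\<phi>1 u, v) = -\<omega>3(u, v) is what \<phi>2 \<phi>1 = -\<phi>3 becomes when
  the metric is eliminated. Existence of such maps is settled by nondegeneracy elsewhere; here
  everything is deduced from the wedge relations.\<close>

locale su2_form_space =
  fixes V :: "'v::real_vector set" and \<eta> :: "'v \<Rightarrow> real" and \<omega>1 \<omega>2 \<omega>3 :: "'v \<Rightarrow> 'v \<Rightarrow> real"
    and \<xi> :: 'v and \<phi>1 \<phi>2 \<phi>3 :: "'v \<Rightarrow> 'v"
  assumes subspace: "subspace V"
    and eta_lin: "\<And>a b u v. u \<in> V \<Longrightarrow> v \<in> V \<Longrightarrow> \<eta> (a *\<^sub>R u + b *\<^sub>R v) = a * \<eta> u + b * \<eta> v"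
    and forms_lin: "\<forall>\<omega>\<in>{\<omega>1, \<omega>2, \<omega>3}. \<forall>a b. \<forall>u\<in>V. \<forall>v\<in>V. \<forall>w\<in>V.
      \<omega> (a *\<^sub>R u + b *\<^sub>R v) w = a * \<omega> u w + b * \<omega> v w"
    and forms_skew: "\<forall>\<omega>\<in>{\<omega>1, \<omega>2, \<omega>3}. \<forall>u v. \<omega> u v = - \<omega> v u"
    and orth12: "\<And>a b c d. a \<in> V \<Longrightarrow> b \<in> V \<Longrightarrow> c \<in> V \<Longrightarrow> d \<in> V \<Longrightarrow> wedge22 \<omega>1 \<omega>2 a b c d = 0"
    and orth23: "\<And>a b c d. a \<in> V \<Longrightarrow> b \<in> V \<Longrightarrow> c \<in> V \<Longrightarrow> d \<in> V \<Longrightarrow> wedge22 \<omega>2 \<omega>3 a b c d = 0"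
    and orth31: "\<And>a b c d. a \<in> V \<Longrightarrow> b \<in> V \<Longrightarrow> c \<in> V \<Longrightarrow> d \<in> V \<Longrightarrow> wedge22 \<omega>3 \<omega>1 a b c d = 0"
    and norm12: "\<And>a b c d. a \<in> V \<Longrightarrow> b \<in> V \<Longrightarrow> c \<in> V \<Longrightarrow> d \<in> V \<Longrightarrow> wedge22 \<omega>1 \<omega>1 a b c d = wedge22 \<omega>2 \<omega>2 a b c d"
    and norm23: "\<And>a b c d. a \<in> V \<Longrightarrow> b \<in> V \<Longrightarrow> c \<in> V \<Longrightarrow> d \<in> V \<Longrightarrow> wedge22 \<omega>2 \<omega>2 a b c d = wedge22 \<omega>3 \<omega>3 a b c d"
    and nonzero: "\<exists>a\<in>V. \<exists>b\<in>V. \<exists>c\<in>V. \<exists>d\<in>V. wedge22 \<omega>1 \<omega>1 a b c d \<noteq> 0"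
    and xi_eta: "\<xi> \<in> V" "\<eta> \<xi> = 1" and forms_xi: "\<forall>\<omega>\<in>{\<omega>1, \<omega>2, \<omega>3}. \<forall>u\<in>V. \<omega> \<xi> u = 0"
    and forms_nondeg: "\<forall>\<omega>\<in>{\<omega>1, \<omega>2, \<omega>3}. \<forall>u\<in>V. \<eta> u = 0 \<longrightarrow> (\<forall>v\<in>V. \<omega> u v = 0) \<longrightarrow> u = 0"
    and phi_V: "\<And>u. u \<in> V \<Longrightarrow> \<phi>1 u \<in> V" "\<And>u. u \<in> V \<Longrightarrow> \<phi>2 u \<in> V" "\<And>u. u \<in> V \<Longrightarrow> \<phi>3 u \<in> V"
    and eta_phi: "\<And>u. u \<in> V \<Longrightarrow> \<eta> (\<phi>1 u) = 0" "\<And>u. u \<in> V \<Longrightarrow> \<eta> (\<phi>2 u) = 0" "\<And>u. u \<in> V \<Longrightarrow> \<eta> (\<phi>3 u) = 0"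
    and phi1: "\<And>u v. u \<in> V \<Longrightarrow> v \<in> V \<Longrightarrow> \<omega>2 (\<phi>1 u) v = - \<omega>3 u v"
    and phi2: "\<And>u v. u \<in> V \<Longrightarrow> v \<in> V \<Longrightarrow> \<omega>3 (\<phi>2 u) v = - \<omega>1 u v"
    and phi3: "\<And>u v. u \<in> V \<Longrightarrow> v \<in> V \<Longrightarrow> \<omega>1 (\<phi>3 u) v = - \<omega>2 u v"
begin

lemma om_lin: "\<omega> \<in> {\<omega>1, \<omega>2, \<omega>3} \<Longrightarrow> u \<in> V \<Longrightarrow> v \<in> V \<Longrightarrow> w \<in> V \<Longrightarrow>
      \<omega> (a *\<^sub>R u + b *\<^sub>R v) w = a * \<omega> u w + b * \<omega> v w"
  and om_skew: "\<omega> \<in> {\<omega>1, \<omega>2, \<omega>3} \<Longrightarrow> \<omega> u v = - \<omega> v u"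
  and xi: "\<xi> \<in> V" "\<eta> \<xi> = 1" "\<omega> \<in> {\<omega>1, \<omega>2, \<omega>3} \<Longrightarrow> u \<in> V \<Longrightarrow> \<omega> \<xi> u = 0"
  and nondeg: "\<omega> \<in> {\<omega>1, \<omega>2, \<omega>3} \<Longrightarrow> u \<in> V \<Longrightarrow> \<eta> u = 0 \<Longrightarrow> (\<And>v. v \<in> V \<Longrightarrow> \<omega> u v = 0) \<Longrightarrow> u = 0"
  using forms_lin forms_skew xi_eta forms_xi forms_nondeg by meson+

lemma rotate_forms: "su2_form_space V \<eta> \<omega>2 \<omega>3 \<omega>1 \<xi> \<phi>2 \<phi>3 \<phi>1"
proof -
  have i: "{\<omega>2, \<omega>3, \<omega>1} = {\<omega>1, \<omega>2, \<omega>3}" by auto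
  show ?thesis
  proof (unfold_locales, unfold i)
    show "wedge22 \<omega>3 \<omega>3 a b c d = wedge22 \<omega>1 \<omega>1 a b c d" if "a \<in> V" "b \<in> V" "c \<in> V" "d \<in> V" for a b c d
      using norm12[OF that] norm23[OF that] by simp
    show "\<exists>a\<in>V. \<exists>b\<in>V. \<exists>c\<in>V. \<exists>d\<in>V. wedge22 \<omega>2 \<omega>2 a b c d \<noteq> 0" using nonzero norm12 by metis
  qed (fact subspace eta_lin forms_lin forms_skew forms_xi forms_nondeg xi_eta phi_V eta_phi phi1 phi2 phi3
      orth12 orth23 orth31 norm12 norm23)+
qed

lemma om_simps:
  assumes "\<omega> \<in> {\<omega>1, \<omega>2, \<omega>3}" "u \<in> V" "v \<in> V" "w \<in> V"
  shows "\<omega> (u + v) w = \<omega> u w + \<omega> v w" "\<omega> (u - v) w = \<omega> u w - \<omega> v w" "\<omega> (a *\<^sub>R u) w = a * \<omega> u w"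
    "\<omega> (- u) w = - \<omega> u w"
  using om_lin[OF assms, of 1 1] om_lin[OF assms, of 1 "-1"] om_lin[OF assms(1,2,2,4), of a 0]
    om_lin[OF assms(1,2,2,4), of "-1" 0] by simp_all

lemma V_closed: "u \<in> V \<Longrightarrow> v \<in> V \<Longrightarrow> u + v \<in> V" "u \<in> V \<Longrightarrow> v \<in> V \<Longrightarrow> u - v \<in> V"
  "u \<in> V \<Longrightarrow> a *\<^sub>R u \<in> V" "u \<in> V \<Longrightarrow> - u \<in> V"
  using subspace by (simp_all add: subspace_add subspace_diff subspace_scale subspace_neg)

lemma eta_add: "u \<in> V \<Longrightarrow> v \<in> V \<Longrightarrow> \<eta> (u + v) = \<eta> u + \<eta> v" "u \<in> V \<Longrightarrow> v \<in> V \<Longrightarrow> \<eta> (u - v) = \<eta> u - \<eta> v"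
  "u \<in> V \<Longrightarrow> \<eta> (a *\<^sub>R u) = a * \<eta> u" "u \<in> V \<Longrightarrow> \<eta> (- u) = - \<eta> u"
  using eta_lin[of u v 1 1] eta_lin[of u v 1 "-1"] eta_lin[of u u a 0] eta_lin[of u u "-1" 0] by simp_all

lemma unique:
  assumes "\<omega> \<in> {\<omega>1, \<omega>2, \<omega>3}" "u \<in> V" "v \<in> V" "\<eta> u = \<eta> v" "\<And>w. w \<in> V \<Longrightarrow> \<omega> u w = \<omega> v w"
  shows "u = v"
  using nondeg[of \<omega> "u - v"] assms by (simp add: om_simps V_closed eta_add)

text \<open>
  Contracting \<open>\<omega>\<^sub>1 \<and> \<omega>\<^sub>2 = 0\<close> with \<open>x\<close> and \<open>\<omega>\<^sub>1 \<and> \<omega>\<^sub>1 = \<omega>\<^sub>2 \<and> \<omega>\<^sub>2\<close> with \<open>\<phi>\<^sub>3x\<close> shows that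
  \<open>\<omega>\<^sub>1(x,\<cdot>) - \<omega>\<^sub>2(\<phi>\<^sub>3x,\<cdot>)\<close> is annihilated by \<open>\<and> \<omega>\<^sub>2\<close>; a nonzero such 1-form would make \<open>\<omega>\<^sub>2\<close>
  decomposable.
\<close>

lemma phi3':
  assumes x: "x \<in> V" and d: "d \<in> V"
  shows "\<omega>2 (\<phi>3 x) d = \<omega>1 x d"
proof (rule ccontr)
  assume ne: "\<omega>2 (\<phi>3 x) d \<noteq> \<omega>1 x d"
  let ?y = "\<phi>3 x"
  define \<alpha> where "\<alpha> v = \<omega>1 x v - \<omega>2 ?y v" for v
  have y: "?y \<in> V" by (rule phi_V(3)[OF x])
  have a0: "\<alpha> a * \<omega>2 b c - \<alpha> b * \<omega>2 a c + \<alpha> c * \<omega>2 a b = 0" if "a \<in> V" "b \<in> V" "c \<in> V" for a b c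
    using orth12[OF x that] norm12[OF y that] that x
    by (simp add: wedge22_def \<alpha>_def phi3) (simp add: algebra_simps)
  have ad: "\<alpha> d \<noteq> 0" using ne by (simp add: \<alpha>_def)
  define \<beta> where "\<beta> v = \<omega>2 d v / \<alpha> d" for v
  have dec: "\<omega>2 b c = \<alpha> b * \<beta> c - \<alpha> c * \<beta> b" if "b \<in> V" "c \<in> V" for b c
    using a0[OF d that] ad by (simp add: \<beta>_def field_simps)
  obtain a b c e where abce: "a \<in> V" "b \<in> V" "c \<in> V" "e \<in> V" "wedge22 \<omega>1 \<omega>1 a b c e \<noteq> 0"
    using nonzero by blast
  then have "wedge22 \<omega>2 \<omega>2 a b c e \<noteq> 0" using norm12 by simp
  moreover have "wedge22 \<omega>2 \<omega>2 a b c e = 0"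
    using abce by (simp add: wedge22_def dec algebra_simps)
  ultimately show False by simp
qed

end

context su2_form_space
begin

interpretation r: su2_form_space V \<eta> \<omega>2 \<omega>3 \<omega>1 \<xi> \<phi>2 \<phi>3 \<phi>1 by (rule rotate_forms)
interpretation rr: su2_form_space V \<eta> \<omega>3 \<omega>1 \<omega>2 \<xi> \<phi>3 \<phi>1 \<phi>2 by (rule r.rotate_forms)

lemma phi1': "x \<in> V \<Longrightarrow> d \<in> V \<Longrightarrow> \<omega>3 (\<phi>1 x) d = \<omega>2 x d" by (rule r.phi3')
lemma phi2': "x \<in> V \<Longrightarrow> d \<in> V \<Longrightarrow> \<omega>1 (\<phi>2 x) d = \<omega>3 x d" by (rule rr.phi3')

lemmas phis = phi1 phi2 phi3 phi1' phi2' phi3'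

text \<open>Each \<phi>i is governed by two equations, its defining one and the primed one coming
  from the wedge relations; applied in succession they give the square.\<close>

lemma phi3_phi3: "x \<in> V \<Longrightarrow> \<phi>3 (\<phi>3 x) = - x + \<eta> x *\<^sub>R \<xi>"
  by (rule unique[of \<omega>1]) (simp_all add: phis phi_V eta_phi xi V_closed eta_add om_simps)

lemma phi1_phi2: "x \<in> V \<Longrightarrow> \<phi>1 (\<phi>2 x) = \<phi>3 x" and phi2_phi1: "x \<in> V \<Longrightarrow> \<phi>2 (\<phi>1 x) = - \<phi>3 x"
  by (rule unique[of \<omega>2], simp_all add: phis phi_V eta_phi V_closed eta_add om_simps)
    (rule unique[of \<omega>1], simp_all add: phis phi_V eta_phi V_closed eta_add om_simps)

text \<open>Read off from \<omega>3(\<phi>3 x, y) = g(\<phi>3 \<phi>3 x, y) = -g(x, y) + \<eta>(x)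
  \<eta>(y).\<close>

definition metric :: "'v \<Rightarrow> 'v \<Rightarrow> real"
  where "metric x y = (if x \<in> V \<and> y \<in> V then \<eta> x * \<eta> y - \<omega>3 (\<phi>3 x) y else 0)"

lemma phi3_lin: "u \<in> V \<Longrightarrow> v \<in> V \<Longrightarrow> \<phi>3 (a *\<^sub>R u + b *\<^sub>R v) = a *\<^sub>R \<phi>3 u + b *\<^sub>R \<phi>3 v"
  by (rule unique[of \<omega>1]) (simp_all add: phis phi_V eta_phi V_closed eta_add om_simps)

end

context su2_form_space
begin

interpretation r: su2_form_space V \<eta> \<omega>2 \<omega>3 \<omega>1 \<xi> \<phi>2 \<phi>3 \<phi>1 by (rule rotate_forms)
interpretation rr: su2_form_space V \<eta> \<omega>3 \<omega>1 \<omega>2 \<xi> \<phi>3 \<phi>1 \<phi>2 by (rule r.rotate_forms)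

lemma quaternions:
  assumes "x \<in> V"
  shows "\<phi>1 (\<phi>1 x) = - x + \<eta> x *\<^sub>R \<xi>" "\<phi>2 (\<phi>2 x) = - x + \<eta> x *\<^sub>R \<xi>" "\<phi>3 (\<phi>3 x) = - x + \<eta> x *\<^sub>R \<xi>"
    "\<phi>1 (\<phi>2 x) = \<phi>3 x" "\<phi>2 (\<phi>1 x) = - \<phi>3 x" "\<phi>2 (\<phi>3 x) = \<phi>1 x" "\<phi>3 (\<phi>2 x) = - \<phi>1 x"
    "\<phi>3 (\<phi>1 x) = \<phi>2 x" "\<phi>1 (\<phi>3 x) = - \<phi>2 x"
  using phi3_phi3[OF assms] r.phi3_phi3[OF assms] rr.phi3_phi3[OF assms] phi1_phi2[OF assms] phi2_phi1[OF assms]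
    r.phi1_phi2[OF assms] r.phi2_phi1[OF assms] rr.phi1_phi2[OF assms] rr.phi2_phi1[OF assms] by simp_all

lemma phi_lins:
  assumes "u \<in> V" "v \<in> V"
  shows "\<phi>1 (a *\<^sub>R u + b *\<^sub>R v) = a *\<^sub>R \<phi>1 u + b *\<^sub>R \<phi>1 v" "\<phi>2 (a *\<^sub>R u + b *\<^sub>R v) = a *\<^sub>R \<phi>2 u + b *\<^sub>R \<phi>2 v"
    "\<phi>3 (a *\<^sub>R u + b *\<^sub>R v) = a *\<^sub>R \<phi>3 u + b *\<^sub>R \<phi>3 v"
  using phi3_lin[OF assms] r.phi3_lin[OF assms] rr.phi3_lin[OF assms] by simp_all

lemma om_phi_eq:
  assumes "x \<in> V" "y \<in> V"
  shows "\<omega>3 (\<phi>3 x) y = \<omega>2 (\<phi>2 x) y" "\<omega>2 (\<phi>2 x) y = \<omega>1 (\<phi>1 x) y"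
  using assms phi1'[of "\<phi>2 x" y] rr.phi1'[of "\<phi>1 x" y] by (simp_all add: phi_V quaternions)

text \<open>No \<phi>i is known to be skew at this stage. The chain moves x and y across by the
  equations between different forms, and uses that \<omega>i(\<phi>i x, y) is the same for all
  i.\<close>

lemma metric_sym: "metric x y = metric y x"
proof (cases "x \<in> V \<and> y \<in> V")
  case True
  then have x: "x \<in> V" and y: "y \<in> V" by auto
  have "\<omega>3 (\<phi>3 x) y = \<omega>2 (\<phi>2 x) y" by (rule om_phi_eq(1)[OF x y])
  also have "\<dots> = - \<omega>2 y (\<phi>2 x)" by (rule om_skew) simp
  also have "\<dots> = - \<omega>3 (\<phi>1 y) (\<phi>2 x)" using x y by (simp add: phis phi_V)
  also have "\<dots> = \<omega>3 (\<phi>2 x) (\<phi>1 y)" using om_skew[of \<omega>3 "\<phi>1 y" "\<phi>2 x"] by simp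
  also have "\<dots> = - \<omega>1 x (\<phi>1 y)" using x y by (simp add: phis phi_V)
  also have "\<dots> = \<omega>1 (\<phi>1 y) x" using om_skew[of \<omega>1 x "\<phi>1 y"] by simp
  also have "\<dots> = \<omega>3 (\<phi>3 y) x" using om_phi_eq[OF y x] by simp
  finally show ?thesis using True by (simp add: metric_def)
qed (auto simp: metric_def)

lemma metric_lin:
  assumes "u \<in> V" "v \<in> V"
  shows "metric (a *\<^sub>R u + b *\<^sub>R v) w = a * metric u w + b * metric v w"
  using assms by (cases "w \<in> V")
    (simp_all add: metric_def V_closed eta_lin phi_lins om_lin phi_V algebra_simps)

lemma om_metric:
  assumes "x \<in> V" "y \<in> V"
  shows "\<omega>1 x y = metric (\<phi>1 x) y" "\<omega>2 x y = metric (\<phi>2 x) y" "\<omega>3 x y = metric (\<phi>3 x) y"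
proof -
  have m: "metric u y = \<eta> u * \<eta> y - \<omega>1 (\<phi>1 u) y" "metric u y = \<eta> u * \<eta> y - \<omega>2 (\<phi>2 u) y"
    "metric u y = \<eta> u * \<eta> y - \<omega>3 (\<phi>3 u) y" if "u \<in> V" for u
    using that assms(2) om_phi_eq[OF that assms(2)] by (simp_all add: metric_def)
  show "\<omega>1 x y = metric (\<phi>1 x) y"
    using assms m(1)[of "\<phi>1 x"] by (simp add: phi_V eta_phi quaternions om_simps V_closed xi)
  show "\<omega>2 x y = metric (\<phi>2 x) y"
    using assms m(2)[of "\<phi>2 x"] by (simp add: phi_V eta_phi quaternions om_simps V_closed xi)
  show "\<omega>3 x y = metric (\<phi>3 x) y"
    using assms m(3)[of "\<phi>3 x"] by (simp add: phi_V eta_phi quaternions om_simps V_closed xi)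
qed

lemma metric_phi_phi:
  assumes "x \<in> V" "y \<in> V"
  shows "metric (\<phi>1 x) (\<phi>1 y) = metric x y - \<eta> x * \<eta> y" "metric (\<phi>2 x) (\<phi>2 y) = metric x y - \<eta> x * \<eta> y"
    "metric (\<phi>3 x) (\<phi>3 y) = metric x y - \<eta> x * \<eta> y"
proof -
  have m: "metric x y = \<eta> x * \<eta> y - \<omega>1 (\<phi>1 y) x" "metric x y = \<eta> x * \<eta> y - \<omega>2 (\<phi>2 y) x"
    "metric x y = \<eta> x * \<eta> y - \<omega>3 (\<phi>3 y) x"
    unfolding metric_sym[of x y] using assms om_phi_eq[OF assms(2,1)] by (simp_all add: metric_def)
  show "metric (\<phi>1 x) (\<phi>1 y) = metric x y - \<eta> x * \<eta> y"
    using om_metric(1)[OF assms(1) phi_V(1)[OF assms(2)]] om_skew[of \<omega>1 x "\<phi>1 y"] m by simp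
  show "metric (\<phi>2 x) (\<phi>2 y) = metric x y - \<eta> x * \<eta> y"
    using om_metric(2)[OF assms(1) phi_V(2)[OF assms(2)]] om_skew[of \<omega>2 x "\<phi>2 y"] m by simp
  show "metric (\<phi>3 x) (\<phi>3 y) = metric x y - \<eta> x * \<eta> y"
    using om_metric(3)[OF assms(1) phi_V(3)[OF assms(2)]] om_skew[of \<omega>3 x "\<phi>3 y"] m by simp
qed

text \<open>The positivity axiom for the pair (-\<phi>3 u, u) yields only a semidefinite form. A
  null vector of a semidefinite form is in its kernel, and nondegeneracy of \<omega>3 then gives
  definiteness.\<close>

lemma metric_pos:
  assumes pos: "\<And>x y. x \<in> V \<Longrightarrow> y \<in> V \<Longrightarrow> (\<And>z. z \<in> V \<Longrightarrow> \<omega>1 x z = \<omega>2 y z) \<Longrightarrow> 0 \<le> \<omega>3 x y"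
    and y: "y \<in> V" "y \<noteq> 0"
  shows "0 < metric y y"
proof (rule ccontr)
  assume neg: "\<not> 0 < metric y y"
  define q where "q u v = - \<omega>3 (\<phi>3 u) v" for u v
  have q: "q u u \<ge> 0" if "u \<in> V" for u
    using pos[of "- \<phi>3 u" u] that by (simp add: q_def phi_V V_closed om_simps phis)
  have mq: "metric u v = \<eta> u * \<eta> v + q u v" if "u \<in> V" "v \<in> V" for u v using that by (simp add: metric_def q_def)
  have y0: "\<eta> y = 0" "q y y = 0"
    using neg q[OF y(1)] mq[OF y(1) y(1)] by (smt (verit) mult_eq_0_iff zero_le_square)+
  have "\<omega>3 (\<phi>3 y) z = 0" if z: "z \<in> V" for z
  proof -
    have e: "q (z + t *\<^sub>R y) (z + t *\<^sub>R y) = q z z + 2 * t * q y z" for t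
    proof -
      have "metric (1 *\<^sub>R z + t *\<^sub>R y) w = 1 * metric z w + t * metric y w" for w by (rule metric_lin[OF z y(1)])
      then have l: "metric (z + t *\<^sub>R y) w = metric z w + t * metric y w" for w by simp
      have "metric (z + t *\<^sub>R y) (z + t *\<^sub>R y) = metric z z + t * metric y z + t * (metric y z + t * metric y y)"
        using l[of "z + t *\<^sub>R y"] l[of z] l[of y] metric_sym[of z "z + t *\<^sub>R y"]
          metric_sym[of y "z + t *\<^sub>R y"] metric_sym[of z y] by simp
      moreover have "\<eta> (z + t *\<^sub>R y) = \<eta> z" using z y y0 by (simp add: eta_add V_closed)
      ultimately show ?thesis using y0 z y by (simp add: mq V_closed)
    qed
    have "q y z = 0"
    proof (rule ccontr)
      assume nz: "q y z \<noteq> 0"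
      \<comment> \<open>Along the line z + t y the form is affine in t because y is null; this t
        makes its value -1.\<close>
      define t where "t = - (q z z + 1) / (2 * q y z)"
      have "q (z + t *\<^sub>R y) (z + t *\<^sub>R y) = -1" using nz by (simp add: e t_def field_simps)
      moreover have "q (z + t *\<^sub>R y) (z + t *\<^sub>R y) \<ge> 0" by (rule q) (use z y in \<open>simp add: V_closed\<close>)
      ultimately show False by linarith
    qed
    then show ?thesis by (simp add: q_def)
  qed
  then have "\<phi>3 y = 0" by (intro nondeg[of \<omega>3]) (simp_all add: phi_V eta_phi y)
  moreover have "\<phi>3 0 = 0" using phi_lins(3)[of y y 0 0] y by simp
  ultimately show False using quaternions(3)[OF y(1)] y0 y by simp
qed

end


section \<open>The two descriptions of \<open>SU(2)\<close>-structures\<close>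

context manifold
begin

lemma form_sum:
  assumes F: "diff_form A k F" and vs: "length vs = k" "set vs \<subseteq> T p" "i < k"
    and S: "finite S" "S \<subseteq> T p"
  shows "F p (vs[i := \<Sum>u\<in>S. c u *\<^sub>R u]) = (\<Sum>u\<in>S. c u * F p (vs[i := u]))"
  using S
proof (induction S rule: finite_induct)
  case empty
  have "F p (vs[i := 0 *\<^sub>R 0 + 0 *\<^sub>R 0]) = 0 * F p (vs[i := 0]) + 0 * F p (vs[i := 0])"
    by (rule form_linear[OF F vs]) auto
  then show ?case by simp
next
  case (insert u S)
  then have "(\<Sum>u\<in>S. c u *\<^sub>R u) \<in> T p" by (intro T_sum T_scale) auto
  then show ?case using insert form_linear[OF F vs, of u "\<Sum>u\<in>S. c u *\<^sub>R u" "c u" 1] by simp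
qed

text \<open>Vectors on which a top form does not vanish form a basis. Inserting x in the i-th place
  isolates the i-th coefficient of x with respect to that basis.\<close>

lemma top_form_nondegenerate:
  assumes F: "diff_form A CARD('n) F" and ne: "F p \<noteq> 0" and x: "x \<in> T p"
    and 0: "\<And>us i. length us = CARD('n) \<Longrightarrow> set us \<subseteq> T p \<Longrightarrow> i < CARD('n) \<Longrightarrow> F p (us[i := x]) = 0"
  shows "x = 0"
proof -
  obtain vs where nz: "F p vs \<noteq> 0" using ne by (auto simp: fun_eq_iff zero_fun_apply)
  then have vs: "length vs = CARD('n)" "set vs \<subseteq> T p" using form_outside[OF F, of vs p] by auto
  have dup: "F p (vs[i := vs ! j]) = 0" if "i \<noteq> j" "i < CARD('n)" "j < CARD('n)" for i j
  proof -
    have "vs ! j \<in> T p" using vs that by (metis nth_mem subsetD)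
    then have s: "set (vs[i := vs ! j]) \<subseteq> T p" using set_update_subset_insert[of vs i "vs ! j"] vs by blast
    show ?thesis
    proof (cases "i < j")
      case True
      show ?thesis by (rule form_alternating[OF F _ s True that(3)]) (use that vs in auto)
    next
      case False
      then have "j < i" using that by simp
      show ?thesis by (rule form_alternating[OF F _ s \<open>j < i\<close> that(2)]) (use that vs in auto)
    qed
  qed
  have dist: "distinct vs"
    unfolding distinct_conv_nth using dup nz vs by (metis list_update_id)
  have ind: "independent (set vs)"
  proof
    assume "dependent (set vs)"
    then obtain a where a: "a \<in> set vs" "a \<in> span (set vs - {a})" unfolding dependent_def by blast
    then obtain i where i: "i < CARD('n)" "a = vs ! i" using vs by (metis in_set_conv_nth)
    obtain t c where t: "finite t" "t \<subseteq> set vs - {a}" "a = (\<Sum>u\<in>t. c u *\<^sub>R u)"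
      using a(2) unfolding span_explicit by auto
    have "F p vs = F p (vs[i := a])" using i by simp
    also have "\<dots> = (\<Sum>u\<in>t. c u * F p (vs[i := u]))"
      using form_sum[OF F vs i(1) t(1), of c] t(2,3) vs by auto
    also have "\<dots> = 0"
    proof (rule sum.neutral, rule ballI)
      fix u assume "u \<in> t"
      then obtain j where "j < CARD('n)" "u = vs ! j" "u \<noteq> a" using t vs by (metis DiffD1 DiffD2 in_set_conv_nth insertI1 subsetD)
      then show "c u * F p (vs[i := u]) = 0" using dup[of i j] i by auto
    qed
    finally show False using nz by simp
  qed
  have card: "card (set vs) = CARD('n)" using distinct_card[OF dist] vs by simp
  have xs: "x \<in> span (set vs)"
  proof (rule ccontr)
    assume nx: "x \<notin> span (set vs)"
    then have "independent (insert x (set vs))" using ind by (simp add: independent_insert)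
    moreover obtain B where B: "finite B" "span B = T p" "card B = CARD('n)" using finite_basis_T by blast
    ultimately have "card (insert x (set vs)) \<le> CARD('n)"
      using independent_span_bound[of B "insert x (set vs)"] vs x by auto
    moreover have "x \<notin> set vs" using nx span_base by blast
    ultimately show False using card by simp
  qed
  then obtain c where c: "x = (\<Sum>u\<in>set vs. c u *\<^sub>R u)"
    using span_finite[of "set vs"] by auto
  have "c u = 0" if u: "u \<in> set vs" for u
  proof -
    obtain i where i: "i < CARD('n)" "u = vs ! i" using u vs by (metis in_set_conv_nth)
    have "0 = F p (vs[i := x])" using 0[OF vs i(1)] by simp
    also have "\<dots> = (\<Sum>w\<in>set vs. c w * F p (vs[i := w]))"
      unfolding c by (rule form_sum[OF F vs i(1)]) (use vs in auto)
    also have "\<dots> = (\<Sum>w\<in>set vs. if w = u then c w * F p (vs[i := w]) else 0)"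
    proof (rule sum.cong)
      fix w assume "w \<in> set vs"
      then obtain j where "j < CARD('n)" "w = vs ! j" using vs by (metis in_set_conv_nth)
      then show "c w * F p (vs[i := w]) = (if w = u then c w * F p (vs[i := w]) else 0)"
        using dup[of i j] i by auto
    qed simp
    also have "\<dots> = c u * F p vs" using u i by simp
    finally show ?thesis using nz by simp
  qed
  then show "x = 0" unfolding c by simp
qed

text \<open>A skew matrix of odd size is singular, as its determinant is its own negative. The
  kernel vector is found at one point only; smooth dependence on the point is obtained
  later.\<close>

lemma skew_kernel:
  assumes w: "diff_form A 2 \<omega>" and odd: "odd CARD('n)"
  obtains x where "x \<in> T p" "x \<noteq> 0" "\<And>y. y \<in> T p \<Longrightarrow> \<omega> p [x, y] = 0"
proof -
  obtain E \<theta> W where fr: "open W" "p \<in> W" "\<And>i::'n. VF (E i)" "\<And>i. C (\<theta> i)"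
    "\<And>i j q. q \<in> W \<Longrightarrow> E i q (\<theta> j) = (if i = j then 1 else 0)"
    "\<And>q v. q \<in> W \<Longrightarrow> v \<in> T q \<Longrightarrow> v = (\<Sum>i\<in>UNIV. v (\<theta> i) *\<^sub>R E i q)"
    by (rule frame_at[of p]) (rule that)
  define M :: "real^'n^'n" where "M = (\<chi> i j. \<omega> p [E i p, E j p])"
  have M: "M $ j $ i = - (M $ i $ j)" for i j
    unfolding M_def by simp (rule form2_antisym[OF w])
  have "transpose M = (\<chi> i. (- 1) *s (M $ i))"
    unfolding vec_eq_iff
  proof (intro allI)
    fix i j show "transpose M $ i $ j = (\<chi> i. (- 1) *s (M $ i)) $ i $ j"
      using M[of i j] by (simp add: transpose_def)
  qed
  then have "det M = det (\<chi> i. (- 1) *s (M $ i))" by (metis det_transpose)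
  also have "\<dots> = (\<Prod>i::'n\<in>UNIV. - 1) * det (\<chi> i. M $ i)" by (rule det_rows_mul)
  also have "\<dots> = - det M" using odd by simp
  finally have "det M = 0" by simp
  then have "\<not> (\<forall>z. M *v z = 0 \<longrightarrow> z = 0)"
    by (metis invertible_det_nz invertible_left_inverse matrix_left_invertible_ker)
  then obtain z where z: "M *v z = 0" "z \<noteq> 0" by blast
  define x where "x = (\<Sum>j\<in>UNIV. z $ j *\<^sub>R E j p)"
  have xT: "x \<in> T p" unfolding x_def by (intro T_sum T_scale VF_T fr(3))
  note B = bilinear_field_form2[OF w]
  have Ex: "\<omega> p [E i p, x] = 0" for i
    using arg_cong[OF z(1), of "\<lambda>v. v $ i"] fr
      bilinear_field_sum_right[OF B, of UNIV "\<lambda>j. E j p" p "E i p" "\<lambda>j. z $ j"]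
    by (simp add: x_def M_def matrix_vector_mult_def mult.commute)
  show thesis
  proof (rule that[OF xT])
    show "x \<noteq> 0"
    proof
      assume "x = 0"
      then have "x (\<theta> j) = 0" for j by (simp add: pointwise)
      then have "z $ j = 0" for j
        by (simp add: x_def sum_fun_apply pointwise fr(5)[OF fr(2)] mult_delta)
      then show False using z(2) by (simp add: vec_eq_iff)
    qed
    fix y assume y: "y \<in> T p"
    have "\<omega> p [y, x] = (\<Sum>i\<in>UNIV. y (\<theta> i) * \<omega> p [E i p, x])"
      using bilinear_field_sum_left[OF B, of UNIV "\<lambda>j. E j p" p x "\<lambda>j. y (\<theta> j)"] fr(6)[OF fr(2) y] fr xT by simp
    then show "\<omega> p [x, y] = 0" using form2_antisym[OF w, of p x y] by (simp add: Ex)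
  qed
qed

text \<open>Solves B(\<phi>u, v) = b(u, v). The solution is chosen at each point; smoothness follows
  because on a vector field it agrees, by uniqueness, with the field supplied by
  \<open>duality\<close>.\<close>

lemma endo_from_bilinear:
  assumes B: "bilinear_field B"
    and nd: "\<And>p u. u \<in> T p \<Longrightarrow> (\<And>v. v \<in> T p \<Longrightarrow> B p u v = 0) \<Longrightarrow> u = 0"
    and b: "bilinear_field b"
  obtains \<phi> where "endo_field A \<phi>" "\<And>p u v. u \<in> T p \<Longrightarrow> v \<in> T p \<Longrightarrow> B p (\<phi> p u) v = b p u v"
proof -
  have field: "\<exists>Z. VF Z \<and> (\<forall>Y p. VF Y \<longrightarrow> B p (Z p) (Y p) = b p (X p) (Y p))" if X: "VF X" for X
  proof -
    have "tensorial (\<lambda>Y p. b p (X p) (Y p))"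
      unfolding tensorial_def
    proof (intro conjI allI impI)
      fix Y Z p assume "VF Y" "VF Z"
      then have "b p (X p) (1 *\<^sub>R Y p + 1 *\<^sub>R Z p) = 1 * b p (X p) (Y p) + 1 * b p (X p) (Z p)"
        using b[unfolded bilinear_field_def] X by (intro b[unfolded bilinear_field_def, THEN conjunct2, THEN conjunct1, rule_format]) auto
      then show "b p (X p) (Y p + Z p) = b p (X p) (Y p) + b p (X p) (Z p)" by simp
    next
      fix f Y p assume "C f" "VF Y"
      then have "b p (X p) (f p *\<^sub>R Y p + 0 *\<^sub>R Y p) = f p * b p (X p) (Y p) + 0 * b p (X p) (Y p)"
        using X by (intro b[unfolded bilinear_field_def, THEN conjunct2, THEN conjunct1, rule_format]) auto
      then show "b p (X p) (f p *\<^sub>R Y p) = f p *\<^sub>R b p (X p) (Y p)" by simp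
    qed
    then show ?thesis
    proof (rule duality[OF B, rotated])
      show "C (\<lambda>p. b p (X p) (Y p))" if "VF Y" for Y
        by (rule b[unfolded bilinear_field_def, THEN conjunct2, THEN conjunct2, rule_format, OF X that])
      show "u = 0" if "u \<in> T p" "\<And>v. v \<in> T p \<Longrightarrow> B p u v = 0" for p u by (rule nd[OF that])
      show ?thesis if "VF Z" "\<And>Y p. VF Y \<Longrightarrow> B p (Z p) (Y p) = b p (X p) (Y p)" for Z
        using that by blast
    qed
  qed
  have uniq: "z = z'" if "z \<in> T p" "z' \<in> T p" "\<And>v. v \<in> T p \<Longrightarrow> B p z v = B p z' v" for p z z'
  proof -
    have "z - z' = 0"
    proof (rule nd[OF T_diff[OF that(1,2)]])
      fix v assume v: "v \<in> T p"
      have "B p (1 *\<^sub>R z + (-1) *\<^sub>R z') v = 1 * B p z v + (-1) * B p z' v"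
        by (rule B[unfolded bilinear_field_def, THEN conjunct1, rule_format, OF that(1,2) v])
      then show "B p (z - z') v = 0" using that(3)[OF v] by simp
    qed
    then show ?thesis by simp
  qed
  have ex: "\<exists>z\<in>T p. \<forall>v\<in>T p. B p z v = b p u v" if u: "u \<in> T p" for p u
  proof -
    obtain Z where "VF Z" "\<And>Y q. VF Y \<Longrightarrow> B q (Z q) (Y q) = b q (extend p u q) (Y q)"
      using field[OF VF_extend[OF u]] by blast
    then show ?thesis
      using extend[of _ p] u by (intro bexI[of _ "Z p"] ballI) (metis, simp)
  qed
  define \<phi> where "\<phi> p u = (if u \<in> T p then SOME z. z \<in> T p \<and> (\<forall>v\<in>T p. B p z v = b p u v) else 0)" for p u
  have \<phi>: "\<phi> p u \<in> T p \<and> (\<forall>v\<in>T p. B p (\<phi> p u) v = b p u v)" if "u \<in> T p" for p u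
    using someI_ex[of "\<lambda>z. z \<in> T p \<and> (\<forall>v\<in>T p. B p z v = b p u v)"] ex[OF that] that
    by (auto simp: \<phi>_def)
  show thesis
  proof (rule that[of \<phi>])
    show "B p (\<phi> p u) v = b p u v" if "u \<in> T p" "v \<in> T p" for p u v using \<phi> that by blast
    show "endo_field A \<phi>"
      unfolding endo_field_def
    proof (intro conjI allI impI ballI)
      show "\<phi> p v = 0" if "v \<notin> T p" for p v using that by (simp add: \<phi>_def)
    next
      fix p c d v w assume v: "v \<in> T p" and w: "w \<in> T p"
      show "\<phi> p (c *\<^sub>R v + d *\<^sub>R w) = c *\<^sub>R \<phi> p v + d *\<^sub>R \<phi> p w"
      proof (rule uniq)
        fix u assume u: "u \<in> T p"
        have "B p (c *\<^sub>R \<phi> p v + d *\<^sub>R \<phi> p w) u = c * B p (\<phi> p v) u + d * B p (\<phi> p w) u"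
          by (rule B[unfolded bilinear_field_def, THEN conjunct1, rule_format]) (use \<phi> v w u in auto)
        also have "\<dots> = c * b p v u + d * b p w u" using \<phi> v w u by simp
        also have "\<dots> = b p (c *\<^sub>R v + d *\<^sub>R w) u"
          by (rule b[unfolded bilinear_field_def, THEN conjunct1, rule_format, OF v w u, symmetric])
        also have "\<dots> = B p (\<phi> p (c *\<^sub>R v + d *\<^sub>R w)) u"
          using \<phi>[OF T_add[OF T_scale[OF v] T_scale[OF w]]] u by simp
        finally show "B p (\<phi> p (c *\<^sub>R v + d *\<^sub>R w)) u = B p (c *\<^sub>R \<phi> p v + d *\<^sub>R \<phi> p w) u" ..
      qed (use \<phi> v w in \<open>auto intro!: T_add T_scale\<close>)
    next
      fix X assume X: "VF X"
      obtain Z where Z: "VF Z" "\<And>Y q. VF Y \<Longrightarrow> B q (Z q) (Y q) = b q (X q) (Y q)"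
        using field[OF X] by blast
      have "\<phi> p (X p) = Z p" for p
      proof (rule uniq)
        fix v assume v: "v \<in> T p"
        show "B p (\<phi> p (X p)) v = B p (Z p) v"
          using \<phi>[OF VF_T[OF X]] Z(2)[OF VF_extend[OF v], of p] extend_apply[OF v] v by simp
      qed (use \<phi> X Z in auto)
      then show "VF (\<lambda>p. \<phi> p (X p))" using Z by simp
    qed
  qed
qed

end

locale manifold5 = manifold A for A :: "('a::{t2_space, second_countable_topology}, real ^ 5) atlas"
begin

lemma riemannian_manifoldI: "riemannian_metric A g \<Longrightarrow> riemannian_manifold A g"
  by unfold_locales

lemma inner_space_T:
  assumes "riemannian_metric A g"
  shows "inner_space (T p) (g p) 5"
proof -
  interpret riemannian_manifold A g by unfold_locales (rule assms)
  show ?thesis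
  proof
    show "\<exists>B. finite B \<and> independent B \<and> span B = T p \<and> card B = 5" using finite_basis_T[of p] by simp
  qed (fact subspace_T g_lin g_sym g_pos)+
qed

lemma
  assumes "endo_field A \<phi>"
  shows endo_T: "v \<in> T p \<Longrightarrow> \<phi> p v \<in> T p"
    and endo_lin: "v \<in> T p \<Longrightarrow> w \<in> T p \<Longrightarrow> \<phi> p (a *\<^sub>R v + b *\<^sub>R w) = a *\<^sub>R \<phi> p v + b *\<^sub>R \<phi> p w"
    and endo_VF: "VF X \<Longrightarrow> VF (\<lambda>p. \<phi> p (X p))"
    and endo_outside: "v \<notin> T p \<Longrightarrow> \<phi> p v = 0"
proof -
  show VF: "VF X \<Longrightarrow> VF (\<lambda>p. \<phi> p (X p))" and "v \<notin> T p \<Longrightarrow> \<phi> p v = 0"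
    and "v \<in> T p \<Longrightarrow> w \<in> T p \<Longrightarrow> \<phi> p (a *\<^sub>R v + b *\<^sub>R w) = a *\<^sub>R \<phi> p v + b *\<^sub>R \<phi> p w" for X
    using assms unfolding endo_field_def by simp_all
  show "\<phi> p v \<in> T p" if v: "v \<in> T p"
    using VF_T[OF VF[OF VF_extend[OF v]], of p] extend_apply[OF v] by simp
qed

lemma acmD:
  assumes "almost_contact_metric A \<phi> \<xi> \<eta> g"
  shows "endo_field A \<phi>" "VF \<xi>" "diff_form A 1 \<eta>" "riemannian_metric A g"
    "v \<in> T p \<Longrightarrow> \<phi> p (\<phi> p v) = - v + \<eta> p [v] *\<^sub>R \<xi> p" "\<eta> p [\<xi> p] = 1"
    "v \<in> T p \<Longrightarrow> w \<in> T p \<Longrightarrow> g p (\<phi> p v) (\<phi> p w) = g p v w - \<eta> p [v] * \<eta> p [w]"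
  using assms unfolding almost_contact_metric_def by simp_all

lemma acm_space_at:
  assumes "almost_contact_metric A \<phi> \<xi> \<eta> g"
  shows "acm_space (T p) (g p) (\<phi> p) (\<xi> p) (\<lambda>v. \<eta> p [v])"
proof -
  note a = acmD[OF assms]
  interpret inner_space "T p" "g p" 5 by (rule inner_space_T[OF a(4)])
  show ?thesis
    by unfold_locales (simp_all add: endo_T[OF a(1)] endo_lin[OF a(1)] form1_lin[OF a(3)] a)
qed

lemma su2_tripleD:
  assumes "su2_triple A \<phi>1 \<phi>2 \<phi>3 \<xi> \<eta> g"
  shows "almost_contact_metric A \<phi>1 \<xi> \<eta> g" "almost_contact_metric A \<phi>2 \<xi> \<eta> g" "almost_contact_metric A \<phi>3 \<xi> \<eta> g"
    "endo_field A \<phi>1" "endo_field A \<phi>2" "endo_field A \<phi>3" "VF \<xi>" "diff_form A 1 \<eta>" "riemannian_metric A g"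
proof -
  note 1 = assms[unfolded su2_triple_def, THEN conjunct2, THEN conjunct1, rule_format]
  show a: "almost_contact_metric A \<phi>1 \<xi> \<eta> g" "almost_contact_metric A \<phi>2 \<xi> \<eta> g" "almost_contact_metric A \<phi>3 \<xi> \<eta> g"
    by (rule 1, simp)+
  show "endo_field A \<phi>1" "endo_field A \<phi>2" "endo_field A \<phi>3" "VF \<xi>" "diff_form A 1 \<eta>" "riemannian_metric A g"
    by (rule acmD[OF a(1)] acmD[OF a(2)] acmD[OF a(3)])+
qed

lemma su2_space_at:
  assumes "su2_triple A \<phi>1 \<phi>2 \<phi>3 \<xi> \<eta> g"
  shows "su2_space (T p) (g p) (\<phi>1 p) (\<phi>2 p) (\<phi>3 p) (\<xi> p) (\<lambda>v. \<eta> p [v])"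
proof -
  note q = assms[unfolded su2_triple_def, THEN conjunct2, THEN conjunct2]
  have q1: "\<phi>1 p (\<phi>2 p u) = \<phi>3 p u \<and> \<phi>3 p u = - \<phi>2 p (\<phi>1 p u)" if "u \<in> T p" for u
    using bspec[OF q, of "(\<phi>1, \<phi>2, \<phi>3)"] that by (simp only: insert_iff simp_thms prod.case)
  have q2: "\<phi>2 p (\<phi>3 p u) = \<phi>1 p u \<and> \<phi>1 p u = - \<phi>3 p (\<phi>2 p u)" if "u \<in> T p" for u
    using bspec[OF q, of "(\<phi>2, \<phi>3, \<phi>1)"] that by (simp only: insert_iff simp_thms prod.case)
  have q3: "\<phi>3 p (\<phi>1 p u) = \<phi>2 p u \<and> \<phi>2 p u = - \<phi>1 p (\<phi>3 p u)" if "u \<in> T p" for u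
    using bspec[OF q, of "(\<phi>3, \<phi>1, \<phi>2)"] that by (simp only: insert_iff simp_thms prod.case)
  have q': "\<phi>2 p (\<phi>1 p u) = - \<phi>3 p u" "\<phi>3 p (\<phi>2 p u) = - \<phi>1 p u" "\<phi>1 p (\<phi>3 p u) = - \<phi>2 p u"
    if "u \<in> T p" for u
    using q1[OF that] q2[OF that] q3[OF that] by (metis minus_minus)+
  show ?thesis
    unfolding su2_space_def su2_space_axioms_def
    by (intro conjI allI impI acm_space_at su2_tripleD(1-3)[OF assms]) (use q1 q2 q3 q' in blast)+
qed

text \<open>Uniqueness: the forms determine \<open>\<xi>\<close> as kernel, then \<open>\<phi>\<close> by \<open>\<omega>\<^sub>1(\<phi>x,y) = -\<omega>\<^sub>2(x,y)\<close>, and then \<open>g\<close>.\<close>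

lemma third_acm_unique:
  assumes "third_acm A s n" "third_acm A s n'"
  shows "n = n'"
proof -
  obtain \<eta> \<omega>1 \<omega>2 \<omega>3 where s: "s = (\<eta>, \<omega>1, \<omega>2, \<omega>3)" by (cases s)
  obtain \<phi> \<xi> \<eta>1 g where n: "n = (\<phi>, \<xi>, \<eta>1, g)" by (cases n)
  obtain \<psi> \<zeta> \<eta>2 k where n': "n' = (\<psi>, \<zeta>, \<eta>2, k)" by (cases n')
  have e: "\<eta>1 = \<eta>" "\<eta>2 = \<eta>" using assms unfolding third_acm_def s n n' by simp_all
  obtain \<phi>1 \<phi>2 where t: "su2_triple A \<phi>1 \<phi>2 \<phi> \<xi> \<eta> g"
    and w: "\<And>p v w. v \<in> T p \<Longrightarrow> w \<in> T p \<Longrightarrow> \<omega>1 p [v, w] = g p (\<phi>1 p v) w"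
      "\<And>p v w. v \<in> T p \<Longrightarrow> w \<in> T p \<Longrightarrow> \<omega>2 p [v, w] = g p (\<phi>2 p v) w"
      "\<And>p v w. v \<in> T p \<Longrightarrow> w \<in> T p \<Longrightarrow> \<omega>3 p [v, w] = g p (\<phi> p v) w"
    using assms(1) unfolding third_acm_def s n by auto
  obtain \<psi>1 \<psi>2 where t': "su2_triple A \<psi>1 \<psi>2 \<psi> \<zeta> \<eta> k"
    and w': "\<And>p v w. v \<in> T p \<Longrightarrow> w \<in> T p \<Longrightarrow> \<omega>1 p [v, w] = k p (\<psi>1 p v) w"
      "\<And>p v w. v \<in> T p \<Longrightarrow> w \<in> T p \<Longrightarrow> \<omega>2 p [v, w] = k p (\<psi>2 p v) w"
      "\<And>p v w. v \<in> T p \<Longrightarrow> w \<in> T p \<Longrightarrow> \<omega>3 p [v, w] = k p (\<psi> p v) w"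
    using assms(2) unfolding third_acm_def s n' by auto
  have all: "\<zeta> p = \<xi> p \<and> \<psi> p v = \<phi> p v \<and> k p v u = g p v u" for p v u
  proof -
    interpret S: su2_space "T p" "g p" "\<phi>1 p" "\<phi>2 p" "\<phi> p" "\<xi> p" "\<lambda>v. \<eta> p [v]" by (rule su2_space_at[OF t])
    interpret S': su2_space "T p" "k p" "\<psi>1 p" "\<psi>2 p" "\<psi> p" "\<zeta> p" "\<lambda>v. \<eta> p [v]" by (rule su2_space_at[OF t'])
    have nd: "x = y" if "x \<in> T p" "y \<in> T p" "\<eta> p [x] = \<eta> p [y]" "\<And>z. z \<in> T p \<Longrightarrow> \<omega>1 p [x, z] = \<omega>1 p [y, z]" for x y
    proof -
      have "\<phi>1 p x = \<phi>1 p y" by (rule S.A1.eqI) (use that w in simp_all)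
      then have "\<phi>1 p (\<phi>1 p x) = \<phi>1 p (\<phi>1 p y)" by simp
      then show ?thesis using that by (simp add: S.A1.phi_phi)
    qed
    have z: "\<zeta> p = \<xi> p"
    proof (rule nd)
      fix z assume z: "z \<in> T p"
      have "\<omega>1 p [\<zeta> p, z] = 0" using w'(1)[OF _ z, of "\<zeta> p"] by simp
      moreover have "\<omega>1 p [\<xi> p, z] = 0" using w(1)[OF _ z, of "\<xi> p"] by simp
      ultimately show "\<omega>1 p [\<zeta> p, z] = \<omega>1 p [\<xi> p, z]" by simp
    qed simp_all
    have f: "\<psi> p x = \<phi> p x" if x: "x \<in> T p" for x
    proof (rule nd)
      fix y assume y: "y \<in> T p"
      have "\<omega>1 p [\<psi> p x, y] = - \<omega>2 p [x, y]"
        using x y by (simp add: w' S'.quaternion S'.A1.minus_left)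
      moreover have "\<omega>1 p [\<phi> p x, y] = - \<omega>2 p [x, y]"
        using x y by (simp add: w S.quaternion S.A1.minus_left)
      ultimately show "\<omega>1 p [\<psi> p x, y] = \<omega>1 p [\<phi> p x, y]" by simp
    qed (use x in simp_all)
    have "k p x y = g p x y" if "x \<in> T p" "y \<in> T p" for x y
      using w(3)[of x p "\<phi> p y"] w'(3)[of x p "\<phi> p y"] f that S.A3.g_phi_phi[of x y] S'.A3.g_phi_phi[of x y] by simp
    moreover have "k p x y = 0" "g p x y = 0" if "\<not> (x \<in> T p \<and> y \<in> T p)" for x y
      using that su2_tripleD(9)[OF t] su2_tripleD(9)[OF t']
      by (simp_all add: riemannian_manifold.g_outside[OF riemannian_manifoldI])
    moreover have "\<psi> p x = \<phi> p x" if "x \<notin> T p" for x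
      using endo_outside[OF su2_tripleD(6)[OF t] that] endo_outside[OF su2_tripleD(6)[OF t'] that] by simp
    ultimately show ?thesis using z f by metis
  qed
  have "\<zeta> = \<xi>" "\<psi> = \<phi>" "k = g" using all by (auto intro!: ext)
  then show ?thesis using e by (simp add: n n')
qed

text \<open>From description (i) to description (ii): the wedge relations are pointwise identities
  in a quaternionic basis, v is \<omega>1 \<and> \<omega>1, and the list e, \<phi>1 e, \<phi>2 e,
  \<phi>3 e with \<xi> shows that v \<and> \<eta> is nonzero.\<close>

lemma su2_forms_of_triple:
  assumes t: "su2_triple A \<phi>1 \<phi>2 \<phi>3 \<xi> \<eta> g"
    and d: "diff_form A 2 \<omega>1" "diff_form A 2 \<omega>2" "diff_form A 2 \<omega>3"
    and w: "\<And>p v w. v \<in> T p \<Longrightarrow> w \<in> T p \<Longrightarrow> \<omega>1 p [v, w] = g p (\<phi>1 p v) w"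
      "\<And>p v w. v \<in> T p \<Longrightarrow> w \<in> T p \<Longrightarrow> \<omega>2 p [v, w] = g p (\<phi>2 p v) w"
      "\<And>p v w. v \<in> T p \<Longrightarrow> w \<in> T p \<Longrightarrow> \<omega>3 p [v, w] = g p (\<phi>3 p v) w"
  shows "su2_forms A \<eta> \<omega>1 \<omega>2 \<omega>3"
proof -
  have d4: "diff_form A 4 (wedge 2 2 \<alpha> \<beta>)" if "diff_form A 2 \<alpha>" "diff_form A 2 \<beta>" for \<alpha> \<beta>
    using diff_form_wedge[OF that] by simp
  have z4: "diff_form A 4 0" using diff_form_scale[OF d4[OF d(1) d(1)], of 0] by simp
  have W: "wedge 2 2 \<alpha> \<beta> p [a, b, c, e] = wedge22 (\<lambda>x y. \<alpha> p [x, y]) (\<lambda>x y. \<beta> p [x, y]) a b c e"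
    if "diff_form A 2 \<alpha>" "diff_form A 2 \<beta>" for \<alpha> \<beta> p a b c e
    unfolding wedge22_def by (rule wedge_2_2) (rule form2_antisym[OF that(1)], rule form2_antisym[OF that(2)])
  have len4: "\<exists>a b c e. vs = [a, b, c, e] \<and> {a, b, c, e} \<subseteq> T p" if "length vs = 4" "set vs \<subseteq> T p" for vs p
    using that by (auto simp: length_Suc_conv eval_nat_numeral)
  have eq: "wedge 2 2 \<omega>1 \<omega>1 = wedge 2 2 \<omega>2 \<omega>2 \<and> wedge 2 2 \<omega>2 \<omega>2 = wedge 2 2 \<omega>3 \<omega>3 \<and>
    wedge 2 2 \<omega>1 \<omega>2 = 0 \<and> wedge 2 2 \<omega>2 \<omega>3 = 0 \<and> wedge 2 2 \<omega>3 \<omega>1 = 0 \<and>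
    wedge 2 2 \<omega>2 \<omega>1 = 0 \<and> wedge 2 2 \<omega>3 \<omega>2 = 0 \<and> wedge 2 2 \<omega>1 \<omega>3 = 0"
  proof (intro conjI; rule form_eqI[of 4])
    fix p vs assume "length vs = 4" "set vs \<subseteq> T p"
    then obtain a b c e where vs: "vs = [a, b, c, e]" and T: "a \<in> T p" "b \<in> T p" "c \<in> T p" "e \<in> T p"
      using len4[of vs p] by auto
    interpret S: su2_space "T p" "g p" "\<phi>1 p" "\<phi>2 p" "\<phi>3 p" "\<xi> p" "\<lambda>v. \<eta> p [v]" by (rule su2_space_at[OF t])
    interpret S2: su2_space "T p" "g p" "\<phi>2 p" "\<phi>3 p" "\<phi>1 p" "\<xi> p" "\<lambda>v. \<eta> p [v]" by (rule S.rotate)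
    interpret S3: su2_space "T p" "g p" "\<phi>3 p" "\<phi>1 p" "\<phi>2 p" "\<xi> p" "\<lambda>v. \<eta> p [v]" by (rule S2.rotate)
    note o = S.wedge22_orthogonal[OF T] S2.wedge22_orthogonal[OF T] S3.wedge22_orthogonal[OF T]
    show "wedge 2 2 \<omega>1 \<omega>1 p vs = wedge 2 2 \<omega>2 \<omega>2 p vs" "wedge 2 2 \<omega>2 \<omega>2 p vs = wedge 2 2 \<omega>3 \<omega>3 p vs"
      "wedge 2 2 \<omega>1 \<omega>2 p vs = 0 p vs" "wedge 2 2 \<omega>2 \<omega>3 p vs = 0 p vs" "wedge 2 2 \<omega>3 \<omega>1 p vs = 0 p vs"
      "wedge 2 2 \<omega>2 \<omega>1 p vs = 0 p vs" "wedge 2 2 \<omega>3 \<omega>2 p vs = 0 p vs" "wedge 2 2 \<omega>1 \<omega>3 p vs = 0 p vs"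
      using o T by (simp_all add: vs W d wedge22_def w pointwise) (simp_all add: mult.commute add.commute algebra_simps)
  qed (use d4 d z4 in auto)
  have nz: "wedge 4 1 (wedge 2 2 \<omega>1 \<omega>1) \<eta> p \<noteq> 0" for p
  proof -
    interpret S: su2_space "T p" "g p" "\<phi>1 p" "\<phi>2 p" "\<phi>3 p" "\<xi> p" "\<lambda>v. \<eta> p [v]" by (rule su2_space_at[OF t])
    obtain e where e: "e \<in> T p" "\<eta> p [e] = 0"
      "wedge22 (\<lambda>x. g p (\<phi>1 p x)) (\<lambda>x. g p (\<phi>1 p x)) e (\<phi>1 p e) (\<phi>2 p e) (\<phi>3 p e) \<noteq> 0"
      by (rule S.wedge22_nonzero)
    show ?thesis
      by (rule wedge_4_1_nonzero[OF d4[OF d(1) d(1)], of "[e, \<phi>1 p e, \<phi>2 p e, \<phi>3 p e]" p "\<xi> p" \<eta>])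
        (use e in \<open>auto simp: W d wedge22_def w\<close>)
  qed
  have pos: "0 \<le> \<omega>3 p [x, y]"
    if xy: "x \<in> T p" "y \<in> T p" and eq: "\<forall>z\<in>T p. \<omega>1 p [x, z] = \<omega>2 p [y, z]" for p x y
  proof -
    interpret S: su2_space "T p" "g p" "\<phi>1 p" "\<phi>2 p" "\<phi>3 p" "\<xi> p" "\<lambda>v. \<eta> p [v]" by (rule su2_space_at[OF t])
    \<comment> \<open>Applying \<phi>1 once more gives x = \<eta>(x) \<xi> - \<phi>3 y, so that
      \<omega>3(x, y) is the squared length of \<phi>3 y.\<close>
    have "\<phi>1 p x = \<phi>2 p y" by (rule S.A1.eqI) (use eq xy w in simp_all)
    then have "\<phi>1 p (\<phi>1 p x) = \<phi>3 p y" using xy by (simp add: S.quaternion)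
    then have x: "x = \<eta> p [x] *\<^sub>R \<xi> p - \<phi>3 p y" using xy by (simp add: S.A1.phi_phi algebra_simps)
    have "\<omega>3 p [x, y] = g p (\<phi>3 p x) y" using xy w by simp
    also have "\<phi>3 p x = \<phi>3 p (\<eta> p [x] *\<^sub>R \<xi> p - \<phi>3 p y)" using x by (rule arg_cong)
    also have "\<dots> = - \<phi>3 p (\<phi>3 p y)" using xy by (simp add: S.A3.phi_simps)
    also have "g p (- \<phi>3 p (\<phi>3 p y)) y = g p (\<phi>3 p y) (\<phi>3 p y)"
      using xy S.A3.phi_skew[of "\<phi>3 p y" y] by (simp add: S.A1.minus_left)
    also have "\<dots> \<ge> 0" using S.A1.pos[of "\<phi>3 p y"] xy by (cases "\<phi>3 p y = 0") auto
    finally show ?thesis .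
  qed
  show ?thesis
    unfolding su2_forms_def
  proof (intro conjI)
    show "\<exists>v. diff_form A 4 v \<and> (\<forall>i<3. \<forall>j<3. wedge 2 2 ([\<omega>1, \<omega>2, \<omega>3] ! i) ([\<omega>1, \<omega>2, \<omega>3] ! j) = (if i = j then v else 0)) \<and>
      (\<forall>p. wedge 4 1 v \<eta> p \<noteq> 0)"
    proof (intro exI[of _ "wedge 2 2 \<omega>1 \<omega>1"] conjI allI impI)
      fix i j :: nat assume "i < 3" "j < 3"
      then have "(i = 0 \<or> i = 1 \<or> i = 2)" "(j = 0 \<or> j = 1 \<or> j = 2)" by auto
      then show "wedge 2 2 ([\<omega>1, \<omega>2, \<omega>3] ! i) ([\<omega>1, \<omega>2, \<omega>3] ! j) = (if i = j then wedge 2 2 \<omega>1 \<omega>1 else 0)"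
        using eq by (elim disjE) simp_all
    qed (use d4 d nz in auto)
  qed (use d su2_tripleD(8)[OF t] pos in auto)
qed

end


context manifold5
begin

text \<open>From description (ii) to description (i). The volume condition v \<and> \<eta> \<noteq>
  0 yields nondegeneracy, odd dimension yields kernels, and bilinear fields of the form \<omega> +
  \<eta> \<otimes> \<eta> convert both into smooth objects.\<close>

lemma third_acm_exists:
  assumes su2: "su2_forms A \<eta> \<omega>1 \<omega>2 \<omega>3"
  shows "\<exists>n. third_acm A (\<eta>, \<omega>1, \<omega>2, \<omega>3) n"
proof -
  have eta: "diff_form A 1 \<eta>" and d: "diff_form A 2 \<omega>1" "diff_form A 2 \<omega>2" "diff_form A 2 \<omega>3"
    using su2 unfolding su2_forms_def by auto
  obtain v where v: "diff_form A 4 v" and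
    vw: "\<And>i j. i < 3 \<Longrightarrow> j < 3 \<Longrightarrow> wedge 2 2 ([\<omega>1, \<omega>2, \<omega>3] ! i) ([\<omega>1, \<omega>2, \<omega>3] ! j) = (if i = j then v else 0)"
    and ne: "\<And>p. wedge 4 1 v \<eta> p \<noteq> 0"
    using su2 unfolding su2_forms_def by blast
  have W: "wedge 2 2 \<omega>1 \<omega>1 = v" "wedge 2 2 \<omega>2 \<omega>2 = v" "wedge 2 2 \<omega>3 \<omega>3 = v"
    "wedge 2 2 \<omega>1 \<omega>2 = 0" "wedge 2 2 \<omega>2 \<omega>3 = 0" "wedge 2 2 \<omega>3 \<omega>1 = 0"
    using vw[of 0 0] vw[of 1 1] vw[of 2 2] vw[of 0 1] vw[of 1 2] vw[of 2 0] by simp_all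
  have pos: "0 \<le> \<omega>3 p [x, y]" if "x \<in> T p" "y \<in> T p" "\<And>z. z \<in> T p \<Longrightarrow> \<omega>1 p [x, z] = \<omega>2 p [y, z]" for p x y
    using su2 that unfolding su2_forms_def by blast
  have dw: "diff_form A 2 \<omega>" "wedge 2 2 \<omega> \<omega> = v" if "\<omega> \<in> {\<omega>1, \<omega>2, \<omega>3}" for \<omega>
    using that d W by auto
  have F: "diff_form A CARD(5) (wedge 4 1 v \<eta>)" using diff_form_wedge[OF v eta] by simp
  \<comment> \<open>A vector annihilated by \<eta> and by v is annihilated by the top form v \<and>
    \<eta> in every place.\<close>
  have N: "x = 0" if x: "x \<in> T p" "\<eta> p [x] = 0"
    "\<And>us j. length us = 4 \<Longrightarrow> set us \<subseteq> T p \<Longrightarrow> j < 4 \<Longrightarrow> v p (us[j := x]) = 0" for p x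
  proof (rule top_form_nondegenerate[OF F ne x(1)])
    fix us i assume us: "length us = CARD(5)" "set us \<subseteq> T p" "i < CARD(5)"
    show "wedge 4 1 v \<eta> p (us[i := x]) = 0"
    proof (rule wedge_update_zero)
      show "v p (us[j := x]) = 0" if "length us = 4" "set us \<subseteq> T p" "j < 4" for us j by (rule x(3)[OF that])
      show "\<eta> p (us[j := x]) = 0" if "length us = 1" "j < 1" for us j
        using that x(2) by (auto simp: length_Suc_conv)
    qed (use us in auto)
  qed
  have kv: "v p (us[j := x]) = 0" if w: "\<omega> \<in> {\<omega>1, \<omega>2, \<omega>3}" and k: "\<And>y. y \<in> T p \<Longrightarrow> \<omega> p [x, y] = 0"
    and us: "length us = 4" "set us \<subseteq> T p" "j < 4" for \<omega> p x us j
  proof -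
    have z: "\<omega> p (us[j := x]) = 0" if "length us = 2" "set us \<subseteq> T p" "j < 2" for us j
    proof -
      obtain a b where ab: "us = [a, b]" using \<open>length us = 2\<close> by (auto simp: length2)
      have "j = 0 \<or> j = 1" using \<open>j < 2\<close> by auto
      moreover have "a \<in> T p" "b \<in> T p" using ab that by auto
      ultimately show ?thesis using ab k form2_antisym[OF dw(1)[OF w], of p a x] by auto
    qed
    have "wedge 2 2 \<omega> \<omega> p (us[j := x]) = 0"
      by (rule wedge_update_zero) (use us z in auto)
    then show ?thesis using dw(2)[OF w] by simp
  qed
  have nondeg: "x = 0" if "\<omega> \<in> {\<omega>1, \<omega>2, \<omega>3}" "x \<in> T p" "\<eta> p [x] = 0" "\<And>y. y \<in> T p \<Longrightarrow> \<omega> p [x, y] = 0" for \<omega> p x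
    by (rule N[OF that(2,3) kv[OF that(1,4)]])
  have ker: "\<exists>z\<in>T p. \<eta> p [z] = 1 \<and> (\<forall>y\<in>T p. \<omega> p [z, y] = 0)" if w: "\<omega> \<in> {\<omega>1, \<omega>2, \<omega>3}" for \<omega> p
  proof -
    obtain x where x: "x \<in> T p" "x \<noteq> 0" "\<And>y. y \<in> T p \<Longrightarrow> \<omega> p [x, y] = 0"
      by (rule skew_kernel[OF dw(1)[OF w], of p]) auto
    then have "\<eta> p [x] \<noteq> 0" using nondeg[OF w] by blast
    then show ?thesis
      using x by (intro bexI[of _ "(1 / \<eta> p [x]) *\<^sub>R x"])
        (simp_all add: form1_simps[OF eta] form2_simps[OF dw(1)[OF w]] T_scale)
  qed
  \<comment> \<open>The kernel vector of each \<omega> is in the kernel of v = \<omega> \<and>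
    \<omega>. Two of them, normalised by \<eta>, differ by a vector annihilated by v and \<eta>,
    hence coincide.\<close>
  have common: "\<exists>z\<in>T p. \<eta> p [z] = 1 \<and> (\<forall>\<omega>\<in>{\<omega>1, \<omega>2, \<omega>3}. \<forall>y\<in>T p. \<omega> p [z, y] = 0)" for p
  proof -
    obtain z1 where z1: "z1 \<in> T p" "\<eta> p [z1] = 1" "\<forall>y\<in>T p. \<omega>1 p [z1, y] = 0" using ker[of \<omega>1 p] by blast
    have "\<forall>y\<in>T p. \<omega> p [z1, y] = 0" if w: "\<omega> \<in> {\<omega>1, \<omega>2, \<omega>3}" for \<omega>
    proof -
      obtain z where z: "z \<in> T p" "\<eta> p [z] = 1" "\<forall>y\<in>T p. \<omega> p [z, y] = 0" using ker[OF w, of p] by blast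
      have "z1 - z = 0"
      proof (rule N)
        show "z1 - z \<in> T p" using z z1 by (simp add: T_diff)
        show "\<eta> p [z1 - z] = 0" using z z1 by (simp add: form1_simps[OF eta])
        fix us j assume us: "length us = 4" "set us \<subseteq> T p" "j < (4::nat)"
        have "v p (us[j := 1 *\<^sub>R z1 + (-1) *\<^sub>R z]) = 1 * v p (us[j := z1]) + (-1) * v p (us[j := z])"
          by (rule form_linear[OF v us z1(1) z(1)])
        then show "v p (us[j := z1 - z]) = 0" using kv[of \<omega>1 p z1, OF _ _ us] kv[OF w _ us] z z1 by simp
      qed
      then show ?thesis using z by simp
    qed
    then show ?thesis using z1 by blast
  qed
  \<comment> \<open>Nondegenerate, since evaluation at the kernel vector isolates \<eta>. The kernel
    vector is the B-dual of \<eta>, which makes it a smooth field.\<close>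
  define B where "B p x y = \<omega>1 p [x, y] + \<eta> p [x] * \<eta> p [y]" for p x y
  have Bb: "bilinear_field B"
    unfolding bilinear_field_def B_def
    using one_formD(2)[OF one_form_form1[OF eta]] two_formD(1)[OF two_form_form2[OF d(1)]]
    by (auto simp: form2_lin_left[OF d(1)] form2_lin_right[OF d(1)] form1_lin[OF eta] algebra_simps intro!: C_add C_mult)
  have Bnd: "u = 0" if u: "u \<in> T p" "\<And>y. y \<in> T p \<Longrightarrow> B p u y = 0" for p u
  proof -
    obtain z where z: "z \<in> T p" "\<eta> p [z] = 1" "\<forall>y\<in>T p. \<omega>1 p [z, y] = 0" using common by blast
    have "\<eta> p [u] = 0" using u(2)[OF z(1)] z u(1) form2_antisym[OF d(1), of p u z] by (simp add: B_def)
    then show ?thesis using u by (intro nondeg[of \<omega>1]) (auto simp: B_def)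
  qed
  obtain \<xi> where xi: "VF \<xi>" "\<And>X p. VF X \<Longrightarrow> B p (\<xi> p) (X p) = \<eta> p [X p]"
    using duality[OF Bb, of "\<lambda>X p. \<eta> p [X p]"] Bnd one_formD[OF one_form_form1[OF eta]] by blast
  have xi_eq: "\<eta> p [\<xi> p] = 1 \<and> (\<forall>\<omega>\<in>{\<omega>1, \<omega>2, \<omega>3}. \<forall>y\<in>T p. \<omega> p [\<xi> p, y] = 0)" for p
  proof -
    obtain z where z: "z \<in> T p" "\<eta> p [z] = 1" "\<forall>\<omega>\<in>{\<omega>1, \<omega>2, \<omega>3}. \<forall>y\<in>T p. \<omega> p [z, y] = 0" using common by blast
    have "\<xi> p - z = 0"
    proof (rule Bnd)
      show "\<xi> p - z \<in> T p" using xi z by (simp add: T_diff)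
      fix y assume y: "y \<in> T p"
      have "B p (\<xi> p) y = \<eta> p [y]" using xi(2)[OF VF_extend[OF y], of p] extend_apply[OF y] by simp
      then show "B p (\<xi> p - z) y = 0"
        using z y VF_T[OF xi(1), of p] by (simp add: B_def form2_simps[OF d(1)] form1_simps[OF eta] algebra_simps)
    qed
    then show ?thesis using z by simp
  qed
  \<comment> \<open>Solving with \<alpha> + \<eta> \<otimes> \<eta> instead of \<alpha> makes the
    equation solvable; evaluation at \<xi> then forces the solution to be horizontal and to satisfy
    the equation for \<alpha> itself.\<close>
  have endo: "\<exists>\<phi>. endo_field A \<phi> \<and> (\<forall>p. \<forall>u\<in>T p. \<eta> p [\<phi> p u] = 0 \<and> (\<forall>y\<in>T p. \<alpha> p [\<phi> p u, y] = - \<beta> p [u, y]))"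
    if a: "\<alpha> \<in> {\<omega>1, \<omega>2, \<omega>3}" and b: "\<beta> \<in> {\<omega>1, \<omega>2, \<omega>3}" for \<alpha> \<beta>
  proof -
    define B' where "B' p x y = \<alpha> p [x, y] + \<eta> p [x] * \<eta> p [y]" for p x y
    have B'b: "bilinear_field B'"
      unfolding bilinear_field_def B'_def
      using one_formD(2)[OF one_form_form1[OF eta]] two_formD(1)[OF two_form_form2[OF dw(1)[OF a]]]
      by (auto simp: form2_lin_left[OF dw(1)[OF a]] form2_lin_right[OF dw(1)[OF a]] form1_lin[OF eta] algebra_simps
          intro!: C_add C_mult)
    have ax: "\<alpha> p [u, \<xi> p] = 0" "\<beta> p [u, \<xi> p] = 0" if "u \<in> T p" for p u
      using xi_eq[of p] a b that form2_antisym[OF dw(1)[OF a], of p u "\<xi> p"] form2_antisym[OF dw(1)[OF b], of p u "\<xi> p"] by auto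
    have B'nd: "u = 0" if u: "u \<in> T p" "\<And>y. y \<in> T p \<Longrightarrow> B' p u y = 0" for p u
    proof -
      have "\<eta> p [u] = 0" using u(2)[of "\<xi> p"] xi_eq[of p] xi(1) u(1) ax by (simp add: B'_def)
      then show ?thesis using u by (intro nondeg[OF a]) (auto simp: B'_def)
    qed
    have "bilinear_field (\<lambda>p x y. - \<beta> p [x, y])"
      unfolding bilinear_field_def
      using two_formD(1)[OF two_form_form2[OF dw(1)[OF b]]]
      by (auto simp: form2_lin_left[OF dw(1)[OF b]] form2_lin_right[OF dw(1)[OF b]] intro!: C_minus)
    then obtain \<phi> where f: "endo_field A \<phi>" "\<And>p u y. u \<in> T p \<Longrightarrow> y \<in> T p \<Longrightarrow> B' p (\<phi> p u) y = - \<beta> p [u, y]"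
      using endo_from_bilinear[OF B'b, where b = "\<lambda>p x y. - \<beta> p [x, y]"] B'nd by blast
    have e0: "\<eta> p [\<phi> p u] = 0" if u: "u \<in> T p" for p u
      using f(2)[OF u, of "\<xi> p"] xi_eq[of p] xi(1) ax u endo_T[OF f(1) u] by (simp add: B'_def)
    show ?thesis
    proof (intro exI[of _ \<phi>] conjI allI ballI f(1))
      show "\<eta> p [\<phi> p u] = 0" if "u \<in> T p" for p u by (rule e0[OF that])
      show "\<alpha> p [\<phi> p u, y] = - \<beta> p [u, y]" if "u \<in> T p" "y \<in> T p" for p u y
        using f(2)[OF that] e0[OF that(1)] by (simp add: B'_def)
    qed
  qed
  obtain \<phi>1 where f1: "endo_field A \<phi>1" "\<And>p u. u \<in> T p \<Longrightarrow> \<eta> p [\<phi>1 p u] = 0"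
    "\<And>p u y. u \<in> T p \<Longrightarrow> y \<in> T p \<Longrightarrow> \<omega>2 p [\<phi>1 p u, y] = - \<omega>3 p [u, y]" using endo[of \<omega>2 \<omega>3] by blast
  obtain \<phi>2 where f2: "endo_field A \<phi>2" "\<And>p u. u \<in> T p \<Longrightarrow> \<eta> p [\<phi>2 p u] = 0"
    "\<And>p u y. u \<in> T p \<Longrightarrow> y \<in> T p \<Longrightarrow> \<omega>3 p [\<phi>2 p u, y] = - \<omega>1 p [u, y]" using endo[of \<omega>3 \<omega>1] by blast
  obtain \<phi>3 where f3: "endo_field A \<phi>3" "\<And>p u. u \<in> T p \<Longrightarrow> \<eta> p [\<phi>3 p u] = 0"
    "\<And>p u y. u \<in> T p \<Longrightarrow> y \<in> T p \<Longrightarrow> \<omega>1 p [\<phi>3 p u, y] = - \<omega>2 p [u, y]" using endo[of \<omega>1 \<omega>2] by blast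
  have W4: "wedge22 (\<lambda>x y. \<alpha> p [x, y]) (\<lambda>x y. \<beta> p [x, y]) a b c e = wedge 2 2 \<alpha> \<beta> p [a, b, c, e]"
    if "diff_form A 2 \<alpha>" "diff_form A 2 \<beta>" for \<alpha> \<beta> p a b c e
    unfolding wedge22_def
    by (rule wedge_2_2[symmetric]) (rule form2_antisym[OF that(1)], rule form2_antisym[OF that(2)])
  have space: "su2_form_space (T p) (\<lambda>u. \<eta> p [u]) (\<lambda>x y. \<omega>1 p [x, y]) (\<lambda>x y. \<omega>2 p [x, y]) (\<lambda>x y. \<omega>3 p [x, y])
      (\<xi> p) (\<phi>1 p) (\<phi>2 p) (\<phi>3 p)" for p
  proof
    show "subspace (T p)" by (rule subspace_T)
    show "\<eta> p [a *\<^sub>R u + b *\<^sub>R v] = a * \<eta> p [u] + b * \<eta> p [v]" if "u \<in> T p" "v \<in> T p" for a b u v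
      by (rule form1_lin[OF eta that])
    show "\<forall>\<omega>\<in>{\<lambda>x y. \<omega>1 p [x, y], \<lambda>x y. \<omega>2 p [x, y], \<lambda>x y. \<omega>3 p [x, y]}. \<forall>a b. \<forall>u\<in>T p. \<forall>v\<in>T p. \<forall>w\<in>T p.
        \<omega> (a *\<^sub>R u + b *\<^sub>R v) w = a * \<omega> u w + b * \<omega> v w"
      by (simp add: form2_lin_left[OF d(1)] form2_lin_left[OF d(2)] form2_lin_left[OF d(3)])
    show "\<forall>\<omega>\<in>{\<lambda>x y. \<omega>1 p [x, y], \<lambda>x y. \<omega>2 p [x, y], \<lambda>x y. \<omega>3 p [x, y]}. \<forall>u v. \<omega> u v = - \<omega> v u"
      unfolding ball_simps using form2_antisym[OF d(1), of p] form2_antisym[OF d(2), of p] form2_antisym[OF d(3), of p]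
      by blast
    show "\<forall>\<omega>\<in>{\<lambda>x y. \<omega>1 p [x, y], \<lambda>x y. \<omega>2 p [x, y], \<lambda>x y. \<omega>3 p [x, y]}. \<forall>u\<in>T p. \<omega> (\<xi> p) u = 0"
      using xi_eq[of p] by simp
    show "\<forall>\<omega>\<in>{\<lambda>x y. \<omega>1 p [x, y], \<lambda>x y. \<omega>2 p [x, y], \<lambda>x y. \<omega>3 p [x, y]}. \<forall>u\<in>T p.
        \<eta> p [u] = 0 \<longrightarrow> (\<forall>v\<in>T p. \<omega> u v = 0) \<longrightarrow> u = 0"
      using nondeg[of \<omega>1 _ p] nondeg[of \<omega>2 _ p] nondeg[of \<omega>3 _ p] by simp
    show "\<exists>a\<in>T p. \<exists>b\<in>T p. \<exists>c\<in>T p. \<exists>e\<in>T p. wedge22 (\<lambda>x y. \<omega>1 p [x, y]) (\<lambda>x y. \<omega>1 p [x, y]) a b c e \<noteq> 0"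
    proof (rule ccontr)
      assume "\<not> ?thesis"
      then have z: "wedge 2 2 \<omega>1 \<omega>1 p [a, b, c, e] = 0" if "a \<in> T p" "b \<in> T p" "c \<in> T p" "e \<in> T p" for a b c e
        using that W4[OF d(1) d(1)] by metis
      have v0: "v p us = 0" for us
      proof (cases "length us = 4 \<and> set us \<subseteq> T p")
        case True
        then obtain a b c e where "us = [a, b, c, e]" by (auto simp: length_Suc_conv eval_nat_numeral)
        then show ?thesis using True z W(1) by auto
      next
        case False
        then show ?thesis by (rule form_outside[OF v])
      qed
      \<comment> \<open>If \<omega>1 \<and> \<omega>1 vanished at p, so would v, and every
        horizontal vector would be zero. A nonzero one exists because the dimension exceeds
        one.\<close>
      obtain x where x: "x \<in> T p" "x \<noteq> \<eta> p [x] *\<^sub>R \<xi> p"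
      proof -
        obtain B where B: "finite B" "independent B" "span B = T p" "card B = CARD(5)" using finite_basis_T[of p] by blast
        have "\<not> T p \<subseteq> span {\<xi> p}"
        proof
          assume "T p \<subseteq> span {\<xi> p}"
          then have "card B \<le> card {\<xi> p}" using independent_span_bound[of "{\<xi> p}" B] B span_superset[of B] by auto
          then show False using B by simp
        qed
        then show thesis using that by (metis insertI1 span_base span_scale subsetI)
      qed
      have xT: "\<xi> p \<in> T p" using xi(1) by (rule VF_T)
      then have sT: "\<eta> p [x] *\<^sub>R \<xi> p \<in> T p" by (rule T_scale)
      have "x - \<eta> p [x] *\<^sub>R \<xi> p = 0"
        by (rule N[OF T_diff[OF x(1) sT] _ v0])
          (simp add: form1_simps(2)[OF eta x(1) sT] form1_simps(3)[OF eta xT] xi_eq)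
      then show False using x by simp
    qed
  qed (use f1 f2 f3 endo_T[OF f1(1)] endo_T[OF f2(1)] endo_T[OF f3(1)] xi xi_eq in
      \<open>simp_all add: W4 d W pointwise\<close>)
  define g where "g p x y = (if x \<in> T p \<and> y \<in> T p then \<eta> p [x] * \<eta> p [y] - \<omega>3 p [\<phi>3 p x, y] else 0)" for p x y
  have gm: "g p = su2_form_space.metric (T p) (\<lambda>u. \<eta> p [u]) (\<lambda>x y. \<omega>3 p [x, y]) (\<phi>3 p)" for p
    unfolding g_def su2_form_space.metric_def[OF space] by (intro ext) simp
  have rm: "riemannian_metric A g"
    unfolding riemannian_metric_def
  proof (intro conjI allI impI ballI)
    show "g p v w = 0" if "\<not> (v \<in> T p \<and> w \<in> T p)" for p v w using that by (auto simp: g_def)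
    show "g p (a *\<^sub>R u + b *\<^sub>R v) w = a * g p u w + b * g p v w" if "u \<in> T p" "v \<in> T p" for p a b u v w
      unfolding gm by (rule su2_form_space.metric_lin[OF space that])
    show "g p v w = g p w v" for p v w unfolding gm by (rule su2_form_space.metric_sym[OF space])
    show "0 < g p v v" if "v \<in> T p" "v \<noteq> 0" for p v
      unfolding gm by (rule su2_form_space.metric_pos[OF space pos that])
    fix X Y assume XY: "VF X" "VF Y"
    have "C (\<lambda>p. \<eta> p [X p] * \<eta> p [Y p] - \<omega>3 p [\<phi>3 p (X p), Y p])"
      using one_formD(2)[OF one_form_form1[OF eta]] two_formD(1)[OF two_form_form2[OF d(3)], OF endo_VF[OF f3(1)]] XY
      by (intro C_diff C_mult) auto
    then show "C (\<lambda>p. g p (X p) (Y p))" using XY by (simp add: g_def)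
  qed
  have acm: "almost_contact_metric A \<phi> \<xi> \<eta> g" if f: "\<phi> \<in> {\<phi>1, \<phi>2, \<phi>3}" for \<phi>
    unfolding almost_contact_metric_def
  proof (intro conjI allI ballI)
    show "odd DIM(real ^ 5)" by simp
    show "endo_field A \<phi>" using f f1(1) f2(1) f3(1) by auto
    show "\<phi> p (\<phi> p v) = - v + \<eta> p [v] *\<^sub>R \<xi> p" if "v \<in> T p" for p v
      using f su2_form_space.quaternions(1-3)[OF space that] by auto
    show "\<eta> p [\<xi> p] = 1" for p using xi_eq by blast
    show "g p (\<phi> p v) (\<phi> p w) = g p v w - \<eta> p [v] * \<eta> p [w]" if "v \<in> T p" "w \<in> T p" for p v w
      unfolding gm using f su2_form_space.metric_phi_phi[OF space that] by auto
  qed (fact xi eta rm)+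
  have "su2_triple A \<phi>1 \<phi>2 \<phi>3 \<xi> \<eta> g"
    unfolding su2_triple_def
  proof (intro conjI)
    show "\<forall>(\<phi>, \<psi>, \<theta>)\<in>{(\<phi>1, \<phi>2, \<phi>3), (\<phi>2, \<phi>3, \<phi>1), (\<phi>3, \<phi>1, \<phi>2)}.
        \<forall>p. \<forall>v\<in>T p. \<phi> p (\<psi> p v) = \<theta> p v \<and> \<theta> p v = - \<psi> p (\<phi> p v)"
      by (auto simp: su2_form_space.quaternions[OF space])
  qed (use acm in auto)
  then have "third_acm A (\<eta>, \<omega>1, \<omega>2, \<omega>3) (\<phi>3, \<xi>, \<eta>, g)"
    unfolding third_acm_def prod.case
    by (intro conjI exI[of _ \<phi>1] exI[of _ \<phi>2]) (auto simp: gm su2_form_space.om_metric[OF space])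
  then show ?thesis by blast
qed

end


section \<open>Covariant derivatives of endomorphism fields\<close>

locale lc_manifold = riemannian_manifold A g
  for A :: "('a::{t2_space, second_countable_topology}, real ^ 'n::finite) atlas" and g +
  fixes D
  assumes lc: "levi_civita A g D"
begin

lemma VF_D: "VF X \<Longrightarrow> VF Y \<Longrightarrow> VF (D X Y)"
  using lc unfolding levi_civita_def affine_connection_def by simp

lemma D_add:
  assumes "VF X" "VF X'" "VF Y"
  shows "D (\<lambda>p. X p + X' p) Y = (\<lambda>p. D X Y p + D X' Y p)" "D Y (\<lambda>p. X p + X' p) = (\<lambda>p. D Y X p + D Y X' p)"
proof -
  have "D (X + X') Y = D X Y + D X' Y \<and> D Y (X + X') = D Y X + D Y X'"
    using lc assms unfolding levi_civita_def affine_connection_def by blast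
  then show "D (\<lambda>p. X p + X' p) Y = (\<lambda>p. D X Y p + D X' Y p)" "D Y (\<lambda>p. X p + X' p) = (\<lambda>p. D Y X p + D Y X' p)"
    by (simp_all add: plus_fun_def[of X] plus_fun_def[of "D _ _"])
qed

lemma D_scale:
  assumes "C f" "VF X" "VF Y"
  shows "D (\<lambda>p. f p *\<^sub>R X p) Y = (\<lambda>p. f p *\<^sub>R D X Y p)"
    "D X (\<lambda>p. f p *\<^sub>R Y p) = (\<lambda>p. X p f *\<^sub>R Y p + f p *\<^sub>R D X Y p)"
  using lc assms unfolding levi_civita_def affine_connection_def by simp_all

lemma D_minus: "VF X \<Longrightarrow> VF Y \<Longrightarrow> D X (\<lambda>p. - Y p) = (\<lambda>p. - D X Y p)"
  using D_scale(2)[OF C_const[of "-1"], of X Y] VF_deriv(6)[of X _ "-1"] by simp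

lemma D_diff: "VF X \<Longrightarrow> VF Y \<Longrightarrow> VF Z \<Longrightarrow> D X (\<lambda>p. Y p - Z p) = (\<lambda>p. D X Y p - D X Z p)"
  using D_add(2)[of Y "\<lambda>p. - Z p" X] by (simp add: D_minus VF_minus)

lemma D_torsion: "VF X \<Longrightarrow> VF Y \<Longrightarrow> lie_bracket X Y p = D X Y p - D Y X p"
proof -
  assume "VF X" "VF Y"
  then have "D X Y - D Y X = lie_bracket X Y" using lc unfolding levi_civita_def by simp
  from fun_cong[OF this, of p] show ?thesis by (simp only: minus_apply)
qed

lemma D_metric: "VF X \<Longrightarrow> VF Y \<Longrightarrow> VF Z \<Longrightarrow>
    X p (\<lambda>q. g q (Y q) (Z q)) = g p (D X Y p) (Z p) + g p (Y p) (D X Z p)"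
  using lc unfolding levi_civita_def by simp

section \<open>Covariant derivatives of endomorphisms and their 2-forms\<close>

definition nab :: "'a endo \<Rightarrow> 'a vfield \<Rightarrow> 'a vfield \<Rightarrow> 'a vfield \<Rightarrow> 'a \<Rightarrow> real" where
  "nab \<psi> X Y Z p = g p (D X (\<lambda>q. \<psi> q (Y q)) p) (Z p) - g p (\<psi> p (D X Y p)) (Z p)"

definition tw :: "'a endo \<Rightarrow> 'a vfield \<Rightarrow> 'a vfield \<Rightarrow> 'a \<Rightarrow> real" where
  "tw \<psi> X Y p = g p (\<psi> p (X p)) (Y p)"

definition skew_endo :: "'a endo \<Rightarrow> bool" where
  "skew_endo \<psi> \<longleftrightarrow> endo_field A \<psi> \<and> (\<forall>p. \<forall>u\<in>T p. \<forall>v\<in>T p. g p (\<psi> p u) v = - g p u (\<psi> p v))"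

lemma
  assumes "endo_field A \<psi>"
  shows eVF: "VF X \<Longrightarrow> VF (\<lambda>p. \<psi> p (X p))"
    and eT: "v \<in> T p \<Longrightarrow> \<psi> p v \<in> T p"
    and elin: "v \<in> T p \<Longrightarrow> w \<in> T p \<Longrightarrow> \<psi> p (a *\<^sub>R v + b *\<^sub>R w) = a *\<^sub>R \<psi> p v + b *\<^sub>R \<psi> p w"
proof -
  show VF: "VF X \<Longrightarrow> VF (\<lambda>p. \<psi> p (X p))"
    and "v \<in> T p \<Longrightarrow> w \<in> T p \<Longrightarrow> \<psi> p (a *\<^sub>R v + b *\<^sub>R w) = a *\<^sub>R \<psi> p v + b *\<^sub>R \<psi> p w" for X
    using assms unfolding endo_field_def by simp_all
  show "\<psi> p v \<in> T p" if v: "v \<in> T p"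
    using VF_T[OF VF[OF VF_extend[OF v]], of p] extend_apply[OF v] by simp
qed

lemma esimps:
  assumes e: "endo_field A \<psi>"
  shows "v \<in> T p \<Longrightarrow> w \<in> T p \<Longrightarrow> \<psi> p (v + w) = \<psi> p v + \<psi> p w"
    "v \<in> T p \<Longrightarrow> w \<in> T p \<Longrightarrow> \<psi> p (v - w) = \<psi> p v - \<psi> p w"
    "v \<in> T p \<Longrightarrow> \<psi> p (a *\<^sub>R v) = a *\<^sub>R \<psi> p v" "v \<in> T p \<Longrightarrow> \<psi> p (- v) = - \<psi> p v"
  using elin[OF e, of v p w 1 1] elin[OF e, of v p w 1 "-1"] elin[OF e, of v p v a 0] elin[OF e, of v p v "-1" 0]
  by simp_all

lemma VF_D_T: "VF X \<Longrightarrow> VF Y \<Longrightarrow> D X Y p \<in> T p" by (rule VF_T[OF VF_D])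

lemma nabla_endo_g:
  assumes e: "endo_field A \<psi>" and "VF X" "VF Y"
  shows "nabla_endo D \<psi> X Y p \<in> T p" "g p (nabla_endo D \<psi> X Y p) (Z p) = nab \<psi> X Y Z p"
  using assms by (simp_all add: nabla_endo_def minus_apply nab_def g_simps T_diff VF_D_T eVF[OF e] eT[OF e])

context
  fixes \<psi> assumes e: "endo_field A \<psi>"
begin

lemma tensorial_nab1: "VF Y \<Longrightarrow> VF Z \<Longrightarrow> tensorial (\<lambda>X. nab \<psi> X Y Z)"
  unfolding tensorial_def
  by (simp add: nab_def D_add D_scale eVF[OF e] eT[OF e] VF_D_T g_simps esimps[OF e] T_scale right_diff_distrib)

lemma tensorial_nab2: "VF X \<Longrightarrow> VF Z \<Longrightarrow> tensorial (\<lambda>Y. nab \<psi> X Y Z)"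
  unfolding tensorial_def
  by (simp add: nab_def esimps[OF e] D_add D_scale eVF[OF e] eT[OF e] VF_D_T g_simps T_scale T_add right_diff_distrib)

lemma tensorial_nab3: "VF X \<Longrightarrow> VF Y \<Longrightarrow> tensorial (nab \<psi> X Y)"
  unfolding tensorial_def
  by (simp add: nab_def g_simps right_diff_distrib)

lemma nab_cong:
  assumes "VF X" "VF Y" "VF Z" "VF X'" "VF Y'" "VF Z'" "X p = X' p" "Y p = Y' p" "Z p = Z' p"
  shows "nab \<psi> X Y Z p = nab \<psi> X' Y' Z' p"
  using tensorial_cong[OF tensorial_nab1, of Y Z X X' p] tensorial_cong[OF tensorial_nab2, of X' Z Y Y' p]
    tensorial_cong[OF tensorial_nab3, of X' Y' Z Z' p] assms by simp

end

lemma tensorial_tw: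
  assumes e: "endo_field A \<psi>" and X: "VF X"
  shows "tensorial (tw \<psi> X)" "VF Y \<Longrightarrow> C (tw \<psi> X Y)"
  using X g_C[OF eVF[OF e X]] by (simp_all add: tensorial_def tw_def[abs_def] g_simps)

lemma skewD:
  assumes "skew_endo \<psi>"
  shows "endo_field A \<psi>" "u \<in> T p \<Longrightarrow> v \<in> T p \<Longrightarrow> g p (\<psi> p u) v = - g p u (\<psi> p v)"
  using assms unfolding skew_endo_def by blast+

lemma two_form_tw: "skew_endo \<psi> \<Longrightarrow> two_form (tw \<psi>)"
proof -
  assume s: "skew_endo \<psi>"
  note t = tensorial_tw[OF skewD(1)[OF s]]
  have "tw \<psi> X Y p = - tw \<psi> Y X p" if "VF X" "VF Y" for X Y p
    using skewD(2)[OF s, of "X p" p "Y p"] that g_sym[of p "X p" "\<psi> p (Y p)"] by (simp add: tw_def)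
  then show ?thesis using t unfolding two_form_def one_form_def by blast
qed

lemma deriv_tw:
  assumes s: "skew_endo \<psi>" and "VF X" "VF Y" "VF Z"
  shows "X p (tw \<psi> Y Z) = nab \<psi> X Y Z p + tw \<psi> (D X Y) Z p + tw \<psi> Y (D X Z) p"
proof -
  note e = skewD(1)[OF s]
  have "X p (\<lambda>q. g q (\<psi> q (Y q)) (Z q)) = g p (D X (\<lambda>q. \<psi> q (Y q)) p) (Z p) + g p (\<psi> p (Y p)) (D X Z p)"
    using D_metric[OF assms(2) eVF[OF e assms(3)] assms(4)] .
  then show ?thesis by (simp add: nab_def tw_def[abs_def])
qed

lemma nab_skew:
  assumes s: "skew_endo \<psi>" and "VF X" "VF Y" "VF Z"
  shows "nab \<psi> X Y Z p = - nab \<psi> X Z Y p"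
proof -
  note e = skewD(1)[OF s]
  have a: "tw \<psi> U W q = - tw \<psi> W U q" if "VF U" "VF W" for U W q
    using two_formD(2)[OF two_form_tw[OF s] that] .
  have "tw \<psi> Y Z = (\<lambda>q. - tw \<psi> Z Y q)" using a assms by blast
  then have "X p (tw \<psi> Y Z) = - X p (tw \<psi> Z Y)"
    using VF_deriv(3)[OF assms(2) tensorial_tw(2)[OF e assms(4,3)]] by simp
  then show ?thesis
    using a[OF VF_D[OF assms(2,3)] assms(4), of p] a[OF assms(3) VF_D[OF assms(2,4)], of p]
      deriv_tw[OF s assms(2-4)] deriv_tw[OF s assms(2,4,3)] by simp
qed

text \<open>Vanishing torsion turns brackets into differences of covariant derivatives; the terms in
  which arguments are differentiated cancel, leaving the cyclic sum of \<nabla>\<psi>.\<close>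

lemma d2_tw:
  assumes s: "skew_endo \<psi>" and X: "VF X" and Y: "VF Y" and Z: "VF Z"
  shows "d2 (tw \<psi>) X Y Z p = nab \<psi> X Y Z p + nab \<psi> Y Z X p + nab \<psi> Z X Y p"
proof -
  note e = skewD(1)[OF s]
  have a: "tw \<psi> U W q = - tw \<psi> W U q" if "VF U" "VF W" for U W q
    using two_formD(2)[OF two_form_tw[OF s] that] .
  have b: "tw \<psi> (lie_bracket U W) Z' p = tw \<psi> (D U W) Z' p - tw \<psi> (D W U) Z' p" if "VF U" "VF W" for U W Z'
    using that by (simp add: tw_def D_torsion esimps[OF e] VF_D_T g_simps eT[OF e])
  show ?thesis
    unfolding d2_def using X Y Z nab_skew[OF s Y X Z, of p]
      a[OF X VF_D[OF Y Z], of p] a[OF Y VF_D[OF X Z], of p] a[OF X VF_D[OF Z Y], of p]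
      a[OF Z VF_D[OF X Y], of p] a[OF Z VF_D[OF Y X], of p] a[OF Y VF_D[OF Z X], of p]
    by (simp add: deriv_tw[OF s] b)
qed

text \<open>The product rule for \<psi>1 \<psi>2. Skewness moves \<psi>1 to the last argument,
  whence the minus sign.\<close>

lemma nab_product:
  assumes s: "skew_endo \<psi>1" and e2: "endo_field A \<psi>2"
    and p12: "\<And>p u. u \<in> T p \<Longrightarrow> \<psi>1 p (\<psi>2 p u) = \<psi>3 p u" and "VF X" "VF Y" "VF Z"
  shows "nab \<psi>3 X Y Z p = nab \<psi>1 X (\<lambda>q. \<psi>2 q (Y q)) Z p - nab \<psi>2 X Y (\<lambda>q. \<psi>1 q (Z q)) p"
proof -
  note e1 = skewD(1)[OF s]
  have f: "(\<lambda>q. \<psi>3 q (Y q)) = (\<lambda>q. \<psi>1 q (\<psi>2 q (Y q)))" using p12 assms by simp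
  show ?thesis
    using assms skewD(2)[OF s]
    by (simp add: nab_def f p12[symmetric] VF_D_T eT[OF e2] eT[OF e1] eVF[OF e2] g_simps)
qed

end

locale acm_lc = lc_manifold A g D + manifold5 A
  for A :: "('a::{t2_space, second_countable_topology}, real ^ 5) atlas" and g D +
  fixes \<phi> \<xi> \<eta>
  assumes acm: "almost_contact_metric A \<phi> \<xi> \<eta> g"
begin

abbreviation "e \<equiv> \<lambda>X p. \<eta> p [X p]"

lemma space: "acm_space (T p) (g p) (\<phi> p) (\<xi> p) (\<lambda>v. \<eta> p [v])"
  by (rule acm_space_at[OF acm])

lemma endo: "endo_field A \<phi>" and xi_VF: "VF \<xi>" and eta_form: "diff_form A 1 \<eta>"
  using acmD[OF acm] by auto

lemma phi_VF: "VF X \<Longrightarrow> VF (\<lambda>p. \<phi> p (X p))" by (rule eVF[OF endo])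

lemma phi_xi: "\<phi> p (\<xi> p) = 0" by (rule acm_space.phi_xi[OF space])
lemma eta_xi: "\<eta> p [\<xi> p] = 1" by (rule acm_space.eta_xi[OF space])
lemma eta_phi: "u \<in> T p \<Longrightarrow> \<eta> p [\<phi> p u] = 0" by (rule acm_space.eta_phi[OF space])
lemma g_xi: "u \<in> T p \<Longrightarrow> g p u (\<xi> p) = \<eta> p [u]" "u \<in> T p \<Longrightarrow> g p (\<xi> p) u = \<eta> p [u]"
  by (rule acm_space.g_xi(1)[OF space], assumption) (rule acm_space.g_xi(2)[OF space])
lemma phi_phi: "u \<in> T p \<Longrightarrow> \<phi> p (\<phi> p u) = - u + \<eta> p [u] *\<^sub>R \<xi> p" by (rule acm_space.phi_phi[OF space])
lemma g_phi_phi: "u \<in> T p \<Longrightarrow> v \<in> T p \<Longrightarrow> g p (\<phi> p u) (\<phi> p v) = g p u v - \<eta> p [u] * \<eta> p [v]"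
  by (rule acm_space.g_phi_phi[OF space])
lemma phi_skew: "u \<in> T p \<Longrightarrow> v \<in> T p \<Longrightarrow> g p (\<phi> p u) v = - g p u (\<phi> p v)"
  by (rule acm_space.phi_skew[OF space])

lemma skew: "skew_endo \<phi>" unfolding skew_endo_def using endo phi_skew by blast

lemma one_form_e: "one_form e" by (rule one_form_form1[OF eta_form])

lemma C_e: "VF X \<Longrightarrow> C (e X)" by (rule one_formD(2)[OF one_form_e])

lemma xi_T [simp]: "\<xi> p \<in> T p" by (rule VF_T[OF xi_VF])

lemma Dxi_xi: "VF X \<Longrightarrow> g p (D X \<xi> p) (\<xi> p) = 0"
  using D_metric[OF _ xi_VF xi_VF, of X p] VF_deriv(6)[of X p 1] g_sym[of p "\<xi> p"] by (simp add: g_xi eta_xi)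

lemma deriv_e: "VF X \<Longrightarrow> VF Y \<Longrightarrow> X p (e Y) = \<eta> p [D X Y p] + g p (D X \<xi> p) (Y p)"
  using D_metric[OF _ _ xi_VF, of X Y p] by (simp add: g_xi VF_D_T g_sym[of p "Y p"])

lemma d1_e: "VF X \<Longrightarrow> VF Y \<Longrightarrow> d1 e X Y p = g p (D X \<xi> p) (Y p) - g p (D Y \<xi> p) (X p)"
  by (simp add: d1_def deriv_e D_torsion form1_simps[OF eta_form] VF_D_T)

text \<open>The covariant derivative of \<phi>^2 = -I + \<eta> \<otimes> \<xi>. On horizontal Y and
  Z the right-hand side vanishes, which gives the commutation rule behind both vanishing
  arguments.\<close>

lemma nab_phi_square:
  assumes X: "VF X" and Y: "VF Y" and Z: "VF Z"
  shows "nab \<phi> X (\<lambda>q. \<phi> q (Y q)) Z p - nab \<phi> X Y (\<lambda>q. \<phi> q (Z q)) p =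
    g p (D X \<xi> p) (Y p) * \<eta> p [Z p] + \<eta> p [Y p] * g p (D X \<xi> p) (Z p)"
proof -
  have f: "(\<lambda>q. \<phi> q (\<phi> q (Y q))) = (\<lambda>q. e Y q *\<^sub>R \<xi> q - Y q)"
    using Y by (simp add: phi_phi)
  have "D X (\<lambda>q. e Y q *\<^sub>R \<xi> q - Y q) p = X p (e Y) *\<^sub>R \<xi> p + \<eta> p [Y p] *\<^sub>R D X \<xi> p - D X Y p"
    using X Y xi_VF C_e[OF Y] by (simp add: D_diff VF_cscale VF_scale D_scale)
  then have h: "g p (D X (\<lambda>q. \<phi> q (\<phi> q (Y q))) p) (Z p) =
      X p (e Y) * \<eta> p [Z p] + \<eta> p [Y p] * g p (D X \<xi> p) (Z p) - g p (D X Y p) (Z p)"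
    unfolding f using X Y Z xi_VF by (simp add: g_simps g_xi VF_D_T T_intros)
  have k: "g p (D X (\<lambda>q. \<phi> q (Y q)) p) (\<phi> p (Z p)) = - g p (\<phi> p (D X (\<lambda>q. \<phi> q (Y q)) p)) (Z p)"
    "g p (\<phi> p (D X Y p)) (\<phi> p (Z p)) = g p (D X Y p) (Z p) - \<eta> p [D X Y p] * \<eta> p [Z p]"
    using X Y Z phi_VF[OF Y] phi_skew[of "D X (\<lambda>q. \<phi> q (Y q)) p" p "Z p"] by (simp_all add: VF_D_T g_phi_phi)
  show ?thesis
    unfolding nab_def h k deriv_e[OF X Y] by (simp add: algebra_simps)
qed

lemma nab_xi2: "VF X \<Longrightarrow> VF Z \<Longrightarrow> nab \<phi> X \<xi> Z p = g p (D X \<xi> p) (\<phi> p (Z p))"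
proof -
  assume X: "VF X" and Z: "VF Z"
  have "(\<lambda>q. \<phi> q (\<xi> q)) = (\<lambda>q. 0 *\<^sub>R \<xi> q)" by (simp add: phi_xi)
  then have "D X (\<lambda>q. \<phi> q (\<xi> q)) p = 0"
    using D_scale(2)[OF C_const X xi_VF, of 0] VF_deriv(6)[OF X] by simp
  then show ?thesis using X Z phi_skew[of "D X \<xi> p" p "Z p"] by (simp add: nab_def VF_D_T xi_VF)
qed

text \<open>\<nabla>\<xi> is contained in \<nabla>\<phi>: differentiate \<phi>\<xi> = 0 and apply
  \<phi>, using that \<nabla>\<xi> is orthogonal to \<xi>.\<close>

lemma Dxi_nab: "VF X \<Longrightarrow> VF Z \<Longrightarrow> g p (D X \<xi> p) (Z p) = - nab \<phi> X \<xi> (\<lambda>q. \<phi> q (Z q)) p"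
  by (simp add: nab_xi2 phi_VF phi_phi g_simps VF_D_T xi_VF Dxi_xi T_intros)

text \<open>The Lie derivative of g along \<xi>, expressed by the connection; see
  \<open>lie_metric\<close>.\<close>

definition killing :: "'a vfield \<Rightarrow> 'a vfield \<Rightarrow> 'a \<Rightarrow> real" where
  "killing X Y p = g p (D X \<xi> p) (Y p) + g p (D Y \<xi> p) (X p)"

lemma lie_metric: "VF X \<Longrightarrow> VF Y \<Longrightarrow>
  \<xi> p (\<lambda>q. g q (X q) (Y q)) = g p (lie_bracket \<xi> X p) (Y p) + g p (X p) (lie_bracket \<xi> Y p) + killing X Y p"
  by (simp add: D_metric xi_VF D_torsion g_simps VF_D_T killing_def g_sym[of p "X p"])

lemma two_form: "two_form (tw \<phi>)" by (rule two_form_tw[OF skew])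

lemma tw_xi: "tw \<phi> \<xi> X p = 0" by (simp add: tw_def phi_xi)

text \<open>Cartan's formula, as \<xi> is in the kernel of the 2-form. It converts every structure
  equation into a Lie derivative.\<close>

lemma lie_tw: "VF Y \<Longrightarrow> VF Z \<Longrightarrow> lie_deriv \<xi> (tw \<phi>) Y Z p = d2 (tw \<phi>) \<xi> Y Z p"
  by (rule d2_contract[OF two_form xi_VF, symmetric]) (auto simp: tw_xi)

end


section \<open>From \<open>SU(2)\<close>-structures to nearly Sasakian structures\<close>

context acm_space
begin

text \<open>The arguments are replaced one after another by their horizontal parts, on which F
  vanishes. No symmetry of F is assumed, so the corrections for several vertical parts stay
  nested.\<close>

lemma trilinear_split:
  assumes F1: "\<And>a b u v y z. u \<in> V \<Longrightarrow> v \<in> V \<Longrightarrow> y \<in> V \<Longrightarrow> z \<in> V \<Longrightarrow>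
      F (a *\<^sub>R u + b *\<^sub>R v) y z = a * F u y z + b * (F v y z :: real)"
    and F2: "\<And>a b u v y z. u \<in> V \<Longrightarrow> v \<in> V \<Longrightarrow> y \<in> V \<Longrightarrow> z \<in> V \<Longrightarrow>
      F y (a *\<^sub>R u + b *\<^sub>R v) z = a * F y u z + b * F y v z"
    and F3: "\<And>a b u v y z. u \<in> V \<Longrightarrow> v \<in> V \<Longrightarrow> y \<in> V \<Longrightarrow> z \<in> V \<Longrightarrow>
      F y z (a *\<^sub>R u + b *\<^sub>R v) = a * F y z u + b * F y z v"
    and 0: "\<And>x y z. x \<in> V \<Longrightarrow> y \<in> V \<Longrightarrow> z \<in> V \<Longrightarrow> \<eta> x = 0 \<Longrightarrow> \<eta> y = 0 \<Longrightarrow> \<eta> z = 0 \<Longrightarrow> F x y z = 0"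
    and x: "x \<in> V" and y: "y \<in> V" and z: "z \<in> V"
  shows "F x y z = \<eta> x * F \<xi> y z + \<eta> y * (F x \<xi> z - \<eta> x * F \<xi> \<xi> z)
    + \<eta> z * (F x y \<xi> - \<eta> x * F \<xi> y \<xi> - \<eta> y * F x \<xi> \<xi> + \<eta> x * \<eta> y * F \<xi> \<xi> \<xi>)"
proof -
  define x' y' z' where "x' = 1 *\<^sub>R x + (- \<eta> x) *\<^sub>R \<xi>" and "y' = 1 *\<^sub>R y + (- \<eta> y) *\<^sub>R \<xi>" and "z' = 1 *\<^sub>R z + (- \<eta> z) *\<^sub>R \<xi>"
  have V': "x' \<in> V" "y' \<in> V" "z' \<in> V" using x y z by (auto simp: x'_def y'_def z'_def intro!: V_add V_diff)
  have "\<eta> x' = 0" "\<eta> y' = 0" "\<eta> z' = 0" unfolding x'_def y'_def z'_def by (simp_all only: eta_lin x y z xi_V eta_xi)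
  then have "F x' y' z' = 0" by (rule 0[OF V'])
  moreover have "F x' y' z' = F x y' z' - \<eta> x * F \<xi> y' z'" using F1[OF x xi_V V'(2,3), of 1 "- \<eta> x"] unfolding x'_def by simp
  moreover have "F u y' z' = F u y z' - \<eta> y * F u \<xi> z'" if "u \<in> V" for u
    using F2[OF y xi_V that V'(3), of 1 "- \<eta> y"] unfolding y'_def by simp
  moreover have "F u v z' = F u v z - \<eta> z * F u v \<xi>" if "u \<in> V" "v \<in> V" for u v
    using F3[OF z xi_V that, of 1 "- \<eta> z"] unfolding z'_def by simp
  ultimately show ?thesis using x y xi_V by (simp add: algebra_simps)
qed

end

context manifold
begin

lemma d2_cong:
  assumes "\<And>X Y. VF X \<Longrightarrow> VF Y \<Longrightarrow> b X Y = b' X Y" "VF X" "VF Y" "VF Z"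
  shows "d2 b X Y Z p = d2 b' X Y Z p"
  unfolding d2_def using assms by (simp add: VF_lie_bracket)

lemma d2_lincomb:
  assumes b: "two_form b" and b': "two_form b'" and X: "VF X" and Y: "VF Y" and Z: "VF Z"
  shows "d2 (\<lambda>X Y p. r * b X Y p + s * b' X Y p) X Y Z p = r * d2 b X Y Z p + s * d2 b' X Y Z p"
  unfolding d2_def
  using two_formD(1)[OF b] two_formD(1)[OF b'] X Y Z C_const
  by (simp add: VF_deriv[OF X] VF_deriv[OF Y] VF_deriv[OF Z] C_mult algebra_simps)

end

context lc_manifold
begin

definition nab_at :: "'a endo \<Rightarrow> 'a \<Rightarrow> 'a tangent \<Rightarrow> 'a tangent \<Rightarrow> 'a tangent \<Rightarrow> real" where
  "nab_at \<psi> p x y z = nab \<psi> (extend p x) (extend p y) (extend p z) p"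

lemma nab_at_field:
  assumes "endo_field A \<psi>" "VF X" "VF Y" "VF Z"
  shows "nab_at \<psi> p (X p) (Y p) (Z p) = nab \<psi> X Y Z p"
  unfolding nab_at_def
  by (rule nab_cong[OF assms(1)]) (use assms in \<open>auto simp: extend\<close>)

lemma nab_at_lin:
  assumes e: "endo_field A \<psi>" and u: "u \<in> T p" and v: "v \<in> T p" and y: "y \<in> T p" and z: "z \<in> T p"
  shows "nab_at \<psi> p (a *\<^sub>R u + b *\<^sub>R v) y z = a * nab_at \<psi> p u y z + b * nab_at \<psi> p v y z"
    "nab_at \<psi> p y (a *\<^sub>R u + b *\<^sub>R v) z = a * nab_at \<psi> p y u z + b * nab_at \<psi> p y v z"
    "nab_at \<psi> p y z (a *\<^sub>R u + b *\<^sub>R v) = a * nab_at \<psi> p y z u + b * nab_at \<psi> p y z v"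
proof -
  let ?U = "extend p u" and ?V = "extend p v" and ?Y = "extend p y" and ?Z = "extend p z"
  let ?W = "\<lambda>q. a *\<^sub>R ?U q + b *\<^sub>R ?V q"
  note VF = VF_extend[OF u] VF_extend[OF v] VF_extend[OF y] VF_extend[OF z]
  note at = extend_apply[OF u] extend_apply[OF v] extend_apply[OF y] extend_apply[OF z]
  have sc: "VF (\<lambda>q. a *\<^sub>R ?U q)" "VF (\<lambda>q. b *\<^sub>R ?V q)" using VF by (auto intro!: VF_cscale)
  have W: "VF ?W" by (rule VF_add[OF sc])
  have lin: "F ?W p = a * F ?U p + b * F ?V p" if t: "tensorial F" for F :: "'a vfield \<Rightarrow> 'a \<Rightarrow> real"
    using tensorial_add[OF t sc, of p] tensorial_scale[OF t C_const VF(1), of a p] tensorial_scale[OF t C_const VF(2), of b p]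
    by simp
  note F = nab_at_field[OF e]
  show "nab_at \<psi> p (a *\<^sub>R u + b *\<^sub>R v) y z = a * nab_at \<psi> p u y z + b * nab_at \<psi> p v y z"
    using F[OF W VF(3,4), of p] lin[OF tensorial_nab1[OF e VF(3,4)]] by (simp add: nab_at_def at)
  show "nab_at \<psi> p y (a *\<^sub>R u + b *\<^sub>R v) z = a * nab_at \<psi> p y u z + b * nab_at \<psi> p y v z"
    using F[OF VF(3) W VF(4), of p] lin[OF tensorial_nab2[OF e VF(3,4)]] by (simp add: nab_at_def at)
  show "nab_at \<psi> p y z (a *\<^sub>R u + b *\<^sub>R v) = a * nab_at \<psi> p y z u + b * nab_at \<psi> p y z v"
    using F[OF VF(3,4) W, of p] lin[OF tensorial_nab3[OF e VF(3,4)]] by (simp add: nab_at_def at)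
qed

end

context acm_lc
begin

lemma tensorial_killing: "VF Y \<Longrightarrow> tensorial (\<lambda>X. killing X Y)"
  unfolding tensorial_def killing_def
  by (simp add: D_add D_scale xi_VF g_simps VF_D_T algebra_simps)

text \<open>Every X equals \<eta>(X) \<xi> - \<phi>\<phi>X, so it suffices to test \<xi> and the
  image of \<phi>.\<close>

lemma killing_zeroI:
  assumes k: "\<And>X Y p. VF X \<Longrightarrow> VF Y \<Longrightarrow> killing (\<lambda>q. \<phi> q (X q)) Y p = 0"
    and kx: "\<And>Y p. VF Y \<Longrightarrow> killing \<xi> Y p = 0" and X: "VF X" and Y: "VF Y"
  shows "killing X Y p = 0"
proof -
  note t = tensorial_killing[OF Y]
  have 1: "VF (\<lambda>q. \<phi> q (\<phi> q (X q)))" "VF (\<lambda>q. e X q *\<^sub>R \<xi> q)"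
    using X by (auto intro!: phi_VF VF_scale xi_VF C_e)
  have "X = (\<lambda>q. e X q *\<^sub>R \<xi> q - \<phi> q (\<phi> q (X q)))" using X by (simp add: phi_phi)
  then have "killing X Y p = killing (\<lambda>q. e X q *\<^sub>R \<xi> q - \<phi> q (\<phi> q (X q))) Y p" by simp
  also have "\<dots> = \<eta> p [X p] *\<^sub>R killing \<xi> Y p - killing (\<lambda>q. \<phi> q (\<phi> q (X q))) Y p"
    by (simp only: tensorial_diff[OF t 1(2,1)] tensorial_scale[OF t C_e[OF X] xi_VF])
  finally show ?thesis using k[OF phi_VF[OF X] Y] kx[OF Y] by simp
qed

text \<open>The 3-form \<eta> \<and> g(\<psi> . , . ) evaluated on fields.\<close>

definition ew :: "'a endo \<Rightarrow> 'a vfield \<Rightarrow> 'a vfield \<Rightarrow> 'a vfield \<Rightarrow> 'a \<Rightarrow> real" where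
  "ew \<psi> X Y Z p = \<eta> p [X p] * tw \<psi> Y Z p - \<eta> p [Y p] * tw \<psi> X Z p + \<eta> p [Z p] * tw \<psi> X Y p"

text \<open>The conclusion no longer mentions the connection, so it can be compared with structure
  equations obtained by way of another one.\<close>

lemma Sasakian_d1:
  assumes "\<And>X Y p. VF X \<Longrightarrow> VF Y \<Longrightarrow> nabla_endo D \<phi> X Y p = g p (X p) (Y p) *\<^sub>R \<xi> p - \<eta> p [Y p] *\<^sub>R X p"
    and X: "VF X" and Y: "VF Y"
  shows "d1 e X Y p = - 2 * tw \<phi> X Y p"
proof -
  have "g p (D X \<xi> p) (Y p) = - tw \<phi> X Y p" if X: "VF X" and Y: "VF Y" for X Y
    using nabla_endo_g(2)[OF endo X xi_VF, of p "\<lambda>q. \<phi> q (Y q)"] assms(1)[OF X xi_VF, of p] X Y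
      phi_skew[of "X p" p "Y p"]
    by (simp add: Dxi_nab tw_def g_simps eta_xi g_xi eta_phi T_intros eT[OF endo])
  then show ?thesis
    using X Y two_formD(2)[OF two_form X Y, of p] by (simp add: d1_e)
qed

end

locale su2_lc = lc_manifold A g D + manifold5 A
  for A :: "('a::{t2_space, second_countable_topology}, real ^ 5) atlas" and g D +
  fixes \<phi>1 \<phi>2 \<phi>3 \<xi> \<eta>
  assumes triple: "su2_triple A \<phi>1 \<phi>2 \<phi>3 \<xi> \<eta> g"
begin

sublocale A1: acm_lc A g D \<phi>1 \<xi> \<eta> by unfold_locales (rule su2_tripleD(1)[OF triple])
sublocale A2: acm_lc A g D \<phi>2 \<xi> \<eta> by unfold_locales (rule su2_tripleD(2)[OF triple])
sublocale A3: acm_lc A g D \<phi>3 \<xi> \<eta> by unfold_locales (rule su2_tripleD(3)[OF triple])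

lemma space: "su2_space (T p) (g p) (\<phi>1 p) (\<phi>2 p) (\<phi>3 p) (\<xi> p) (\<lambda>v. \<eta> p [v])"
  by (rule su2_space_at[OF triple])

lemma q:
  assumes "u \<in> T p"
  shows "\<phi>1 p (\<phi>2 p u) = \<phi>3 p u" "\<phi>2 p (\<phi>1 p u) = - \<phi>3 p u" "\<phi>2 p (\<phi>3 p u) = \<phi>1 p u"
    "\<phi>3 p (\<phi>2 p u) = - \<phi>1 p u" "\<phi>3 p (\<phi>1 p u) = \<phi>2 p u" "\<phi>1 p (\<phi>3 p u) = - \<phi>2 p u"
  using su2_space.quaternion(1-6)[OF space assms] .

end

section \<open>The structure equations of the family and their consequences\<close>

locale su2_family_lc = su2_lc A g D \<phi>1 \<phi>2 \<phi>3 \<xi> \<eta>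
  for A :: "('a::{t2_space, second_countable_topology}, real ^ 5) atlas" and g D \<phi>1 \<phi>2 \<phi>3 \<xi> \<eta> +
  fixes l :: real
  assumes E1: "\<And>X Y p. VF X \<Longrightarrow> VF Y \<Longrightarrow> d1 (\<lambda>X p. \<eta> p [X p]) X Y p = - 2 * tw \<phi>3 X Y p + 2 * l * tw \<phi>1 X Y p"
    and E2: "\<And>X Y Z p. VF X \<Longrightarrow> VF Y \<Longrightarrow> VF Z \<Longrightarrow> d2 (tw \<phi>1) X Y Z p = 3 * A1.ew \<phi>2 X Y Z p"
    and E3: "\<And>X Y Z p. VF X \<Longrightarrow> VF Y \<Longrightarrow> VF Z \<Longrightarrow>
      d2 (tw \<phi>2) X Y Z p = - 3 * A1.ew \<phi>1 X Y Z p - 3 * l * A1.ew \<phi>3 X Y Z p"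
    and l: "l \<noteq> 0"
begin

abbreviation "e \<equiv> \<lambda>X p. \<eta> p [X p]"

text \<open>The closedness of d\<eta> = -2\<omega>3 + 2\<lambda>\<omega>1 ties d\<omega>3 to
  d\<omega>1.\<close>

lemma E4: "VF X \<Longrightarrow> VF Y \<Longrightarrow> VF Z \<Longrightarrow> d2 (tw \<phi>3) X Y Z p = 3 * l * A1.ew \<phi>2 X Y Z p"
proof -
  assume XYZ: "VF X" "VF Y" "VF Z"
  have "0 = d2 (d1 e) X Y Z p" using d2_d1[OF A1.one_form_e XYZ] by simp
  also have "\<dots> = d2 (\<lambda>X Y p. (- 2) * tw \<phi>3 X Y p + (2 * l) * tw \<phi>1 X Y p) X Y Z p"
    by (rule d2_cong) (use XYZ E1 in auto)
  also have "\<dots> = (- 2) * d2 (tw \<phi>3) X Y Z p + (2 * l) * d2 (tw \<phi>1) X Y Z p"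
    by (rule d2_lincomb[OF A3.two_form A1.two_form XYZ])
  finally show ?thesis using E2[OF XYZ] by simp
qed

lemma L:
  assumes "VF Y" "VF Z"
  shows "lie_deriv \<xi> (tw \<phi>1) Y Z p = 3 * tw \<phi>2 Y Z p"
    "lie_deriv \<xi> (tw \<phi>2) Y Z p = - 3 * tw \<phi>1 Y Z p - 3 * l * tw \<phi>3 Y Z p"
    "lie_deriv \<xi> (tw \<phi>3) Y Z p = 3 * l * tw \<phi>2 Y Z p"
  using assms by (simp_all add: A1.lie_tw A2.lie_tw A3.lie_tw E2 E3 E4 A1.xi_VF A1.ew_def
      A1.tw_xi A2.tw_xi A3.tw_xi A1.eta_xi)

lemma eta_lie_xi: "VF Y \<Longrightarrow> \<eta> p [lie_bracket \<xi> Y p] = \<xi> p (e Y)"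
  using E1[OF A1.xi_VF, of Y p] VF_deriv(6)[of Y p 1] A1.eta_xi
  by (simp add: d1_def A1.tw_xi A3.tw_xi)

text \<open>The metric enters each \<omega>i, so it cannot be differentiated away directly. But
  \<omega>1(\<phi>3 X, W) = -\<omega>2(X, W) holds without it; this yields the Lie derivative of
  \<phi>3, and \<omega>3 then compares it with that of the metric.\<close>

lemma killing: "VF X \<Longrightarrow> VF Y \<Longrightarrow> A1.killing X Y p = 0"
proof -
  have x: "A1.killing \<xi> Y p = 0" if "VF Y" for Y p
    using E1[OF A1.xi_VF that, of p] A1.d1_e[OF A1.xi_VF that, of p] A1.Dxi_xi[OF that, of p]
    by (simp add: A1.killing_def A1.tw_xi A3.tw_xi)
  have f: "A1.killing (\<lambda>q. \<phi>3 q (X q)) Y p = 0" if X: "VF X" and Y: "VF Y" for X Y p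
  proof -
    have X3: "VF (\<lambda>q. \<phi>3 q (X q))" by (rule A3.phi_VF[OF X])
    \<comment> \<open>U is the value at p of the Lie derivative of \<phi>3 applied to X.\<close>
    define U where "U = lie_bracket \<xi> (\<lambda>q. \<phi>3 q (X q)) p - \<phi>3 p (lie_bracket \<xi> X p)"
    have LT: "lie_bracket \<xi> X p \<in> T p" "lie_bracket \<xi> (\<lambda>q. \<phi>3 q (X q)) p \<in> T p"
      using X X3 A1.xi_VF by (auto intro!: T_lie_bracket)
    have UT: "U \<in> T p" using LT by (simp add: U_def T_diff eT[OF A3.endo])
    have "(\<lambda>q. \<eta> q [\<phi>3 q (X q)]) = (\<lambda>q. 0)" using X by (simp add: A3.eta_phi)
    then have "\<eta> p [lie_bracket \<xi> (\<lambda>q. \<phi>3 q (X q)) p] = 0"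
      using eta_lie_xi[OF X3, of p] VF_deriv(6)[OF A1.xi_VF, of p 0] by simp
    then have eU: "\<eta> p [U] = 0" using LT
      by (simp add: U_def form1_simps[OF A1.eta_form] eT[OF A3.endo] A3.eta_phi)
    have 1: "tw \<phi>1 (\<lambda>q. \<phi>3 q (X q)) W q = - tw \<phi>2 X W q" if "VF W" for W q
      using X that by (simp add: tw_def q g_simps eT[OF A2.endo])
    \<comment> \<open>The Lie derivative of \<omega>1(\<phi>3 X, W) = -\<omega>2(X, W): the terms
      3\<omega>1 on both sides cancel and 3\<lambda>\<omega>3 remains.\<close>
    have "g p (\<phi>1 p U) (W p) = 3 * l * tw \<phi>3 X W p" if W: "VF W" for W
    proof -
      have "tw \<phi>1 (\<lambda>q. \<phi>3 q (X q)) W = (\<lambda>q. - tw \<phi>2 X W q)" using 1[OF W] by blast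
      then have "\<xi> p (tw \<phi>1 (\<lambda>q. \<phi>3 q (X q)) W) = - \<xi> p (tw \<phi>2 X W)"
        using VF_deriv(3)[OF A1.xi_VF two_formD(1)[OF A2.two_form X W]] by simp
      then show ?thesis
        using L(1)[OF X3 W, of p] L(2)[OF X W, of p] 1[OF VF_lie_bracket[OF A1.xi_VF W], of p] X W LT
        by (simp add: lie_deriv_def tw_def U_def q g_simps esimps[OF A1.endo] eT[OF A1.endo] eT[OF A2.endo] eT[OF A3.endo] T_intros)
    qed
    \<comment> \<open>With W = \<phi>1 Y the left-hand side is g(U, Y), since U is horizontal; thus
      U = 3\<lambda> \<phi>2 X. This accounts for all of the Lie derivative of \<omega>3, and
      nothing is left for the metric.\<close>
    from this[OF A1.phi_VF[OF Y]] have "g p U (Y p) = 3 * l * tw \<phi>2 X Y p"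
      using X Y UT eU A1.phi_skew[of "\<phi>3 p (X p)" p "Y p"]
      by (simp add: tw_def A1.g_phi_phi q g_simps eT[OF A2.endo] eT[OF A3.endo])
    then show ?thesis
      using A1.lie_metric[OF X3 Y, of p] L(3)[OF X Y, of p] X Y LT
      by (simp add: lie_deriv_def tw_def[abs_def] U_def g_simps eT[OF A3.endo])
  qed
  assume "VF X" "VF Y"
  then show ?thesis using A3.killing_zeroI f x unfolding A1.killing_def A3.killing_def by blast
qed

text \<open>For a Killing field the bilinear form g(\<nabla>\<xi>, .) is skew, hence half of
  d\<eta>.\<close>

lemma D_xi:
  assumes X: "VF X" and Y: "VF Y"
  shows "g p (D X \<xi> p) (Y p) = - tw \<phi>3 X Y p + l * tw \<phi>1 X Y p"
  using E1[OF assms, of p] A1.d1_e[OF assms, of p] killing[OF assms, of p] by (simp add: A1.killing_def)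

lemma nab3_xi2:
  assumes X: "VF X" and Z: "VF Z"
  shows "nab \<phi>3 X \<xi> Z p = - (g p (X p) (Z p) - \<eta> p [X p] * \<eta> p [Z p]) - l * tw \<phi>2 X Z p"
  using assms A3.phi_skew[of "\<phi>1 p (X p)" p "Z p"] D_xi[OF X A3.phi_VF[OF Z], of p]
  by (simp add: A3.nab_xi2 tw_def A3.g_phi_phi q eT[OF A1.endo] eT[OF A3.endo])

text \<open>Of the three cyclic terms of d\<omega>3(\<xi>, Y, Z) = 3\<lambda>\<omega>2(Y, Z), two
  differentiate along Y and Z and are known from \<nabla>\<xi>; together they contribute
  2\<lambda>\<omega>2.\<close>

lemma nab3_xi1:
  assumes Y: "VF Y" and Z: "VF Z"
  shows "nab \<phi>3 \<xi> Y Z p = l * tw \<phi>2 Y Z p"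
  using E4[OF A1.xi_VF Y Z, of p] d2_tw[OF A3.skew A1.xi_VF Y Z, of p]
    nab3_xi2[OF Y Z, of p] nab3_xi2[OF Z Y, of p] nab_skew[OF A3.skew Y Z A1.xi_VF, of p]
    two_formD(2)[OF A2.two_form Y Z, of p] g_sym[of p "Y p" "Z p"]
  by (simp add: A1.ew_def A1.eta_xi A2.tw_xi)

text \<open>Each d\<omega>i is a multiple of \<eta>, so all three forms are closed on horizontal
  vectors. The other hypotheses of Hitchin's lemma are the derivatives of \<phi>i^2 and of the
  products \<phi>i \<phi>j.\<close>

lemma nab3_horizontal:
  assumes xyz: "x \<in> T p" "y \<in> T p" "z \<in> T p" "\<eta> p [x] = 0" "\<eta> p [y] = 0" "\<eta> p [z] = 0"
  shows "nab_at \<phi>3 p x y z = 0"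
proof -
  interpret S: su2_space "T p" "g p" "\<phi>1 p" "\<phi>2 p" "\<phi>3 p" "\<xi> p" "\<lambda>v. \<eta> p [v]" by (rule space)
  note at = nab_at_field[OF A1.endo] nab_at_field[OF A2.endo] nab_at_field[OF A3.endo]
  have J: "nab_at \<psi> p x (\<psi> p y) z = nab_at \<psi> p x y (\<psi> p z)"
    if s: "acm_lc A g D \<psi> \<xi> \<eta>" and xyz: "x \<in> T p" "y \<in> T p" "z \<in> T p" "\<eta> p [y] = 0" "\<eta> p [z] = 0" for \<psi> x y z
  proof -
    interpret P: acm_lc A g D \<psi> \<xi> \<eta> by (rule s)
    note VF = VF_extend[OF xyz(1)] VF_extend[OF xyz(2)] VF_extend[OF xyz(3)]
    show ?thesis
      using P.nab_phi_square[OF VF, of p] nab_at_field[OF P.endo VF(1) P.phi_VF[OF VF(2)] VF(3), of p]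
        nab_at_field[OF P.endo VF(1,2) P.phi_VF[OF VF(3)], of p] xyz by (simp add: extend_apply)
  qed
  have R: "nab_at \<psi>3 p x y z = nab_at \<psi>1 p x (\<psi>2 p y) z - nab_at \<psi>2 p x y (\<psi>1 p z)"
    if s: "skew_endo \<psi>1" and e: "endo_field A \<psi>2" "endo_field A \<psi>3" and q: "\<And>p u. u \<in> T p \<Longrightarrow> \<psi>1 p (\<psi>2 p u) = \<psi>3 p u"
      and xyz: "x \<in> T p" "y \<in> T p" "z \<in> T p" for \<psi>1 \<psi>2 \<psi>3 x y z
  proof -
    note VF = VF_extend[OF xyz(1)] VF_extend[OF xyz(2)] VF_extend[OF xyz(3)]
    show ?thesis
      using nab_product[of \<psi>1 \<psi>2 \<psi>3, OF s e(1) q VF, of p] nab_at_field[OF skewD(1)[OF s] VF(1) eVF[OF e(1) VF(2)] VF(3), of p]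
        nab_at_field[OF e(1) VF(1,2) eVF[OF skewD(1)[OF s] VF(3)], of p] nab_at_field[OF e(2) VF, of p] xyz
      by (simp add: extend_apply)
  qed
  have cl: "nab_at \<psi> p x y z + nab_at \<psi> p y z x + nab_at \<psi> p z x y = 0"
    if s: "\<psi> \<in> {\<phi>1, \<phi>2, \<phi>3}" and xyz: "x \<in> T p" "y \<in> T p" "z \<in> T p" "\<eta> p [x] = 0" "\<eta> p [y] = 0" "\<eta> p [z] = 0" for \<psi> x y z
  proof -
    note VF = VF_extend[OF xyz(1)] VF_extend[OF xyz(2)] VF_extend[OF xyz(3)]
    have "d2 (tw \<psi>) (extend p x) (extend p y) (extend p z) p = 0"
      using s E2[OF VF, of p] E3[OF VF, of p] E4[OF VF, of p] xyz by (auto simp: A1.ew_def extend_apply)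
    moreover have "skew_endo \<psi>" using s A1.skew A2.skew A3.skew by auto
    ultimately show ?thesis using d2_tw[of \<psi>, OF _ VF, of p] by (simp add: nab_at_def)
  qed
  have r: "nab_at \<phi>3 p x y z = nab_at \<phi>1 p x (\<phi>2 p y) z - nab_at \<phi>2 p x y (\<phi>1 p z) \<and>
      nab_at \<phi>1 p x y z = nab_at \<phi>2 p x (\<phi>3 p y) z - nab_at \<phi>3 p x y (\<phi>2 p z) \<and>
      nab_at \<phi>2 p x y z = nab_at \<phi>3 p x (\<phi>1 p y) z - nab_at \<phi>1 p x y (\<phi>3 p z)"
    if xyz: "x \<in> T p" "y \<in> T p" "z \<in> T p" for x y z
  proof (intro conjI)
    show "nab_at \<phi>3 p x y z = nab_at \<phi>1 p x (\<phi>2 p y) z - nab_at \<phi>2 p x y (\<phi>1 p z)"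
      by (rule R[of \<phi>1 \<phi>2 \<phi>3, OF A1.skew A2.endo A3.endo _ xyz]) (rule q(1))
    show "nab_at \<phi>1 p x y z = nab_at \<phi>2 p x (\<phi>3 p y) z - nab_at \<phi>3 p x y (\<phi>2 p z)"
      by (rule R[of \<phi>2 \<phi>3 \<phi>1, OF A2.skew A3.endo A1.endo _ xyz]) (rule q(3))
    show "nab_at \<phi>2 p x y z = nab_at \<phi>3 p x (\<phi>1 p y) z - nab_at \<phi>1 p x y (\<phi>3 p z)"
      by (rule R[of \<phi>3 \<phi>1 \<phi>2, OF A3.skew A1.endo A2.endo _ xyz]) (rule q(5))
  qed
  interpret su2_torsion "T p" "g p" "\<phi>1 p" "\<phi>2 p" "\<phi>3 p" "\<xi> p" "\<lambda>v. \<eta> p [v]" "nab_at \<phi>1 p" "nab_at \<phi>2 p" "nab_at \<phi>3 p"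
  proof
    note lin = nab_at_lin[OF A1.endo] nab_at_lin[OF A2.endo] nab_at_lin[OF A3.endo]
    show "\<forall>F\<in>{nab_at \<phi>1 p, nab_at \<phi>2 p, nab_at \<phi>3 p}. \<forall>a b. \<forall>u\<in>T p. \<forall>v\<in>T p. \<forall>y\<in>T p. \<forall>z\<in>T p.
        F (a *\<^sub>R u + b *\<^sub>R v) y z = a * F u y z + b * F v y z"
      "\<forall>F\<in>{nab_at \<phi>1 p, nab_at \<phi>2 p, nab_at \<phi>3 p}. \<forall>a b. \<forall>u\<in>T p. \<forall>v\<in>T p. \<forall>y\<in>T p. \<forall>z\<in>T p.
        F y z (a *\<^sub>R u + b *\<^sub>R v) = a * F y z u + b * F y z v"
      unfolding ball_simps by (simp_all add: lin)
    have sk: "nab_at \<psi> p x y z = - nab_at \<psi> p x z y" if "skew_endo \<psi>" "x \<in> T p" "y \<in> T p" "z \<in> T p" for \<psi> x y z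
      unfolding nab_at_def by (rule nab_skew[OF that(1)]) (rule VF_extend, rule that)+
    show "\<forall>F\<in>{nab_at \<phi>1 p, nab_at \<phi>2 p, nab_at \<phi>3 p}. \<forall>x\<in>T p. \<forall>y\<in>T p. \<forall>z\<in>T p. F x y z = - F x z y"
      unfolding ball_simps using sk[OF A1.skew] sk[OF A2.skew] sk[OF A3.skew] by blast
    show "\<forall>F\<in>{nab_at \<phi>1 p, nab_at \<phi>2 p, nab_at \<phi>3 p}. \<forall>x\<in>T p. \<forall>y\<in>T p. \<forall>z\<in>T p.
        \<eta> p [x] = 0 \<longrightarrow> \<eta> p [y] = 0 \<longrightarrow> \<eta> p [z] = 0 \<longrightarrow> F x y z + F y z x + F z x y = 0"
      unfolding ball_simps using cl[of \<phi>1] cl[of \<phi>2] cl[of \<phi>3] by blast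
    show "nab_at \<phi>1 p x (\<phi>1 p y) z = nab_at \<phi>1 p x y (\<phi>1 p z)" "nab_at \<phi>2 p x (\<phi>2 p y) z = nab_at \<phi>2 p x y (\<phi>2 p z)"
      "nab_at \<phi>3 p x (\<phi>3 p y) z = nab_at \<phi>3 p x y (\<phi>3 p z)"
      if "x \<in> T p" "y \<in> T p" "z \<in> T p" "\<eta> p [y] = 0" "\<eta> p [z] = 0" for x y z
      by (rule J[OF A1.acm_lc_axioms that], rule J[OF A2.acm_lc_axioms that], rule J[OF A3.acm_lc_axioms that])
    show "nab_at \<phi>3 p x y z = nab_at \<phi>1 p x (\<phi>2 p y) z - nab_at \<phi>2 p x y (\<phi>1 p z)"
      "nab_at \<phi>1 p x y z = nab_at \<phi>2 p x (\<phi>3 p y) z - nab_at \<phi>3 p x y (\<phi>2 p z)"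
      "nab_at \<phi>2 p x y z = nab_at \<phi>3 p x (\<phi>1 p y) z - nab_at \<phi>1 p x y (\<phi>3 p z)"
      if "x \<in> T p" "y \<in> T p" "z \<in> T p" for x y z
      using r[OF that] by auto
  qed
  show ?thesis by (rule T3_horizontal[OF xyz])
qed

text \<open>The horizontal part vanishes, so \<nabla>\<phi>3 is assembled from its values with \<xi>
  inserted in one place; inserting \<xi> twice gives zero.\<close>

lemma nab3:
  assumes X: "VF X" and Y: "VF Y" and Z: "VF Z"
  shows "nab \<phi>3 X Y Z p = g p (X p) (Y p) * \<eta> p [Z p] - \<eta> p [Y p] * g p (X p) (Z p) + l * A1.ew \<phi>2 X Y Z p"
proof -
  note x = A1.xi_VF and e = A3.endo
  note at = nab_at_field[OF e X Y Z] nab_at_field[OF e x Y Z] nab_at_field[OF e X x Z] nab_at_field[OF e x x Z]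
    nab_at_field[OF e X Y x] nab_at_field[OF e x Y x] nab_at_field[OF e X x x] nab_at_field[OF e x x x]
  have xi2: "tw \<phi>2 X \<xi> q = 0" if "VF X" for X q
    using two_formD(2)[OF A2.two_form that x, of q] by (simp add: A2.tw_xi)
  have z: "nab \<phi>3 \<xi> \<xi> Z p = 0" "nab \<phi>3 \<xi> Y \<xi> p = 0" "nab \<phi>3 X \<xi> \<xi> p = 0" "nab \<phi>3 \<xi> \<xi> \<xi> p = 0"
    unfolding nab3_xi1[OF x Z] nab3_xi1[OF Y x] nab3_xi2[OF X x] nab3_xi1[OF x x] xi2[OF X] xi2[OF Y] xi2[OF x]
    using X by (simp_all add: A2.tw_xi A1.g_xi A1.eta_xi)
  interpret P: acm_space "T p" "g p" "\<phi>3 p" "\<xi> p" "\<lambda>v. \<eta> p [v]" by (rule A3.space)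
  have "nab_at \<phi>3 p (X p) (Y p) (Z p) = \<eta> p [X p] * nab_at \<phi>3 p (\<xi> p) (Y p) (Z p)
      + \<eta> p [Y p] * (nab_at \<phi>3 p (X p) (\<xi> p) (Z p) - \<eta> p [X p] * nab_at \<phi>3 p (\<xi> p) (\<xi> p) (Z p))
      + \<eta> p [Z p] * (nab_at \<phi>3 p (X p) (Y p) (\<xi> p) - \<eta> p [X p] * nab_at \<phi>3 p (\<xi> p) (Y p) (\<xi> p)
        - \<eta> p [Y p] * nab_at \<phi>3 p (X p) (\<xi> p) (\<xi> p) + \<eta> p [X p] * \<eta> p [Y p] * nab_at \<phi>3 p (\<xi> p) (\<xi> p) (\<xi> p))"
    by (rule P.trilinear_split[where F = "nab_at \<phi>3 p"])
      (assumption | rule VF_T[OF X] VF_T[OF Y] VF_T[OF Z] | rule nab_at_lin(1)[OF e] | rule nab_at_lin(2)[OF e] |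
        rule nab_at_lin(3)[OF e] | rule nab3_horizontal)+
  then show ?thesis
    unfolding at z nab3_xi1[OF Y Z] nab3_xi2[OF X Z] nab_skew[OF A3.skew X Y x] nab3_xi2[OF X Y] A1.ew_def
    by (simp add: algebra_simps)
qed

text \<open>The deviation from the Sasakian formula is the 3-form \<lambda> \<eta> \<and> \<omega>2,
  which disappears on symmetrising in X and Y.\<close>

lemma nearly_sasakian: "nearly_sasakian A \<phi>3 \<xi> \<eta> g"
  unfolding nearly_sasakian_def
proof (intro conjI exI[of _ D] allI impI)
  show "almost_contact_metric A \<phi>3 \<xi> \<eta> g" by (rule A3.acm)
  show "levi_civita A g D" by (rule lc)
  fix X Y p assume X: "VF X" and Y: "VF Y"
  note n = nabla_endo_g[OF A3.endo X Y] nabla_endo_g[OF A3.endo Y X]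
  show "nabla_endo D \<phi>3 X Y p + nabla_endo D \<phi>3 Y X p =
      (2 * g p (X p) (Y p)) *\<^sub>R \<xi> p - \<eta> p [X p] *\<^sub>R Y p - \<eta> p [Y p] *\<^sub>R X p" (is "?l = ?r")
  proof (rule g_eqI)
    show "?l \<in> T p" "?r \<in> T p" using X Y A1.xi_VF n(1,3) by (simp_all add: T_intros)
    fix w assume w: "w \<in> T p"
    note W = VF_extend[OF w]
    show "g p ?l w = g p ?r w"
      using n(2,4)[of p "extend p w"] nab3[OF X Y W, of p] nab3[OF Y X W, of p] X Y w n(1,3)
        two_formD(2)[OF A2.two_form X Y, of p] g_sym[of p "X p" "Y p"]
      by (simp add: extend_apply g_simps A1.g_xi A1.ew_def T_intros algebra_simps)
  qed
qed

text \<open>A Sasakian structure has d\<eta> = -2\<omega>3, leaving 2\<lambda>\<omega>1 = 0. The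
  comparison is made on d\<eta> because the witnessing connection D' need not be D.\<close>

lemma not_sasakian: "\<not> sasakian A \<phi>3 \<xi> \<eta> g"
proof
  assume "sasakian A \<phi>3 \<xi> \<eta> g"
  then obtain D' where lc': "levi_civita A g D'" and S: "\<And>X Y p. VF X \<Longrightarrow> VF Y \<Longrightarrow>
      nabla_endo D' \<phi>3 X Y p = g p (X p) (Y p) *\<^sub>R \<xi> p - \<eta> p [Y p] *\<^sub>R X p"
    unfolding sasakian_def by blast
  interpret S: acm_lc A g D' \<phi>3 \<xi> \<eta> by unfold_locales (rule lc', rule A3.acm)
  fix p :: 'a
  obtain u where u: "u \<in> T p" "\<eta> p [u] = 0" "g p u u = 1"
    by (rule acm_space.adapted_basis[OF A1.space, of p])
  have "S.tw = tw" by (simp add: fun_eq_iff tw_def S.tw_def)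
  then have "2 * l * tw \<phi>1 (extend p u) (extend p (\<phi>1 p u)) p = 0"
    using S.Sasakian_d1[OF S, of "extend p u" "extend p (\<phi>1 p u)" p] E1[of "extend p u" "extend p (\<phi>1 p u)" p] u
    by (simp add: VF_extend eT[OF A1.endo])
  then show False using u l by (simp add: tw_def extend_apply eT[OF A1.endo] A1.g_phi_phi)
qed

end


section \<open>From nearly Sasakian structures to \<open>SU(2)\<close>-structures\<close>

context manifold
begin

lemma two_form_lincomb:
  assumes b: "two_form b" and b': "two_form b'" and r: "C r" and s: "C s"
  shows "two_form (\<lambda>X Y p. r p * b X Y p + s p * b' X Y p)"
  unfolding two_form_def one_form_def tensorial_def
proof (intro conjI allI impI)
  fix X Y p assume "VF X" "VF Y"
  then show "r p * b X Y p + s p * b' X Y p = - (r p * b Y X p + s p * b' Y X p)"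
    using two_formD(2)[OF b, of X Y p] two_formD(2)[OF b', of X Y p] by simp
qed (use two_formD(1)[OF b] two_formD(1)[OF b'] r s tensorial_add[OF two_formD(3)[OF b]] tensorial_add[OF two_formD(3)[OF b']]
    tensorial_scale[OF two_formD(3)[OF b]] tensorial_scale[OF two_formD(3)[OF b']] in
    \<open>simp_all add: C_add C_mult algebra_simps\<close>)

lemma two_form_cong:
  assumes b: "two_form b" and eq: "\<And>X Y. VF X \<Longrightarrow> VF Y \<Longrightarrow> b' X Y = b X Y"
  shows "two_form b'"
  unfolding two_form_def one_form_def tensorial_def
proof (intro conjI allI impI)
  fix X Y p assume "VF X" "VF Y"
  then show "b' X Y p = - b' Y X p"
    using two_formD(2)[OF b, of X Y p] by (simp add: eq)
qed (use two_formD(1)[OF b] tensorial_add[OF two_formD(3)[OF b]] tensorial_scale[OF two_formD(3)[OF b]] in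
    \<open>simp_all add: eq VF_add VF_scale\<close>)

end

context lc_manifold
begin

lemma tensorial_nabla_endo:
  assumes e: "endo_field A \<psi>" and X: "VF X"
  shows "tensorial (\<lambda>Y. nabla_endo D \<psi> X Y)" "VF Y \<Longrightarrow> VF (nabla_endo D \<psi> X Y)"
proof -
  show "tensorial (\<lambda>Y. nabla_endo D \<psi> X Y)"
    unfolding tensorial_def nabla_endo_def minus_apply[of "D X _" "\<lambda>p. _ p (D X _ p)"]
    using X by (simp add: esimps[OF e] D_add D_scale eVF[OF e] eT[OF e] VF_D_T T_scale T_add scaleR_right_diff_distrib)
  show "VF (nabla_endo D \<psi> X Y)" if Y: "VF Y"
  proof -
    have "nabla_endo D \<psi> X Y = (\<lambda>p. D X (\<lambda>q. \<psi> q (Y q)) p - \<psi> p (D X Y p))"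
      by (rule ext) (simp only: nabla_endo_def minus_apply)
    then show ?thesis using VF_diff[OF VF_D[OF X eVF[OF e Y]] eVF[OF e VF_D[OF X Y]]] by simp
  qed
qed

text \<open>\<open>nabla_endo D \<psi> X\<close> acts on fields; tensoriality makes it an
  endomorphism at each point, as needed to form products with \<phi>.\<close>

definition nabla_along :: "'a vfield \<Rightarrow> 'a endo \<Rightarrow> 'a endo" where
  "nabla_along X \<psi> = value_at (nabla_endo D \<psi> X)"

lemma nabla_along:
  assumes e: "endo_field A \<psi>" and X: "VF X"
  shows "endo_field A (nabla_along X \<psi>)" "VF Y \<Longrightarrow> VF Z \<Longrightarrow> tw (nabla_along X \<psi>) Y Z p = nab \<psi> X Y Z p"
proof -
  note t = tensorial_nabla_endo[OF e X]
  have f: "nabla_along X \<psi> p (Y p) = nabla_endo D \<psi> X Y p" if "VF Y" for Y p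
    unfolding nabla_along_def by (rule value_at_field[OF t(1) that])
  show "endo_field A (nabla_along X \<psi>)"
    unfolding endo_field_def
  proof (intro conjI allI ballI impI)
    show "nabla_along X \<psi> p v = 0" if "v \<notin> T p" for p v using that by (simp add: nabla_along_def value_at_def)
    show "nabla_along X \<psi> p (a *\<^sub>R v + b *\<^sub>R w) = a *\<^sub>R nabla_along X \<psi> p v + b *\<^sub>R nabla_along X \<psi> p w"
      if "v \<in> T p" "w \<in> T p" for p a b v w
      unfolding nabla_along_def by (rule value_at_linear[OF t(1) that])
    show "VF (\<lambda>p. nabla_along X \<psi> p (Y p))" if "VF Y" for Y
      using t(2)[OF that] f[OF that] by simp
  qed
  show "tw (nabla_along X \<psi>) Y Z p = nab \<psi> X Y Z p" if "VF Y" "VF Z"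
    using nabla_endo_g(2)[OF e X that(1)] by (simp add: tw_def f[OF that(1)])
qed

lemma endo_field_scale:
  assumes "endo_field A \<psi>" shows "endo_field A (\<lambda>p v. r *\<^sub>R \<psi> p v)"
proof -
  have o: "\<psi> p v = 0" if "v \<notin> T p" for p v using assms that unfolding endo_field_def by blast
  show ?thesis
    unfolding endo_field_def
    using o by (simp add: elin[OF assms] scaleR_add_right mult.commute VF_cscale eVF[OF assms])
qed

lemma endo_field_comp:
  assumes "endo_field A \<psi>" "endo_field A \<theta>" shows "endo_field A (\<lambda>p v. \<psi> p (\<theta> p v))"
proof -
  have o: "\<theta> p v = 0" if "v \<notin> T p" for p v using assms that unfolding endo_field_def by blast
  have z: "\<psi> p 0 = 0" for p using elin[OF assms(1), of 0 p 0 0 0] by (simp add: T_intros)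
  show ?thesis
    unfolding endo_field_def
    using o z by (simp add: elin[OF assms(1)] elin[OF assms(2)] eVF[OF assms(1)] eVF[OF assms(2)] eT[OF assms(2)])
qed

end

locale nearly_sasakian_lc = acm_lc A g D \<phi> \<xi> \<eta>
  for A :: "('a::{t2_space, second_countable_topology}, real ^ 5) atlas" and g D \<phi> \<xi> \<eta> +
  assumes NS: "\<And>X Y p. VF X \<Longrightarrow> VF Y \<Longrightarrow> nabla_endo D \<phi> X Y p + nabla_endo D \<phi> Y X p =
      (2 * g p (X p) (Y p)) *\<^sub>R \<xi> p - \<eta> p [X p] *\<^sub>R Y p - \<eta> p [Y p] *\<^sub>R X p"
begin

lemma nab_sym:
  assumes X: "VF X" and Y: "VF Y" and Z: "VF Z"
  shows "nab \<phi> X Y Z p + nab \<phi> Y X Z p =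
    2 * g p (X p) (Y p) * \<eta> p [Z p] - \<eta> p [X p] * g p (Y p) (Z p) - \<eta> p [Y p] * g p (X p) (Z p)"
proof -
  have "g p (nabla_endo D \<phi> X Y p + nabla_endo D \<phi> Y X p) (Z p) =
      2 * g p (X p) (Y p) * \<eta> p [Z p] - \<eta> p [X p] * g p (Y p) (Z p) - \<eta> p [Y p] * g p (X p) (Z p)"
    unfolding NS[OF X Y] using X Y Z by (simp add: g_simps g_xi T_intros)
  then show ?thesis
    using nabla_endo_g[OF endo X Y, of p] nabla_endo_g[OF endo Y X, of p] by (simp add: g_simps)
qed

section \<open>The skew tensor and the endomorphisms k and h\<close>

definition P :: "'a \<Rightarrow> 'a tangent \<Rightarrow> 'a tangent \<Rightarrow> 'a tangent \<Rightarrow> real" where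
  "P p x y z = nab_at \<phi> p x y z - g p x y * \<eta> p [z] + \<eta> p [y] * g p x z"

lemma P_skew:
  assumes "x \<in> T p" "y \<in> T p" "z \<in> T p"
  shows "P p x y z = - P p y x z" "P p x y z = - P p x z y"
proof -
  note VF = VF_extend[OF assms(1)] VF_extend[OF assms(2)] VF_extend[OF assms(3)]
  show "P p x y z = - P p y x z"
    using nab_sym[OF VF, of p] g_sym[of p y x] assms by (simp add: P_def nab_at_def extend_apply)
  show "P p x y z = - P p x z y"
    using nab_skew[OF skew VF, of p] by (simp add: P_def nab_at_def)
qed

lemma P_lin:
  assumes "u \<in> T p" "v \<in> T p" "y \<in> T p" "z \<in> T p"
  shows "P p (a *\<^sub>R u + b *\<^sub>R v) y z = a * P p u y z + b * P p v y z"
    "P p y (a *\<^sub>R u + b *\<^sub>R v) z = a * P p y u z + b * P p y v z"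
    "P p y z (a *\<^sub>R u + b *\<^sub>R v) = a * P p y z u + b * P p y z v"
  unfolding P_def nab_at_lin[OF endo assms] form1_lin[OF eta_form assms(1,2)]
  using assms by (simp_all add: g_simps T_scale algebra_simps)

lemma P_horizontal:
  assumes xyz: "x \<in> T p" "y \<in> T p" "z \<in> T p" "\<eta> p [x] = 0" "\<eta> p [y] = 0" "\<eta> p [z] = 0"
  shows "P p x y z = 0"
proof -
  have J: "P p x (\<phi> p y) z = P p x y (\<phi> p z)"
    if xyz: "x \<in> T p" "y \<in> T p" "z \<in> T p" "\<eta> p [y] = 0" "\<eta> p [z] = 0" for x y z
  proof -
    note VF = VF_extend[OF xyz(1)] VF_extend[OF xyz(2)] VF_extend[OF xyz(3)]
    show ?thesis
      using nab_phi_square[OF VF, of p] nab_at_field[OF endo VF(1) phi_VF[OF VF(2)] VF(3), of p]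
        nab_at_field[OF endo VF(1,2) phi_VF[OF VF(3)], of p] xyz by (simp add: P_def extend_apply eta_phi)
  qed
  show ?thesis
    by (rule acm_space.skew_3_form_horizontal[OF space, of p "P p"])
      (assumption | rule xyz | rule P_lin(1) | rule P_skew(1) | rule P_skew(2) | rule J)+
qed

definition k :: "'a endo" where "k = nabla_along \<xi> \<phi>"
definition h :: "'a endo" where "h p v = (-1) *\<^sub>R \<phi> p (k p v)"

lemma k_endo: "endo_field A k" and tw_k: "VF Y \<Longrightarrow> VF Z \<Longrightarrow> tw k Y Z p = nab \<phi> \<xi> Y Z p"
  unfolding k_def by (rule nabla_along[OF endo xi_VF], (assumption+)?)+

lemma h_endo: "endo_field A h"
  using endo_field_scale[OF endo_field_comp[OF endo k_endo], of "-1"] by (simp add: h_def[abs_def])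

lemma k_skew: "skew_endo k"
  unfolding skew_endo_def
proof (intro conjI k_endo allI ballI)
  fix p u v assume uv: "u \<in> T p" "v \<in> T p"
  show "g p (k p u) v = - g p u (k p v)"
    using tw_k[OF VF_extend[OF uv(1)] VF_extend[OF uv(2)], of p] tw_k[OF VF_extend[OF uv(2)] VF_extend[OF uv(1)], of p]
      nab_skew[OF skew xi_VF VF_extend[OF uv(1)] VF_extend[OF uv(2)], of p] uv g_sym[of p u "k p v"]
    by (simp add: tw_def extend_apply)
qed

lemma P_xi: "VF Y \<Longrightarrow> VF Z \<Longrightarrow> P p (\<xi> p) (Y p) (Z p) = tw k Y Z p"
  by (simp add: P_def nab_at_field[OF endo xi_VF] tw_k g_xi)

text \<open>The skew tensor has no horizontal part and vanishes when \<xi> is inserted twice, so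
  only its contractions with \<xi>, which are given by k, survive.\<close>

lemma nab_phi:
  assumes X: "VF X" and Y: "VF Y" and Z: "VF Z"
  shows "nab \<phi> X Y Z p = g p (X p) (Y p) * \<eta> p [Z p] - \<eta> p [Y p] * g p (X p) (Z p) + ew k X Y Z p"
proof -
  note x = xi_VF and V = VF_T[OF X, of p] VF_T[OF Y, of p] VF_T[OF Z, of p] xi_T
  have "P p (X p) (Y p) (Z p) = \<eta> p [X p] * P p (\<xi> p) (Y p) (Z p)
      + \<eta> p [Y p] * (P p (X p) (\<xi> p) (Z p) - \<eta> p [X p] * P p (\<xi> p) (\<xi> p) (Z p))
      + \<eta> p [Z p] * (P p (X p) (Y p) (\<xi> p) - \<eta> p [X p] * P p (\<xi> p) (Y p) (\<xi> p)
        - \<eta> p [Y p] * P p (X p) (\<xi> p) (\<xi> p) + \<eta> p [X p] * \<eta> p [Y p] * P p (\<xi> p) (\<xi> p) (\<xi> p))"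
    by (rule acm_space.trilinear_split[OF space, where F = "P p"])
      (assumption | rule V | rule P_lin(1) | rule P_lin(2) | rule P_lin(3) | rule P_horizontal)+
  moreover have "P p (\<xi> p) (\<xi> p) w = 0" "P p w (\<xi> p) (\<xi> p) = 0" "P p (\<xi> p) w (\<xi> p) = 0" if w: "w \<in> T p" for w
    using P_skew(1)[OF xi_T xi_T w] P_skew(2)[OF w xi_T xi_T] P_skew(2)[OF xi_T w xi_T] P_skew(1)[OF xi_T xi_T w] by simp_all
  moreover have "P p (X p) (\<xi> p) (Z p) = - tw k X Z p"
    using P_skew(1)[OF V(1,4,3)] P_xi[OF X Z] by simp
  moreover have "P p (X p) (Y p) (\<xi> p) = tw k X Y p"
    using P_skew(2)[OF V(1,2,4)] P_skew(1)[OF V(1,4,2)] P_xi[OF X Y] by simp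
  ultimately have "P p (X p) (Y p) (Z p) = ew k X Y Z p"
    using V P_xi[OF Y Z, of p] by (simp add: ew_def)
  then show ?thesis using nab_at_field[OF endo X Y Z, of p] by (simp add: P_def)
qed

lemma k_xi: "k p (\<xi> p) = 0"
proof (rule g_eqI)
  show "k p (\<xi> p) \<in> T p" by (simp add: eT[OF k_endo])
  show "(0::'a tangent) \<in> T p" by (simp add: T_intros)
  show "g p (k p (\<xi> p)) w = g p 0 w" if w: "w \<in> T p" for w
    using P_xi[OF xi_VF VF_extend[OF w], of p] P_skew(1)[OF xi_T xi_T w] w
    by (simp add: tw_def extend_apply T_intros)
qed

lemma eta_k: "u \<in> T p \<Longrightarrow> \<eta> p [k p u] = 0"
  using skewD(2)[OF k_skew, of u p "\<xi> p"] by (simp add: g_xi eT[OF k_endo] k_xi T_intros)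

lemma phi_h: "u \<in> T p \<Longrightarrow> \<phi> p (h p u) = k p u"
  by (simp add: h_def esimps[OF endo] eT[OF endo] eT[OF k_endo] phi_phi eta_k)

lemma phi_k: "\<phi> p (k p u) = - h p u"
  by (simp add: h_def)

lemma h_xi: "h p (\<xi> p) = 0"
  using esimps(3)[OF endo, of 0 p 0] by (simp add: h_def k_xi T_intros)

lemma k_phi: "u \<in> T p \<Longrightarrow> k p (\<phi> p u) = h p u"
proof (rule g_eqI)
  assume u: "u \<in> T p"
  show "k p (\<phi> p u) \<in> T p" "h p u \<in> T p" using u by (simp_all add: eT[OF k_endo] eT[OF endo] eT[OF h_endo])
  fix w assume w: "w \<in> T p"
  note VF = VF_extend[OF u] VF_extend[OF w]
  have z: "g p (D \<xi> \<xi> p) v = 0" if "v \<in> T p" for v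
    using Dxi_nab[OF xi_VF VF_extend[OF that], of p] tw_k[OF xi_VF phi_VF[OF VF_extend[OF that]], of p] that
    by (simp add: tw_def k_xi extend_apply T_intros)
  show "g p (k p (\<phi> p u)) w = g p (h p u) w"
    using nab_phi_square[OF xi_VF VF, of p] z[OF u] z[OF w] tw_k[OF phi_VF[OF VF(1)] VF(2), of p]
      tw_k[OF VF(1) phi_VF[OF VF(2)], of p] u w phi_skew[of "k p u" p w]
    by (simp add: tw_def extend_apply h_def g_simps eT[OF k_endo] eT[OF endo])
qed

lemma h_phi: "u \<in> T p \<Longrightarrow> h p (\<phi> p u) = - k p u"
  using k_phi[of u p] phi_h[of u p] by (simp add: h_def k_phi)

lemma h_skew: "skew_endo h"
  unfolding skew_endo_def
proof (intro conjI h_endo allI ballI)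
  fix p u v assume uv: "u \<in> T p" "v \<in> T p"
  have "g p (h p u) v = g p (k p u) (\<phi> p v)"
    using uv phi_skew[of "k p u" p v] by (simp add: h_def g_simps eT[OF k_endo] eT[OF endo])
  also have "\<dots> = - g p u (k p (\<phi> p v))" using uv skewD(2)[OF k_skew] by (simp add: eT[OF endo])
  finally show "g p (h p u) v = - g p u (h p v)" using uv by (simp add: k_phi)
qed

lemma D_xi:
  assumes X: "VF X" and Z: "VF Z"
  shows "g p (D X \<xi> p) (Z p) = - tw \<phi> X Z p + tw h X Z p"
proof -
  have "tw k X \<xi> p = 0" "tw k \<xi> W p = 0" for W
    using X by (simp_all add: tw_def g_xi eT[OF k_endo] eta_k k_xi T_intros)
  then show ?thesis
    using Dxi_nab[OF X Z, of p] nab_phi[OF X xi_VF phi_VF[OF Z], of p] X Z phi_skew[of "X p" p "Z p"]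
      phi_skew[of "k p (X p)" p "Z p"]
    by (simp add: ew_def eta_phi eta_xi g_xi tw_def h_def g_simps eT[OF k_endo] eT[OF endo] k_xi)
qed

lemma killing: "VF X \<Longrightarrow> VF Y \<Longrightarrow> killing X Y p = 0"
  using two_formD(2)[OF two_form, of X Y p] two_formD(2)[OF two_form_tw[OF h_skew], of X Y p]
  by (simp add: killing_def D_xi)

lemma d1_eta: "VF X \<Longrightarrow> VF Y \<Longrightarrow> d1 e X Y p = - 2 * tw \<phi> X Y p + 2 * tw h X Y p"
  using two_formD(2)[OF two_form, of X Y p] two_formD(2)[OF two_form_tw[OF h_skew], of X Y p]
  by (simp add: d1_e D_xi)

text \<open>Each of the three cyclic terms contributes \<eta> \<and> \<sigma>2 once, hence the
  factor 3; the metric terms cancel.\<close>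

lemma d2_phi: "VF X \<Longrightarrow> VF Y \<Longrightarrow> VF Z \<Longrightarrow> d2 (tw \<phi>) X Y Z p = 3 * ew k X Y Z p"
  using two_formD(2)[OF two_form_tw[OF k_skew], of X Y p] two_formD(2)[OF two_form_tw[OF k_skew], of X Z p]
    two_formD(2)[OF two_form_tw[OF k_skew], of Y Z p] g_sym[of p "X p"] g_sym[of p "Y p" "Z p"]
  by (simp add: d2_tw[OF skew] nab_phi ew_def algebra_simps)

text \<open>Closedness of d\<eta> = -2\<omega>3 + 2\<sigma>1 equates the differentials of the two
  summands.\<close>

lemma d2_h: "VF X \<Longrightarrow> VF Y \<Longrightarrow> VF Z \<Longrightarrow> d2 (tw h) X Y Z p = 3 * ew k X Y Z p"
proof -
  assume XYZ: "VF X" "VF Y" "VF Z"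
  have "0 = d2 (d1 e) X Y Z p" using d2_d1[OF one_form_e XYZ] by simp
  also have "\<dots> = d2 (\<lambda>X Y p. (- 2) * tw \<phi> X Y p + 2 * tw h X Y p) X Y Z p"
    by (rule d2_cong) (use XYZ d1_eta in auto)
  also have "\<dots> = (- 2) * d2 (tw \<phi>) X Y Z p + 2 * d2 (tw h) X Y Z p"
    by (rule d2_lincomb[OF two_form two_form_tw[OF h_skew] XYZ])
  finally show ?thesis using d2_phi[OF XYZ] by simp
qed

section \<open>Lie derivatives along the Reeb field\<close>

lemma eta_lie_xi: "VF Y \<Longrightarrow> \<eta> p [lie_bracket \<xi> Y p] = \<xi> p (e Y)"
  using d1_eta[OF xi_VF, of Y p] VF_deriv(6)[of Y p 1] eta_xi
  by (simp add: d1_def tw_def phi_xi h_xi)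

text \<open>As \<xi> is Killing, lowering an index commutes with the Lie derivative, so brackets
  with \<xi> can be computed from 2-forms.\<close>

lemma lie_endo:
  assumes e: "endo_field A \<psi>" and X: "VF X" and Y: "VF Y"
  shows "g p (lie_bracket \<xi> (\<lambda>q. \<psi> q (X q)) p - \<psi> p (lie_bracket \<xi> X p)) (Y p) = lie_deriv \<xi> (tw \<psi>) X Y p"
  using lie_metric[OF eVF[OF e X] Y, of p] killing[OF eVF[OF e X] Y, of p] X Y xi_VF
  by (simp add: lie_deriv_def tw_def[abs_def] g_simps eT[OF e] eVF[OF e] T_lie_bracket)

lemma lie_phi: "VF X \<Longrightarrow> lie_bracket \<xi> (\<lambda>q. \<phi> q (X q)) p = \<phi> p (lie_bracket \<xi> X p) + 3 *\<^sub>R k p (X p)"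
  and lie_h: "VF X \<Longrightarrow> lie_bracket \<xi> (\<lambda>q. h q (X q)) p = h p (lie_bracket \<xi> X p) + 3 *\<^sub>R k p (X p)"
proof -
  have *: "lie_bracket \<xi> (\<lambda>q. \<psi> q (X q)) p = \<psi> p (lie_bracket \<xi> X p) + 3 *\<^sub>R k p (X p)"
    if e: "endo_field A \<psi>" and X: "VF X"
      and L: "\<And>Y. VF Y \<Longrightarrow> lie_deriv \<xi> (tw \<psi>) X Y p = 3 * tw k X Y p" for \<psi> X
  proof -
    have LT: "lie_bracket \<xi> X p \<in> T p" "lie_bracket \<xi> (\<lambda>q. \<psi> q (X q)) p \<in> T p"
      using X xi_VF eVF[OF e X] by (auto intro!: T_lie_bracket)
    show ?thesis
    proof (rule g_eqI)
      show "lie_bracket \<xi> (\<lambda>q. \<psi> q (X q)) p \<in> T p" by (rule LT)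
      show "\<psi> p (lie_bracket \<xi> X p) + 3 *\<^sub>R k p (X p) \<in> T p"
        using LT X by (intro T_add T_scale eT[OF e] eT[OF k_endo]) auto
      fix w assume w: "w \<in> T p"
      show "g p (lie_bracket \<xi> (\<lambda>q. \<psi> q (X q)) p) w = g p (\<psi> p (lie_bracket \<xi> X p) + 3 *\<^sub>R k p (X p)) w"
        using lie_endo[OF e X VF_extend[OF w], of p] L[OF VF_extend[OF w]] w X LT
        by (simp add: tw_def extend_apply g_simps eT[OF e] eT[OF k_endo] T_scale)
    qed
  qed
  have kx: "ew k \<xi> X Y p = tw k X Y p" for X Y
    by (simp add: ew_def eta_xi tw_def k_xi)
  show "VF X \<Longrightarrow> lie_bracket \<xi> (\<lambda>q. \<phi> q (X q)) p = \<phi> p (lie_bracket \<xi> X p) + 3 *\<^sub>R k p (X p)"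
    by (rule *[OF endo]) (simp_all add: lie_tw d2_phi xi_VF kx)
  show "VF X \<Longrightarrow> lie_bracket \<xi> (\<lambda>q. h q (X q)) p = h p (lie_bracket \<xi> X p) + 3 *\<^sub>R k p (X p)"
  proof (rule *[OF h_endo])
    assume X: "VF X"
    show "lie_deriv \<xi> (tw h) X Y p = 3 * tw k X Y p" if "VF Y" for Y
      using d2_contract[OF two_form_tw[OF h_skew] xi_VF X that, of p] d2_h[OF xi_VF X that, of p]
      by (simp add: tw_def h_xi kx[unfolded tw_def])
  qed
qed

section \<open>The function f in the square of h, and its constancy\<close>

lemma h_square_ex: "\<exists>r\<ge>0. \<forall>u\<in>T p. h p (h p u) = - r *\<^sub>R (u - \<eta> p [u] *\<^sub>R \<xi> p)"
proof -
  have "h p (\<phi> p u) = - \<phi> p (h p u)" if "u \<in> T p" for u using that by (simp add: h_phi phi_h)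
  note anti = this
  interpret S: acm_space "T p" "g p" "\<phi> p" "\<xi> p" "\<lambda>v. \<eta> p [v]" by (rule space)
  obtain r where "r \<ge> 0" "\<And>u. u \<in> T p \<Longrightarrow> h p (h p u) = - r *\<^sub>R (u - \<eta> p [u] *\<^sub>R \<xi> p)"
    by (rule S.anticommuting_skew_square[where h = "h p"], rule eT[OF h_endo], assumption, rule elin[OF h_endo],
      assumption+, rule skewD(2)[OF h_skew], assumption+, rule anti, assumption, rule h_xi, rule that)
  then show ?thesis by blast
qed

definition f :: "'a \<Rightarrow> real" where
  "f p = (SOME r. r \<ge> 0 \<and> (\<forall>u\<in>T p. h p (h p u) = - r *\<^sub>R (u - \<eta> p [u] *\<^sub>R \<xi> p)))"

lemma f_nonneg: "0 \<le> f p" and h_square: "u \<in> T p \<Longrightarrow> h p (h p u) = - f p *\<^sub>R (u - \<eta> p [u] *\<^sub>R \<xi> p)"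
  using someI_ex[of "\<lambda>r. r \<ge> 0 \<and> (\<forall>u\<in>T p. h p (h p u) = - r *\<^sub>R (u - \<eta> p [u] *\<^sub>R \<xi> p))", folded f_def] h_square_ex
  by blast+

lemma g_h_h: "u \<in> T p \<Longrightarrow> v \<in> T p \<Longrightarrow> g p (h p u) (h p v) = f p * (g p u v - \<eta> p [u] * \<eta> p [v])"
  using skewD(2)[OF h_skew, of u p "h p v"]
  by (simp add: h_square eT[OF h_endo] g_simps T_scale T_diff g_xi algebra_simps)

lemma g_k_h: "u \<in> T p \<Longrightarrow> g p (k p u) (h p u) = 0"
  using phi_skew[of "h p u" p "h p u"] g_sym[of p "h p u" "\<phi> p (h p u)"] by (simp add: phi_h eT[OF h_endo])

lemma horizontal_field:
  obtains E where "VF E" "g p (E p) (E p) - e E p * e E p = 1"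
proof -
  obtain u where u: "u \<in> T p" "\<eta> p [u] = 0" "g p u u = 1"
    by (rule acm_space.adapted_basis[OF space, of p])
  then show thesis using that[of "extend p u"] by (simp add: VF_extend extend_apply)
qed

text \<open>f is defined by a choice at each point. Near p it is the quotient of g(hE, hE) by g(E,
  E) - \<eta>(E)^2 for a field E whose denominator is 1 at p.\<close>

lemma C_f: "C f"
proof (rule smooth_fun_localI)
  fix p
  obtain E where E: "VF E" "g p (E p) (E p) - e E p * e E p = 1" by (rule horizontal_field)
  define r where "r q = g q (E q) (E q) - e E q * e E q" for q
  have Cr: "C r" unfolding r_def[abs_def] using g_C[OF E(1,1)] C_e[OF E(1)] by (intro C_diff C_mult)
  obtain s N where s: "C s" "open N" "p \<in> N" "\<And>q. q \<in> N \<Longrightarrow> s q * r q = 1"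
    by (rule C_inverse_local[OF Cr, of p]) (simp add: r_def E(2), rule that)
  have Ch: "C (\<lambda>q. g q (h q (E q)) (h q (E q)))" using g_C[OF eVF[OF h_endo E(1)] eVF[OF h_endo E(1)]] .
  show "\<exists>g' W. open W \<and> p \<in> W \<and> C g' \<and> (\<forall>q\<in>W. f q = g' q)"
  proof (intro exI[of _ "\<lambda>q. s q * g q (h q (E q)) (h q (E q))"] exI[of _ N] conjI ballI)
    show "C (\<lambda>q. s q * g q (h q (E q)) (h q (E q)))" by (rule C_mult[OF s(1) Ch])
    fix q assume "q \<in> N"
    then have "s q * r q = 1" by (rule s)
    moreover have "g q (h q (E q)) (h q (E q)) = f q * r q" using E(1) by (simp add: g_h_h r_def)
    ultimately show "f q = s q * g q (h q (E q)) (h q (E q))" by (metis mult.left_commute mult.right_neutral)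
  qed (fact s)+
qed

text \<open>Differentiate g(hE, hE) = f (g(E, E) - \<eta>(E)^2) along \<xi>. Both g and \<eta> are
  invariant, and the Lie derivative 3k of h is orthogonal to h.\<close>

lemma xi_f: "\<xi> p f = 0"
proof -
  obtain E where E: "VF E" "g p (E p) (E p) - e E p * e E p = 1" by (rule horizontal_field)
  have hE: "VF (\<lambda>q. h q (E q))" by (rule eVF[OF h_endo E(1)])
  have LT: "lie_bracket \<xi> E p \<in> T p" using E xi_VF by (auto intro!: T_lie_bracket)
  note D = VF_deriv[OF xi_VF] and C1 = g_C[OF E(1,1)] and C2 = C_e[OF E(1)]
  have "(\<lambda>q. g q (h q (E q)) (h q (E q))) = (\<lambda>q. f q * (g q (E q) (E q) - e E q * e E q))"
    using E(1) by (simp add: g_h_h)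
  then have "\<xi> p (\<lambda>q. g q (h q (E q)) (h q (E q))) = \<xi> p (\<lambda>q. f q * (g q (E q) (E q) - e E q * e E q))" by simp
  also have "\<dots> = \<xi> p f + f p * (\<xi> p (\<lambda>q. g q (E q) (E q)) - 2 * e E p * \<xi> p (e E))"
    using E(2) C1 C2 C_f by (simp add: D C_mult C_diff algebra_simps)
  also have "\<xi> p (\<lambda>q. g q (E q) (E q)) = 2 * g p (lie_bracket \<xi> E p) (E p)"
    using lie_metric[OF E(1,1), of p] killing[OF E(1,1), of p] g_sym[of p "E p"] by simp
  finally have "\<xi> p (\<lambda>q. g q (h q (E q)) (h q (E q))) =
      \<xi> p f + 2 * f p * (g p (lie_bracket \<xi> E p) (E p) - e E p * \<eta> p [lie_bracket \<xi> E p])"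
    using E by (simp add: eta_lie_xi algebra_simps)
  moreover have "\<xi> p (\<lambda>q. g q (h q (E q)) (h q (E q))) = 2 * g p (h p (lie_bracket \<xi> E p) + 3 *\<^sub>R k p (E p)) (h p (E p))"
    using lie_metric[OF hE hE, of p] killing[OF hE hE, of p] g_sym[of p "h p (E p)"] lie_h[OF E(1), of p] by simp
  moreover have "\<dots> = 2 * f p * (g p (lie_bracket \<xi> E p) (E p) - e E p * \<eta> p [lie_bracket \<xi> E p])"
    using E LT by (simp add: g_simps eT[OF h_endo] eT[OF k_endo] T_scale g_k_h g_h_h)
  ultimately show ?thesis by simp
qed

definition \<beta> where "\<beta> = lie_deriv \<xi> (tw k)"

lemma k_h: "u \<in> T p \<Longrightarrow> k p (h p u) = - f p *\<^sub>R \<phi> p u"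
  using phi_h[of "h p u" p] by (simp add: h_square eT[OF h_endo] esimps[OF endo] T_scale T_diff phi_xi)

text \<open>Since k = \<phi>h and both \<phi> and h have Lie derivative 3k, that of k is 3kh +
  3\<phi>k = -3f\<phi> - 3h.\<close>

lemma beta: "VF X \<Longrightarrow> VF Y \<Longrightarrow> \<beta> X Y p = - 3 * tw h X Y p - 3 * (f p * tw \<phi> X Y p)"
proof -
  assume X: "VF X" and Y: "VF Y"
  have LT: "lie_bracket \<xi> X p \<in> T p" using X xi_VF by (auto intro!: T_lie_bracket)
  have "lie_bracket \<xi> (\<lambda>q. k q (X q)) = lie_bracket \<xi> (\<lambda>q. \<phi> q (h q (X q)))"
    using X by (simp add: phi_h)
  then have "lie_bracket \<xi> (\<lambda>q. k q (X q)) p = \<phi> p (lie_bracket \<xi> (\<lambda>q. h q (X q)) p) + 3 *\<^sub>R k p (h p (X p))"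
    by (simp only: lie_phi[OF eVF[OF h_endo X]])
  also have "\<dots> = k p (lie_bracket \<xi> X p) - 3 *\<^sub>R h p (X p) - (3 * f p) *\<^sub>R \<phi> p (X p)"
    using X LT by (simp add: lie_h esimps[OF endo] eT[OF h_endo] eT[OF k_endo] T_scale phi_h k_h phi_k algebra_simps)
  finally have "lie_bracket \<xi> (\<lambda>q. k q (X q)) p - k p (lie_bracket \<xi> X p) = - (3 *\<^sub>R h p (X p) + (3 * f p) *\<^sub>R \<phi> p (X p))"
    by simp
  then show ?thesis
    using lie_endo[OF k_endo X Y, of p] X Y
    by (simp add: \<beta>_def tw_def g_simps eT[OF h_endo] eT[OF endo] T_intros)
qed

text \<open>If db = \<eta> \<and> c, then dL_\<xi>b = L_\<xi>(\<eta> \<and> c) = \<eta> \<and>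
  L_\<xi>c, as \<eta> is invariant under \<xi>.\<close>

lemma d2_lie_wedge:
  assumes b: "two_form b" and c: "two_form c"
    and bc: "\<And>X Y Z p. VF X \<Longrightarrow> VF Y \<Longrightarrow> VF Z \<Longrightarrow> d2 b X Y Z p = e X p * c Y Z p - e Y p * c X Z p + e Z p * c X Y p"
    and X: "VF X" and Y: "VF Y" and Z: "VF Z"
  shows "d2 (lie_deriv \<xi> b) X Y Z p = e X p * lie_deriv \<xi> c Y Z p - e Y p * lie_deriv \<xi> c X Z p + e Z p * lie_deriv \<xi> c X Y p"
proof -
  note L = VF_lie_bracket[OF xi_VF X] VF_lie_bracket[OF xi_VF Y] VF_lie_bracket[OF xi_VF Z]
  note Cs = C_e[OF X] C_e[OF Y] C_e[OF Z] two_formD(1)[OF c X Y] two_formD(1)[OF c X Z] two_formD(1)[OF c Y Z]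
  have "d2 b X Y Z = (\<lambda>p. e X p * c Y Z p - e Y p * c X Z p + e Z p * c X Y p)" using bc[OF X Y Z] by blast
  then have "\<xi> p (d2 b X Y Z) = \<xi> p (\<lambda>p. e X p * c Y Z p - e Y p * c X Z p + e Z p * c X Y p)" by simp
  also have "\<dots> = \<xi> p (e X) * c Y Z p + e X p * \<xi> p (c Y Z) - \<xi> p (e Y) * c X Z p - e Y p * \<xi> p (c X Z)
      + \<xi> p (e Z) * c X Y p + e Z p * \<xi> p (c X Y)"
    using Cs by (simp add: VF_deriv[OF xi_VF] C_mult C_diff)
  finally show ?thesis
    unfolding d2_lie_deriv[OF b xi_VF X Y Z] bc[OF L(1) Y Z] bc[OF X L(2) Z] bc[OF X Y L(3)]
      eta_lie_xi[OF X] eta_lie_xi[OF Y] eta_lie_xi[OF Z] lie_deriv_def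
    by (simp add: algebra_simps)
qed

text \<open>The 2-form of \<phi> has Lie derivative 3\<sigma>2 and differential 3\<eta> \<and>
  \<sigma>2, so \<open>d2_lie_wedge\<close> computes d\<sigma>2.\<close>

lemma d2_k:
  assumes X: "VF X" and Y: "VF Y" and Z: "VF Z"
  shows "d2 (tw k) X Y Z p = e X p * \<beta> Y Z p - e Y p * \<beta> X Z p + e Z p * \<beta> X Y p"
proof -
  note k2 = two_form_tw[OF k_skew]
  \<comment> \<open>The zero summand makes a constant multiple an instance of the rules for linear
    combinations.\<close>
  have t: "two_form (\<lambda>X Y p. 3 * tw k X Y p + 0 * tw k X Y p)" by (rule two_form_lincomb[OF k2 k2 C_const C_const])
  have l3: "lie_deriv \<xi> (\<lambda>X Y p. 3 * tw k X Y p + 0 * tw k X Y p) X Y p = 3 * \<beta> X Y p" if "VF X" "VF Y" for X Y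
    using two_formD(1)[OF k2 that] by (simp add: lie_deriv_def \<beta>_def VF_deriv[OF xi_VF])
  have "3 * d2 (tw k) X Y Z p = d2 (\<lambda>X Y p. 3 * tw k X Y p + 0 * tw k X Y p) X Y Z p"
    using d2_lincomb[OF k2 k2 X Y Z, of 3 0] by simp
  also have "\<dots> = d2 (lie_deriv \<xi> (tw \<phi>)) X Y Z p"
  proof (rule d2_cong[OF _ X Y Z])
    fix X Y assume XY: "VF X" "VF Y"
    show "(\<lambda>p. 3 * tw k X Y p + 0 * tw k X Y p) = lie_deriv \<xi> (tw \<phi>) X Y"
      using XY by (intro ext) (simp add: lie_tw d2_phi xi_VF ew_def eta_xi tw_def k_xi)
  qed
  also have "\<dots> = e X p * (3 * \<beta> Y Z p) - e Y p * (3 * \<beta> X Z p) + e Z p * (3 * \<beta> X Y p)"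
    unfolding l3[OF Y Z, symmetric] l3[OF X Z, symmetric] l3[OF X Y, symmetric]
    by (rule d2_lie_wedge[OF two_form t _ X Y Z]) (simp add: d2_phi ew_def algebra_simps)
  finally show ?thesis by (simp add: algebra_simps)
qed

text \<open>\<open>d2_lie_wedge\<close> for \<sigma>2 shows that d\<beta> is a multiple of \<eta>.
  In d(-3\<sigma>1 - 3f\<omega>3) the differentials of \<sigma>1 and \<omega>3 are multiples of
  \<eta> too, which isolates df \<and> \<omega>3.\<close>

lemma df_horizontal:
  assumes XYZ: "VF X" "VF Y" "VF Z" and 0: "e X p = 0" "e Y p = 0" "e Z p = 0"
  shows "X p f * tw \<phi> Y Z p - Y p f * tw \<phi> X Z p + Z p f * tw \<phi> X Y p = 0"
proof -
  note k2 = two_form_tw[OF k_skew] and h2 = two_form_tw[OF h_skew]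
  have b: "\<beta> X Y = (\<lambda>p. (-3) * tw h X Y p + (- 3 * f p) * tw \<phi> X Y p)" if "VF X" "VF Y" for X Y
    using beta[OF that] by (auto simp: algebra_simps)
  have t: "two_form (\<lambda>X Y p. (-3) * tw h X Y p + (- 3 * f p) * tw \<phi> X Y p)"
    by (rule two_form_lincomb[OF h2 two_form C_const C_mult[OF C_const C_f]])
  have b2: "two_form \<beta>"
    by (rule two_form_cong[OF t b])
  have z: "d2 (lie_deriv \<xi> (tw k)) X Y Z p = 0"
    using d2_lie_wedge[OF k2 b2 d2_k XYZ, of p] 0 by simp
  have der: "W p (\<lambda>p. (-3) * tw h X Y p + (- 3 * f p) * tw \<phi> X Y p) =
      (-3) * W p (tw h X Y) + ((- 3 * W p f) * tw \<phi> X Y p + (- 3 * f p) * W p (tw \<phi> X Y))"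
    if W: "VF W" and XY: "VF X" "VF Y" for W X Y
  proof -
    note Cs = two_formD(1)[OF h2 XY] two_formD(1)[OF two_form XY]
    have f3: "C (\<lambda>p. - 3 * f p)" by (rule C_mult[OF C_const C_f])
    show ?thesis
      unfolding VF_deriv(1)[OF W C_mult[OF C_const Cs(1)] C_mult[OF f3 Cs(2)]] VF_deriv(5)[OF W Cs(1)]
        VF_deriv(4)[OF W f3 Cs(2)] VF_deriv(5)[OF W C_f] ..
  qed
  have "0 = d2 (\<lambda>X Y p. (-3) * tw h X Y p + (- 3 * f p) * tw \<phi> X Y p) X Y Z p"
    using d2_cong[of "lie_deriv \<xi> (tw k)", OF b[unfolded \<beta>_def] XYZ, of p] z by simp
  also have "\<dots> = (-3) * d2 (tw h) X Y Z p + (- 3 * f p) * d2 (tw \<phi>) X Y Z p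
      - 3 * (X p f * tw \<phi> Y Z p - Y p f * tw \<phi> X Z p + Z p f * tw \<phi> X Y p)"
    unfolding d2_def der[OF XYZ(1,2,3)] der[OF XYZ(2,1,3)] der[OF XYZ(3,1,2)] by (simp add: algebra_simps)
  finally show ?thesis using XYZ 0 by (simp add: d2_h d2_phi ew_def)
qed

text \<open>In an adapted basis, df \<and> \<omega>3 on a vector of one \<phi>-line and the two
  basis vectors of the other gives the derivative along the former. This is where a horizontal rank
  of at least four is required; the derivative along \<xi> is \<open>xi_f\<close>.\<close>

lemma f_const: "f p = f q"
proof (rule constant_if_derivatives_vanish[OF C_f])
  fix p v assume v: "v \<in> T p"
  obtain u w where uw: "u \<in> T p" "w \<in> T p" "\<eta> p [u] = 0" "\<eta> p [w] = 0" "g p u u = 1" "g p w w = 1"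
      "g p u w = 0" "g p (\<phi> p u) w = 0"
    and b: "\<And>x. x \<in> T p \<Longrightarrow> x = \<eta> p [x] *\<^sub>R \<xi> p + g p x u *\<^sub>R u + g p x (\<phi> p u) *\<^sub>R \<phi> p u + g p x w *\<^sub>R w + g p x (\<phi> p w) *\<^sub>R \<phi> p w"
    by (rule acm_space.adapted_basis[OF space, of p]) (rule that)
  note V = uw(1,2) eT[OF endo uw(1)] eT[OF endo uw(2)]
  have d: "x f * g p (\<phi> p y) z - y f * g p (\<phi> p x) z + z f * g p (\<phi> p x) y = 0"
    if xyz: "x \<in> T p" "y \<in> T p" "z \<in> T p" and 0: "\<eta> p [x] = 0" "\<eta> p [y] = 0" "\<eta> p [z] = 0" for x y z
    using df_horizontal[OF VF_extend[OF xyz(1)] VF_extend[OF xyz(2)] VF_extend[OF xyz(3)], of p] xyz 0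
    by (simp add: tw_def extend_apply)
  have e0: "\<eta> p [\<phi> p u] = 0" "\<eta> p [\<phi> p w] = 0" using uw by (simp_all add: eta_phi)
  have o: "g p (\<phi> p w) u = 0" "g p u (\<phi> p w) = 0" "g p w (\<phi> p u) = 0" "g p w u = 0"
    using uw phi_skew[of w p u] g_sym[of p w "\<phi> p u"] g_sym[of p w u] g_sym[of p u "\<phi> p w"] by simp_all
  note s = g_phi_phi phi_phi g_simps V uw o T_minus
  have "u f = 0" using d[OF V(1,2,4) uw(3,4) e0(2)] by (simp add: s)
  moreover have "\<phi> p u f = 0" using d[OF V(3,2,4) e0(1) uw(4) e0(2)] by (simp add: s)
  moreover have "w f = 0" using d[OF V(2,1,3) uw(4,3) e0(1)] by (simp add: s)
  moreover have "\<phi> p w f = 0" using d[OF V(4,1,3) e0(2) uw(3) e0(1)] by (simp add: s)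
  ultimately have "(\<eta> p [v] *\<^sub>R \<xi> p + g p v u *\<^sub>R u + g p v (\<phi> p u) *\<^sub>R \<phi> p u + g p v w *\<^sub>R w + g p v (\<phi> p w) *\<^sub>R \<phi> p w) f = 0"
    using xi_f by (simp add: pointwise)
  then show "v f = 0" using b[OF v] by simp
qed

text \<open>The squared length of hu is f times that of the horizontal part of u. Hence f = 0 kills
  h and k, and \<nabla>\<phi> reduces to the Sasakian formula.\<close>

lemma f_pos: assumes "\<not> sasakian A \<phi> \<xi> \<eta> g" shows "0 < f p"
proof (rule ccontr)
  assume "\<not> ?thesis"
  then have f0: "f q = 0" for q using f_nonneg[of p] f_const[of q p] by simp
  have h0: "h q u = 0" if u: "u \<in> T q" for q u
    using g_h_h[OF u u] f0 g_pos[of "h q u" q] eT[OF h_endo u] by force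
  have k0: "k q u = 0" if u: "u \<in> T q" for q u
    using phi_h[OF u] h0[OF u] phi_h[of 0 q] h0[of 0 q] esimps(3)[OF endo, of 0 q 0] by (simp add: T_intros)
  have "sasakian A \<phi> \<xi> \<eta> g"
    unfolding sasakian_def
  proof (intro conjI exI[of _ D] allI impI)
    fix X Y p assume X: "VF X" and Y: "VF Y"
    show "nabla_endo D \<phi> X Y p = g p (X p) (Y p) *\<^sub>R \<xi> p - \<eta> p [Y p] *\<^sub>R X p"
    proof (rule g_eqI)
      show "nabla_endo D \<phi> X Y p \<in> T p" by (rule nabla_endo_g(1)[OF endo X Y])
      show "g p (X p) (Y p) *\<^sub>R \<xi> p - \<eta> p [Y p] *\<^sub>R X p \<in> T p" using X by (intro T_diff T_scale) auto
      fix w assume w: "w \<in> T p"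
      show "g p (nabla_endo D \<phi> X Y p) w = g p (g p (X p) (Y p) *\<^sub>R \<xi> p - \<eta> p [Y p] *\<^sub>R X p) w"
        using nabla_endo_g(2)[OF endo X Y, of p "extend p w"] nab_phi[OF X Y VF_extend[OF w], of p] w X Y
        by (simp add: extend_apply ew_def tw_def k0 g_simps g_xi T_scale)
    qed
  qed (fact acm lc)+
  then show False using assms by blast
qed

section \<open>The normalised triple\<close>

lemma ex_su2:
  assumes "\<not> sasakian A \<phi> \<xi> \<eta> g"
  obtains \<phi>1 \<phi>2 l where "l > 0" "su2_triple A \<phi>1 \<phi>2 \<phi> \<xi> \<eta> g" "skew_endo \<phi>1" "skew_endo \<phi>2"
    "\<And>X Y p. VF X \<Longrightarrow> VF Y \<Longrightarrow> d1 e X Y p = - 2 * tw \<phi> X Y p + 2 * l * tw \<phi>1 X Y p"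
    "\<And>X Y Z p. VF X \<Longrightarrow> VF Y \<Longrightarrow> VF Z \<Longrightarrow> d2 (tw \<phi>1) X Y Z p = 3 * ew \<phi>2 X Y Z p"
    "\<And>X Y Z p. VF X \<Longrightarrow> VF Y \<Longrightarrow> VF Z \<Longrightarrow>
      d2 (tw \<phi>2) X Y Z p = - 3 * ew \<phi>1 X Y Z p - 3 * l * ew \<phi> X Y Z p"
proof -
  define c where "c = f undefined"
  \<comment> \<open>The positive root is chosen; its negative would replace the triple by (-\<phi>1,
    -\<phi>2, \<phi>).\<close>
  define l where "l = sqrt c"
  have f: "f p = c" for p unfolding c_def by (rule f_const)
  have c: "0 < c" using f_pos[OF assms] by (simp add: f)
  then have l: "l > 0" "l * l = c" by (simp_all add: l_def)
  define \<phi>1 where "\<phi>1 p u = (1 / l) *\<^sub>R h p u" for p u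
  define \<phi>2 where "\<phi>2 p u = (1 / l) *\<^sub>R k p u" for p u
  have e: "endo_field A \<phi>1" "endo_field A \<phi>2"
    unfolding \<phi>1_def[abs_def] \<phi>2_def[abs_def] by (rule endo_field_scale[OF h_endo] endo_field_scale[OF k_endo])+
  have sk: "skew_endo \<phi>1" "skew_endo \<phi>2"
    unfolding skew_endo_def using e skewD(2)[OF h_skew] skewD(2)[OF k_skew]
    by (auto simp: \<phi>1_def \<phi>2_def g_simps eT[OF h_endo] eT[OF k_endo])
  have tw: "tw h X Y p = l * tw \<phi>1 X Y p" "tw k X Y p = l * tw \<phi>2 X Y p" if "VF X" for X Y p
    using that l by (simp_all add: tw_def \<phi>1_def \<phi>2_def g_simps eT[OF h_endo] eT[OF k_endo])
  have d2s: "d2 b X Y Z p = l * d2 b' X Y Z p"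
    if b: "two_form b'" and eq: "\<And>X Y p. VF X \<Longrightarrow> VF Y \<Longrightarrow> b X Y p = l * b' X Y p" and XYZ: "VF X" "VF Y" "VF Z" for b b' X Y Z p
  proof -
    have "d2 b X Y Z p = d2 (\<lambda>X Y p. l * b' X Y p + 0 * b' X Y p) X Y Z p"
      by (rule d2_cong[OF _ XYZ]) (intro ext, simp add: eq)
    then show ?thesis using d2_lincomb[OF b b XYZ, of l 0 p] by simp
  qed
  have hh: "h p (h p u) = - c *\<^sub>R (u - \<eta> p [u] *\<^sub>R \<xi> p)" if "u \<in> T p" for p u
    using h_square[OF that] by (simp add: f)
  have kh: "k p (h p u) = - c *\<^sub>R \<phi> p u" if "u \<in> T p" for p u
    using k_h[OF that] by (simp add: f)
  have kk: "k p (k p u) = - c *\<^sub>R (u - \<eta> p [u] *\<^sub>R \<xi> p)" if u: "u \<in> T p" for p u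
    using k_phi[OF eT[OF h_endo u]] hh[OF u] phi_h[OF u] by simp
  have hk: "h p (k p u) = c *\<^sub>R \<phi> p u" if u: "u \<in> T p" for p u
    using h_phi[OF eT[OF h_endo u]] phi_h[OF u] kh[OF u] by simp
  have s: "endo_field A \<psi> \<Longrightarrow> u \<in> T p \<Longrightarrow> \<psi> p ((1 / l) *\<^sub>R \<theta> p u) = (1 / l) *\<^sub>R \<psi> p (\<theta> p u)"
    if "endo_field A \<theta>" for \<psi> \<theta> p u
    using esimps(3)[of \<psi>] eT[OF that] by blast
  have q: "\<phi>1 p (\<phi>1 p u) = - u + \<eta> p [u] *\<^sub>R \<xi> p" "\<phi>2 p (\<phi>2 p u) = - u + \<eta> p [u] *\<^sub>R \<xi> p"
    "\<phi>1 p (\<phi>2 p u) = \<phi> p u" "\<phi>2 p (\<phi>1 p u) = - \<phi> p u" "\<phi>2 p (\<phi> p u) = \<phi>1 p u" "\<phi> p (\<phi>2 p u) = - \<phi>1 p u"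
    "\<phi> p (\<phi>1 p u) = \<phi>2 p u" "\<phi>1 p (\<phi> p u) = - \<phi>2 p u" if u: "u \<in> T p" for p u
    using u c l(1) unfolding \<phi>1_def \<phi>2_def
    by (simp_all add: s h_endo k_endo endo hh kk hk kh phi_h phi_k h_phi k_phi l(2))
  have gg: "g p (\<psi> p u) (\<psi> p v) = g p u v - \<eta> p [u] * \<eta> p [v]"
    if sp: "skew_endo \<psi>" and sq: "\<And>u. u \<in> T p \<Longrightarrow> \<psi> p (\<psi> p u) = - u + \<eta> p [u] *\<^sub>R \<xi> p" and uv: "u \<in> T p" "v \<in> T p" for \<psi> p u v
    using skewD(2)[OF sp, of u p "\<psi> p v"] uv by (simp add: sq eT[OF skewD(1)[OF sp]] g_simps g_xi T_intros algebra_simps)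
  have acm': "almost_contact_metric A \<psi> \<xi> \<eta> g"
    if sp: "skew_endo \<psi>" and sq: "\<And>p u. u \<in> T p \<Longrightarrow> \<psi> p (\<psi> p u) = - u + \<eta> p [u] *\<^sub>R \<xi> p" for \<psi>
    unfolding almost_contact_metric_def
  proof (intro conjI allI ballI)
    show "odd DIM(real ^ 5)" by simp
    show "g p (\<psi> p u) (\<psi> p v) = g p u v - \<eta> p [u] * \<eta> p [v]" if "u \<in> T p" "v \<in> T p" for p u v by (rule gg[OF sp sq that])
  qed (fact skewD(1)[OF sp] xi_VF eta_form acmD(4)[OF acm] eta_xi | rule sq, assumption)+
  have triple: "su2_triple A \<phi>1 \<phi>2 \<phi> \<xi> \<eta> g"
    unfolding su2_triple_def
    using acm acm'[OF sk(1) q(1)] acm'[OF sk(2) q(2)] by (simp add: q)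
  show thesis
  proof (rule that[OF l(1) triple sk])
    show "d1 e X Y p = - 2 * tw \<phi> X Y p + 2 * l * tw \<phi>1 X Y p" if "VF X" "VF Y" for X Y p
      using d1_eta[OF that] tw(1)[OF that(1)] by simp
    show "d2 (tw \<phi>1) X Y Z p = 3 * ew \<phi>2 X Y Z p" if XYZ: "VF X" "VF Y" "VF Z" for X Y Z p
    proof -
      have "ew k X Y Z p = l * ew \<phi>2 X Y Z p" using XYZ by (simp add: ew_def tw(2) algebra_simps)
      then have "l * d2 (tw \<phi>1) X Y Z p = l * (3 * ew \<phi>2 X Y Z p)"
        using d2s[OF two_form_tw[OF sk(1)] tw(1) XYZ, of p] d2_h[OF XYZ, of p] by auto
      then show ?thesis using l(1) by simp
    qed
    show "d2 (tw \<phi>2) X Y Z p = - 3 * ew \<phi>1 X Y Z p - 3 * l * ew \<phi> X Y Z p" if XYZ: "VF X" "VF Y" "VF Z" for X Y Z p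
    proof -
      have "l * d2 (tw \<phi>2) X Y Z p = l * (- 3 * ew \<phi>1 X Y Z p - 3 * l * ew \<phi> X Y Z p)"
      proof -
        have b: "\<beta> X Y p = l * (- 3 * tw \<phi>1 X Y p - 3 * l * tw \<phi> X Y p)" if "VF X" "VF Y" for X Y
          using that by (simp add: beta tw(1) f algebra_simps flip: l(2))
        have D: "d2 (tw k) X Y Z p = l * d2 (tw \<phi>2) X Y Z p"
          by (rule d2s[OF two_form_tw[OF sk(2)] _ XYZ]) (rule tw(2))
        show ?thesis
          unfolding D[symmetric] d2_k[OF XYZ]
            b[OF XYZ(1,2)] b[OF XYZ(1,3)] b[OF XYZ(2,3)] ew_def
          by (simp only: algebra_simps)
      qed
      then show ?thesis using l(1) by simp
    qed
  qed
qed

end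


section \<open>The correspondence\<close>

context su2_lc
begin

context
  fixes \<omega>1 \<omega>2 \<omega>3
  assumes d: "diff_form A 2 \<omega>1" "diff_form A 2 \<omega>2" "diff_form A 2 \<omega>3"
    and w: "\<forall>p. \<forall>u\<in>T p. \<forall>v\<in>T p. \<omega>1 p [u, v] = g p (\<phi>1 p u) v"
      "\<forall>p. \<forall>u\<in>T p. \<forall>v\<in>T p. \<omega>2 p [u, v] = g p (\<phi>2 p u) v"
      "\<forall>p. \<forall>u\<in>T p. \<forall>v\<in>T p. \<omega>3 p [u, v] = g p (\<phi>3 p u) v"
begin

lemma form_fields:
  assumes "VF X" "VF Y"
  shows "\<omega>1 p [X p, Y p] = tw \<phi>1 X Y p" "\<omega>2 p [X p, Y p] = tw \<phi>2 X Y p" "\<omega>3 p [X p, Y p] = tw \<phi>3 X Y p"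
  using assms w by (simp_all add: tw_def)

lemma wedge_fields:
  assumes "VF X" "VF Y" "VF Z"
  shows "wedge 1 2 \<eta> \<omega>1 p [X p, Y p, Z p] = A1.ew \<phi>1 X Y Z p" "wedge 1 2 \<eta> \<omega>2 p [X p, Y p, Z p] = A1.ew \<phi>2 X Y Z p"
    "wedge 1 2 \<eta> \<omega>3 p [X p, Y p, Z p] = A1.ew \<phi>3 X Y Z p"
proof -
  have a: "wedge 1 2 \<eta> \<omega> p [x, y, z] = \<eta> p [x] * \<omega> p [y, z] - \<eta> p [y] * \<omega> p [x, z] + \<eta> p [z] * \<omega> p [x, y]"
    if "diff_form A 2 \<omega>" for \<omega> x y z
    by (rule wedge_1_2) (rule form2_antisym[OF that])
  show "wedge 1 2 \<eta> \<omega>1 p [X p, Y p, Z p] = A1.ew \<phi>1 X Y Z p" "wedge 1 2 \<eta> \<omega>2 p [X p, Y p, Z p] = A1.ew \<phi>2 X Y Z p"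
    "wedge 1 2 \<eta> \<omega>3 p [X p, Y p, Z p] = A1.ew \<phi>3 X Y Z p"
    unfolding a[OF d(1)] a[OF d(2)] a[OF d(3)] A1.ew_def using assms by (simp_all add: form_fields)
qed

lemma d2_fields:
  assumes XYZ: "VF X" "VF Y" "VF Z"
  shows "d2 (\<lambda>X Y p. \<omega>1 p [X p, Y p]) X Y Z p = d2 (tw \<phi>1) X Y Z p"
    "d2 (\<lambda>X Y p. \<omega>2 p [X p, Y p]) X Y Z p = d2 (tw \<phi>2) X Y Z p"
    "d2 (\<lambda>X Y p. \<omega>3 p [X p, Y p]) X Y Z p = d2 (tw \<phi>3) X Y Z p"
  by (rule d2_cong[OF _ XYZ], rule ext, simp add: form_fields)+

lemma diff_form_wedge_3: "diff_form A 2 \<omega> \<Longrightarrow> diff_form A 3 (wedge 1 2 \<eta> \<omega>)"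
  using diff_form_wedge[OF A1.eta_form, of 2 \<omega>] by (simp del: One_nat_def)

text \<open>This and the next two lemmas exchange the equations between differential forms for
  equations between operators on vector fields, in which both directions of the proof are carried
  out.\<close>

lemma ext_deriv_eta: "has_ext_deriv A 1 \<eta> (- 2 *\<^sub>R \<omega>3 + (2 * l) *\<^sub>R \<omega>1) \<longleftrightarrow>
    (\<forall>X Y p. VF X \<longrightarrow> VF Y \<longrightarrow> d1 (\<lambda>X p. \<eta> p [X p]) X Y p = - 2 * tw \<phi>3 X Y p + 2 * l * tw \<phi>1 X Y p)"
  unfolding has_ext_deriv_1 using A1.eta_form diff_form_lincomb[OF d(3,1), of "- 2" "2 * l"]
  by (auto simp: pointwise form_fields simp del: One_nat_def)

lemma ext_deriv_omega1: "has_ext_deriv A 2 \<omega>1 (3 *\<^sub>R wedge 1 2 \<eta> \<omega>2) \<longleftrightarrow>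
    (\<forall>X Y Z p. VF X \<longrightarrow> VF Y \<longrightarrow> VF Z \<longrightarrow> d2 (tw \<phi>1) X Y Z p = 3 * A1.ew \<phi>2 X Y Z p)"
  unfolding has_ext_deriv_2 using d(1) diff_form_scale[OF diff_form_wedge_3[OF d(2)], of 3]
  by (auto simp: pointwise wedge_fields d2_fields simp del: One_nat_def)

lemma ext_deriv_omega2: "has_ext_deriv A 2 \<omega>2 (- 3 *\<^sub>R wedge 1 2 \<eta> \<omega>1 - (3 * l) *\<^sub>R wedge 1 2 \<eta> \<omega>3) \<longleftrightarrow>
    (\<forall>X Y Z p. VF X \<longrightarrow> VF Y \<longrightarrow> VF Z \<longrightarrow> d2 (tw \<phi>2) X Y Z p = - 3 * A1.ew \<phi>1 X Y Z p - 3 * l * A1.ew \<phi>3 X Y Z p)"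
  unfolding has_ext_deriv_2
  using d(2) diff_form_diff[OF diff_form_scale[OF diff_form_wedge_3[OF d(1)], of "- 3"] diff_form_scale[OF diff_form_wedge_3[OF d(3)], of "3 * l"]]
  by (auto simp: pointwise wedge_fields d2_fields simp del: One_nat_def)

end

end

context su2_family_lc
begin

text \<open>d(\<eta> \<and> \<omega>3) = d\<eta> \<and> \<omega>3 - \<eta> \<and> d\<omega>3. The
  second term contains \<eta> twice, and in the first \<omega>1 \<and> \<omega>3 = 0 and \<omega>3
  \<and> \<omega>3 = \<omega>1 \<and> \<omega>1.\<close>

lemma nearly_hypo:
  assumes d: "diff_form A 2 \<omega>1" "diff_form A 2 \<omega>2" "diff_form A 2 \<omega>3"
    and w: "\<forall>p. \<forall>u\<in>T p. \<forall>v\<in>T p. \<omega>1 p [u, v] = g p (\<phi>1 p u) v"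
      "\<forall>p. \<forall>u\<in>T p. \<forall>v\<in>T p. \<omega>2 p [u, v] = g p (\<phi>2 p u) v"
      "\<forall>p. \<forall>u\<in>T p. \<forall>v\<in>T p. \<omega>3 p [u, v] = g p (\<phi>3 p u) v"
  shows "has_ext_deriv A 3 (wedge 1 2 \<eta> \<omega>3) (- 2 *\<^sub>R wedge 2 2 \<omega>1 \<omega>1)"
  unfolding has_ext_deriv_3
proof (intro conjI allI impI)
  show "diff_form A 3 (wedge 1 2 \<eta> \<omega>3)" by (rule diff_form_wedge_3[OF d w d(3)])
  show "diff_form A 4 (- 2 *\<^sub>R wedge 2 2 \<omega>1 \<omega>1)" using diff_form_scale[OF diff_form_wedge[OF d(1,1)], of "- 2"] by simp
  fix W X Y Z p assume V: "VF W" "VF X" "VF Y" "VF Z"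
  note L = VF_lie_bracket[OF V(1,2)] VF_lie_bracket[OF V(1,3)] VF_lie_bracket[OF V(1,4)]
    VF_lie_bracket[OF V(2,3)] VF_lie_bracket[OF V(2,4)] VF_lie_bracket[OF V(3,4)]
  interpret S: su2_space "T p" "g p" "\<phi>1 p" "\<phi>2 p" "\<phi>3 p" "\<xi> p" "\<lambda>v. \<eta> p [v]" by (rule space)
  interpret S2: su2_space "T p" "g p" "\<phi>2 p" "\<phi>3 p" "\<phi>1 p" "\<xi> p" "\<lambda>v. \<eta> p [v]" by (rule S.rotate)
  interpret S3: su2_space "T p" "g p" "\<phi>3 p" "\<phi>1 p" "\<phi>2 p" "\<xi> p" "\<lambda>v. \<eta> p [v]" by (rule S2.rotate)
  note VT = VF_T[OF V(1)] VF_T[OF V(2)] VF_T[OF V(3)] VF_T[OF V(4)]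
  define c where "c = (\<lambda>X Y Z q. e X q * tw \<phi>3 Y Z q - e Y q * tw \<phi>3 X Z q + e Z q * tw \<phi>3 X Y q)"
  have c: "wedge 1 2 \<eta> \<omega>3 q [X q, Y q, Z q] = c X Y Z q" if "VF X" "VF Y" "VF Z" for X Y Z q
    using wedge_fields(3)[OF d w that] by (simp add: c_def A1.ew_def)
  have "wedge 2 2 \<omega>1 \<omega>1 p [W p, X p, Y p, Z p] = wedge22 (\<lambda>x. g p (\<phi>1 p x)) (\<lambda>x. g p (\<phi>1 p x)) (W p) (X p) (Y p) (Z p)"
  proof -
    have "wedge 2 2 \<omega>1 \<omega>1 p [W p, X p, Y p, Z p] = wedge22 (\<lambda>x y. \<omega>1 p [x, y]) (\<lambda>x y. \<omega>1 p [x, y]) (W p) (X p) (Y p) (Z p)"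
      unfolding wedge22_def by (rule wedge_2_2) (rule form2_antisym[OF d(1)])+
    then show ?thesis by (simp only: wedge22_def w[rule_format] VT)
  qed
  also have "\<dots> = wedge22 (\<lambda>x. g p (\<phi>3 p x)) (\<lambda>x. g p (\<phi>3 p x)) (W p) (X p) (Y p) (Z p)"
    by (rule S3.wedge22_orthogonal(2)[OF VT])
  \<comment> \<open>The vanishing product of \<omega>3 and \<omega>1 is added to obtain the
    expansion of d\<eta> \<and> \<omega>3 literally.\<close>
  finally have w13: "(- 2 *\<^sub>R wedge 2 2 \<omega>1 \<omega>1) p [W p, X p, Y p, Z p] =
      - 2 * wedge22 (\<lambda>x. g p (\<phi>3 p x)) (\<lambda>x. g p (\<phi>3 p x)) (W p) (X p) (Y p) (Z p)
      + 2 * l * wedge22 (\<lambda>x. g p (\<phi>3 p x)) (\<lambda>x. g p (\<phi>1 p x)) (W p) (X p) (Y p) (Z p)"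
    using S3.wedge22_orthogonal(1)[OF VT] by (simp add: pointwise)
  have "(- 2 *\<^sub>R wedge 2 2 \<omega>1 \<omega>1) p [W p, X p, Y p, Z p] =
     (d1 e W X p * tw \<phi>3 Y Z p - d1 e W Y p * tw \<phi>3 X Z p + d1 e W Z p * tw \<phi>3 X Y p
      + d1 e X Y p * tw \<phi>3 W Z p - d1 e X Z p * tw \<phi>3 W Y p + d1 e Y Z p * tw \<phi>3 W X p)
    - (e W p * d2 (tw \<phi>3) X Y Z p - e X p * d2 (tw \<phi>3) W Y Z p + e Y p * d2 (tw \<phi>3) W X Z p - e Z p * d2 (tw \<phi>3) W X Y p)"
    unfolding w13 wedge22_def using V by (simp add: E1 E4 A1.ew_def tw_def algebra_simps)
  also note Leibniz_1_2[OF A1.one_form_e A3.two_form V, of p, folded c_def, symmetric]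
  finally show "(- 2 *\<^sub>R wedge 2 2 \<omega>1 \<omega>1) p [W p, X p, Y p, Z p] =
      W p (\<lambda>q. wedge 1 2 \<eta> \<omega>3 q [X q, Y q, Z q]) - X p (\<lambda>q. wedge 1 2 \<eta> \<omega>3 q [W q, Y q, Z q])
      + Y p (\<lambda>q. wedge 1 2 \<eta> \<omega>3 q [W q, X q, Z q]) - Z p (\<lambda>q. wedge 1 2 \<eta> \<omega>3 q [W q, X q, Y q])
      - wedge 1 2 \<eta> \<omega>3 p [lie_bracket W X p, Y p, Z p] + wedge 1 2 \<eta> \<omega>3 p [lie_bracket W Y p, X p, Z p]
      - wedge 1 2 \<eta> \<omega>3 p [lie_bracket W Z p, X p, Y p] - wedge 1 2 \<eta> \<omega>3 p [lie_bracket X Y p, W p, Z p]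
      + wedge 1 2 \<eta> \<omega>3 p [lie_bracket X Z p, W p, Y p] - wedge 1 2 \<eta> \<omega>3 p [lie_bracket Y Z p, W p, X p]"
    using V L by (simp only: c c_def)
qed

end

context manifold5
begin

lemma su2_familyD:
  assumes "(\<eta>, \<omega>1, \<omega>2, \<omega>3) \<in> su2_family A L"
  shows "su2_forms A \<eta> \<omega>1 \<omega>2 \<omega>3" "diff_form A 2 \<omega>1" "diff_form A 2 \<omega>2" "diff_form A 2 \<omega>3"
  using assms unfolding su2_family_def su2_forms_def by auto

lemma third_acmD:
  assumes "third_acm A (\<eta>, \<omega>1, \<omega>2, \<omega>3) (\<phi>, \<xi>, \<eta>', g)"
  obtains \<phi>1 \<phi>2 where "\<eta>' = \<eta>" "su2_triple A \<phi>1 \<phi>2 \<phi> \<xi> \<eta> g"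
    "\<forall>p. \<forall>u\<in>T p. \<forall>v\<in>T p. \<omega>1 p [u, v] = g p (\<phi>1 p u) v"
    "\<forall>p. \<forall>u\<in>T p. \<forall>v\<in>T p. \<omega>2 p [u, v] = g p (\<phi>2 p u) v"
    "\<forall>p. \<forall>u\<in>T p. \<forall>v\<in>T p. \<omega>3 p [u, v] = g p (\<phi> p u) v"
proof -
  obtain \<phi>1 \<phi>2 where "\<eta>' = \<eta>" "su2_triple A \<phi>1 \<phi>2 \<phi> \<xi> \<eta> g"
    and w: "\<forall>(\<omega>, \<psi>)\<in>{(\<omega>1, \<phi>1), (\<omega>2, \<phi>2), (\<omega>3, \<phi>)}. \<forall>p. \<forall>v\<in>T p. \<forall>w\<in>T p. \<omega> p [v, w] = g p (\<psi> p v) w"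
    using assms unfolding third_acm_def by auto
  with w[unfolded ball_simps prod.case] show thesis using that[of \<phi>1 \<phi>2] by blast
qed

lemma third_acmI:
  assumes "su2_triple A \<phi>1 \<phi>2 \<phi> \<xi> \<eta> g"
    "\<forall>p. \<forall>u\<in>T p. \<forall>v\<in>T p. \<omega>1 p [u, v] = g p (\<phi>1 p u) v"
    "\<forall>p. \<forall>u\<in>T p. \<forall>v\<in>T p. \<omega>2 p [u, v] = g p (\<phi>2 p u) v"
    "\<forall>p. \<forall>u\<in>T p. \<forall>v\<in>T p. \<omega>3 p [u, v] = g p (\<phi> p u) v"
  shows "third_acm A (\<eta>, \<omega>1, \<omega>2, \<omega>3) (\<phi>, \<xi>, \<eta>, g)"
  unfolding third_acm_def prod.case
proof (rule conjI[OF refl], rule exI[of _ \<phi>1], rule exI[of _ \<phi>2], rule conjI[OF assms(1)])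
  show "\<forall>(\<omega>, \<psi>)\<in>{(\<omega>1, \<phi>1), (\<omega>2, \<phi>2), (\<omega>3, \<phi>)}. \<forall>p. \<forall>v\<in>T p. \<forall>w\<in>T p. \<omega> p [v, w] = g p (\<psi> p v) w"
    unfolding ball_simps prod.case using assms(2-4) by blast
qed

lemma su2_lcI: "su2_triple A \<phi>1 \<phi>2 \<phi> \<xi> \<eta> g \<Longrightarrow> levi_civita A g D \<Longrightarrow> su2_lc A g D \<phi>1 \<phi>2 \<phi> \<xi> \<eta>"
proof -
  assume t: "su2_triple A \<phi>1 \<phi>2 \<phi> \<xi> \<eta> g" and D: "levi_civita A g D"
  interpret riemannian_manifold A g by (rule riemannian_manifoldI[OF su2_tripleD(9)[OF t]])
  show ?thesis by unfold_locales (fact D t)+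
qed

lemma su2_family_lcI:
  assumes s: "(\<eta>, \<omega>1, \<omega>2, \<omega>3) \<in> su2_family A (- {0})" and n: "third_acm A (\<eta>, \<omega>1, \<omega>2, \<omega>3) (\<phi>, \<xi>, \<eta>', g)"
  obtains D \<phi>1 \<phi>2 l where "\<eta>' = \<eta>" "su2_family_lc A g D \<phi>1 \<phi>2 \<phi> \<xi> \<eta> l"
    "\<forall>p. \<forall>u\<in>T p. \<forall>v\<in>T p. \<omega>1 p [u, v] = g p (\<phi>1 p u) v"
    "\<forall>p. \<forall>u\<in>T p. \<forall>v\<in>T p. \<omega>2 p [u, v] = g p (\<phi>2 p u) v"
    "\<forall>p. \<forall>u\<in>T p. \<forall>v\<in>T p. \<omega>3 p [u, v] = g p (\<phi> p u) v"
proof -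
  obtain \<phi>1 \<phi>2 where e: "\<eta>' = \<eta>" and t: "su2_triple A \<phi>1 \<phi>2 \<phi> \<xi> \<eta> g"
    and w: "\<forall>p. \<forall>u\<in>T p. \<forall>v\<in>T p. \<omega>1 p [u, v] = g p (\<phi>1 p u) v"
    "\<forall>p. \<forall>u\<in>T p. \<forall>v\<in>T p. \<omega>2 p [u, v] = g p (\<phi>2 p u) v"
    "\<forall>p. \<forall>u\<in>T p. \<forall>v\<in>T p. \<omega>3 p [u, v] = g p (\<phi> p u) v"
    by (rule third_acmD[OF n]) (rule that)
  interpret riemannian_manifold A g by (rule riemannian_manifoldI[OF su2_tripleD(9)[OF t]])
  interpret S: su2_lc A g nabla \<phi>1 \<phi>2 \<phi> \<xi> \<eta> by (rule su2_lcI[OF t levi_civita_nabla])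
  note d = su2_familyD(2-4)[OF s]
  obtain l where l: "l \<noteq> 0" and E: "has_ext_deriv A 1 \<eta> (- 2 *\<^sub>R \<omega>3 + (2 * l) *\<^sub>R \<omega>1)"
    "has_ext_deriv A 2 \<omega>1 (3 *\<^sub>R wedge 1 2 \<eta> \<omega>2)"
    "has_ext_deriv A 2 \<omega>2 (- 3 *\<^sub>R wedge 1 2 \<eta> \<omega>1 - (3 * l) *\<^sub>R wedge 1 2 \<eta> \<omega>3)"
    using s unfolding su2_family_def by auto
  have "su2_family_lc A g nabla \<phi>1 \<phi>2 \<phi> \<xi> \<eta> l"
  proof unfold_locales
    show "d1 (\<lambda>X p. \<eta> p [X p]) X Y p = - 2 * S.tw \<phi> X Y p + 2 * l * S.tw \<phi>1 X Y p" if "VF X" "VF Y" for X Y p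
      using iffD1[OF S.ext_deriv_eta[OF d w] E(1)] that by blast
    show "d2 (S.tw \<phi>1) X Y Z p = 3 * S.A1.ew \<phi>2 X Y Z p" if "VF X" "VF Y" "VF Z" for X Y Z p
      using iffD1[OF S.ext_deriv_omega1[OF d w] E(2)] that by blast
    show "d2 (S.tw \<phi>2) X Y Z p = - 3 * S.A1.ew \<phi>1 X Y Z p - 3 * l * S.A1.ew \<phi> X Y Z p" if "VF X" "VF Y" "VF Z" for X Y Z p
      using iffD1[OF S.ext_deriv_omega2[OF d w] E(3)] that by blast
  qed (fact l)
  then show thesis by (rule that[OF e _ w])
qed

text \<open>The almost contact metric structure fixes \<eta>, g and \<phi>3, hence \<omega>3; then
  d\<eta> fixes \<lambda>\<omega>1. Comparing lengths determines \<lambda> up to sign, and \<phi>2 =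
  \<phi>3 \<phi>1 passes the sign of \<phi>1 on to \<phi>2.\<close>

lemma family_unique:
  assumes n: "third_acm A (\<eta>, \<omega>1, \<omega>2, \<omega>3) n" "third_acm A (\<eta>', \<omega>1', \<omega>2', \<omega>3') n"
    and d: "diff_form A 2 \<omega>1" "diff_form A 2 \<omega>2" "diff_form A 2 \<omega>3"
    and d': "diff_form A 2 \<omega>1'" "diff_form A 2 \<omega>2'" "diff_form A 2 \<omega>3'"
    and E: "has_ext_deriv A 1 \<eta> (- 2 *\<^sub>R \<omega>3 + (2 * l) *\<^sub>R \<omega>1)" "has_ext_deriv A 1 \<eta>' (- 2 *\<^sub>R \<omega>3' + (2 * l') *\<^sub>R \<omega>1')"
    and l: "l \<noteq> 0" "l' \<noteq> 0"
  shows "l' = l \<and> (\<eta>', \<omega>1', \<omega>2', \<omega>3') = (\<eta>, \<omega>1, \<omega>2, \<omega>3) \<or> l' = - l \<and> (\<eta>', \<omega>1', \<omega>2', \<omega>3') = su2_flip (\<eta>, \<omega>1, \<omega>2, \<omega>3)"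
proof -
  obtain \<phi> \<xi> \<eta>'' g where nn: "n = (\<phi>, \<xi>, \<eta>'', g)" by (cases n)
  obtain \<phi>1 \<phi>2 where e: "\<eta>'' = \<eta>" and t: "su2_triple A \<phi>1 \<phi>2 \<phi> \<xi> \<eta> g"
    and w: "\<forall>p. \<forall>u\<in>T p. \<forall>v\<in>T p. \<omega>1 p [u, v] = g p (\<phi>1 p u) v"
    "\<forall>p. \<forall>u\<in>T p. \<forall>v\<in>T p. \<omega>2 p [u, v] = g p (\<phi>2 p u) v"
    "\<forall>p. \<forall>u\<in>T p. \<forall>v\<in>T p. \<omega>3 p [u, v] = g p (\<phi> p u) v"
    by (rule third_acmD[OF n(1)[unfolded nn]]) (rule that)
  obtain \<phi>1' \<phi>2' where e': "\<eta>'' = \<eta>'" and t': "su2_triple A \<phi>1' \<phi>2' \<phi> \<xi> \<eta>' g"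
    and w': "\<forall>p. \<forall>u\<in>T p. \<forall>v\<in>T p. \<omega>1' p [u, v] = g p (\<phi>1' p u) v"
    "\<forall>p. \<forall>u\<in>T p. \<forall>v\<in>T p. \<omega>2' p [u, v] = g p (\<phi>2' p u) v"
    "\<forall>p. \<forall>u\<in>T p. \<forall>v\<in>T p. \<omega>3' p [u, v] = g p (\<phi> p u) v"
    by (rule third_acmD[OF n(2)[unfolded nn]]) (rule that)
  have ee: "\<eta>' = \<eta>" using e e' by simp
  have two: "\<exists>u v. vs = [u, v] \<and> u \<in> T p \<and> v \<in> T p" if "length vs = 2" "set vs \<subseteq> T p" for vs p
    using that by (auto simp: length2)
  have o3: "\<omega>3' = \<omega>3"
    by (rule form_eqI[OF d'(3) d(3)]) (use two w(3) w'(3) in metis)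
  have dd: "l * \<omega>1 p [u, v] = l' * \<omega>1' p [u, v]" if "u \<in> T p" "v \<in> T p" for p u v
  proof -
    have "(- 2 *\<^sub>R \<omega>3 + (2 * l) *\<^sub>R \<omega>1) p [extend p u p, extend p v p] = (- 2 *\<^sub>R \<omega>3' + (2 * l') *\<^sub>R \<omega>1') p [extend p u p, extend p v p]"
      using E VF_extend[OF that(1)] VF_extend[OF that(2)] unfolding has_ext_deriv_1 ee by simp
    then show ?thesis using that by (simp add: pointwise o3 extend_apply)
  qed
  have S: "su2_space (T p) (g p) (\<phi>1 p) (\<phi>2 p) (\<phi> p) (\<xi> p) (\<lambda>v. \<eta> p [v])" for p by (rule su2_space_at[OF t])
  have S': "su2_space (T p) (g p) (\<phi>1' p) (\<phi>2' p) (\<phi> p) (\<xi> p) (\<lambda>v. \<eta> p [v])" for p by (rule su2_space_at[OF t'[unfolded ee]])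
  have v1: "l *\<^sub>R \<phi>1 p u = l' *\<^sub>R \<phi>1' p u" if u: "u \<in> T p" for p u
  proof -
    interpret S: su2_space "T p" "g p" "\<phi>1 p" "\<phi>2 p" "\<phi> p" "\<xi> p" "\<lambda>v. \<eta> p [v]" by (rule S)
    interpret S': su2_space "T p" "g p" "\<phi>1' p" "\<phi>2' p" "\<phi> p" "\<xi> p" "\<lambda>v. \<eta> p [v]" by (rule S')
    show ?thesis
      by (rule S.A1.eqI) (use u dd[OF u] w(1) w'(1) in \<open>simp_all add: S.A1.g_simps\<close>)
  qed
  have "l * l = l' * l'"
  proof -
    fix p :: 'a
    interpret S: su2_space "T p" "g p" "\<phi>1 p" "\<phi>2 p" "\<phi> p" "\<xi> p" "\<lambda>v. \<eta> p [v]" by (rule S)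
    interpret S': su2_space "T p" "g p" "\<phi>1' p" "\<phi>2' p" "\<phi> p" "\<xi> p" "\<lambda>v. \<eta> p [v]" by (rule S')
    obtain u where u: "u \<in> T p" "\<eta> p [u] = 0" "g p u u = 1" by (rule S.A1.adapted_basis)
    have "g p (l *\<^sub>R \<phi>1 p u) (l *\<^sub>R \<phi>1 p u) = g p (l' *\<^sub>R \<phi>1' p u) (l' *\<^sub>R \<phi>1' p u)" by (simp only: v1[OF u(1)])
    then show ?thesis using u by (simp add: S.A1.g_simps S.A1.g_phi_phi S'.A1.g_phi_phi)
  qed
  then have ll: "l' = l \<or> l' = - l" by (metis square_eq_iff)
  \<comment> \<open>The two cases are treated together by a sign r.\<close>
  then obtain r :: real where r: "l' = r * l" "r = 1 \<or> r = - 1" by force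
  then have rr: "r * r = 1" "r * l' = l" by auto
  have p1: "\<phi>1' p u = r *\<^sub>R \<phi>1 p u" if u: "u \<in> T p" for p u
  proof -
    have "l' *\<^sub>R \<phi>1' p u = l' *\<^sub>R (r *\<^sub>R \<phi>1 p u)" using v1[OF u] rr by (simp add: mult.commute)
    then show ?thesis using l(2) by (simp only: scaleR_cancel_left simp_thms)
  qed
  have p2: "\<phi>2' p u = r *\<^sub>R \<phi>2 p u" if u: "u \<in> T p" for p u
  proof -
    interpret S: su2_space "T p" "g p" "\<phi>1 p" "\<phi>2 p" "\<phi> p" "\<xi> p" "\<lambda>v. \<eta> p [v]" by (rule S)
    interpret S': su2_space "T p" "g p" "\<phi>1' p" "\<phi>2' p" "\<phi> p" "\<xi> p" "\<lambda>v. \<eta> p [v]" by (rule S')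
    show ?thesis using S'.q31[OF u] S.q31[OF u] p1[OF u] S.A3.phi_simps(3)[of "\<phi>1 p u" r] u by simp
  qed
  have T: "\<phi>1 p u \<in> T p" "\<phi>2 p u \<in> T p" if "u \<in> T p" for p u
    using su2_tripleD(4,5)[OF t] endo_T that by blast+
  have sc: "g p (r *\<^sub>R u) v = r * g p u v" if "u \<in> T p" for p u v
    using inner_space.scale_left[OF inner_space_T[OF su2_tripleD(9)[OF t]] that] .
  have o12: "\<omega>1' = r *\<^sub>R \<omega>1 \<and> \<omega>2' = r *\<^sub>R \<omega>2"
  proof
    show "\<omega>1' = r *\<^sub>R \<omega>1"
    proof (rule form_eqI[OF d'(1) diff_form_scale[OF d(1)]])
      fix p and vs :: "'a tangent list" assume "length vs = 2" "set vs \<subseteq> T p"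
      then obtain u v where "vs = [u, v]" "u \<in> T p" "v \<in> T p" using two by blast
      then show "\<omega>1' p vs = (r *\<^sub>R \<omega>1) p vs" by (simp add: w[rule_format] w'[rule_format] p1 sc T pointwise)
    qed
    show "\<omega>2' = r *\<^sub>R \<omega>2"
    proof (rule form_eqI[OF d'(2) diff_form_scale[OF d(2)]])
      fix p and vs :: "'a tangent list" assume "length vs = 2" "set vs \<subseteq> T p"
      then obtain u v where "vs = [u, v]" "u \<in> T p" "v \<in> T p" using two by blast
      then show "\<omega>2' p vs = (r *\<^sub>R \<omega>2) p vs" by (simp add: w[rule_format] w'[rule_format] p2 sc T pointwise)
    qed
  qed
  show ?thesis using r o12 o3 ee by (auto simp: su2_flip_def)
qed

lemma su2_triple_minus:
  assumes t: "su2_triple A \<phi>1 \<phi>2 \<phi>3 \<xi> \<eta> g"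
  shows "su2_triple A (\<lambda>p v. - \<phi>1 p v) (\<lambda>p v. - \<phi>2 p v) \<phi>3 \<xi> \<eta> g"
proof -
  note D = su2_tripleD[OF t]
  have S: "su2_space (T p) (g p) (\<phi>1 p) (\<phi>2 p) (\<phi>3 p) (\<xi> p) (\<lambda>v. \<eta> p [v])" for p by (rule su2_space_at[OF t])
  interpret riemannian_manifold A g by (rule riemannian_manifoldI[OF D(9)])
  interpret L: lc_manifold A g nabla by unfold_locales (rule levi_civita_nabla)
  have m: "almost_contact_metric A (\<lambda>p v. - \<phi> p v) \<xi> \<eta> g" if a: "almost_contact_metric A \<phi> \<xi> \<eta> g" for \<phi>
  proof -
    note aD = acmD[OF a]
    have "endo_field A (\<lambda>p v. - \<phi> p v)" using L.endo_field_scale[OF aD(1), of "-1"] by simp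
    moreover have "- \<phi> p (- \<phi> p v) = \<phi> p (\<phi> p v)" if "v \<in> T p" for p v
      using L.esimps(4)[OF aD(1), of "\<phi> p v" p] endo_T[OF aD(1) that] by simp
    moreover have "g p (- \<phi> p v) (- \<phi> p w) = g p (\<phi> p v) (\<phi> p w)" if "v \<in> T p" "w \<in> T p" for p v w
      using endo_T[OF aD(1)] that by (simp add: g_simps T_minus)
    ultimately show ?thesis
      using a unfolding almost_contact_metric_def by simp
  qed
  have q: "- \<phi>1 p (- \<phi>2 p v) = \<phi>3 p v" "- \<phi>2 p (- \<phi>1 p v) = - \<phi>3 p v" "- \<phi>2 p (\<phi>3 p v) = - \<phi>1 p v"
    "\<phi>3 p (- \<phi>2 p v) = \<phi>1 p v" "\<phi>3 p (- \<phi>1 p v) = - \<phi>2 p v" "- \<phi>1 p (\<phi>3 p v) = \<phi>2 p v" if v: "v \<in> T p" for p v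
    using su2_space.quaternion(1-6)[OF S v] v endo_T[OF D(4) v] endo_T[OF D(5) v]
    by (simp_all add: L.esimps(4)[OF D(4)] L.esimps(4)[OF D(5)] L.esimps(4)[OF D(6)])
  show ?thesis
    unfolding su2_triple_def using m[OF D(1)] m[OF D(2)] D(3) by (simp add: q)
qed

lemma su2_flip_family:
  assumes s: "s \<in> su2_family A (- {0})" and n: "third_acm A s n"
  shows "su2_flip s \<in> su2_family A (- {0})" "third_acm A (su2_flip s) n"
proof -
  obtain \<eta> \<omega>1 \<omega>2 \<omega>3 where ss: "s = (\<eta>, \<omega>1, \<omega>2, \<omega>3)" by (cases s)
  obtain \<phi> \<xi> \<eta>' g where nn: "n = (\<phi>, \<xi>, \<eta>', g)" by (cases n)
  note d = su2_familyD(2-4)[OF s[unfolded ss]]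
  obtain D \<phi>1 \<phi>2 l where e: "\<eta>' = \<eta>" and F: "su2_family_lc A g D \<phi>1 \<phi>2 \<phi> \<xi> \<eta> l" and
    w: "\<forall>p. \<forall>u\<in>T p. \<forall>v\<in>T p. \<omega>1 p [u, v] = g p (\<phi>1 p u) v"
    "\<forall>p. \<forall>u\<in>T p. \<forall>v\<in>T p. \<omega>2 p [u, v] = g p (\<phi>2 p u) v"
    "\<forall>p. \<forall>u\<in>T p. \<forall>v\<in>T p. \<omega>3 p [u, v] = g p (\<phi> p u) v"
    by (rule su2_family_lcI[OF s[unfolded ss] n[unfolded ss nn]]) (rule that)
  interpret F: su2_family_lc A g D \<phi>1 \<phi>2 \<phi> \<xi> \<eta> l by (rule F)
  define \<psi>1 \<psi>2 where "\<psi>1 = (\<lambda>p v. - \<phi>1 p v)" and "\<psi>2 = (\<lambda>p v. - \<phi>2 p v)"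
  have t: "su2_triple A \<psi>1 \<psi>2 \<phi> \<xi> \<eta> g" unfolding \<psi>1_def \<psi>2_def by (rule su2_triple_minus[OF F.triple])
  interpret M: su2_lc A g D \<psi>1 \<psi>2 \<phi> \<xi> \<eta> by (rule su2_lcI[OF t F.lc])
  have d': "diff_form A 2 (- \<omega>1)" "diff_form A 2 (- \<omega>2)" using d diff_form_minus by blast+
  have T: "\<phi>1 p u \<in> T p" "\<phi>2 p u \<in> T p" if "u \<in> T p" for p u
    using su2_tripleD(4,5)[OF F.triple] endo_T that by blast+
  have w': "\<forall>p. \<forall>u\<in>T p. \<forall>v\<in>T p. (- \<omega>1) p [u, v] = g p (\<psi>1 p u) v"
    "\<forall>p. \<forall>u\<in>T p. \<forall>v\<in>T p. (- \<omega>2) p [u, v] = g p (\<psi>2 p u) v"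
    using w T by (simp_all add: pointwise \<psi>1_def \<psi>2_def F.g_simps)
  have tw: "F.tw \<psi>1 X Y p = - F.tw \<phi>1 X Y p" "F.tw \<psi>2 X Y p = - F.tw \<phi>2 X Y p" if "VF X" for X Y p
    using that T by (simp_all add: F.tw_def \<psi>1_def \<psi>2_def F.g_simps)
  have d2m: "d2 (F.tw \<psi>1) X Y Z p = - d2 (F.tw \<phi>1) X Y Z p" "d2 (F.tw \<psi>2) X Y Z p = - d2 (F.tw \<phi>2) X Y Z p"
    if XYZ: "VF X" "VF Y" "VF Z" for X Y Z p
  proof -
    have "d2 b X Y Z p = - d2 b' X Y Z p" if b: "two_form b'" and eq: "\<And>X Y p. VF X \<Longrightarrow> VF Y \<Longrightarrow> b X Y p = - b' X Y p" for b b'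
    proof -
      have "d2 b X Y Z p = d2 (\<lambda>X Y p. (-1) * b' X Y p + 0 * b' X Y p) X Y Z p"
        by (rule d2_cong[OF _ XYZ]) (intro ext, simp add: eq)
      then show ?thesis using d2_lincomb[OF b b XYZ, of "-1" 0 p] by simp
    qed
    from this[OF F.A1.two_form, of "F.tw \<psi>1"] this[OF F.A2.two_form, of "F.tw \<psi>2"]
    show "d2 (F.tw \<psi>1) X Y Z p = - d2 (F.tw \<phi>1) X Y Z p" "d2 (F.tw \<psi>2) X Y Z p = - d2 (F.tw \<phi>2) X Y Z p"
      using tw by simp_all
  qed
  have "has_ext_deriv A 1 \<eta> (- 2 *\<^sub>R \<omega>3 + (2 * - l) *\<^sub>R - \<omega>1)"
    unfolding M.ext_deriv_eta[OF d' d(3) w' w(3)] using tw F.E1 by simp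
  moreover have "has_ext_deriv A 2 (- \<omega>1) (3 *\<^sub>R wedge 1 2 \<eta> (- \<omega>2))"
    unfolding M.ext_deriv_omega1[OF d' d(3) w' w(3)] using tw F.E2 by (simp add: d2m F.A1.ew_def algebra_simps)
  moreover have "has_ext_deriv A 2 (- \<omega>2) (- 3 *\<^sub>R wedge 1 2 \<eta> (- \<omega>1) - (3 * - l) *\<^sub>R wedge 1 2 \<eta> \<omega>3)"
    unfolding M.ext_deriv_omega2[OF d' d(3) w' w(3)] using tw F.E3 by (simp add: d2m F.A1.ew_def algebra_simps)
  moreover have "su2_forms A \<eta> (- \<omega>1) (- \<omega>2) \<omega>3"
    by (rule su2_forms_of_triple[OF t d' d(3)]) (use w' w(3) in blast)+
  moreover have "- l \<in> - {0}" using F.l by simp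
  ultimately show "su2_flip s \<in> su2_family A (- {0})"
    unfolding ss su2_flip_def su2_family_def prod.case mem_Collect_eq by (intro conjI bexI[of _ "- l"])
  show "third_acm A (su2_flip s) n"
    unfolding ss nn e su2_flip_def prod.case by (rule third_acmI, rule t, rule w', rule w', rule w)
qed

lemma family_proper:
  assumes s: "s \<in> su2_family A (- {0})" and n: "third_acm A s n"
  shows "n \<in> proper_nearly_sasakian A"
proof -
  obtain \<eta> \<omega>1 \<omega>2 \<omega>3 where ss: "s = (\<eta>, \<omega>1, \<omega>2, \<omega>3)" by (cases s)
  obtain \<phi> \<xi> \<eta>' g where nn: "n = (\<phi>, \<xi>, \<eta>', g)" by (cases n)
  obtain D \<phi>1 \<phi>2 l where e: "\<eta>' = \<eta>" and F: "su2_family_lc A g D \<phi>1 \<phi>2 \<phi> \<xi> \<eta> l"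
    by (rule su2_family_lcI[OF s[unfolded ss] n[unfolded ss nn]]) (rule that)
  show ?thesis
    using su2_family_lc.nearly_sasakian[OF F] su2_family_lc.not_sasakian[OF F]
    by (simp add: proper_nearly_sasakian_def nn e)
qed

text \<open>The equation for d\<omega>1 is part of the definition; the other one needs
  endomorphisms, so a compatible structure is produced first.\<close>

lemma family_nearly_hypo:
  assumes s: "s \<in> su2_family A (- {0})"
  shows "nearly_hypo A s"
proof -
  obtain \<eta> \<omega>1 \<omega>2 \<omega>3 where ss: "s = (\<eta>, \<omega>1, \<omega>2, \<omega>3)" by (cases s)
  note d = su2_familyD[OF s[unfolded ss]]
  obtain n where n: "third_acm A s n" using third_acm_exists[OF d(1)] ss by blast
  obtain \<phi> \<xi> \<eta>' g where nn: "n = (\<phi>, \<xi>, \<eta>', g)" by (cases n)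
  obtain D \<phi>1 \<phi>2 l where e: "\<eta>' = \<eta>" and F: "su2_family_lc A g D \<phi>1 \<phi>2 \<phi> \<xi> \<eta> l" and
    w: "\<forall>p. \<forall>u\<in>T p. \<forall>v\<in>T p. \<omega>1 p [u, v] = g p (\<phi>1 p u) v"
    "\<forall>p. \<forall>u\<in>T p. \<forall>v\<in>T p. \<omega>2 p [u, v] = g p (\<phi>2 p u) v"
    "\<forall>p. \<forall>u\<in>T p. \<forall>v\<in>T p. \<omega>3 p [u, v] = g p (\<phi> p u) v"
    by (rule su2_family_lcI[OF s[unfolded ss] n[unfolded ss nn]]) (rule that)
  interpret F: su2_family_lc A g D \<phi>1 \<phi>2 \<phi> \<xi> \<eta> l by (rule F)
  have "has_ext_deriv A 3 (wedge 1 2 \<eta> \<omega>3) (- 2 *\<^sub>R wedge 2 2 \<omega>1 \<omega>1)"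
    using F.nearly_hypo[OF d(2-4) w] .
  then show ?thesis using s d(1) unfolding ss nearly_hypo_def su2_family_def by blast
qed

text \<open>Two parameter sets, because the lemma is applied both to a positive \<lambda> against
  all nonzero ones, where the flip occurs, and to positive against positive, where it
  cannot.\<close>

lemma third_acm_family_unique:
  assumes s: "s \<in> su2_family A L" "s' \<in> su2_family A L'" and L: "0 \<notin> L" "0 \<notin> L'"
    and n: "third_acm A s n" "third_acm A s' n"
  shows "(\<exists>l\<in>L \<inter> L'. s' = s) \<or> (\<exists>l\<in>L. - l \<in> L' \<and> s' = su2_flip s)"
proof -
  obtain \<eta> \<omega>1 \<omega>2 \<omega>3 where ss: "s = (\<eta>, \<omega>1, \<omega>2, \<omega>3)" by (cases s)
  obtain \<eta>' \<omega>1' \<omega>2' \<omega>3' where ss': "s' = (\<eta>', \<omega>1', \<omega>2', \<omega>3')" by (cases s')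
  obtain l where l: "l \<in> L" and E: "has_ext_deriv A 1 \<eta> (- 2 *\<^sub>R \<omega>3 + (2 * l) *\<^sub>R \<omega>1)"
    using s(1) unfolding ss su2_family_def by auto
  obtain l' where l': "l' \<in> L'" and E': "has_ext_deriv A 1 \<eta>' (- 2 *\<^sub>R \<omega>3' + (2 * l') *\<^sub>R \<omega>1')"
    using s(2) unfolding ss' su2_family_def by auto
  have "l \<noteq> 0" "l' \<noteq> 0" using l l' L by auto
  from family_unique[OF n[unfolded ss ss'] su2_familyD(2-4)[OF s(1)[unfolded ss]] su2_familyD(2-4)[OF s(2)[unfolded ss']] E E' this]
  show ?thesis using l l' unfolding ss ss' by auto
qed

lemma proper_ex_family:
  assumes "n \<in> proper_nearly_sasakian A"
  obtains s where "s \<in> su2_family A {0<..}" "third_acm A s n"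
proof -
  obtain \<phi> \<xi> \<eta> g where nn: "n = (\<phi>, \<xi>, \<eta>, g)" by (cases n)
  have acm: "almost_contact_metric A \<phi> \<xi> \<eta> g" and ns: "\<not> sasakian A \<phi> \<xi> \<eta> g"
    using assms unfolding proper_nearly_sasakian_def nn nearly_sasakian_def by auto
  obtain D where D: "levi_civita A g D" and NS: "\<And>X Y p. VF X \<Longrightarrow> VF Y \<Longrightarrow>
      nabla_endo D \<phi> X Y p + nabla_endo D \<phi> Y X p =
        (2 * g p (X p) (Y p)) *\<^sub>R \<xi> p - \<eta> p [X p] *\<^sub>R Y p - \<eta> p [Y p] *\<^sub>R X p"
    using assms unfolding proper_nearly_sasakian_def nn nearly_sasakian_def by blast
  interpret riemannian_manifold A g by (rule riemannian_manifoldI[OF acmD(4)[OF acm]])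
  interpret N: nearly_sasakian_lc A g D \<phi> \<xi> \<eta> by unfold_locales (fact D acm, fact acm, fact NS)
  obtain \<phi>1 \<phi>2 l where l: "l > 0" and t: "su2_triple A \<phi>1 \<phi>2 \<phi> \<xi> \<eta> g" and sk: "N.skew_endo \<phi>1" "N.skew_endo \<phi>2"
    and E1: "\<And>X Y p. VF X \<Longrightarrow> VF Y \<Longrightarrow> d1 N.e X Y p = - 2 * N.tw \<phi> X Y p + 2 * l * N.tw \<phi>1 X Y p"
    and E2: "\<And>X Y Z p. VF X \<Longrightarrow> VF Y \<Longrightarrow> VF Z \<Longrightarrow> d2 (N.tw \<phi>1) X Y Z p = 3 * N.ew \<phi>2 X Y Z p"
    and E3: "\<And>X Y Z p. VF X \<Longrightarrow> VF Y \<Longrightarrow> VF Z \<Longrightarrow>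
      d2 (N.tw \<phi>2) X Y Z p = - 3 * N.ew \<phi>1 X Y Z p - 3 * l * N.ew \<phi> X Y Z p"
    by (rule N.ex_su2[OF ns]) (rule that)
  interpret S: su2_lc A g D \<phi>1 \<phi>2 \<phi> \<xi> \<eta> by (rule su2_lcI[OF t D])
  define \<omega> where "\<omega> \<psi> = form2_of (\<lambda>p u v. g p (\<psi> p u) v)" for \<psi>
  have d: "diff_form A 2 (\<omega> \<psi>)" if sk: "N.skew_endo \<psi>" for \<psi>
    unfolding \<omega>_def
  proof (rule diff_form_form2_of)
    note e = N.skewD(1)[OF sk]
    show "bilinear_field (\<lambda>p u v. g p (\<psi> p u) v)"
      unfolding bilinear_field_def using g_C N.eVF[OF e]
      by (simp add: N.elin[OF e] g_simps N.eT[OF e] T_scale)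
    show "g p (\<psi> p v) v = 0" if "v \<in> T p" for p v
      using N.skewD(2)[OF sk that that] g_sym[of p v "\<psi> p v"] by simp
  qed
  have w: "\<forall>p. \<forall>u\<in>T p. \<forall>v\<in>T p. \<omega> \<psi> p [u, v] = g p (\<psi> p u) v" for \<psi>
    unfolding \<omega>_def by (simp add: form2_of_apply)
  note dd = d[OF sk(1)] d[OF sk(2)] d[OF N.skew]
  show thesis
  proof (rule that[of "(\<eta>, \<omega> \<phi>1, \<omega> \<phi>2, \<omega> \<phi>)"])
    show "third_acm A (\<eta>, \<omega> \<phi>1, \<omega> \<phi>2, \<omega> \<phi>) n"
      unfolding nn by (rule third_acmI, rule t, rule w, rule w, rule w)
    have "has_ext_deriv A 1 \<eta> (- 2 *\<^sub>R \<omega> \<phi> + (2 * l) *\<^sub>R \<omega> \<phi>1)"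
      unfolding S.ext_deriv_eta[OF dd w w w] using E1 by blast
    moreover have "has_ext_deriv A 2 (\<omega> \<phi>1) (3 *\<^sub>R wedge 1 2 \<eta> (\<omega> \<phi>2))"
      unfolding S.ext_deriv_omega1[OF dd w w w] using E2 by blast
    moreover have "has_ext_deriv A 2 (\<omega> \<phi>2) (- 3 *\<^sub>R wedge 1 2 \<eta> (\<omega> \<phi>1) - (3 * l) *\<^sub>R wedge 1 2 \<eta> (\<omega> \<phi>))"
      unfolding S.ext_deriv_omega2[OF dd w w w] using E3 by blast
    moreover have "su2_forms A \<eta> (\<omega> \<phi>1) (\<omega> \<phi>2) (\<omega> \<phi>)"
      by (rule su2_forms_of_triple[OF t dd]) (use w in blast)+
    ultimately show "(\<eta>, \<omega> \<phi>1, \<omega> \<phi>2, \<omega> \<phi>) \<in> su2_family A {0<..}"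
      unfolding su2_family_def prod.case mem_Collect_eq using l by (intro conjI bexI[of _ l]) simp_all
  qed
qed

end

text \<open>The one-to-one correspondence is given in two readings: for all \<lambda> \<noteq> 0 the
  map to nearly Sasakian structures has fibres consisting of a quadruplet and its flip, and for
  \<lambda> > 0 it is a bijection.\<close>

theorem theorem4p3:
  fixes A :: "('a::{t2_space, second_countable_topology}, real ^ 5) atlas"
  assumes "smooth_manifold A"
  shows "(\<forall>s\<in>su2_family A (- {0}). \<exists>!n. third_acm A s n) \<and>
    (\<forall>s\<in>su2_family A (- {0}). \<forall>n. third_acm A s n \<longrightarrow> n \<in> proper_nearly_sasakian A) \<and>
    (\<forall>n\<in>proper_nearly_sasakian A. \<exists>s\<in>su2_family A (- {0}).
       {s' \<in> su2_family A (- {0}). third_acm A s' n} = {s, su2_flip s}) \<and>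
    (\<forall>n\<in>proper_nearly_sasakian A. \<exists>!s. s \<in> su2_family A {0<..} \<and> third_acm A s n) \<and>
    (\<forall>s\<in>su2_family A (- {0}). nearly_hypo A s)"
proof -
  interpret manifold5 A by unfold_locales (rule assms)
  have sub: "s \<in> su2_family A (- {0})" if "s \<in> su2_family A {0<..}" for s
  proof -
    have "{0<..} \<subseteq> - {0::real}" by auto
    then show ?thesis using that unfolding su2_family_def by blast
  qed
  show ?thesis
  proof (intro conjI ballI allI impI)
    fix s assume s: "s \<in> su2_family A (- {0})"
    obtain \<eta> \<omega>1 \<omega>2 \<omega>3 where ss: "s = (\<eta>, \<omega>1, \<omega>2, \<omega>3)" by (cases s)
    show "\<exists>!n. third_acm A s n"
      using third_acm_exists[OF su2_familyD(1)[OF s[unfolded ss]]] third_acm_unique unfolding ss by blast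
    show "nearly_hypo A s" by (rule family_nearly_hypo[OF s])
    show "n \<in> proper_nearly_sasakian A" if "third_acm A s n" for n by (rule family_proper[OF s that])
  next
    fix n assume "n \<in> proper_nearly_sasakian A"
    then obtain s where s: "s \<in> su2_family A {0<..}" "third_acm A s n" by (rule proper_ex_family)
    have "s' = s \<or> s' = su2_flip s" if "s' \<in> su2_family A (- {0})" "third_acm A s' n" for s'
      using third_acm_family_unique[OF s(1) that(1) _ _ s(2) that(2)] by auto
    then have "{s' \<in> su2_family A (- {0}). third_acm A s' n} = {s, su2_flip s}"
      using s(2) sub[OF s(1)] su2_flip_family[OF sub[OF s(1)] s(2)] by blast
    then show "\<exists>s\<in>su2_family A (- {0}). {s' \<in> su2_family A (- {0}). third_acm A s' n} = {s, su2_flip s}"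
      using sub[OF s(1)] by blast
    \<comment> \<open>The flip would require both \<lambda> and -\<lambda> to be positive.\<close>
    have "s' = s" if "s' \<in> su2_family A {0<..}" "third_acm A s' n" for s'
      using third_acm_family_unique[OF s(1) that(1) _ _ s(2) that(2)] by auto
    then show "\<exists>!s. s \<in> su2_family A {0<..} \<and> third_acm A s n" using s by blast
  qed
qed

end
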